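(* Suppose: \begin{itemize} \item $\theta<\kappa$ is a pair of infinite regular cardinals; \item $c_0:[\kappa]^2\rightarrow\kappa$ and $c_1:[\kappa]^2\rightarrow\kappa$ are two colorings; \item $e:[\kappa]^2\rightarrow\theta$ is a subadditive coloring; \item for every $A\in[\kappa]^\kappa$, there exists a club $D\subseteq\kappa$ such that for every $\delta\in D$, for every $\beta\in A\setminus\delta$, for every $(\xi_0,\xi_1)\in\delta\times\delta$, for every $i<\theta$, there are cofinally many (in $\delta$) $\alpha\in A\cap\delta$ such that $c_0(\alpha,\beta)=\xi_0$, $c_1(\alpha,\beta)=\xi_1$ and $e(\alpha,\beta)>i$. \end{itemize} Then there exists a torsion-free Shelah group $G$ of size $\kappa$ such that, moreover: \begin{enumerate} \item $G$ admits no $T_1$ group topology other than the discrete topology; \item $G\setminus\{1\}$ is a nonalgebraic unconditionally closed set. \end{enumerate}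
   Context: The ambient theory is ZFC. Cardinals are von Neumann ordinals. $[\kappa]^\kappa$ is the set of subsets of $\kappa$ of cardinality $\kappa$, and $[\kappa]^2$ is the set of two-element subsets of $\kappa$. For a map $f$ on $[\kappa]^2$ and $\alpha<\beta<\kappa$, $f(\alpha,\beta)$ denotes $f(\{\alpha,\beta\})$. A club in $\kappa$ is a closed unbounded subset of $\kappa$. A coloring $e:[\kappa]^2\rightarrow\theta$ is subadditive if for all $\alpha<\beta<\gamma<\kappa$: (1) $e(\alpha,\gamma)\le\max\{e(\alpha,\beta),e(\beta,\gamma)\}$, and (2) $e(\alpha,\beta)\le\max\{e(\alpha,\gamma),e(\beta,\gamma)\}$. For a group $G$, $X\subseteq G$ and a positive integer $n$, $X^n$ is the set of all products $x_1\cdots x_n$ with $x_1,\ldots,x_n\in X$. A group $G$ is $n$-Shelah if $X^n=G$ for every $X\subseteq G$ with $|X|=|G|$, and it is Shelah if it is $n$-Shelah for some positive integer $n$. A group topology on $G$ is a topology making multiplication and inversion continuous. $1$ denotes the identity of $G$. A subset of $G$ is unconditionally closed if it is closed in every Hausdorff group topology on $G$. For a word $w\in{}^{<\omega}(G\cup\{x\})$, where $x$ is an abstract variable outside $G$, and for $g\in G$, $f_w(g)\in G$ is the value obtained by substituting $g$ for each occurrence of $x$ in $w$ and evaluating the product in $G$. A subset of $G$ is algebraic if it is of the form $\bigcap_{i\in I}\{g\in G\mid f_{w_i}(g)=1\}$ for some system $\langle w_i\mid i\in I\rangle$ of such words; otherwise it is nonalgebraic. *)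

theory Defs
  imports
    "HOL-Algebra.Group"
    "HOL-Analysis.Abstract_Topology"
    "HOL-Analysis.T1_Spaces"
    "HOL-Library.FuncSet"
    "HOL-Library.Ramsey"
begin

unbundle cardinal_syntax

text \<open>
  A cardinal is a relation \<open>r\<close> with \<open>Card_order r\<close>, that is, a well-order of \<open>Field r\<close>
  of minimal order type; it stands for the von Neumann cardinal to which it is order-isomorphic.
  The ordinals below the cardinal are the elements of \<open>Field r\<close>, and \<open>underS r \<delta>\<close> is the
  ordinal \<open>\<delta>\<close> regarded as the set of its elements. A map \<open>f\<close> on the two-element subsets is
  literally a function on sets, applied as \<open>f {\<alpha>, \<beta>}\<close>.
\<close>

definition infinite_regular_cardinal :: "'a rel \<Rightarrow> bool" where
  "infinite_regular_cardinal r \<longleftrightarrow> Card_order r \<and> infinite (Field r) \<and> regularCard r"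

abbreviation ord_less :: "'a rel \<Rightarrow> 'a \<Rightarrow> 'a \<Rightarrow> bool" where
  "ord_less r \<alpha> \<beta> \<equiv> \<alpha> \<in> underS r \<beta>"

definition subadditive :: "'k rel \<Rightarrow> 't rel \<Rightarrow> ('k set \<Rightarrow> 't) \<Rightarrow> bool" where
  "subadditive \<kappa> \<theta> e \<longleftrightarrow>
    (\<forall>\<alpha> \<beta> \<gamma>. ord_less \<kappa> \<alpha> \<beta> \<and> ord_less \<kappa> \<beta> \<gamma> \<longrightarrow>
      (e {\<alpha>, \<gamma>}, wo_rel.max2 \<theta> (e {\<alpha>, \<beta>}) (e {\<beta>, \<gamma>})) \<in> \<theta> \<and>
      (e {\<alpha>, \<beta>}, wo_rel.max2 \<theta> (e {\<alpha>, \<gamma>}) (e {\<beta>, \<gamma>})) \<in> \<theta>)"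

text \<open>
  Closedness: \<open>D\<close> contains every nonzero \<open>\<delta>\<close> with \<open>sup (D \<inter> \<delta>) = \<delta>\<close>. The strict inequality
  \<open>\<alpha> < \<beta>\<close> below forces such a \<open>\<delta>\<close> to be a limit. Unboundedness is the library's \<open>cofinal\<close>.
\<close>

definition club :: "'k rel \<Rightarrow> 'k set \<Rightarrow> bool" where
  "club \<kappa> D \<longleftrightarrow> D \<subseteq> Field \<kappa> \<and> cofinal D \<kappa> \<and>
    (\<forall>\<delta>\<in>Field \<kappa>. underS \<kappa> \<delta> \<noteq> {} \<and>
        (\<forall>\<alpha>\<in>underS \<kappa> \<delta>. \<exists>\<beta>\<in>D \<inter> underS \<kappa> \<delta>. ord_less \<kappa> \<alpha> \<beta>) \<longrightarrow> \<delta> \<in> D)"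

definition cofinal_in :: "'k rel \<Rightarrow> 'k \<Rightarrow> 'k set \<Rightarrow> bool" where
  "cofinal_in \<kappa> \<delta> S \<longleftrightarrow> S \<subseteq> underS \<kappa> \<delta> \<and> (\<forall>\<gamma>\<in>underS \<kappa> \<delta>. \<exists>\<alpha>\<in>S. (\<gamma>, \<alpha>) \<in> \<kappa>)"

definition torsion_free :: "('a, 'b) monoid_scheme \<Rightarrow> bool" where
  "torsion_free G \<longleftrightarrow>
    (\<forall>g\<in>carrier G. \<forall>n::nat. n > 0 \<and> g [^]\<^bsub>G\<^esub> n = \<one>\<^bsub>G\<^esub> \<longrightarrow> g = \<one>\<^bsub>G\<^esub>)"

definition set_power :: "('a, 'b) monoid_scheme \<Rightarrow> 'a set \<Rightarrow> nat \<Rightarrow> 'a set" where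
  "set_power G X n = {foldr (mult G) xs \<one>\<^bsub>G\<^esub> | xs. length xs = n \<and> set xs \<subseteq> X}"

definition n_Shelah :: "('a, 'b) monoid_scheme \<Rightarrow> nat \<Rightarrow> bool" where
  "n_Shelah G n \<longleftrightarrow>
    (\<forall>X. X \<subseteq> carrier G \<and> |X| =o |carrier G| \<longrightarrow> set_power G X n = carrier G)"

definition Shelah :: "('a, 'b) monoid_scheme \<Rightarrow> bool" where
  "Shelah G \<longleftrightarrow> (\<exists>n>0. n_Shelah G n)"

definition group_topology :: "('a, 'b) monoid_scheme \<Rightarrow> 'a topology \<Rightarrow> bool" where
  "group_topology G T \<longleftrightarrow> topspace T = carrier G \<and>
    continuous_map (prod_topology T T) T (\<lambda>(x, y). x \<otimes>\<^bsub>G\<^esub> y) \<and>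
    continuous_map T T (\<lambda>x. inv\<^bsub>G\<^esub> x)"

definition unconditionally_closed :: "('a, 'b) monoid_scheme \<Rightarrow> 'a set \<Rightarrow> bool" where
  "unconditionally_closed G A \<longleftrightarrow> A \<subseteq> carrier G \<and>
    (\<forall>T. group_topology G T \<and> Hausdorff_space T \<longrightarrow> closedin T A)"

datatype 'a letter = Const 'a | Var

definition group_words :: "('a, 'b) monoid_scheme \<Rightarrow> 'a letter list set" where
  "group_words G = lists (insert Var (Const ` carrier G))"

primrec subst_letter :: "'a \<Rightarrow> 'a letter \<Rightarrow> 'a" where
  "subst_letter g (Const a) = a"
| "subst_letter g Var = g"

definition word_value :: "('a, 'b) monoid_scheme \<Rightarrow> 'a letter list \<Rightarrow> 'a \<Rightarrow> 'a" where
  "word_value G w g = foldr (mult G) (map (subst_letter g) w) \<one>\<^bsub>G\<^esub>"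

text \<open>
  A system of words enters only through its range \<open>W\<close>. Comprehension inside \<open>carrier G\<close> makes
  the empty system define \<open>carrier G\<close>.
\<close>

definition algebraic_subset :: "('a, 'b) monoid_scheme \<Rightarrow> 'a set \<Rightarrow> bool" where
  "algebraic_subset G A \<longleftrightarrow>
    (\<exists>W \<subseteq> group_words G. A = {g \<in> carrier G. \<forall>w\<in>W. word_value G w g = \<one>\<^bsub>G\<^esub>})"

end

theory Submission
  imports Defs
begin

text \<open>
  Index stages by pairs \<open>(\<gamma>, k)\<close> with \<open>\<gamma> < \<kappa>\<close> and \<open>k < \<theta>\<close>, and put \<open>(\<beta>, j)\<close> below \<open>(\<gamma>, k)\<close> when
  \<open>j \<le> k\<close> and either \<open>\<beta> = \<gamma>\<close> or \<open>\<beta> < \<gamma>\<close> and \<open>e(\<beta>, \<gamma>) \<le> k\<close>; this is a partial order because \<open>e\<close> is subadditive.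
  By recursion, each stage gets a torsion-free group of size less than \<open>\<kappa>\<close> in which the groups of all
  lower stages are malnormal. The group of \<open>(\<gamma>, k)\<close> is a quotient of \<open>K *\<^sub>H (L * \<langle>t\<rangle>)\<close>, where \<open>K\<close> is the union of
  the lower stages with first coordinate less than \<open>\<gamma>\<close>, \<open>L\<close> is the union of the stages below some \<open>(\<gamma>, k')\<close>
  with \<open>k' < k\<close>, \<open>H = K \<inter> L\<close>, and \<open>t\<close> is a free letter. For \<open>a \<in> K - L\<close> with first appearance at \<open>\<alpha>\<close> and \<open>y \<in> L - K\<close>,
  the quotient identifies a fixed long positive word in \<open>a, y, b\<^sub>1, b\<^sub>2\<close> with the element \<open>h\<close> of \<open>H\<close>, where
  \<open>h\<close> and \<open>(b\<^sub>1, b\<^sub>2)\<close> are coded by \<open>c\<^sub>0(\<alpha>, \<gamma>)\<close> and \<open>c\<^sub>1(\<alpha>, \<gamma>)\<close>.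

  These relators satisfy small cancellation over the malnormal subgroup \<open>H\<close>. Translates of their axes in
  the Bass--Serre tree overlap only in short segments, so a windmill argument shows that every
  nontrivial element of the normal closure shares a long segment with one of the axes. Hence \<open>K\<close> and \<open>L\<close>
  embed, remain malnormal, and no torsion arises.

  A set \<open>X\<close> of size \<open>\<kappa>\<close> contains elements first appearing at \<open>\<kappa>\<close> many ordinals with a common second
  coordinate. The hypothesis on the colorings yields, for every \<open>h\<close>, elements \<open>a, y, b\<^sub>1, b\<^sub>2\<close> of \<open>X\<close> to which
  the relator with value \<open>h\<close> applies, so the union \<open>G\<close> is Shelah. In a \<open>T\<^sub>1\<close> group topology some neighborhood
  \<open>V\<close> of \<open>1\<close> has \<open>V\<^sup>n \<noteq> G\<close>, thus lies in a malnormal subgroup, and meets a conjugate of itself only in \<open>1\<close>. Finally,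
  the free letters show that a word with parameters that is trivial on \<open>G - {1}\<close> is trivial at \<open>1\<close>.
\<close>

section \<open>Rotation families\<close>

text \<open>Being \<open>n\<close>-Shelah asks for products of exactly \<open>n\<close> members of
  an arbitrary large set \<open>X\<close>. So the relators are positive words of one length, and
  even the letters \<open>b1\<close>, \<open>b2\<close> that mark positions must come from
  \<open>X\<close>. The obstacle is consistency: relators whose letters are conjugate under some
  \<open>c\<close> in \<open>H\<close> need conjugate right-hand sides, or else \<open>H\<close>
  could collapse. Requiring the heights of \<open>b1\<close>, \<open>b2\<close>, \<open>a\<close> to
  increase strictly forces such a \<open>c\<close> to be trivial, because malnormality of the lower
  stages controls the height of a conjugate.

  The constants: axes of different rotations share only edges whose indices differ by at most 80, so
  the Behrstock constant is 81 and the windmill loses 6 * 81 = 486. With 200 blocks the period is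
  2402; it exceeds 12 * 81, and far more than half of it survives the losses.

  The geometry is done in an ambient group of permutations, written additively. The stages are
  records on sets of ordinals below \<kappa>, each containing the earlier ones literally, with names
  reserved in advance; so the colorings can name group elements, and limits are plain
  unions.\<close>

lemmas grp_norm = add.assoc minus_add diff_conv_add_uminus

section \<open>Subgroups and integer multiples in additive notation\<close>

definition add_subgroup :: "'g::group_add set \<Rightarrow> bool" where
  "add_subgroup Q \<longleftrightarrow> 0 \<in> Q \<and> (\<forall>x\<in>Q. \<forall>y\<in>Q. x + y \<in> Q) \<and> (\<forall>x\<in>Q. - x \<in> Q)"

lemma add_subgroupD:
  assumes "add_subgroup Q"
  shows "0 \<in> Q" "\<And>x y. x \<in> Q \<Longrightarrow> y \<in> Q \<Longrightarrow> x + y \<in> Q" "\<And>x. x \<in> Q \<Longrightarrow> - x \<in> Q"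
    "\<And>x y. x \<in> Q \<Longrightarrow> y \<in> Q \<Longrightarrow> x - y \<in> Q"
  using assms unfolding add_subgroup_def diff_conv_add_uminus by blast+

inductive_set add_span :: "'g::group_add set \<Rightarrow> 'g set" for A where
  zero: "0 \<in> add_span A"
| plus: "a \<in> A \<Longrightarrow> x \<in> add_span A \<Longrightarrow> a + x \<in> add_span A"
| minus: "a \<in> A \<Longrightarrow> x \<in> add_span A \<Longrightarrow> - a + x \<in> add_span A"

lemma add_span_add: "x \<in> add_span A \<Longrightarrow> y \<in> add_span A \<Longrightarrow> x + y \<in> add_span A"
  by (induction rule: add_span.induct) (auto simp: add.assoc intro: add_span.intros)

lemma add_span_base: "a \<in> A \<Longrightarrow> a \<in> add_span A"
  using add_span.plus[OF _ add_span.zero] by force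

lemma add_span_uminus: "x \<in> add_span A \<Longrightarrow> - x \<in> add_span A"
proof (induction rule: add_span.induct)
  case (plus a x)
  have "- a \<in> add_span A" using add_span.minus[OF plus(1) add_span.zero] by simp
  then show ?case using add_span_add[OF plus(3)] by (simp only: minus_add)
next
  case (minus a x)
  then show ?case using add_span_add[OF _ add_span_base] by (simp add: minus_add)
qed (simp add: add_span.zero)

lemma add_subgroup_span: "add_subgroup (add_span A)"
  unfolding add_subgroup_def by (simp add: add_span.zero add_span_add add_span_uminus)

lemma add_span_least:
  assumes "A \<subseteq> Q" "add_subgroup Q" shows "add_span A \<subseteq> Q"
proof
  fix x assume "x \<in> add_span A" then show "x \<in> Q"
    by (induction rule: add_span.induct) (use assms in \<open>auto simp: add_subgroup_def\<close>)
qed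

definition zmult :: "int \<Rightarrow> 'g::group_add \<Rightarrow> 'g" where
  "zmult k g = (if k \<ge> 0 then ((+) g ^^ nat k) 0 else ((+) (- g) ^^ nat (- k)) 0)"

lemma zmult_0 [simp]: "zmult 0 g = 0"
  by (simp add: zmult_def)

lemma zmult_Suc_left: "zmult (k + 1) g = g + zmult k g"
proof (cases "k \<ge> 0")
  case True
  then have "nat (k + 1) = Suc (nat k)" by simp
  then show ?thesis using True by (simp add: zmult_def)
next
  case False
  then have "nat (- k) = Suc (nat (- (k + 1)))" by simp
  then have "zmult k g = - g + ((+) (- g) ^^ nat (- (k + 1))) 0"
    using False by (simp add: zmult_def)
  then show ?thesis using False by (auto simp: zmult_def)
qed

lemma zmult_add: "zmult (j + k) g = zmult j g + zmult k g"
proof (induction j rule: int_induct[where k = 0])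
  case (step1 i)
  have "zmult (i + 1 + k) g = g + zmult (i + k) g"
    using zmult_Suc_left[of "i + k" g] by (simp add: algebra_simps)
  then show ?case using step1 by (simp add: zmult_Suc_left add.assoc)
next
  case (step2 i)
  have "g + zmult (i - 1 + k) g = zmult (i + k) g"
    using zmult_Suc_left[of "i - 1 + k" g] by (simp add: algebra_simps)
  also have "\<dots> = g + zmult (i - 1) g + zmult k g"
    using step2 zmult_Suc_left[of "i - 1" g] by simp
  finally show ?case by (simp add: add.assoc)
qed simp

lemma zmult_1 [simp]: "zmult 1 g = g"
  using zmult_Suc_left[of 0 g] by simp

lemma zmult_minus: "zmult (- k) g = - zmult k g"
  using zmult_add[of "- k" k g] by (simp add: eq_neg_iff_add_eq_0)

lemma zmult_conj: "zmult k (q + g - q) = q + zmult k g - q"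
proof (induction k rule: int_induct[where k = 0])
  case (step1 i)
  then show ?case by (simp add: zmult_Suc_left grp_norm del: add_uminus_conv_diff)
next
  case (step2 i)
  have "q + g - q + zmult (i - 1) (q + g - q) = q + (g + zmult (i - 1) g) - q"
    using step2 zmult_Suc_left[of "i - 1" "q + g - q"] zmult_Suc_left[of "i - 1" g] by simp
  then have "- (q + g - q) + (q + g - q + zmult (i - 1) (q + g - q))
      = - (q + g - q) + (q + (g + zmult (i - 1) g) - q)" by simp
  then show ?case unfolding minus_add_cancel
    by (simp only: grp_norm minus_minus minus_add_cancel add_minus_cancel)
qed simp

lemma zmult_in: "add_subgroup Q \<Longrightarrow> g \<in> Q \<Longrightarrow> zmult k g \<in> Q"
proof (induction k rule: int_induct[where k = 0])
  case (step2 i)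
  have "zmult (i - 1) g = - g + zmult i g"
    using zmult_Suc_left[of "i - 1" g] by simp
  then show ?case using step2 by (auto simp: add_subgroup_def)
qed (auto simp: add_subgroup_def zmult_Suc_left)

text \<open>The windmill argument: an admissible pair \<open>(W, Q)\<close> is enlarged, by adjoining to \<open>Q\<close> the
  rotations whose projections spread out on \<open>W\<close> and by thickening \<open>W\<close>, until \<open>W = P\<close>. Every
  nontrivial element of the group generated by the rotations then moves some projection by almost \<open>T\<close>.\<close>

locale windmill =
  fixes P S :: "'g::group_add set" and I :: "'i set" and act :: "'g \<Rightarrow> 'i \<Rightarrow> 'i"
    and pr :: "'i \<Rightarrow> 'g \<Rightarrow> int" and rot :: "'i \<Rightarrow> 'g" and T \<epsilon> :: int
  assumes P: "add_subgroup P"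
    and S: "S \<subseteq> P"
    and gen: "\<And>A. A \<subseteq> P \<Longrightarrow> A \<noteq> {} \<Longrightarrow> (\<And>x s. x \<in> A \<Longrightarrow> s \<in> S \<Longrightarrow> x + s \<in> A) \<Longrightarrow> A = P"
    and act: "\<And>g i. g \<in> P \<Longrightarrow> i \<in> I \<Longrightarrow> act g i \<in> I"
    and pr_act: "\<And>g i x. g \<in> P \<Longrightarrow> i \<in> I \<Longrightarrow> x \<in> P \<Longrightarrow> pr (act g i) (g + x) = pr i x"
    and rot: "\<And>i. i \<in> I \<Longrightarrow> rot i \<in> P"
    and rot_act: "\<And>g i. g \<in> P \<Longrightarrow> i \<in> I \<Longrightarrow> rot (act g i) = g + rot i - g"
    and pr_rot: "\<And>i x. i \<in> I \<Longrightarrow> x \<in> P \<Longrightarrow> pr i (rot i + x) = pr i x + T"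
    and lipschitz: "\<And>i x s. i \<in> I \<Longrightarrow> x \<in> P \<Longrightarrow> s \<in> S \<Longrightarrow> \<bar>pr i (x + s) - pr i x\<bar> \<le> 1"
    and behrstock: "\<And>i j. i \<in> I \<Longrightarrow> j \<in> I \<Longrightarrow> rot i \<noteq> rot j \<Longrightarrow>
      \<exists>a b. \<forall>x\<in>P. \<bar>pr i x - a\<bar> \<le> \<epsilon> \<or> \<bar>pr j x - b\<bar> \<le> \<epsilon>"
    and eps: "\<epsilon> \<ge> 1" and T: "T > 12 * \<epsilon>"
begin

definition diam_le :: "'i \<Rightarrow> 'g set \<Rightarrow> int \<Rightarrow> bool" where
  "diam_le i W t \<longleftrightarrow> (\<forall>x\<in>W. \<forall>y\<in>W. \<bar>pr i x - pr i y\<bar> \<le> t)"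

text \<open>The slacks are solved backwards. A nonzero power of a rotation moves a projection by at
  least \<open>T\<close>; subtracting \<open>t1\<close> for the spread of \<open>W\<close> and
  \<open>2 * \<epsilon>\<close> for one use of \<open>behrstock\<close> leaves exactly
  \<open>D\<close>. The gap \<open>t1 - t0 = 4 * \<epsilon>\<close> pays for passing to the orbit of
  \<open>W\<close>. Finally \<open>T > 12 * \<epsilon>\<close> gives
  \<open>t0 \<ge> 2 * \<epsilon>\<close>, so that no window of radius \<epsilon> contains a
  projection of \<open>W\<close> whose spread exceeds \<open>t0\<close>.\<close>

abbreviation "t1 \<equiv> T - 6 * \<epsilon> - 1"
abbreviation "t0 \<equiv> T - 10 * \<epsilon> - 1"
abbreviation "D \<equiv> 4 * \<epsilon> + 1"

definition admissible :: "'g set \<Rightarrow> 'g set \<Rightarrow> bool" where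
  "admissible W Q \<longleftrightarrow> W \<subseteq> P \<and> add_subgroup Q \<and> Q \<subseteq> P \<and> W \<noteq> {} \<and>
    (\<forall>q\<in>Q. \<forall>w\<in>W. q + w \<in> W) \<and> (\<forall>i\<in>I. rot i \<in> Q \<or> diam_le i W t1)"

lemma pr_zmult: "i \<in> I \<Longrightarrow> x \<in> P \<Longrightarrow> pr i (zmult k (rot i) + x) = pr i x + k * T"
proof (induction k rule: int_induct[where k = 0])
  case (step1 k)
  then have "zmult k (rot i) + x \<in> P" using P zmult_in[OF P rot] by (auto simp: add_subgroup_def)
  then show ?case using step1 pr_rot[of i "zmult k (rot i) + x"]
    by (simp add: zmult_Suc_left add.assoc distrib_right)
next
  case (step2 k)
  then have *: "zmult (k - 1) (rot i) + x \<in> P" using P zmult_in[OF P rot] by (auto simp: add_subgroup_def)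
  have "rot i + (zmult (k - 1) (rot i) + x) = zmult k (rot i) + x"
    using zmult_Suc_left[of "k - 1" "rot i"] by (simp add: add.assoc)
  then show ?case using step2 pr_rot[OF step2.prems(1) *] by (simp add: left_diff_distrib)
qed simp

context
  fixes W Q assumes WQ: "admissible W Q"
begin

lemma WQD: "W \<subseteq> P" "add_subgroup Q" "Q \<subseteq> P" "W \<noteq> {}"
  "\<And>q w. q \<in> Q \<Longrightarrow> w \<in> W \<Longrightarrow> q + w \<in> W" "\<And>i. i \<in> I \<Longrightarrow> rot i \<notin> Q \<Longrightarrow> diam_le i W t1"
  using WQ unfolding admissible_def by blast+

text \<open>The indices whose rotations are adjoined next. By admissibility the spread of
  \<open>W\<close> on them lies between \<open>t0\<close> and \<open>t1\<close>.\<close>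

definition big :: "'i set" where
  "big = {i \<in> I. rot i \<notin> Q \<and> \<not> diam_le i W t0}"

lemma big_act: assumes q: "q \<in> Q" and i: "i \<in> big" shows "act q i \<in> big"
proof -
  have iI: "i \<in> I" "rot i \<notin> Q" "\<not> diam_le i W t0" using i by (auto simp: big_def)
  have qP: "q \<in> P" using q WQD by auto
  have "rot (act q i) \<notin> Q"
  proof
    assume "rot (act q i) \<in> Q"
    then have "- q + (q + rot i - q) + q \<in> Q"
      using rot_act[OF qP iI(1)] q add_subgroupD(2,3)[OF WQD(2)] by simp
    moreover have "- q + (q + rot i - q) + q = rot i"
      by (simp only: grp_norm minus_add_cancel left_minus add_0_right)
    ultimately show False using iI by simp
  qed
  moreover have "\<not> diam_le (act q i) W t0"
  proof -
    obtain x y where "x \<in> W" "y \<in> W" "\<bar>pr i x - pr i y\<bar> > t0" using iI by (auto simp: diam_le_def)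
    then have "\<bar>pr (act q i) (q + x) - pr (act q i) (q + y)\<bar> > t0" "q + x \<in> W" "q + y \<in> W"
      using pr_act[OF qP iI(1)] WQD(1,5) q by (auto simp: subset_iff)
    then show ?thesis unfolding diam_le_def by (meson not_le)
  qed
  ultimately show ?thesis using act[OF qP iI(1)] by (simp add: big_def)
qed

lemma big_far: assumes "i \<in> big" shows "\<exists>w\<in>W. \<bar>pr i w - c\<bar> > \<epsilon>"
proof -
  obtain x y where "x \<in> W" "y \<in> W" "\<bar>pr i x - pr i y\<bar> > t0"
    using assms by (auto simp: big_def diam_le_def)
  moreover have "t0 \<ge> 2 * \<epsilon>" using T eps by simp
  ultimately have "\<bar>pr i x - c\<bar> > \<epsilon> \<or> \<bar>pr i y - c\<bar> > \<epsilon>" by linarith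
  then show ?thesis using \<open>x \<in> W\<close> \<open>y \<in> W\<close> by blast
qed

text \<open>Consecutive entries must differ in their rotations, not merely in their indices: several
  indices may carry the same rotation, and \<open>behrstock\<close> speaks of distinct
  rotations.\<close>

fun chain :: "('i \<times> int) list \<Rightarrow> bool" where
  "chain [] = True"
| "chain [(i, k)] = (i \<in> big \<and> k \<noteq> 0)"
| "chain ((i, k) # (j, l) # c) = (i \<in> big \<and> k \<noteq> 0 \<and> rot i \<noteq> rot j \<and> chain ((j, l) # c))"

fun chain_val :: "('i \<times> int) list \<Rightarrow> 'g" where
  "chain_val [] = 0"
| "chain_val ((i, k) # c) = zmult k (rot i) + chain_val c"

lemma chain_ConsD: "chain ((i, k) # c) \<Longrightarrow> i \<in> big \<and> k \<noteq> 0 \<and> chain c"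
  by (cases c) auto

lemma bigD: "i \<in> big \<Longrightarrow> i \<in> I" "i \<in> big \<Longrightarrow> rot i \<in> P" "i \<in> big \<Longrightarrow> diam_le i W t1"
  using rot WQD(6) by (auto simp: big_def)

lemma chain_val_P: "chain c \<Longrightarrow> chain_val c \<in> P"
proof (induction c)
  case (Cons a c)
  then show ?case using chain_ConsD[of "fst a" "snd a" c] bigD(2) zmult_in[OF P] add_subgroupD[OF P]
    by (cases a) auto
qed (use add_subgroupD[OF P] in simp)

text \<open>Ping-pong. The tail of the chain is far from \<open>W\<close> on its own first index, so
  \<open>behrstock\<close> puts it within \<open>2 * \<epsilon>\<close> of \<open>W\<close> on the
  index \<open>i\<close>; the nonzero power of \<open>rot i\<close> then throws it off by at least
  \<open>T - 2 * \<epsilon> - t1 = D\<close>.\<close>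

lemma chain_far:
  assumes "chain ((i, k) # c)" "u \<in> W" "w \<in> W"
  shows "\<bar>pr i (chain_val ((i, k) # c) + u) - pr i w\<bar> \<ge> D"
  using assms
proof (induction c arbitrary: i k w)
  case Nil
  then have i: "i \<in> I" "k \<noteq> 0" "u \<in> P" "\<bar>pr i u - pr i w\<bar> \<le> t1"
    using bigD[of i] WQD(1) by (auto simp: diam_le_def)
  have "\<bar>k * T\<bar> \<ge> T" using i(2) T eps by (simp add: abs_mult mult_le_cancel_right1 )
  then show ?case using i pr_zmult[of i u k] T eps by (simp; linarith)
next
  case (Cons jl c)
  obtain j l where jl: "jl = (j, l)" by force
  let ?y = "chain_val ((j, l) # c) + u"
  have ij: "i \<in> big" "k \<noteq> 0" "rot i \<noteq> rot j" "chain ((j, l) # c)" "j \<in> big"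
    using Cons.prems jl chain_ConsD[of j l c] by auto
  have yP: "?y \<in> P" using chain_val_P[OF ij(4)] Cons.prems WQD(1) add_subgroupD[OF P] by auto
  have far: "\<bar>pr j ?y - pr j v\<bar> \<ge> D" if "v \<in> W" for v
    using Cons.IH[OF ij(4) \<open>u \<in> W\<close> that] .
  obtain a b where ab: "\<And>x. x \<in> P \<Longrightarrow> \<bar>pr i x - a\<bar> \<le> \<epsilon> \<or> \<bar>pr j x - b\<bar> \<le> \<epsilon>"
    using behrstock[of i j] ij bigD by blast
  have val: "pr i (chain_val ((i, k) # jl # c) + u) = pr i ?y + k * T"
    using pr_zmult[OF bigD(1)[OF ij(1)] yP, of k] by (simp add: jl add.assoc)
  have kT: "\<bar>k * T\<bar> \<ge> T" using ij(2) T eps by (simp add: abs_mult mult_le_cancel_right1)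
  have "\<exists>v\<in>W. \<bar>pr i ?y - pr i v\<bar> \<le> 2 * \<epsilon>"
  proof (cases "\<bar>pr j ?y - b\<bar> \<le> \<epsilon>")
    case True
    have "\<bar>pr i v - a\<bar> \<le> \<epsilon>" if "v \<in> W" for v
    proof -
      have "\<bar>pr j v - b\<bar> > \<epsilon>" using far[OF that] True eps by linarith
      then show ?thesis using ab[of v] that WQD(1) by auto
    qed
    then have False using big_far[OF ij(1), of a] by force
    then show ?thesis ..
  next
    case False
    obtain v where v: "v \<in> W" "\<bar>pr j v - b\<bar> > \<epsilon>" using big_far[OF ij(5)] by blast
    then have "\<bar>pr i v - a\<bar> \<le> \<epsilon>" "\<bar>pr i ?y - a\<bar> \<le> \<epsilon>" using ab[of v] ab[OF yP] False WQD(1) by auto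
    then show ?thesis using v(1) by (intro bexI[of _ v]) linarith+
  qed
  then obtain v where "v \<in> W" "\<bar>pr i ?y - pr i v\<bar> \<le> 2 * \<epsilon>" by blast
  moreover then have "\<bar>pr i v - pr i w\<bar> \<le> t1"
    using bigD(3)[OF ij(1)] Cons.prems(3) by (auto simp: diam_le_def)
  ultimately show ?case using kT val by linarith
qed

text \<open>A normal form for the subgroup generated by \<open>Q\<close> and the big rotations:
  since \<open>Q\<close> permutes \<open>big\<close>, its elements can be moved to the right end of
  any product.\<close>

definition Q' :: "'g set" where "Q' = {chain_val c + q | c q. chain c \<and> q \<in> Q}"

lemma chain_val_Cons:
  assumes "i \<in> big" "chain c" shows "\<exists>c'. chain c' \<and> chain_val c' = zmult k (rot i) + chain_val c"
proof (cases "k = 0")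
  case True
  then show ?thesis using assms by auto
next
  case False
  show ?thesis
  proof (cases c)
    case Nil
    then show ?thesis using assms False by (intro exI[of _ "[(i, k)]"]) simp
  next
    case (Cons jl d)
    obtain j l where jl: "jl = (j, l)" by force
    show ?thesis
    proof (cases "rot i = rot j")
      case True
      have v: "zmult k (rot i) + chain_val c = zmult (k + l) (rot j) + chain_val d"
        using True Cons jl by (simp add: zmult_add add.assoc)
      show ?thesis
      proof (cases "k + l = 0")
        case True
        then show ?thesis using v assms(2) Cons jl chain_ConsD[of j l d] by (intro exI[of _ d]) simp
      next
        case False
        then have "chain ((j, k + l) # d)" using assms(2) Cons jl by (cases d) auto
        then show ?thesis using v by (intro exI[of _ "(j, k + l) # d"]) simp
      qed
    next
      case False
      then show ?thesis using assms Cons jl \<open>k \<noteq> 0\<close> by (intro exI[of _ "(i, k) # c"]) simp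
    qed
  qed
qed

lemma chain_conj:
  assumes "q \<in> Q" "chain c"
  shows "chain (map (\<lambda>(i, k). (act q i, k)) c) \<and>
    chain_val (map (\<lambda>(i, k). (act q i, k)) c) = q + chain_val c - q"
  using assms(2)
proof (induction c rule: chain.induct)
  case (2 i k)
  then show ?case using big_act[OF assms(1)] rot_act[of q i] bigD(1)[of i] WQD(3) assms(1)
    by (auto simp: zmult_conj)
next
  case (3 i k j l c)
  have qP: "q \<in> P" using assms WQD(3) by auto
  have ij: "i \<in> big" "j \<in> big" using 3 chain_ConsD[of j l c] by auto
  have r: "rot (act q i) = q + rot i - q" "rot (act q j) = q + rot j - q"
    using rot_act[OF qP] ij bigD(1) by auto
  have "rot (act q i) \<noteq> rot (act q j)" using 3(2) unfolding r diff_conv_add_uminus by (metis add_left_imp_eq add_right_imp_eq chain.simps(3))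
  moreover have "q + zmult k (rot i) - q + (q + chain_val ((j, l) # c) - q) =
      q + chain_val ((i, k) # (j, l) # c) - q"
    by (simp only: chain_val.simps grp_norm minus_add_cancel)
  ultimately show ?case using 3 big_act[OF assms(1) ij(1)] r ij(2)
    by (simp add: zmult_conj)
qed simp

lemma Q'_left:
  assumes "x \<in> Q'" shows "q \<in> Q \<Longrightarrow> q + x \<in> Q'" "i \<in> big \<Longrightarrow> zmult k (rot i) + x \<in> Q'"
proof -
  obtain c r where x: "x = chain_val c + r" "chain c" "r \<in> Q" using assms by (auto simp: Q'_def)
  { assume q: "q \<in> Q"
    have e: "q + x = (q + chain_val c - q) + (q + r)"
      by (simp only: x grp_norm minus_add_cancel)
    obtain c' where "chain c'" "chain_val c' = q + chain_val c - q" using chain_conj[OF q x(2)] by blast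
    moreover have "q + r \<in> Q" using q x(3) add_subgroupD(2)[OF WQD(2)] by blast
    ultimately show "q + x \<in> Q'" unfolding Q'_def e by (auto intro!: exI[of _ c'] exI[of _ "q + r"]) }
  { assume "i \<in> big"
    then obtain c' where "chain c'" "chain_val c' = zmult k (rot i) + chain_val c"
      using chain_val_Cons[OF _ x(2), of i k] by blast
    moreover then have "zmult k (rot i) + x = chain_val c' + r" by (simp add: x add.assoc)
    ultimately show "zmult k (rot i) + x \<in> Q'" unfolding Q'_def using x(3) by blast }
qed

lemma Q_Q': "Q \<subseteq> Q'"
  unfolding Q'_def by (force intro: exI[of _ "[]"])

lemma Q'_eq_span: "Q' = add_span (Q \<union> rot ` big)"
proof
  show "add_span (Q \<union> rot ` big) \<subseteq> Q'"
  proof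
    fix x assume "x \<in> add_span (Q \<union> rot ` big)"
    then show "x \<in> Q'"
    proof induction
      case zero
      then show ?case using Q_Q' add_subgroupD[OF WQD(2)] by auto
    next
      case (plus a x)
      then show ?case using Q'_left(1)[of x a] Q'_left(2)[of x _ 1] by auto
    next
      case (minus a x)
      then show ?case using Q'_left(1)[of x "- a"] Q'_left(2)[of x _ "- 1"] add_subgroupD(3)[OF WQD(2)]
        by (auto simp: zmult_minus)
    qed
  qed
  have "chain c \<Longrightarrow> chain_val c \<in> add_span (Q \<union> rot ` big)" for c
  proof (induction c)
    case (Cons a c)
    then show ?case using chain_ConsD[of "fst a" "snd a" c]
      by (cases a) (auto intro!: add_span_add zmult_in[OF add_subgroup_span] intro: add_span_base)
  qed (simp add: add_span.zero)
  then show "Q' \<subseteq> add_span (Q \<union> rot ` big)"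
    unfolding Q'_def by (auto intro!: add_span_add intro: add_span_base)
qed

lemma Q'_subgroup: "add_subgroup Q'" and Q'_P: "Q' \<subseteq> P"
proof -
  show "add_subgroup Q'" by (simp add: Q'_eq_span add_subgroup_span)
  show "Q' \<subseteq> P" unfolding Q'_eq_span
    by (rule add_span_least[OF _ P]) (use WQD(3) bigD(2) in auto)
qed

text \<open>A point is compared with the translates of \<open>W\<close> met along the chain one after the other;
  the two hypotheses on \<open>x\<close> are what survives the passage to the next translate.\<close>

lemma chain_near_step:
  assumes chain: "chain ((i, k) # c)" and u: "u \<in> W" and j: "j \<in> I" "rot j \<notin> Q'" and x: "x \<in> P"
    and near: "\<exists>w\<in>W. \<bar>pr j x - pr j w\<bar> \<le> 2 * \<epsilon>" "\<exists>w\<in>W. \<bar>pr i x - pr i w\<bar> \<le> 2 * \<epsilon>"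
    and IH: "\<And>i2 k2 d l z. \<lbrakk>c = (i2, k2) # d; chain c; l \<in> I; rot l \<notin> Q'; z \<in> P;
      \<exists>w\<in>W. \<bar>pr l z - pr l w\<bar> \<le> 2 * \<epsilon>; \<exists>w\<in>W. \<bar>pr i2 z - pr i2 w\<bar> \<le> 2 * \<epsilon>\<rbrakk>
      \<Longrightarrow> \<bar>pr l z - pr l (chain_val c + u)\<bar> \<le> t0 + 4 * \<epsilon>"
  shows "\<bar>pr j x - pr j (chain_val ((i, k) # c) + u)\<bar> \<le> t0 + 4 * \<epsilon>"
proof -
  obtain w1 w where w1: "w1 \<in> W" "\<bar>pr j x - pr j w1\<bar> \<le> 2 * \<epsilon>"
    and w: "w \<in> W" "\<bar>pr i x - pr i w\<bar> \<le> 2 * \<epsilon>" using near by blast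
  have i: "i \<in> big" "i \<in> I" "k \<noteq> 0" "rot i \<in> P" "diam_le i W t1" "chain c"
    using chain chain_ConsD[of i k c] bigD[of i] by auto
  have "rot i \<in> Q'" using i(1) by (auto simp: Q'_eq_span intro: add_span_base)
  then have ne: "rot j \<noteq> rot i" using j by auto
  have j_small: "diam_le l W t0" if "l \<in> I" "rot l \<notin> Q'" for l
    using that Q_Q' unfolding Q'_eq_span big_def by (auto intro: add_span_base)
  obtain a b where ab: "\<And>z. z \<in> P \<Longrightarrow> \<bar>pr j z - a\<bar> \<le> \<epsilon> \<or> \<bar>pr i z - b\<bar> \<le> \<epsilon>"
    using behrstock[OF j(1) i(2) ne] by blast
  define \<sigma> where "\<sigma> = zmult k (rot i)"
  define y where "y = chain_val c + u"
  have yP: "y \<in> P" unfolding y_def using chain_val_P[OF i(6)] u WQD(1) add_subgroupD(2)[OF P] by blast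
  have sP: "\<sigma> \<in> P" "- \<sigma> \<in> P" "\<sigma> + y \<in> P" "- \<sigma> + x \<in> P"
    using zmult_in[OF P i(4)] add_subgroupD(2,3)[OF P] yP x by (auto simp: \<sigma>_def)
  have val: "chain_val ((i, k) # c) + u = \<sigma> + y" by (simp add: \<sigma>_def y_def add.assoc)
  show ?thesis
  proof (cases "\<bar>pr i (\<sigma> + y) - b\<bar> \<le> \<epsilon>")
    case False
    obtain w0 where w0: "w0 \<in> W" "\<bar>pr i w0 - b\<bar> > \<epsilon>" using big_far[OF i(1)] by blast
    then have "\<bar>pr j w0 - a\<bar> \<le> \<epsilon>" using ab[of w0] WQD(1) by auto
    moreover have "\<bar>pr j (\<sigma> + y) - a\<bar> \<le> \<epsilon>" using ab[OF sP(3)] False by auto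
    moreover have "\<bar>pr j w1 - pr j w0\<bar> \<le> t0" using j_small[OF j] w0(1) w1(1) by (auto simp: diam_le_def)
    ultimately show ?thesis unfolding val using w1(2) by linarith
  next
    case True
    \<comment> \<open>The end point is at least \<open>D\<close> from \<open>w\<close> on
      \<open>i\<close> and close to \<open>b\<close>, whereas \<open>x\<close> is within
      \<open>2 * \<epsilon>\<close> of \<open>w\<close>. So \<open>x\<close> avoids the window
      around \<open>b\<close> and projects near \<open>a\<close> on \<open>j\<close>, and so does
      some point \<open>\<sigma> + v\<close> of the translated \<open>W\<close>. After moving back
      by \<open>\<sigma>\<close>, the point \<open>v\<close> witnesses the first nearness hypothesis
      for the shorter chain.\<close>
    have "\<bar>pr i (\<sigma> + y) - pr i w\<bar> \<ge> D"
      using chain_far[OF chain u w(1)] unfolding val .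
    then have "\<bar>pr i x - b\<bar> > \<epsilon>" using True w(2) by linarith
    then have xa: "\<bar>pr j x - a\<bar> \<le> \<epsilon>" using ab[OF x] by auto
    obtain v where v: "v \<in> W" "\<bar>pr i v - (b - k * T)\<bar> > \<epsilon>" using big_far[OF i(1)] by blast
    then have vP: "v \<in> P" "\<sigma> + v \<in> P" using WQD(1) sP add_subgroupD(2)[OF P] by auto
    have "\<bar>pr i (\<sigma> + v) - b\<bar> > \<epsilon>" using pr_zmult[OF i(2) vP(1), of k] v(2) by (simp add: \<sigma>_def)
    then have va: "\<bar>pr j (\<sigma> + v) - a\<bar> \<le> \<epsilon>" using ab[OF vP(2)] by auto
    define l where "l = act (- \<sigma>) j"
    have pr_l: "pr l z = pr j (\<sigma> + z)" if "z \<in> P" for z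
      using pr_act[OF sP(2) j(1), of "\<sigma> + z"] that sP(1) add_subgroupD(2)[OF P] by (simp add: l_def)
    have lI: "l \<in> I" unfolding l_def using act sP j by blast
    have sQ: "\<sigma> \<in> Q'" unfolding \<sigma>_def using zmult_in[OF Q'_subgroup \<open>rot i \<in> Q'\<close>] .
    have lQ: "rot l \<notin> Q'"
    proof
      assume "rot l \<in> Q'"
      then have "\<sigma> + rot l + - \<sigma> \<in> Q'" using sQ add_subgroupD(2,3)[OF Q'_subgroup] by blast
      moreover have "rot l = - \<sigma> + rot j - - \<sigma>" unfolding l_def using rot_act[OF sP(2) j(1)] .
      then have "\<sigma> + rot l + - \<sigma> = rot j"
        by (simp only: grp_norm minus_minus add_minus_cancel right_minus add_0_right)
      ultimately show False using j(2) by simp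
    qed
    show ?thesis
    proof (cases c)
      case Nil
      then have "\<bar>pr l v - pr l y\<bar> \<le> t0" using j_small[OF lI lQ] v(1) u by (auto simp: diam_le_def y_def)
      then show ?thesis unfolding val using xa va pr_l[OF vP(1)] pr_l[OF yP] eps by linarith
    next
      case (Cons p d)
      obtain i2 k2 where p: "p = (i2, k2)" by force
      have i2: "i2 \<in> big" "rot i \<noteq> rot i2" using chain Cons p chain_ConsD[of i2 k2 d] by auto
      have near1: "\<bar>pr l (- \<sigma> + x) - pr l v\<bar> \<le> 2 * \<epsilon>"
        using xa va pr_l[OF vP(1)] pr_l[OF sP(4)] by simp
      have kT: "\<bar>k * T\<bar> \<ge> T" using i(3) T eps by (simp add: abs_mult mult_le_cancel_right1)
      have prx: "pr i (- \<sigma> + x) = pr i x - k * T"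
        using pr_zmult[OF i(2) x, of "- k"] by (simp add: \<sigma>_def zmult_minus)
      have far: "\<bar>pr i (- \<sigma> + x) - pr i z\<bar> \<ge> D" if "z \<in> W" for z
      proof -
        have "\<bar>pr i w - pr i z\<bar> \<le> t1" using i(5) that w(1) by (auto simp: diam_le_def)
        then show ?thesis using w(2) kT prx by linarith
      qed
      obtain a' b' where ab': "\<And>z. z \<in> P \<Longrightarrow> \<bar>pr i z - a'\<bar> \<le> \<epsilon> \<or> \<bar>pr i2 z - b'\<bar> \<le> \<epsilon>"
        using behrstock[OF i(2) bigD(1)[OF i2(1)] i2(2)] by blast
      obtain z1 where z1: "z1 \<in> W" "\<bar>pr i2 z1 - b'\<bar> > \<epsilon>" using big_far[OF i2(1)] by blast
      then have "\<bar>pr i z1 - a'\<bar> \<le> \<epsilon>" using ab'[of z1] WQD(1) by auto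
      then have "\<bar>pr i (- \<sigma> + x) - a'\<bar> > \<epsilon>" using far[OF z1(1)] eps by linarith
      then have e1: "\<bar>pr i2 (- \<sigma> + x) - b'\<bar> \<le> \<epsilon>" using ab'[OF sP(4)] by auto
      obtain z2 where z2: "z2 \<in> W" "\<bar>pr i z2 - a'\<bar> > \<epsilon>" using big_far[OF i(1)] by blast
      then have "\<bar>pr i2 z2 - b'\<bar> \<le> \<epsilon>" using ab'[of z2] WQD(1) by auto
      then have near2: "\<bar>pr i2 (- \<sigma> + x) - pr i2 z2\<bar> \<le> 2 * \<epsilon>" using e1 by linarith
      have "\<bar>pr l (- \<sigma> + x) - pr l y\<bar> \<le> t0 + 4 * \<epsilon>"
        unfolding y_def using IH[OF _ i(6) lI lQ sP(4)] Cons p near1 near2 v(1) z2(1) by blast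
      then show ?thesis using pr_l[OF yP] pr_l[OF sP(4)] val by simp
    qed
  qed
qed

lemma chain_near:
  assumes "chain ((i, k) # c)" "u \<in> W" "j \<in> I" "rot j \<notin> Q'" "x \<in> P"
    and "\<exists>w\<in>W. \<bar>pr j x - pr j w\<bar> \<le> 2 * \<epsilon>" "\<exists>w\<in>W. \<bar>pr i x - pr i w\<bar> \<le> 2 * \<epsilon>"
  shows "\<bar>pr j x - pr j (chain_val ((i, k) # c) + u)\<bar> \<le> t0 + 4 * \<epsilon>"
  using assms
proof (induction c arbitrary: i k j x)
  case (Cons a c)
  show ?case by (rule chain_near_step[OF Cons.prems]) (use Cons.IH \<open>u \<in> W\<close> in blast)
next
  case Nil
  show ?case by (rule chain_near_step[OF Nil]) auto
qed

text \<open>A nonempty chain carries every point of \<open>W\<close> off \<open>W\<close>, by at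
  least \<open>D\<close> on its first index.\<close>

lemma Q'_meet:
  assumes "\<nu> \<in> Q'" "x \<in> W" "\<nu> + x \<in> W" shows "\<nu> \<in> Q"
proof -
  obtain c q where c: "\<nu> = chain_val c + q" "chain c" "q \<in> Q" using assms(1) by (auto simp: Q'_def)
  show ?thesis
  proof (cases c)
    case Nil
    then show ?thesis using c by simp
  next
    case (Cons p d)
    obtain i k where p: "p = (i, k)" by force
    have "q + x \<in> W" using WQD(5) c(3) assms(2) by blast
    then have "\<bar>pr i (chain_val c + (q + x)) - pr i (\<nu> + x)\<bar> \<ge> D"
      using chain_far[of i k d "q + x" "\<nu> + x"] c Cons p assms by blast
    then show ?thesis using c(1) eps by (simp add: add.assoc)
  qed
qed

definition W' :: "'g set" where "W' = {q + w | q w. q \<in> Q' \<and> w \<in> W}"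

lemma W_W': "W \<subseteq> W'"
  using add_subgroupD(1)[OF Q'_subgroup] unfolding W'_def by force

text \<open>Moving the first of two points of the orbit back into \<open>W\<close> leaves one point
  of \<open>W\<close> and the end point of one chain; \<open>chain_near\<close> bounds their
  distance by \<open>t0 + 4 * \<epsilon> = t1\<close>.\<close>

lemma admissible_step: "admissible W' Q'"
proof -
  have "diam_le j W' t1" if j: "j \<in> I" "rot j \<notin> Q'" for j
    unfolding diam_le_def
  proof (intro ballI)
    fix x y assume "x \<in> W'" "y \<in> W'"
    then obtain q1 w1 q2 w2 where xy: "x = q1 + w1" "y = q2 + w2" "q1 \<in> Q'" "q2 \<in> Q'" "w1 \<in> W" "w2 \<in> W"
      unfolding W'_def by blast
    have "- q1 + q2 \<in> Q'" using xy add_subgroupD(2,3)[OF Q'_subgroup] by blast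
    then obtain c q where c: "- q1 + q2 = chain_val c + q" "chain c" "q \<in> Q" by (auto simp: Q'_def)
    define l where "l = act (- q1) j"
    have qP: "q1 \<in> P" "- q1 \<in> P" using xy(3) Q'_P add_subgroupD(3)[OF P] by auto
    have pr_l: "pr l z = pr j (q1 + z)" if "z \<in> P" for z
      using pr_act[OF qP(2) j(1), of "q1 + z"] that qP(1) add_subgroupD(2)[OF P] by (simp add: l_def)
    have lI: "l \<in> I" unfolding l_def using act qP j by blast
    have lQ: "rot l \<notin> Q'"
    proof
      assume "rot l \<in> Q'"
      then have "q1 + rot l + - q1 \<in> Q'" using xy(3) add_subgroupD(2,3)[OF Q'_subgroup] by blast
      moreover have "rot l = - q1 + rot j - - q1" unfolding l_def using rot_act[OF qP(2) j(1)] .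
      then have "q1 + rot l + - q1 = rot j"
        by (simp only: grp_norm minus_minus add_minus_cancel right_minus add_0_right)
      ultimately show False using j(2) by simp
    qed
    have qw: "q + w2 \<in> W" using WQD(5) c xy by blast
    define z where "z = chain_val c + (q + w2)"
    have wP: "w1 \<in> P" "z \<in> P" using xy WQD(1) chain_val_P[OF c(2)] qw add_subgroupD(2)[OF P] by (auto simp: z_def)
    have "q1 + z = q1 + (chain_val c + q) + w2" by (simp add: z_def add.assoc)
    also have "\<dots> = y" by (simp only: c(1)[symmetric] xy add_minus_cancel)
    finally have y: "y = q1 + z" ..
    have "\<bar>pr l w1 - pr l z\<bar> \<le> t1"
    proof (cases c)
      case Nil
      have "diam_le l W t0" using lI lQ Q_Q' unfolding Q'_eq_span big_def by (auto intro: add_span_base)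
      then have "\<bar>pr l w1 - pr l z\<bar> \<le> t0" using Nil xy qw by (simp add: diam_le_def z_def)
      then show ?thesis using eps by linarith
    next
      case (Cons p d)
      obtain i k where p: "p = (i, k)" by force
      have "\<exists>w\<in>W. \<bar>pr l w1 - pr l w\<bar> \<le> 2 * \<epsilon>" "\<exists>w\<in>W. \<bar>pr i w1 - pr i w\<bar> \<le> 2 * \<epsilon>"
        using xy(5) eps by (auto intro!: bexI[of _ w1])
      then show ?thesis
        using chain_near[of i k d "q + w2" l w1] c(2) Cons p qw lI lQ wP unfolding z_def by simp
    qed
    then show "\<bar>pr j x - pr j y\<bar> \<le> t1" using pr_l wP xy(1) y by simp
  qed
  moreover have "W' \<subseteq> P" unfolding W'_def using Q'_P WQD(1) add_subgroupD(2)[OF P] by blast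
  moreover have "q + w \<in> W'" if qw: "q \<in> Q'" "w \<in> W'" for q w
  proof -
    obtain q2 w2 where "w = q2 + w2" "q2 \<in> Q'" "w2 \<in> W" using qw(2) unfolding W'_def by blast
    moreover then have "q + w = (q + q2) + w2" by (simp add: add.assoc)
    ultimately show ?thesis using qw(1) add_subgroupD(2)[OF Q'_subgroup, of q q2]
      unfolding W'_def by blast
  qed
  ultimately show ?thesis
    unfolding admissible_def using Q'_subgroup Q'_P W_W' WQD(4) by blast
qed

text \<open>When no index is big, all relevant spreads are at most \<open>t0\<close>. A generator at
  each of the two points adds at most 2, which the gap \<open>4 * \<epsilon>\<close>
  absorbs.\<close>

lemma admissible_nbhd:
  assumes "big = {}" shows "admissible (W \<union> {w + s | w s. w \<in> W \<and> s \<in> S}) Q" (is "admissible ?V Q")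
proof -
  have "diam_le i ?V t1" if i: "i \<in> I" "rot i \<notin> Q" for i
  proof -
    have near: "\<exists>w\<in>W. \<bar>pr i x - pr i w\<bar> \<le> 1" if x: "x \<in> ?V" for x
    proof (cases "x \<in> W")
      case False
      then obtain w s where "x = w + s" "w \<in> W" "s \<in> S" using x by blast
      then show ?thesis using lipschitz[OF i(1), of w s] WQD(1) by (intro bexI[of _ w]) auto
    qed (intro bexI[of _ x], simp_all)
    have "diam_le i W t0" using assms i by (auto simp: big_def)
    then have small: "\<bar>pr i w - pr i w'\<bar> \<le> t0" if "w \<in> W" "w' \<in> W" for w w'
      using that by (simp add: diam_le_def)
    show ?thesis unfolding diam_le_def
    proof (intro ballI)
      fix x y assume "x \<in> ?V" "y \<in> ?V"
      then obtain w w' where "w \<in> W" "\<bar>pr i x - pr i w\<bar> \<le> 1" "w' \<in> W" "\<bar>pr i y - pr i w'\<bar> \<le> 1"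
        using near by meson
      then show "\<bar>pr i x - pr i y\<bar> \<le> t1" using small[of w w'] eps by linarith
    qed
  qed
  moreover have "?V \<subseteq> P" using WQD(1) S add_subgroupD(2)[OF P] by blast
  moreover have "q + v \<in> ?V" if qv: "q \<in> Q" "v \<in> ?V" for q v
  proof (cases "v \<in> W")
    case False
    then obtain w s where ws: "v = w + s" "w \<in> W" "s \<in> S" using qv by blast
    then have "q + v = (q + w) + s" by (simp add: add.assoc)
    then show ?thesis using WQD(5)[OF qv(1) ws(2)] ws(3) by blast
  qed (use qv WQD(5) in blast)
  ultimately show ?thesis unfolding admissible_def using WQD by blast
qed

end

text \<open>Zorn's lemma is applied to the admissible pairs whose \<open>W\<close> contains both
  points and whose \<open>Q\<close> has no nontrivial element carrying one of these points to one of
  them. In a maximal pair \<open>W = P\<close>. On any index \<open>P\<close> has spread at least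
  \<open>T\<close>, so every rotation lies in \<open>Q\<close>; then \<nu> lies in \<open>Q\<close>
  and carries \<open>x\<close> to \<open>\<nu> + x\<close>.\<close>

theorem rot_span_trivial:
  assumes \<nu>: "\<nu> \<in> add_span (rot ` I)" and x: "x \<in> P"
    and small: "\<And>i. i \<in> I \<Longrightarrow> \<bar>pr i (\<nu> + x) - pr i x\<bar> \<le> T - 6 * \<epsilon> - 1"
  shows "\<nu> = 0"
proof -
  \<comment> \<open>A pair of sets is coded as one set of Boolean-tagged elements, so that inclusion
    of pairs is inclusion of sets.\<close>
  let ?W = "\<lambda>Z. {z. (z, True) \<in> Z}" and ?Q = "\<lambda>Z. {z. (z, False) \<in> Z}"
  have \<nu>P: "\<nu> \<in> P" using add_span_least[OF _ P, of "rot ` I"] rot \<nu> by blast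
  define A where "A = {Z. admissible (?W Z) (?Q Z) \<and> {x, \<nu> + x} \<subseteq> ?W Z \<and>
    (\<forall>q\<in>?Q Z. \<forall>y\<in>{x, \<nu> + x}. q + y \<in> {x, \<nu> + x} \<longrightarrow> q = 0)}"
  have "{(x, True), (\<nu> + x, True), (0, False)} \<in> A"
  proof -
    let ?Z = "{(x, True), (\<nu> + x, True), (0, False)}"
    have W: "?W ?Z = {x, \<nu> + x}" "?Q ?Z = {0}" by auto
    have "diam_le i {x, \<nu> + x} t1" if "i \<in> I" for i
      using small[OF that] T eps by (auto simp: diam_le_def abs_minus_commute)
    then show ?thesis unfolding A_def mem_Collect_eq W admissible_def
      using x \<nu>P add_subgroupD(1,2)[OF P] by (auto simp: add_subgroup_def)
  qed
  then have "A \<noteq> {}" by blast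
  moreover have "\<Union>C \<in> A" if C: "C \<noteq> {}" "subset.chain A C" for C
  proof -
    have CA: "C \<subseteq> A" and tot: "\<And>Z Z'. Z \<in> C \<Longrightarrow> Z' \<in> C \<Longrightarrow> Z \<subseteq> Z' \<or> Z' \<subseteq> Z"
      using C(2) by (auto simp: subset.chain_def)
    have join: "\<exists>Z''\<in>C. Z \<subseteq> Z'' \<and> Z' \<subseteq> Z''" if "Z \<in> C" "Z' \<in> C" for Z Z'
      using tot[OF that] that by blast
    have adm: "admissible (?W Z) (?Q Z)" if "Z \<in> C" for Z using that CA by (auto simp: A_def)
    have W: "?W (\<Union>C) = (\<Union>Z\<in>C. ?W Z)" "?Q (\<Union>C) = (\<Union>Z\<in>C. ?Q Z)" by auto
    have 1: "diam_le i (?W (\<Union>C)) t1" if "i \<in> I" "rot i \<notin> ?Q (\<Union>C)" for i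
      unfolding diam_le_def
    proof (intro ballI)
      fix u v assume "u \<in> ?W (\<Union>C)" "v \<in> ?W (\<Union>C)"
      then obtain Z where "Z \<in> C" "u \<in> ?W Z" "v \<in> ?W Z" using join by blast
      then show "\<bar>pr i u - pr i v\<bar> \<le> t1"
        using adm[of Z] that unfolding admissible_def diam_le_def by blast
    qed
    have 2: "add_subgroup (?Q (\<Union>C))"
      unfolding add_subgroup_def
    proof (intro conjI ballI)
      show "0 \<in> ?Q (\<Union>C)" using C(1) adm unfolding admissible_def add_subgroup_def by blast
      fix u assume u: "u \<in> ?Q (\<Union>C)"
      then show "- u \<in> ?Q (\<Union>C)" using adm unfolding admissible_def add_subgroup_def by blast
      fix v assume v: "v \<in> ?Q (\<Union>C)"
      obtain Z where "Z \<in> C" "u \<in> ?Q Z" "v \<in> ?Q Z" using join u v by blast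
      then show "u + v \<in> ?Q (\<Union>C)" using adm[of Z] unfolding admissible_def add_subgroup_def by blast
    qed
    have 3: "q + w \<in> ?W (\<Union>C)" if qw: "q \<in> ?Q (\<Union>C)" "w \<in> ?W (\<Union>C)" for q w
    proof -
      obtain Z1 Z2 where "Z1 \<in> C" "(q, False) \<in> Z1" "Z2 \<in> C" "(w, True) \<in> Z2" using qw by auto
      then obtain Z where "Z \<in> C" "q \<in> ?Q Z" "w \<in> ?W Z" using join[of Z1 Z2] by auto
      then show ?thesis using adm[of Z] unfolding admissible_def by blast
    qed
    have 4: "?W (\<Union>C) \<subseteq> P" "?Q (\<Union>C) \<subseteq> P"
      using adm unfolding admissible_def by blast+
    have 5: "{x, \<nu> + x} \<subseteq> ?W (\<Union>C)" using C(1) CA unfolding A_def by blast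
    have 6: "\<forall>q\<in>?Q (\<Union>C). \<forall>y\<in>{x, \<nu> + x}. q + y \<in> {x, \<nu> + x} \<longrightarrow> q = 0"
    proof (intro ballI)
      fix q y assume "q \<in> ?Q (\<Union>C)" "y \<in> {x, \<nu> + x}"
      moreover then obtain Z where "Z \<in> C" "q \<in> ?Q Z" by blast
      ultimately show "q + y \<in> {x, \<nu> + x} \<longrightarrow> q = 0" using CA unfolding A_def by blast
    qed
    have "?W (\<Union>C) \<noteq> {}" using 5 by auto
    then have "admissible (?W (\<Union>C)) (?Q (\<Union>C))"
      unfolding admissible_def using 1 2 3 4 by (intro conjI ballI) (simp_all only: , blast+)
    then show ?thesis using 5 6 unfolding A_def mem_Collect_eq by (intro conjI)
  qed
  ultimately obtain Z where Z: "Z \<in> A" and max: "\<And>Z'. Z' \<in> A \<Longrightarrow> Z \<subseteq> Z' \<Longrightarrow> Z' = Z"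
    using subset_Zorn_nonempty[of A] by blast
  define W Q where "W = ?W Z" and "Q = ?Q Z"
  have WQ: "admissible W Q" "{x, \<nu> + x} \<subseteq> W"
    "\<And>q y. q \<in> Q \<Longrightarrow> y \<in> {x, \<nu> + x} \<Longrightarrow> q + y \<in> {x, \<nu> + x} \<Longrightarrow> q = 0"
    using Z unfolding A_def W_def Q_def by blast+
  have max': "W2 = W \<and> Q2 = Q" if "admissible W2 Q2" "W \<subseteq> W2" "Q \<subseteq> Q2"
    "\<And>q y. q \<in> Q2 \<Longrightarrow> y \<in> {x, \<nu> + x} \<Longrightarrow> q + y \<in> {x, \<nu> + x} \<Longrightarrow> q = 0" for W2 Q2
  proof -
    let ?Z = "W2 \<times> {True} \<union> Q2 \<times> {False}"
    have e: "?W ?Z = W2" "?Q ?Z = Q2" by auto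
    have "?Z \<in> A" unfolding A_def mem_Collect_eq e using that WQ(2) by blast
    moreover have "Z \<subseteq> ?Z"
    proof
      fix z assume z: "z \<in> Z"
      obtain g b where "z = (g, b)" by force
      then show "z \<in> ?Z" using z that(2,3) unfolding W_def Q_def by (cases b) auto
    qed
    ultimately have "?Z = Z" by (rule max)
    then show ?thesis unfolding W_def Q_def using e by simp
  qed
  have "big W Q = {}"
  proof (rule ccontr)
    assume "big W Q \<noteq> {}"
    then obtain i where i: "i \<in> big W Q" by blast
    \<comment> \<open>Elements outside \<open>Q\<close> that enter the enlarged subgroup never carry
      a point of \<open>W\<close> into \<open>W\<close>, so the condition on the two points survives
      and maximality applies.\<close>
    have "q = 0" if "q \<in> Q' W Q" "y \<in> {x, \<nu> + x}" "q + y \<in> {x, \<nu> + x}" for q y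
      using Q'_meet[OF WQ(1) that(1), of y] that WQ(2,3) by blast
    then have "Q' W Q = Q"
      using max'[OF admissible_step[OF WQ(1)] W_W'[OF WQ(1)] Q_Q'[OF WQ(1)]] by blast
    then have "rot i \<in> Q" using i by (auto simp: Q'_eq_span[OF WQ(1)] intro: add_span_base)
    then show False using i by (auto simp: big_def[OF WQ(1)])
  qed
  then have "W \<union> {w + s | w s. w \<in> W \<and> s \<in> S} = W"
    using max'[OF admissible_nbhd[OF WQ(1)]] WQ(3) by blast
  then have "W = P" using gen[of W] WQ(1) unfolding admissible_def by blast
  have "rot i \<in> Q" if i: "i \<in> I" for i
  proof (rule ccontr)
    assume "rot i \<notin> Q"
    then have "diam_le i P t1" using WQ(1) i \<open>W = P\<close> unfolding admissible_def by blast
    moreover have "rot i + x \<in> P" using rot[OF i] x add_subgroupD(2)[OF P] by blast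
    ultimately have "\<bar>pr i (rot i + x) - pr i x\<bar> \<le> t1" using x unfolding diam_le_def by blast
    then show False using pr_rot[OF i x] eps by simp
  qed
  then have "\<nu> \<in> Q"
    using add_span_least[of "rot ` I" Q] \<nu> WQ(1) unfolding admissible_def by blast
  then show ?thesis using WQ(3)[of \<nu> x] by simp
qed

end

section \<open>Lines in an amalgamated product\<close>

primrec alternating :: "(bool \<Rightarrow> 'a set) \<Rightarrow> bool \<Rightarrow> 'a list \<Rightarrow> bool" where
  "alternating Y b [] \<longleftrightarrow> True"
| "alternating Y b (s # ws) \<longleftrightarrow> s \<in> Y b \<and> alternating Y (\<not> b) ws"

primrec flip :: "nat \<Rightarrow> bool \<Rightarrow> bool" where
  "flip 0 b = b"
| "flip (Suc n) b = (\<not> flip n b)"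

lemma flip_not [simp]: "flip n (\<not> b) \<longleftrightarrow> \<not> flip n b"
  by (induction n) auto

lemma flip_flip [simp]: "flip n (flip n b) = b"
  by (induction n) auto

lemma flip_iff: "flip n b \<longleftrightarrow> (b = even n)"
  by (induction n) auto

text \<open>The normal form theorem serves as the definition: that no nonempty alternating product
  vanishes says that \<open>K\<close> and \<open>L\<close> generate their free product amalgamated
  over \<open>H\<close> inside the ambient group.\<close>

locale amalgam =
  fixes K L :: "'g::group_add set" and X :: "bool \<Rightarrow> 'g set" and H :: "'g set"
    and alt :: "bool \<Rightarrow> 'g list \<Rightarrow> bool"
  defines "X b \<equiv> (if b then K else L)" and "H \<equiv> K \<inter> L"
    and "alt \<equiv> alternating (\<lambda>b. X b - H)"
  assumes K: "add_subgroup K" and L: "add_subgroup L"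
    and alt_nonzero: "alt b ws \<Longrightarrow> ws \<noteq> [] \<Longrightarrow> sum_list ws \<noteq> 0"
begin

lemma X_sub: "add_subgroup (X b)" and H_sub: "add_subgroup H" and H_X: "h \<in> H \<Longrightarrow> h \<in> X b"
  using K L unfolding X_def H_def add_subgroup_def by auto

lemma X_absorb: assumes "h \<in> H" shows "h + s \<in> X b - H \<longleftrightarrow> s \<in> X b - H" "s + h \<in> X b - H \<longleftrightarrow> s \<in> X b - H"
proof -
  have *: "h + s \<in> Z \<longleftrightarrow> s \<in> Z" "s + h \<in> Z \<longleftrightarrow> s \<in> Z" if "add_subgroup Z" "h \<in> Z" for Z
    using add_subgroupD(2,3)[OF that(1)] that(2) minus_add_cancel[of h s] add.assoc[of s h "- h"]
    by (metis add.right_neutral right_minus)+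
  show "h + s \<in> X b - H \<longleftrightarrow> s \<in> X b - H" "s + h \<in> X b - H \<longleftrightarrow> s \<in> X b - H"
    using *[OF X_sub H_X[OF assms]] *[OF H_sub assms] by auto
qed

lemma X_uminus: "- s \<in> X b - H \<longleftrightarrow> s \<in> X b - H"
  using add_subgroupD(3)[OF X_sub] add_subgroupD(3)[OF H_sub] minus_minus[of s] by (metis Diff_iff)

lemma X_other: "s \<in> X b \<Longrightarrow> s \<in> X (\<not> b) \<Longrightarrow> s \<in> H"
  unfolding X_def H_def by (auto split: if_splits)

lemma alt_Nil [simp]: "alt b []" and alt_Cons [simp]: "alt b (s # ws) \<longleftrightarrow> s \<in> X b - H \<and> alt (\<not> b) ws"
  by (simp_all add: alt_def)

lemma alt_append: "alt b (us @ vs) \<longleftrightarrow> alt b us \<and> alt (flip (length us) b) vs"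
  by (induction us arbitrary: b) auto

lemma alt_rev: "alt b ws \<Longrightarrow> alt (flip (length ws) (\<not> b)) (rev (map uminus ws))"
proof (induction ws arbitrary: b)
  case (Cons s ws)
  have "- s \<in> X b - H" using Cons.prems X_uminus by simp
  then show ?case using Cons.IH[of "\<not> b"] Cons.prems by (simp add: alt_append)
qed simp

lemma sum_list_rev: "sum_list (rev (map uminus ws)) = - sum_list (ws :: 'g list)"
  by (induction ws) (simp_all add: minus_add)

lemma alt_take: "alt b ws \<Longrightarrow> alt b (take k ws)"
  using alt_append[of b "take k ws" "drop k ws"] by simp

lemma alt_drop: "alt b ws \<Longrightarrow> k \<le> length ws \<Longrightarrow> alt (flip k b) (drop k ws)"
  using alt_append[of b "take k ws" "drop k ws"] by (simp add: min_absorb2)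

lemma alt_absorb_last: "alt b (us @ [t]) \<Longrightarrow> h \<in> H \<Longrightarrow> alt b (us @ [t + h])"
  using X_absorb(2) by (auto simp: alt_append)

lemma alt_absorb_hd: "alt b (t # us) \<Longrightarrow> h \<in> H \<Longrightarrow> alt b ((h + t) # us)"
  using X_absorb(1) by auto

text \<open>An element of \<open>H\<close> can be absorbed into the last syllable; subtracting the
  sum there would leave a nonempty alternating word with sum 0.\<close>

lemma alt_notin_H: assumes "alt b ws" "ws \<noteq> []" shows "sum_list ws \<notin> H"
proof
  assume h: "sum_list ws \<in> H"
  obtain us t where ws: "ws = us @ [t]" using assms(2) by (metis rev_exhaust)
  have "alt b (us @ [t + - sum_list ws])"
    using alt_absorb_last[of b us t "- sum_list ws"] assms(1) ws add_subgroupD(3)[OF H_sub h] by simp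
  then have "sum_list (us @ [t + - sum_list ws]) \<noteq> 0" by (rule alt_nonzero) simp
  moreover have "sum_list us + (t - (sum_list us + t)) = 0"
    unfolding add_diff_eq[symmetric] by (simp only: grp_norm add_minus_cancel right_minus)
  ultimately show False by (simp add: ws)
qed

text \<open>Syllables are unique only up to elements of \<open>H\<close> inserted between them, so
  prefixes are compared modulo \<open>H\<close>. The element \<open>h\<close> in front carries the
  correction from one syllable to the next through the induction.\<close>

lemma alt_unique:
  assumes "alt b ws" "alt c vs" "h \<in> H" "- sum_list ws + h + sum_list vs \<in> H" "ws \<noteq> []"
  shows "c = b \<and> length vs = length ws \<and>
    (\<forall>k \<le> length ws. - sum_list (take k ws) + h + sum_list (take k vs) \<in> H)"
  using assms
proof (induction ws arbitrary: b c vs h)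
  case (Cons w ws)
  let ?r = "rev (map uminus ws)"
  have r: "alt (flip (length ws) b) ?r" using alt_rev[of "\<not> b" ws] Cons.prems(1) by simp
  have w: "w \<in> X b - H" using Cons.prems(1) by simp
  have vs: "vs \<noteq> []"
  proof
    assume "vs = []"
    then have "sum_list (rev (map uminus (w # ws))) + h \<in> H"
      using Cons.prems(4) by (simp only: sum_list_rev sum_list.Nil add_0_right)
    then have "(sum_list (rev (map uminus (w # ws))) + h) + - h \<in> H"
      using Cons.prems(3) add_subgroupD(2,3)[OF H_sub] by blast
    then have "sum_list (rev (map uminus (w # ws))) \<in> H" by (simp only: add.assoc right_minus add_0_right)
    then show False using alt_notin_H[OF alt_rev[OF Cons.prems(1)]] by simp
  qed
  then obtain v us where v: "vs = v # us" by (cases vs) auto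
  have vX: "v \<in> X c - H" "alt (\<not> c) us" using Cons.prems(2) v by auto
  have e: "- sum_list (w # ws) + h + sum_list vs = sum_list ?r + (- w + (h + v)) + sum_list us"
    by (simp only: v sum_list.Cons sum_list_rev grp_norm)
  have bc: "c = b"
  proof (rule ccontr)
    assume "c \<noteq> b"
    then have "c = (\<not> b)" by auto
    then have "alt (flip (length ws) b) (?r @ - w # (h + v) # us)"
      using r w vX X_absorb(1)[OF Cons.prems(3), of v c] X_uminus[of w b] by (simp add: alt_append)
    from alt_notin_H[OF this] have "sum_list ?r + (- w + (h + v)) + sum_list us \<notin> H"
      by (simp add: add.assoc)
    then show False using Cons.prems(4) e by simp
  qed
  \<comment> \<open>The first syllables differ by this element. Outside \<open>H\<close> it would be
    the middle syllable of an alternating word whose sum lies in \<open>H\<close>.\<close>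
  define h2 where "h2 = - w + (h + v)"
  have h2X: "h2 \<in> X b" unfolding h2_def
    using add_subgroupD(2,3)[OF X_sub[of b]] w vX bc H_X[OF Cons.prems(3)] by blast
  have h2: "h2 \<in> H"
  proof (rule ccontr)
    assume "h2 \<notin> H"
    then have "alt (flip (length ws) b) (?r @ h2 # us)"
      using r h2X vX bc by (simp add: alt_append)
    from alt_notin_H[OF this] show False using Cons.prems(4) e unfolding h2_def
      by (simp add: add.assoc)
  qed
  have rest: "- sum_list ws + h2 + sum_list us \<in> H"
    using Cons.prems(4) unfolding e by (simp only: sum_list_rev h2_def)
  have us: "length us = length ws \<and> (\<forall>k \<le> length ws. - sum_list (take k ws) + h2 + sum_list (take k us) \<in> H)"
  proof (cases "ws = []")
    case True
    then have "h2 + sum_list us \<in> H" using rest by simp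
    then have "- h2 + (h2 + sum_list us) \<in> H" using h2 add_subgroupD(2,3)[OF H_sub] by blast
    then have "us = []" using alt_notin_H[OF vX(2)] by auto
    then show ?thesis using True h2 by simp
  next
    case False
    have "alt (\<not> b) ws" using Cons.prems(1) by simp
    from Cons.IH[OF this vX(2) h2 rest False] show ?thesis by blast
  qed
  have "- sum_list (take k (w # ws)) + h + sum_list (take k vs) \<in> H" if "k \<le> length (w # ws)" for k
  proof (cases k)
    case (Suc j)
    then have "- sum_list (take j ws) + h2 + sum_list (take j us) \<in> H" using us that by simp
    then show ?thesis by (simp only: Suc v take_Suc_Cons sum_list.Cons h2_def grp_norm)
  qed (use Cons.prems(3) in simp)
  then show ?case using bc us v by simp
qed simp

section \<open>Half-trees and lines in the Bass--Serre tree\<close>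

definition P :: "'g set" where "P = add_span (K \<union> L)"

lemma P_sub: "add_subgroup P" by (simp add: P_def add_subgroup_span)

lemma X_P: "s \<in> X b \<Longrightarrow> s \<in> P" unfolding P_def X_def by (auto split: if_splits intro: add_span_base)

lemma alt_P: "alt b ws \<Longrightarrow> sum_list ws \<in> P"
  by (induction ws arbitrary: b) (auto intro: X_P add_subgroupD(2)[OF P_sub] add_subgroupD(1)[OF P_sub])

text \<open>The cosets of \<open>H\<close> are the edges of the Bass--Serre tree. The edge of such a
  \<open>g\<close> lies on the side of the endpoint of type \<open>b\<close> of the base edge, so
  this describes a half-tree.\<close>

definition starts :: "bool \<Rightarrow> 'g \<Rightarrow> bool" where
  "starts b g \<longleftrightarrow> (\<exists>ws. alt b ws \<and> ws \<noteq> [] \<and> g = sum_list ws)"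

lemma starts_Cons: "starts b g \<longleftrightarrow> (\<exists>w ws. w \<in> X b - H \<and> alt (\<not> b) ws \<and> g = w + sum_list ws)"
proof
  assume "starts b g"
  then obtain vs where "alt b vs" "vs \<noteq> []" "g = sum_list vs" by (auto simp: starts_def)
  then show "\<exists>w ws. w \<in> X b - H \<and> alt (\<not> b) ws \<and> g = w + sum_list ws" by (cases vs) auto
next
  assume "\<exists>w ws. w \<in> X b - H \<and> alt (\<not> b) ws \<and> g = w + sum_list ws"
  then obtain w ws where "alt b (w # ws)" "g = sum_list (w # ws)" by auto
  then show "starts b g" unfolding starts_def by blast
qed

lemma starts_snoc: "starts b g \<Longrightarrow> \<exists>us t. alt b (us @ [t]) \<and> g = sum_list us + t"
proof -
  assume "starts b g"
  then obtain vs where vs: "alt b vs" "vs \<noteq> []" "g = sum_list vs" by (auto simp: starts_def)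
  then have "vs = butlast vs @ [last vs]" by simp
  then have "alt b (butlast vs @ [last vs])" "g = sum_list (butlast vs) + last vs"
    using vs by (simp, metis add.right_neutral sum_list.Cons sum_list.Nil sum_list_append)
  then show ?thesis by blast
qed

lemma starts_notin_H: "starts b g \<Longrightarrow> g \<notin> H"
  using alt_notin_H by (auto simp: starts_def)

lemma starts_excl: assumes "starts b g" "starts (\<not> b) g" shows False
proof -
  obtain ws vs where ws: "alt b ws" "ws \<noteq> []" "alt (\<not> b) vs" "sum_list ws = g" "sum_list vs = g"
    using assms by (auto simp: starts_def)
  then have "- sum_list ws + 0 + sum_list vs \<in> H" using add_subgroupD(1)[OF H_sub] by simp
  then show False using alt_unique[OF ws(1,3) _ _ ws(2)] add_subgroupD(1)[OF H_sub] by blast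
qed

lemma starts_X: "s \<in> X b \<Longrightarrow> s \<in> H \<or> starts b s"
  unfolding starts_def by (cases "s \<in> H") (auto intro!: exI[of _ "[s]"])

lemma starts_absorb: assumes "h \<in> H" shows "starts b (h + g) \<longleftrightarrow> starts b g"
proof -
  have *: "starts b (h + g)" if g: "starts b g" and h: "h \<in> H" for h g
  proof -
    obtain w ws where "alt b (w # ws)" "g = sum_list (w # ws)" using g
      unfolding starts_Cons by auto
    then show ?thesis unfolding starts_def using alt_absorb_hd[OF _ h, of b w ws]
      by (intro exI[of _ "(h + w) # ws"]) (auto simp: add.assoc)
  qed
  show ?thesis using *[of g h] *[of "h + g" "- h"] assms add_subgroupD(3)[OF H_sub] by auto
qed

lemma starts_cases: assumes "g \<in> P" shows "g \<in> H \<or> starts True g \<or> starts False g"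
proof -
  have step: "s + x \<in> H \<or> (\<exists>c. starts c (s + x))" if s: "s \<in> X b" and x: "x \<in> H \<or> (\<exists>c. starts c x)" for s x b
  proof (cases "x \<in> H")
    case True
    then show ?thesis using starts_X[of "s + x" b] add_subgroupD(2)[OF X_sub s H_X] by blast
  next
    case False
    then obtain c where "starts c x" using x by blast
    then obtain w ws where w: "alt c (w # ws)" "x = sum_list (w # ws)"
      unfolding starts_Cons by auto
    show ?thesis
    proof (cases "s \<in> H")
      case True
      then show ?thesis using starts_absorb[OF True, of c x] \<open>starts c x\<close> by blast
    next
      case sH: False
      show ?thesis
      proof (cases "c = b")
        case False
        then have "c = (\<not> b)" by auto
        then have "alt b (s # w # ws)" using w s sH by simp
        then show ?thesis using w unfolding starts_def by (intro disjI2 exI[of _ b] exI[of _ "s # w # ws"]) simp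
      next
        case True
        have sw: "s + w \<in> X b" using w True s add_subgroupD(2)[OF X_sub] by auto
        show ?thesis
        proof (cases "s + w \<in> H")
          case False
          then have "starts b (s + x)" using w True sw unfolding starts_def
            by (intro exI[of _ "(s + w) # ws"]) (auto simp: add.assoc)
          then show ?thesis by blast
        next
          case swH: True
          show ?thesis
          proof (cases "ws = []")
            case True
            then show ?thesis using swH w by simp
          next
            case False
            then have "starts (\<not> c) (sum_list ws)" using w(1) by (auto simp: starts_def)
            then have "starts (\<not> c) ((s + w) + sum_list ws)" using starts_absorb[OF swH] by blast
            then show ?thesis using w(2) by (auto simp: add.assoc)
          qed
        qed
      qed
    qed
  qed
  have "g \<in> H \<or> (\<exists>c. starts c g)" using assms unfolding P_def
  proof induction
    case zero
    then show ?case using add_subgroupD(1)[OF H_sub] by blast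
  next
    case (plus a x)
    then have "a \<in> X (a \<in> K)" by (auto simp: X_def)
    then show ?case using step plus by blast
  next
    case (minus a x)
    then have "- a \<in> X (a \<in> K)" using add_subgroupD(3)[OF K] add_subgroupD(3)[OF L] by (auto simp: X_def)
    then show ?case using step minus by blast
  qed
  then show ?thesis by (metis (full_types))
qed

lemma not_starts: "g \<in> P \<Longrightarrow> \<not> starts b g \<longleftrightarrow> g \<in> H \<or> starts (\<not> b) g"
  using starts_cases[of g] starts_notin_H starts_excl[of b g] by (cases b) auto

lemma starts_add:
  assumes "s \<in> X b - H" "g \<in> P" "\<not> starts b g" shows "starts b (s + g)"
proof (cases "g \<in> H")
  case True
  then show ?thesis using X_absorb(2)[OF True, of s b] assms(1) starts_X[of "s + g" b] by blast
next
  case False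
  then obtain ws where "alt (\<not> b) ws" "g = sum_list ws"
    using assms not_starts[OF assms(2), of b] by (auto simp: starts_def)
  then show ?thesis unfolding starts_def using assms(1) by (intro exI[of _ "s # ws"]) simp
qed

text \<open>From an edge \<open>g\<close> on one side of the base edge, the base edge and everything
  on its other side are seen in one and the same direction.\<close>

lemma starts_nest:
  assumes "starts b g"
  shows "\<exists>c. starts c (- g) \<and> (\<forall>x\<in>P. \<not> starts b x \<longrightarrow> starts c (- g + x))"
proof -
  obtain ws where ws: "alt b ws" "ws \<noteq> []" "g = sum_list ws" using assms by (auto simp: starts_def)
  let ?r = "rev (map uminus ws)" and ?c = "flip (length ws) (\<not> b)"
  have r: "alt ?c ?r" "?r \<noteq> []" "sum_list ?r = - g" using alt_rev[OF ws(1)] ws sum_list_rev by auto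
  have par: "flip (length ?r) ?c = (\<not> b)" by simp
  have "starts ?c (- g + x)" if x: "x \<in> P" "\<not> starts b x" for x
  proof (cases "x \<in> H")
    case True
    obtain us t where us: "?r = us @ [t]" using r(2) by (metis rev_exhaust)
    then have "alt ?c (us @ [t + x])" using alt_absorb_last[OF _ True] r(1) by simp
    moreover have "- g + x = sum_list (us @ [t + x])" unfolding r(3)[symmetric] us by (simp add: add.assoc)
    ultimately show ?thesis unfolding starts_def by blast
  next
    case False
    then obtain vs where vs: "alt (\<not> b) vs" "x = sum_list vs"
      using x not_starts[OF x(1), of b] by (auto simp: starts_def)
    then have "alt ?c (?r @ vs)" unfolding alt_append par using r by blast
    then show ?thesis unfolding starts_def using r vs by (intro exI[of _ "?r @ vs"]) simp
  qed
  moreover have "starts ?c (- g)" using r unfolding starts_def by (intro exI[of _ ?r]) simp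
  ultimately show ?thesis by blast
qed

text \<open>The edges \<open>g\<close> and \<open>g + s\<close> share an endpoint, so a step that
  leaves a half-tree can only end on the base edge bounding it.\<close>

lemma starts_change:
  assumes g: "starts b g" and s: "s \<in> X c" and n: "\<not> starts b (g + s)"
  shows "g \<in> X b \<and> g + s \<in> H"
proof -
  obtain us t where ws: "alt b (us @ [t])" "g = sum_list us + t" using g
    using starts_snoc by blast
  define d where "d = flip (length us) b"
  have t: "t \<in> X d - H" "alt b us" using ws(1) by (auto simp: alt_append d_def)
  have no: "\<not> alt b vs" if "vs \<noteq> []" "g + s = sum_list vs" for vs using n that by (auto simp: starts_def)
  have sH: "s \<notin> H"
  proof
    assume "s \<in> H"
    then show False using no[of "us @ [t + s]"] alt_absorb_last[OF ws(1)] ws(2) by (simp add: add.assoc)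
  qed
  have cd: "c = d"
  proof (rule ccontr)
    assume "c \<noteq> d"
    then have "s \<in> X (\<not> d)" using s by (cases d) auto
    then have "alt b ((us @ [t]) @ [s])" using ws(1) sH by (simp add: alt_append d_def)
    then show False using no[of "us @ [t] @ [s]"] ws(2) by (simp add: add.assoc)
  qed
  then have ts: "t + s \<in> X d" using s t add_subgroupD(2)[OF X_sub] by auto
  have tsH: "t + s \<in> H"
  proof (rule ccontr)
    assume "t + s \<notin> H"
    then have "alt b (us @ [t + s])" using t ts by (auto simp: alt_append d_def)
    then show False using no[of "us @ [t + s]"] ws(2) by (simp add: add.assoc)
  qed
  have "us = []"
  proof (rule ccontr)
    assume "us \<noteq> []"
    then obtain vs v where v: "us = vs @ [v]" by (metis rev_exhaust)
    then have "alt b (vs @ [v + (t + s)])" using alt_absorb_last[OF _ tsH] t by simp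
    then show False using no[of "vs @ [v + (t + s)]"] ws(2) v by (simp add: add.assoc)
  qed
  then show ?thesis using ws t tsH by (auto simp: d_def)
qed


lemma P_right_induct:
  assumes "A \<subseteq> P" "A \<noteq> {}" and step: "\<And>x s. x \<in> A \<Longrightarrow> s \<in> K \<union> L \<Longrightarrow> x + s \<in> A"
  shows "A = P"
proof -
  have *: "z \<in> P \<Longrightarrow> \<forall>x\<in>A. x + z \<in> A" for z unfolding P_def
  proof (induction rule: add_span.induct)
    case (minus a z)
    have "- a \<in> K \<union> L" using minus(1) add_subgroupD(3)[OF K] add_subgroupD(3)[OF L] by blast
    then show ?case using minus step by (auto simp: add.assoc[symmetric] simp del: add_uminus_conv_diff)
  qed (use step in \<open>auto simp: add.assoc[symmetric]\<close>)
  obtain x where x: "x \<in> A" using assms(2) by blast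
  have "y \<in> A" if "y \<in> P" for y
    using *[of "- x + y"] x assms(1) that add_subgroupD(2,3)[OF P_sub] by (metis add_minus_cancel in_mono)
  then show ?thesis using assms(1) by blast
qed

text \<open>A line is a bi-infinite alternating path in the Bass--Serre tree, and \<open>proj p x\<close> is the last
  index from which the geodesic to \<open>x\<close> leaves along the line. The index is unique by \<open>cut_unique\<close> below.\<close>

definition line :: "(int \<Rightarrow> 'g) \<Rightarrow> bool" where
  "line p \<longleftrightarrow> (\<forall>i. p i \<in> P \<and> - p i + p (i + 1) \<in> X (odd i) - H)"

text \<open>The half-tree beyond the edge \<open>p i\<close> in the direction of the line.\<close>

definition forward :: "(int \<Rightarrow> 'g) \<Rightarrow> int \<Rightarrow> 'g \<Rightarrow> bool" where
  "forward p i x \<longleftrightarrow> starts (odd i) (- p i + x)"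

definition cut :: "(int \<Rightarrow> 'g) \<Rightarrow> 'g \<Rightarrow> int \<Rightarrow> bool" where
  "cut p x m \<longleftrightarrow> (\<forall>i. forward p i x \<longleftrightarrow> i \<le> m)"

definition proj :: "(int \<Rightarrow> 'g) \<Rightarrow> 'g \<Rightarrow> int" where
  "proj p x = (THE m. cut p x m)"

definition same_edge :: "'g \<Rightarrow> 'g \<Rightarrow> bool" (infix "\<sim>" 50) where
  "x \<sim> y \<longleftrightarrow> - x + y \<in> H"

lemma same_edge_refl [simp]: "x \<sim> x"
  using add_subgroupD(1)[OF H_sub] by (simp add: same_edge_def)

lemma same_edge_sym: "x \<sim> y \<Longrightarrow> y \<sim> x"
  using add_subgroupD(3)[OF H_sub] unfolding same_edge_def by (metis minus_add minus_minus)

lemma same_edge_trans: "x \<sim> y \<Longrightarrow> y \<sim> z \<Longrightarrow> x \<sim> z"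
proof -
  assume "x \<sim> y" "y \<sim> z"
  then have "(- x + y) + (- y + z) \<in> H" using add_subgroupD(2)[OF H_sub] by (simp add: same_edge_def)
  then show "x \<sim> z" by (simp only: same_edge_def add.assoc add_minus_cancel)
qed

lemma same_edge_left: "g + x \<sim> g + y \<longleftrightarrow> x \<sim> y"
  unfolding same_edge_def by (simp only: minus_add add.assoc minus_add_cancel)

lemma lineD: "line p \<Longrightarrow> p i \<in> P" "line p \<Longrightarrow> - p i + p (i + 1) \<in> X (odd i) - H"
  by (auto simp: line_def)

lemma line_shift: "line p \<Longrightarrow> g \<in> P \<Longrightarrow> line (\<lambda>i. g + p i)"
  using add_subgroupD(2)[OF P_sub] unfolding line_def by (simp only: minus_add add.assoc minus_add_cancel) blast

text \<open>The shift by 1 restores the parity convention: the step of the reversed line at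
  \<open>i\<close> is the inverse of the step of \<open>p\<close> at \<open>- i\<close>, and
  \<open>i\<close> and \<open>- i\<close> have the same parity.\<close>

lemma line_reverse: assumes "line p" shows "line (\<lambda>i. p (1 - i))"
proof -
  have "- (- p (- i) + p (- i + 1)) \<in> X (odd i) - H" for i
    using lineD(2)[OF assms, of "- i"] X_uminus by simp
  moreover have "- (- p (- i) + p (- i + 1)) = - p (1 - i) + p (- i)" for i
    by (simp add: minus_add)
  ultimately have "- p (1 - i) + p (- i) \<in> X (odd i) - H" for i by metis
  then show ?thesis using lineD(1)[OF assms] unfolding line_def by (simp add: algebra_simps)
qed

lemma line_diff:
  assumes "line p"
  shows "\<exists>ws. alt (odd i) ws \<and> length ws = n \<and>
    (\<forall>m\<le>n. sum_list (take m ws) = - p i + p (i + int m))"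
proof (induction n arbitrary: i)
  case (Suc n)
  obtain ws where ws: "alt (odd (i + 1)) ws" "length ws = n"
    "\<forall>m\<le>n. sum_list (take m ws) = - p (i + 1) + p (i + 1 + int m)" using Suc[of "i + 1"] by blast
  let ?s = "- p i + p (i + 1)"
  have "sum_list (take m (?s # ws)) = - p i + p (i + int m)" if "m \<le> Suc n" for m
  proof (cases m)
    case (Suc k)
    then have "sum_list (take k ws) = - p (i + 1) + p (i + 1 + int k)" using ws(3) that by simp
    then show ?thesis using Suc by (simp add: add.assoc)
  qed simp
  then show ?case using ws lineD(2)[OF assms, of i] by (intro exI[of _ "?s # ws"]) simp
qed simp

lemma forward_line: assumes "line p" shows "forward p i (p j) \<longleftrightarrow> i < j"
proof -
  have lt: "starts (odd i) (- p i + p j)" if ij: "i < j" for i j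
  proof -
    obtain ws where "alt (odd i) ws" "length ws = nat (j - i)"
      "\<forall>m\<le>nat (j - i). sum_list (take m ws) = - p i + p (i + int m)"
      using line_diff[OF assms, of i "nat (j - i)"] by blast
    moreover from this(2,3) have "sum_list ws = - p i + p j" using ij by (metis add_diff_cancel_left' diff_add_cancel int_nat_eq less_imp_le order_refl take_all_iff add.commute diff_ge_0_iff_ge)
    ultimately show ?thesis using ij unfolding starts_def by (intro exI[of _ ws]) auto
  qed
  have ge: "\<not> starts (odd i) (- p i + p j)" if ij: "j \<le> i" for i j
  proof (cases "j = i")
    case True
    then show ?thesis using starts_notin_H[of "odd i" 0] add_subgroupD(1)[OF H_sub] by auto
  next
    case False
    obtain ws where ws: "alt (odd j) ws" "length ws = nat (i - j)"
      "\<forall>m\<le>nat (i - j). sum_list (take m ws) = - p j + p (j + int m)"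
      using line_diff[OF assms, of j "nat (i - j)"] by blast
    then have s: "sum_list ws = - p j + p i" using ij by (metis add_diff_cancel_left' diff_add_cancel int_nat_eq order_refl take_all_iff add.commute diff_ge_0_iff_ge)
    have "alt (flip (length ws) (\<not> odd j)) (rev (map uminus ws))" "ws \<noteq> []"
      using alt_rev[OF ws(1)] ws(2) ij False by auto
    then have "starts (flip (length ws) (\<not> odd j)) (- p i + p j)"
      unfolding starts_def using s sum_list_rev[of ws] by (intro exI[of _ "rev (map uminus ws)"]) (simp add: minus_add)
    moreover have "flip (length ws) (\<not> odd j) = (\<not> odd i)"
    proof -
      have "i = j + int (length ws)" using ws(2) ij by simp
      then show ?thesis by (auto simp: flip_iff)
    qed
    ultimately show ?thesis using starts_excl[of "odd i"] by auto
  qed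
  show ?thesis unfolding forward_def using lt ge by (meson not_le)
qed

lemma forward_mono: assumes p: "line p" and x: "x \<in> P" and "forward p (i + 1) x" shows "forward p i x"
proof -
  have "\<not> starts (odd i) (- p (i + 1) + x)" using assms(3) starts_excl[of "odd i"] by (auto simp: forward_def)
  moreover have "- p (i + 1) + x \<in> P" using lineD(1)[OF p] x add_subgroupD(2,3)[OF P_sub] by blast
  ultimately have "starts (odd i) ((- p i + p (i + 1)) + (- p (i + 1) + x))"
    using starts_add[OF lineD(2)[OF p]] by blast
  then show ?thesis by (simp only: forward_def add.assoc add_minus_cancel)
qed

lemma forward_mono': assumes "line p" "x \<in> P" "forward p j x" "i \<le> j" shows "forward p i x"
  using assms(4,3) by (induction rule: int_le_induct) (use forward_mono[OF assms(1,2), of "_ - 1"] in auto)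

text \<open>A step that leaves the half-tree beyond \<open>p i\<close> lands on the edge
  \<open>p i\<close> itself, coming from an edge that is not yet beyond \<open>p (i + 1)\<close>.
  Hence a step changes the cut by at most 1.\<close>

lemma forward_change:
  assumes p: "line p" and x: "x \<in> P" and s: "s \<in> X c" and f: "forward p i x" "\<not> forward p i (x + s)"
  shows "p i \<sim> x + s" "\<not> forward p (i + 1) x"
proof -
  have *: "- p i + x \<in> X (odd i) \<and> (- p i + x) + s \<in> H"
    using starts_change[OF _ s, of "odd i" "- p i + x"] f by (simp add: forward_def add.assoc)
  then show "p i \<sim> x + s" by (simp add: same_edge_def add.assoc)
  have "- (- p i + p (i + 1)) + (- p i + x) \<in> X (odd i)"
    using * lineD(2)[OF p, of i] add_subgroupD(2,3)[OF X_sub] by blast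
  then have "- p (i + 1) + x \<in> X (odd i)" by (simp only: minus_add minus_minus add.assoc add_minus_cancel)
  then show "\<not> forward p (i + 1) x"
    using starts_X[of "- p (i + 1) + x" "odd i"] starts_excl[of "odd i"] starts_notin_H by (auto simp: forward_def)
qed

lemma cut_unique: "cut p x m \<Longrightarrow> cut p x n \<Longrightarrow> m = n"
  unfolding cut_def by (meson order_antisym order_refl)

lemma cut_step:
  assumes p: "line p" and x: "x \<in> P" and s: "s \<in> X c" and m: "cut p x m"
  shows "\<exists>n. cut p (x + s) n \<and> \<bar>n - m\<bar> \<le> 1"
proof -
  have xs: "x + s \<in> P" using x X_P[OF s] add_subgroupD(2)[OF P_sub] by blast
  have ms: "- s \<in> X c" using s add_subgroupD(3)[OF X_sub] by blast
  have down: "i = m" if "forward p i x" "\<not> forward p i (x + s)" for i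
    using forward_change(2)[OF p x s that] that(1) m unfolding cut_def by (meson not_le order_antisym zle_add1_eq_le)
  have up: "\<not> forward p (i + 1) (x + s)" if "\<not> forward p i x" "forward p i (x + s)" for i
    using forward_change(2)[OF p xs ms that(2)] that(1) by (simp add: add.assoc)
  show ?thesis
  proof (cases "forward p m (x + s)")
    case False
    then have "\<not> forward p i (x + s)" if "i \<ge> m" for i
      using forward_mono'[OF p xs _ that] by blast
    moreover have "forward p i (x + s)" if "i < m" for i using down[of i] that m unfolding cut_def by fastforce
    ultimately have "cut p (x + s) (m - 1)" unfolding cut_def by (meson not_le zle_diff1_eq)
    then show ?thesis by (intro exI[of _ "m - 1"]) simp
  next
    case True
    then have le: "forward p i (x + s)" if "i \<le> m" for i using forward_mono'[OF p xs _ that] by blast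
    show ?thesis
    proof (cases "forward p (m + 1) (x + s)")
      case False
      then have "\<not> forward p i (x + s)" if "i > m" for i
        using forward_mono'[OF p xs, of i "m + 1"] that by force
      then have "cut p (x + s) m" unfolding cut_def using le by (meson not_le)
      then show ?thesis by (intro exI[of _ m]) simp
    next
      case T: True
      then have "\<not> forward p (m + 2) (x + s)" using up[of "m + 1"] m unfolding cut_def by (simp add: add.assoc)
      then have "\<not> forward p i (x + s)" if "i > m + 1" for i
        using forward_mono'[OF p xs, of i "m + 2"] that by force
      moreover have "forward p i (x + s)" if "i \<le> m + 1" for i using forward_mono'[OF p xs T that] .
      ultimately have "cut p (x + s) (m + 1)" unfolding cut_def by (meson not_le)
      then show ?thesis by (intro exI[of _ "m + 1"]) simp
    qed
  qed
qed

lemma cut_ex: assumes p: "line p" and x: "x \<in> P" shows "\<exists>m. cut p x m"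
proof -
  let ?A = "{x \<in> P. \<exists>m. cut p x m}"
  \<comment> \<open>The edge \<open>p 0\<close> is beyond \<open>p i\<close> exactly for
    \<open>i < 0\<close>; from this edge, steps reach all of \<open>P\<close> and preserve the
    existence of a cut.\<close>
  have "cut p (p 0) (- 1)" using forward_line[OF p] by (auto simp: cut_def)
  then have "p 0 \<in> ?A" using lineD(1)[OF p] by blast
  moreover have "x + s \<in> ?A" if xs: "x \<in> ?A" "s \<in> K \<union> L" for x s
  proof -
    have s: "s \<in> X (s \<in> K)" using xs(2) by (auto simp: X_def)
    obtain m where "cut p x m" using xs(1) by blast
    then show ?thesis using cut_step[OF p _ s] xs(1) X_P[OF s] add_subgroupD(2)[OF P_sub] by blast
  qed
  ultimately have "?A = P" by (intro P_right_induct) blast+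
  then show ?thesis using x by blast
qed

lemma cut_proj: assumes "line p" "x \<in> P" shows "cut p x (proj p x)"
  unfolding proj_def using cut_ex[OF assms] cut_unique by (metis theI')

lemma forward_iff: "line p \<Longrightarrow> x \<in> P \<Longrightarrow> forward p i x \<longleftrightarrow> i \<le> proj p x"
  using cut_proj unfolding cut_def by blast

lemma proj_eqI: "line p \<Longrightarrow> x \<in> P \<Longrightarrow> (\<And>i. forward p i x \<longleftrightarrow> i \<le> m) \<Longrightarrow> proj p x = m"
  using cut_proj cut_unique unfolding cut_def by blast

lemma proj_step: assumes "line p" "x \<in> P" "s \<in> K \<union> L" shows "\<bar>proj p (x + s) - proj p x\<bar> \<le> 1"
proof -
  have s: "s \<in> X (s \<in> K)" using assms(3) by (auto simp: X_def)
  have xs: "x + s \<in> P" using assms(2) X_P[OF s] add_subgroupD(2)[OF P_sub] by blast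
  obtain n where "cut p (x + s) n" "\<bar>n - proj p x\<bar> \<le> 1"
    using cut_step[OF assms(1,2) s cut_proj[OF assms(1,2)]] by blast
  then show ?thesis using cut_unique[OF cut_proj[OF assms(1) xs]] by blast
qed

lemma proj_shift: assumes "line p" "g \<in> P" "x \<in> P" shows "proj (\<lambda>i. g + p i) (g + x) = proj p x"
proof (rule proj_eqI[OF line_shift[OF assms(1,2)]])
  show "g + x \<in> P" using assms add_subgroupD(2)[OF P_sub] by blast
  show "forward (\<lambda>i. g + p i) i (g + x) \<longleftrightarrow> i \<le> proj p x" for i
    unfolding forward_iff[OF assms(1,3), symmetric] forward_def
    by (simp only: minus_add add.assoc minus_add_cancel)
qed

text \<open>Only an even shift respects the assignment of the two factors to even and odd
  indices.\<close>

lemma proj_reindex: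
  assumes "line p" "even k" "x \<in> P" shows "proj (\<lambda>i. p (i + k)) x = proj p x - k"
proof (rule proj_eqI[OF _ assms(3)])
  show "line (\<lambda>i. p (i + k))" using lineD[OF assms(1), of "_ + k"] assms(2)
    unfolding line_def by (simp add: algebra_simps)
  show "forward (\<lambda>i. p (i + k)) i x \<longleftrightarrow> i \<le> proj p x - k" for i
    using forward_iff[OF assms(1,3), of "i + k"] assms(2) unfolding forward_def by auto
qed

end

section \<open>Overlapping lines and the Behrstock inequality\<close>

context amalgam begin

lemma line_same_edge: assumes "line p" "p i \<sim> p j" shows "i = j"
proof -
  have *: False if "i < j" "p i \<sim> p j" for i j
    using forward_line[OF assms(1), of i j] that starts_notin_H by (simp add: forward_def same_edge_def)
  show ?thesis using *[of i j] *[of j i] assms(2) same_edge_sym by (metis linorder_less_linear)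
qed

text \<open>Geodesics in a tree are unique: two shared edges force the segments between them to
  agree, in equal or in opposite directions. Algebraically this is
  \<open>alt_unique\<close>.\<close>

lemma shared_segment:
  assumes p: "line p" and q: "line q" and e: "p i \<sim> q j" "p (i + int n) \<sim> q j'" and n: "n > 0"
  shows "(\<forall>m\<le>n. p (i + int m) \<sim> q (j + int m)) \<or> (\<forall>m\<le>n. p (i + int m) \<sim> q (j - int m))"
proof -
  have main: "\<forall>m\<le>n. p (i + int m) \<sim> q (j + int m)"
    if q: "line q" and e: "p i \<sim> q j" "p (i + int n) \<sim> q j'" and j: "j < j'" for q j j'
  proof -
    obtain ws where ws: "alt (odd i) ws" "length ws = n"
      "\<And>m. m \<le> n \<Longrightarrow> sum_list (take m ws) = - p i + p (i + int m)" using line_diff[OF p] by blast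
    define k where "k = nat (j' - j)"
    obtain vs where vs: "alt (odd j) vs" "length vs = k"
      "\<And>m. m \<le> k \<Longrightarrow> sum_list (take m vs) = - q j + q (j + int m)" using line_diff[OF q] by blast
    have h: "- p i + q j \<in> H" using e(1) by (simp add: same_edge_def)
    have tel: "- (- p i + u) + (- p i + q j) + (- q j + v) = - u + v" for u v
      by (simp only: minus_add minus_minus add.assoc add_minus_cancel)
    have w: "sum_list ws = - p i + p (i + int n)" using ws(3)[of n] ws(2) by simp
    have v: "sum_list vs = - q j + q j'" using vs(3)[of k] vs(2) j by (simp add: k_def)
    have "- sum_list ws + (- p i + q j) + sum_list vs \<in> H"
      unfolding w v tel using e(2) by (simp add: same_edge_def)
    moreover have "ws \<noteq> []" using ws(2) n by auto
    ultimately have *: "length vs = n" "\<And>k. k \<le> n \<Longrightarrow> - sum_list (take k ws) + (- p i + q j) + sum_list (take k vs) \<in> H"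
      using alt_unique[OF ws(1) vs(1) h] ws(2) by auto
    show ?thesis
    proof (intro allI impI)
      fix m assume m: "m \<le> n"
      then have "sum_list (take m vs) = - q j + q (j + int m)" using vs(2,3) *(1) by simp
      then show "p (i + int m) \<sim> q (j + int m)" using *(2)[OF m] unfolding ws(3)[OF m] by (simp only: tel same_edge_def)
    qed
  qed
  consider "j < j'" | "j' < j" | "j = j'" by linarith
  then show ?thesis
  proof cases
    case 1
    then show ?thesis using main[OF q e] by blast
  next
    case 2
    have "\<forall>m\<le>n. p (i + int m) \<sim> q (1 - (1 - j + int m))"
      using main[OF line_reverse[OF q], of "1 - j" "1 - j'"] e 2 by simp
    moreover have "1 - (1 - j + int m) = j - int m" for m by simp
    ultimately show ?thesis by simp
  next
    case 3
    then have "p i \<sim> p (i + int n)" using e same_edge_sym same_edge_trans by blast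
    then show ?thesis using line_same_edge[OF p] n by fastforce
  qed
qed

text \<open>A line that does not contain the edge \<open>p i\<close> never crosses it and stays on
  one side of it.\<close>

lemma forward_unshared:
  assumes p: "line p" and q: "line q" and n: "\<And>j. \<not> p i \<sim> q j"
  shows "forward p i (q j) = forward p i (q k)"
proof -
  have step: "forward p i (q j) = forward p i (q (j + 1))" for j
  proof -
    have s: "- q j + q (j + 1) \<in> X (odd j)" and s': "- q (j + 1) + q j \<in> X (odd j)"
      using lineD(2)[OF q, of j] add_subgroupD(3)[OF X_sub, of "- q j + q (j + 1)"] by (auto simp: minus_add)
    show ?thesis
      using forward_change(1)[OF p lineD(1)[OF q, of j] s, of i]
        forward_change(1)[OF p lineD(1)[OF q, of "j + 1"] s', of i] n
      unfolding add_minus_cancel by blast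
  qed
  have "forward p i (q j) = forward p i (q 0)" for j
    by (induction j rule: int_induct[where k = 0]) (use step step[of "_ - 1"] in auto)
  then show ?thesis by metis
qed

text \<open>If the edge \<open>p i\<close> separates \<open>x\<close> from \<open>y\<close>, then
  \<open>x\<close> and \<open>p i\<close> are seen from \<open>y\<close> in the same
  direction.\<close>

lemma starts_opposite:
  assumes p: "line p" and x: "x \<in> P" and y: "y \<in> P" "\<not> p i \<sim> y" and ne: "forward p i x \<noteq> forward p i y"
  shows "starts b (- y + x) = starts b (- y + p i)"
proof -
  have *: "starts b (- g + z) = starts b (- g)" if g: "starts c g" and z: "z \<in> P" "\<not> starts c z" for c g z
  proof -
    obtain d where "starts d (- g)" "starts d (- g + z)" using starts_nest[OF g] z by blast
    then show ?thesis using starts_excl[of d] by (cases "b = d") auto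
  qed
  have gP: "- p i + x \<in> P" "- p i + y \<in> P"
    using lineD(1)[OF p] x y add_subgroupD(2,3)[OF P_sub] by blast+
  have gH: "- p i + y \<notin> H" using y(2) by (simp add: same_edge_def)
  have "starts b (- (- p i + y) + (- p i + x)) = starts b (- (- p i + y))"
  proof (cases "forward p i y")
    case True
    then show ?thesis using *[of "odd i" "- p i + y" "- p i + x"] gP ne by (simp add: forward_def)
  next
    case False
    then have "starts (\<not> odd i) (- p i + y)" "\<not> starts (\<not> odd i) (- p i + x)"
      using not_starts[OF gP(2)] gH ne starts_excl[of "odd i" "- p i + x"] by (auto simp: forward_def)
    then show ?thesis using * gP by blast
  qed
  then show ?thesis by (simp only: minus_add minus_minus add.assoc add_minus_cancel)
qed

text \<open>Failure at \<open>x\<close> would give an edge of \<open>p\<close>, not on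
  \<open>q\<close>, that separates \<open>x\<close> from \<open>q\<close>, and likewise an edge of
  \<open>q\<close> that separates \<open>x\<close> from \<open>p\<close>; in a tree these exclude
  each other. The bound is \<open>n + 1\<close> because the first and the last of the separating
  edges then have indices too far apart to be both shared.\<close>

lemma behrstock_lines:
  assumes p: "line p" and q: "line q"
    and few: "\<And>i j i' j'. p i \<sim> q j \<Longrightarrow> p i' \<sim> q j' \<Longrightarrow> \<bar>i - i'\<bar> \<le> n \<and> \<bar>j - j'\<bar> \<le> n"
    and n: "n \<ge> 0"
  shows "\<exists>a b. \<forall>x\<in>P. \<bar>proj p x - a\<bar> \<le> n + 1 \<or> \<bar>proj q x - b\<bar> \<le> n + 1"
proof (intro exI ballI)
  have unshared: "\<exists>i. forward p i x \<noteq> forward p i y \<and> (\<forall>j. \<not> p i \<sim> q j)"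
    if p: "line p" and xy: "x \<in> P" "y \<in> P" and far: "\<bar>proj p x - proj p y\<bar> > n + 1"
      and few: "\<And>i j i' j'. p i \<sim> q j \<Longrightarrow> p i' \<sim> q j' \<Longrightarrow> \<bar>i - i'\<bar> \<le> n" for p q x y
  proof -
    define lo hi where "lo = min (proj p x) (proj p y) + 1" and "hi = max (proj p x) (proj p y)"
    have lh: "hi - lo \<ge> n + 1" using far by (simp add: lo_def hi_def)
    have ne: "forward p i x \<noteq> forward p i y" if "lo \<le> i" "i \<le> hi" for i
      using that forward_iff[OF p] xy by (auto simp: lo_def hi_def)
    show ?thesis
    proof (cases "\<exists>j. p lo \<sim> q j")
      case True
      then have "\<nexists>j. p hi \<sim> q j" using few lh by fastforce
      moreover have "lo \<le> hi" using lh n by linarith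
      ultimately show ?thesis using ne[of hi] by blast
    next
      case False
      moreover have "lo \<le> hi" using lh n by linarith
      ultimately show ?thesis using ne[of lo] by blast
    qed
  qed
  fix x assume x: "x \<in> P"
  show "\<bar>proj p x - proj p (q 0)\<bar> \<le> n + 1 \<or> \<bar>proj q x - proj q (p 0)\<bar> \<le> n + 1"
  proof (rule ccontr)
    assume "\<not> ?thesis"
    then have far: "\<bar>proj p x - proj p (q 0)\<bar> > n + 1" "\<bar>proj q x - proj q (p 0)\<bar> > n + 1" by auto
    obtain i where i: "forward p i x \<noteq> forward p i (q 0)" "\<And>j. \<not> p i \<sim> q j"
      using unshared[OF p x lineD(1)[OF q] far(1)] few by blast
    obtain j where j: "forward q j x \<noteq> forward q j (p 0)" "\<And>i. \<not> q j \<sim> p i"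
      using unshared[OF q x lineD(1)[OF p] far(2), of p] few same_edge_sym by metis
    have "forward p i x \<noteq> forward p i (q j)" using i forward_unshared[OF p q, of i j 0] by simp
    then have "forward q j x = forward q j (p i)"
      using starts_opposite[OF p x lineD(1)[OF q] i(2)] unfolding forward_def[of q] by blast
    then show False using j forward_unshared[OF q p, of j i 0] by simp
  qed
qed

section \<open>Reduced paths that follow a line\<close>

lemma path_P: "x \<in> P \<Longrightarrow> alt b ws \<Longrightarrow> x + sum_list (take k ws) \<in> P"
  using alt_P[OF alt_take] add_subgroupD(2)[OF P_sub] by blast

text \<open>Every edge of the line between the two projections separates the endpoints of the path,
  so the path must use it; \<open>\<kappa> i\<close> counts the steps made before the first one that
  gets beyond \<open>p i\<close>. Since the word is reduced, consecutive edges of the line are used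
  at consecutive steps.\<close>

lemma path_segment_pos:
  assumes p: "line p" and x: "x \<in> P" and ws: "alt b ws"
  defines "pt \<equiv> \<lambda>k. x + sum_list (take k ws)"
  defines "d \<equiv> nat (proj p (x + sum_list ws) - proj p x)"
  shows "\<exists>k. \<forall>m<d. k + m \<le> length ws \<and> pt (k + m) \<sim> p (proj p x + 1 + int m)"
proof (cases "d = 0")
  case False
  have ptP: "pt k \<in> P" for k unfolding pt_def using path_P[OF x ws] .
  have pt0: "pt 0 = x" "pt (length ws) = x + sum_list ws" by (simp_all add: pt_def)
  have ptS: "pt (Suc k) = pt k + ws ! k \<and> ws ! k \<in> X (flip k b)" if "k < length ws" for k
  proof -
    have "alt b (take k ws @ [ws ! k])" using alt_take[OF ws, of "Suc k"] that by (simp add: take_Suc_conv_app_nth)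
    then show ?thesis using that by (simp add: pt_def alt_append take_Suc_conv_app_nth add.assoc min_absorb2)
  qed
  define \<kappa> where "\<kappa> i = (LEAST k. forward p i (pt (Suc k)))" for i
  have K: "\<kappa> i < length ws" "forward p i (pt (Suc (\<kappa> i)))" "pt (\<kappa> i) \<sim> p i" "\<And>k. k < \<kappa> i \<Longrightarrow> \<not> forward p i (pt (Suc k))"
    if i: "proj p x < i" "i \<le> proj p x + int d" for i
  proof -
    have f: "\<not> forward p i (pt 0)" "forward p i (pt (length ws))"
      unfolding forward_iff[OF p ptP] using i by (auto simp: d_def pt0 split: if_splits)
    then have "length ws \<noteq> 0" by metis
    then have ex: "forward p i (pt (Suc (length ws - 1)))" using f by simp
    have le: "\<kappa> i \<le> length ws - 1" unfolding \<kappa>_def using ex by (rule Least_le)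
    then show lt: "\<kappa> i < length ws" using \<open>length ws \<noteq> 0\<close> by linarith
    show fw: "forward p i (pt (Suc (\<kappa> i)))" unfolding \<kappa>_def using ex by (rule LeastI)
    show nf: "\<not> forward p i (pt (Suc k))" if "k < \<kappa> i" for k
      using not_less_Least[of k "\<lambda>k. forward p i (pt (Suc k))"] that unfolding \<kappa>_def by blast
    have "\<not> forward p i (pt (\<kappa> i))" using nf[of "\<kappa> i - 1"] f(1) by (cases "\<kappa> i") auto
    moreover have "pt (Suc (\<kappa> i)) + - (ws ! \<kappa> i) = pt (\<kappa> i)" using ptS[OF lt] by (simp add: add.assoc)
    moreover have "- (ws ! \<kappa> i) \<in> X (flip (\<kappa> i) b)" using ptS[OF lt] add_subgroupD(3)[OF X_sub] by blast
    ultimately show "pt (\<kappa> i) \<sim> p i"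
      using forward_change(1)[OF p ptP _ fw] same_edge_sym by metis
  qed
  have succ: "\<kappa> (i + 1) = \<kappa> i + 1" if i: "proj p x < i" "i + 1 \<le> proj p x + int d" for i
  proof -
    have Ki: "\<kappa> i < length ws" "pt (\<kappa> i) \<sim> p i" and Kj: "\<kappa> (i + 1) < length ws" "pt (\<kappa> (i + 1)) \<sim> p (i + 1)"
      using K[of i] K[of "i + 1"] i by auto
    have "forward p i (pt (Suc (\<kappa> (i + 1))))" using K(2)[of "i + 1"] i forward_mono[OF p ptP] by auto
    then have le: "\<kappa> i \<le> \<kappa> (i + 1)" using K(4)[of i "\<kappa> (i + 1)"] i not_le by fastforce
    define vs where "vs = take (\<kappa> (i + 1) - \<kappa> i) (drop (\<kappa> i) ws)"
    have vs: "alt (flip (\<kappa> i) b) vs" "length vs = \<kappa> (i + 1) - \<kappa> i"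
      unfolding vs_def using alt_take[OF alt_drop[OF ws]] Ki(1) Kj(1) by auto
    have "take (\<kappa> (i + 1)) ws = take (\<kappa> i) ws @ vs" unfolding vs_def using le by (metis le_add_diff_inverse take_add)
    then have sv: "sum_list vs = - pt (\<kappa> i) + pt (\<kappa> (i + 1))"
      unfolding pt_def by (simp only: sum_list_append grp_norm minus_add_cancel)
    have s: "alt (odd i) [- p i + p (i + 1)]" using lineD(2)[OF p] by simp
    have "- sum_list [- p i + p (i + 1)] + (- p i + pt (\<kappa> i)) + sum_list vs = - p (i + 1) + pt (\<kappa> (i + 1))"
      unfolding sv by (simp only: sum_list.Cons sum_list.Nil add_0_right minus_add minus_minus add.assoc add_minus_cancel)
    also have "\<dots> \<in> H" using same_edge_sym[OF Kj(2)] by (simp add: same_edge_def)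
    finally have "length vs = length [- p i + p (i + 1)]"
      using alt_unique[OF s vs(1), of "- p i + pt (\<kappa> i)"] same_edge_sym[OF Ki(2)] by (simp add: same_edge_def)
    then show ?thesis using vs(2) by simp
  qed
  define k where "k = \<kappa> (proj p x + 1)"
  have "\<kappa> (proj p x + 1 + int m) = k + m" if "m < d" for m
    using that
  proof (induction m)
    case (Suc m)
    then show ?case using succ[of "proj p x + 1 + int m"] by (simp add: algebra_simps)
  qed (simp add: k_def)
  moreover have "proj p x < proj p x + 1 + int m \<and> proj p x + 1 + int m \<le> proj p x + int d" if "m < d" for m
    using that by linarith
  ultimately have "k + m \<le> length ws \<and> pt (k + m) \<sim> p (proj p x + 1 + int m)" if "m < d" for m
    using K(1,3)[of "proj p x + 1 + int m"] that by auto
  then show ?thesis by blast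
qed simp

text \<open>If the projection decreases, the previous lemma is applied to the path run backwards.
  The segment is then renumbered along the original path, so that \<sigma> records its direction on
  the line.\<close>

lemma path_segment:
  assumes p: "line p" and x: "x \<in> P" and ws: "alt b ws"
  defines "pt \<equiv> \<lambda>k. x + sum_list (take k ws)"
  defines "d \<equiv> nat \<bar>proj p (x + sum_list ws) - proj p x\<bar>"
  shows "\<exists>k i \<sigma>. \<sigma> \<in> {1, - 1} \<and> (\<forall>m<d. k + m \<le> length ws \<and> pt (k + m) \<sim> p (i + \<sigma> * int m))"
proof (cases "proj p (x + sum_list ws) \<ge> proj p x")
  case True
  then have "\<exists>k. \<forall>m<d. k + m \<le> length ws \<and> pt (k + m) \<sim> p (proj p x + 1 + int m)"
    unfolding d_def pt_def using path_segment_pos[OF p x ws] by simp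
  then show ?thesis by (metis insertI1 mult_1)
next
  case False
  define y where "y = x + sum_list ws"
  let ?r = "rev (map uminus ws)"
  have y: "y \<in> P" unfolding y_def using path_P[OF x ws, of "length ws"] by simp
  have yr: "y + sum_list ?r = x" by (simp add: y_def sum_list_rev add.assoc)
  have bck: "y + sum_list (take k ?r) = pt (length ws - k)" if "k \<le> length ws" for k
  proof -
    have "take k ?r = rev (map uminus (drop (length ws - k) ws))"
      using that by (simp add: take_rev rev_map drop_map take_map)
    then have "sum_list (take k ?r) = - sum_list (drop (length ws - k) ws)" by (simp only: sum_list_rev)
    moreover have "sum_list ws = sum_list (take (length ws - k) ws) + sum_list (drop (length ws - k) ws)"
      by (metis append_take_drop_id sum_list_append)
    ultimately show ?thesis by (simp only: y_def pt_def add.assoc right_minus add_0_right)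
  qed
  have "d = nat (proj p (y + sum_list ?r) - proj p y)" using False unfolding d_def yr unfolding y_def by simp
  then obtain k where k: "\<And>m. m < d \<Longrightarrow> k + m \<le> length ws \<and> y + sum_list (take (k + m) ?r) \<sim> p (proj p y + 1 + int m)"
    using path_segment_pos[OF p y alt_rev[OF ws]] by auto
  show ?thesis
  proof (cases "d = 0")
    case False
    define k' where "k' = length ws - (k + (d - 1))"
    have "k' + m \<le> length ws \<and> pt (k' + m) \<sim> p (proj p y + int d + - 1 * int m)" if m: "m < d" for m
    proof -
      define n where "n = d - 1 - m"
      have n: "n < d" "k + n \<le> length ws" using k[of n] m False by (auto simp: n_def)
      have "k + (d - 1) \<le> length ws" using k[of "d - 1"] False by simp
      then have "k' + m = length ws - (k + n)" unfolding k'_def n_def using m by simp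
      moreover have "proj p y + int d + - 1 * int m = proj p y + 1 + int n" unfolding n_def using m by simp
      ultimately show ?thesis using k[OF n(1)] unfolding bck[OF n(2)] by (simp only: diff_le_self)
    qed
    then show ?thesis by blast
  qed auto
qed

end

section \<open>Small cancellation relators\<close>

text \<open>The relator of \<open>(a, y, b1, b2, h)\<close> makes the positive word
  \<open>y u\<^sub>0 y u\<^sub>1 \<dots> y u\<^sub>6\<^sub>N\<^sub>-\<^sub>1 y a\<close> equal to \<open>h\<close>. Positions are counted so that the letters \<open>y\<close>
  stand at the even ones, and the last letter \<open>a\<close> absorbs \<open>h\<close>.\<close>

type_synonym 'g relator = "'g \<times> 'g \<times> 'g \<times> 'g \<times> 'g"

text \<open>The growing exponent of \<open>a\<close> distinguishes the blocks of six letters, and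
  the residues 0 to 2, 3 to 4 and 5 receive \<open>0\<close>, \<open>b1\<close> and
  \<open>b2\<close>. Position \<open>6 * N\<close> is the only one that involves \<open>h\<close>,
  hence the exceptional one in all comparisons.\<close>

fun rel_u :: "nat \<Rightarrow> 'g::group_add relator \<Rightarrow> nat \<Rightarrow> 'g" where
  "rel_u N (a, y, b1, b2, h) t = (if t = 6 * N then a - h else
    zmult (int (t div 6) + 1) a + (if t mod 6 < 3 then 0 else if t mod 6 < 5 then b1 else b2))"

fun rel_y :: "'g relator \<Rightarrow> 'g" where
  "rel_y (a, y, b1, b2, h) = y"

definition rel_uz :: "nat \<Rightarrow> 'g::group_add relator \<Rightarrow> int \<Rightarrow> 'g" where
  "rel_uz N \<tau> z = rel_u N \<tau> (nat (z mod int (6 * N + 1)))"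

definition rel_step :: "nat \<Rightarrow> 'g::group_add relator \<Rightarrow> int \<Rightarrow> 'g" where
  "rel_step N \<tau> i = (if even i then rel_y \<tau> else rel_uz N \<tau> (i div 2))"

definition rel_prefix :: "nat \<Rightarrow> 'g::group_add relator \<Rightarrow> nat \<Rightarrow> 'g" where
  "rel_prefix N \<tau> k = sum_list (map (\<lambda>j. rel_step N \<tau> (int j)) [0..<k])"

abbreviation rel_len :: "nat \<Rightarrow> nat" where "rel_len N \<equiv> 2 * (6 * N + 1)"

definition rel_word :: "nat \<Rightarrow> 'g::group_add relator \<Rightarrow> 'g" where
  "rel_word N \<tau> = rel_prefix N \<tau> (rel_len N)"

text \<open>The axis of the relator: \<open>rel_word N \<tau>\<close> translates this bi-infinite
  path along itself by \<open>rel_len N\<close> steps.\<close>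

definition rel_line :: "nat \<Rightarrow> 'g::group_add relator \<Rightarrow> int \<Rightarrow> 'g" where
  "rel_line N \<tau> i = zmult (i div int (rel_len N)) (rel_word N \<tau>) + rel_prefix N \<tau> (nat (i mod int (rel_len N)))"

definition conj_relator :: "'g::group_add \<Rightarrow> 'g relator \<Rightarrow> 'g relator" where
  "conj_relator c = (\<lambda>(a, y, b1, b2, h). (- c + a + c, - c + y + c, - c + b1 + c, - c + b2 + c, - c + h + c))"

lemma conj_cancel: "- c + x + c + (- c + y + c) = - c + (x + y) + (c :: 'g::group_add)"
  by (simp only: add.assoc add_minus_cancel)

lemma zmult_conj': "zmult k (- c + g + c) = - c + zmult k g + (c :: 'g::group_add)"
  using zmult_conj[of k "- c" g] by (simp only: diff_conv_add_uminus minus_minus)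

lemma zmult_commute: "zmult j g + zmult k g = zmult k g + zmult j (g :: 'g::group_add)"
  by (simp only: zmult_add[symmetric] add.commute)

lemma conj_rel_u: "rel_u N (conj_relator c \<tau>) t = - c + rel_u N \<tau> t + (c :: 'g::group_add)"
proof -
  obtain a y b1 b2 h where \<tau>: "\<tau> = (a, y, b1, b2, h)" by (metis prod_cases5)
  have e1: "- c + a + c - (- c + h + c) = - c + (a - h) + c"
    by (simp only: grp_norm minus_minus add_minus_cancel)
  have e2: "- c + x + c + (if A then 0 else if B then - c + b1 + c else - c + b2 + c)
      = - c + (x + (if A then 0 else if B then b1 else b2)) + c" for x A B
    using conj_cancel[of c x] by auto
  show ?thesis unfolding \<tau> conj_relator_def prod.case rel_u.simps zmult_conj'
    by (cases "t = 6 * N") (simp_all only: if_True if_False e1 e2 simp_thms)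
qed

lemma conj_rel_step: "rel_step N (conj_relator c \<tau>) i = - c + rel_step N \<tau> i + (c :: 'g::group_add)"
proof -
  have "rel_y (conj_relator c \<tau>) = - c + rel_y \<tau> + c"
    by (cases \<tau>) (auto simp: conj_relator_def)
  then show ?thesis by (simp add: rel_step_def rel_uz_def conj_rel_u)
qed

lemma conj_rel_prefix: "rel_prefix N (conj_relator c \<tau>) k = - c + rel_prefix N \<tau> k + (c :: 'g::group_add)"
proof (induction k)
  case (Suc k)
  then show ?case using conj_cancel[of c "rel_prefix N \<tau> k"] by (simp add: rel_prefix_def conj_rel_step)
qed (simp add: rel_prefix_def)

lemma conj_rel_word: "rel_word N (conj_relator c \<tau>) = - c + rel_word N \<tau> + (c :: 'g::group_add)"
  by (simp add: rel_word_def conj_rel_prefix)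

lemma conj_rel_line: "rel_line N (conj_relator c \<tau>) i = - c + rel_line N \<tau> i + (c :: 'g::group_add)"
  unfolding rel_line_def conj_rel_prefix conj_rel_word zmult_conj' by (rule conj_cancel)

lemma rel_step_mod: "rel_step N \<tau> (i mod int (rel_len N)) = rel_step N \<tau> i"
proof -
  let ?n = "int (6 * N + 1)"
  have e: "i mod (2 * ?n) = i mod 2 + 2 * (i div 2 mod ?n)"
    by (rule zmod_zmult2_eq[of ?n i 2, unfolded add.commute[of "2 * _"]]) simp
  have "even (i mod (2 * ?n)) = even i" unfolding e by simp
  moreover have "(i mod (2 * ?n)) div 2 mod ?n = i div 2 mod ?n" unfolding e by (simp add: mod_2_eq_odd)
  ultimately show ?thesis unfolding rel_step_def rel_uz_def by simp
qed

lemma rel_line_Suc: "rel_line N \<tau> (i + 1) = rel_line N \<tau> i + rel_step N \<tau> (i :: int)"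
proof -
  let ?T = "int (rel_len N)" and ?k = "nat (i mod int (rel_len N))"
  have T: "?T > 0" by simp
  have k: "int ?k = i mod ?T" by simp
  have s: "rel_prefix N \<tau> ?k + rel_step N \<tau> i = rel_prefix N \<tau> (Suc ?k)"
    using rel_step_mod[of N \<tau> i] k by (simp add: rel_prefix_def del: int_nat_eq)
  have i: "i = ?T * (i div ?T) + i mod ?T" by simp
  show ?thesis
  proof (cases "i mod ?T = ?T - 1")
    case True
    then have "i + 1 = ?T * (i div ?T + 1)" using i by (simp add: algebra_simps)
    then have "(i + 1) div ?T = i div ?T + 1" "(i + 1) mod ?T = 0"
      using T by (metis nonzero_mult_div_cancel_left less_irrefl, metis mod_mult_self1_is_0)
    moreover have "Suc ?k = rel_len N" using True by simp
    ultimately show ?thesis unfolding rel_line_def using s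
      by (simp only: add.assoc zmult_add zmult_1 rel_word_def nat_0) (simp add: rel_prefix_def)
  next
    case False
    then have lt: "i mod ?T + 1 < ?T" using T pos_mod_bound[of ?T i] by linarith
    have "i + 1 = (i mod ?T + 1) + ?T * (i div ?T)" using i by linarith
    then have "(i + 1) div ?T = i div ?T" "(i + 1) mod ?T = i mod ?T + 1"
      using lt T pos_mod_sign[of ?T i] by (metis add.commute div_mult_self2 div_pos_pos_trivial add_0 add_increasing2 less_imp_le zero_less_one less_numeral_extra(3), metis mod_mult_self2 mod_pos_pos_trivial add_increasing2 less_imp_le zero_less_one add.commute)
    moreover have "nat (i mod ?T + 1) = Suc ?k" using T pos_mod_sign[of ?T i] by linarith
    ultimately show ?thesis unfolding rel_line_def using s by (simp only: add.assoc)
  qed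
qed

lemma rel_line_0: "rel_line N \<tau> 0 = 0"
  by (simp add: rel_line_def rel_prefix_def)

lemma rel_line_period: "rel_line N \<tau> (i + k * int (rel_len N)) = zmult k (rel_word N \<tau>) + rel_line N \<tau> i"
proof -
  have "(i + k * int (rel_len N)) div int (rel_len N) = k + i div int (rel_len N)"
    by (subst div_mult_self1) auto
  moreover have "(i + k * int (rel_len N)) mod int (rel_len N) = i mod int (rel_len N)" by (rule mod_mult_self1)
  ultimately show ?thesis by (simp only: rel_line_def zmult_add add.assoc)
qed

text \<open>\<open>R_conj\<close> is the consistency condition. If the other four entries of two
  relators are conjugate by one element of \<open>H\<close>, so must be the right-hand sides;
  otherwise their axes could share a long segment without having the same rotation. The bound on
  \<open>N\<close> makes the period exceed \<open>12 * 81\<close> and keeps more than half a period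
  after all later losses.\<close>

locale relators = amalgam +
  fixes R :: "'a::group_add relator set" and N :: nat
  assumes N: "N \<ge> 200"
    and malnormal: "\<And>b s h. s \<in> X b - H \<Longrightarrow> h \<in> H \<Longrightarrow> - s + h + s \<in> H \<Longrightarrow> h = 0"
    and torsion_free: "\<And>b s k. s \<in> X b \<Longrightarrow> k \<noteq> 0 \<Longrightarrow> zmult k s = 0 \<Longrightarrow> s = 0"
    and R: "\<And>a y b1 b2 h. (a, y, b1, b2, h) \<in> R \<Longrightarrow>
      a \<in> K - H \<and> y \<in> L - H \<and> b1 \<in> H \<and> b2 \<in> H \<and> h \<in> H \<and> b1 \<noteq> 0 \<and> b1 \<noteq> b2"
    and R_conj: "\<And>a y b1 b2 h h' c. c \<in> H \<Longrightarrow> (a, y, b1, b2, h) \<in> R \<Longrightarrow>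
      (- c + a + c, - c + y + c, - c + b1 + c, - c + b2 + c, h') \<in> R \<Longrightarrow> h' = - c + h + c"
begin

text \<open>A multiple of \<open>s\<close> commutes with \<open>s\<close>, so if it lies in
  \<open>H\<close> malnormality makes it 0, and then \<open>s\<close> would be a torsion
  element.\<close>

lemma zmult_notin_H: assumes "s \<in> X b - H" "k \<noteq> 0" shows "zmult k s \<notin> H"
proof
  assume H: "zmult k s \<in> H"
  have "- s + zmult k s + s = zmult k s"
    using zmult_commute[of k s 1] by (simp add: add.assoc)
  then have "zmult k s = 0" using malnormal[OF assms(1) H] H by simp
  then show False using torsion_free[of s b k] assms add_subgroupD(1)[OF H_sub] by auto
qed

lemma rel_u_X: assumes "\<tau> \<in> R" shows "rel_u N \<tau> t \<in> K - H"
proof -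
  obtain a y b1 b2 h where \<tau>: "\<tau> = (a, y, b1, b2, h)" by (metis prod_cases5)
  have r: "a \<in> X True - H" "b1 \<in> H" "b2 \<in> H" "h \<in> H" using R assms \<tau> by (auto simp: X_def)
  have z: "zmult (int k + 1) a \<in> X True - H" for k
    using zmult_notin_H[OF r(1), of "int k + 1"] zmult_in[OF X_sub, of a True] r(1) by auto
  have "a + - h \<in> X True - H" using X_absorb(2)[of "- h" a True] r add_subgroupD(3)[OF H_sub] by blast
  moreover have "zmult (int k + 1) a + b \<in> X True - H" if "b \<in> H" for k b
    using X_absorb(2)[OF that] z by blast
  ultimately have "rel_u N \<tau> t \<in> X True - H"
    unfolding \<tau> rel_u.simps using r add_subgroupD(1)[OF H_sub] by (auto simp del: Diff_iff)
  then show ?thesis by (simp add: X_def)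
qed

lemma rel_y_X: "\<tau> \<in> R \<Longrightarrow> rel_y \<tau> \<in> L - H"
  using R by (cases \<tau>) auto

lemma rel_step_X: "\<tau> \<in> R \<Longrightarrow> rel_step N \<tau> i \<in> X (odd i) - H"
  using rel_u_X rel_y_X unfolding rel_step_def rel_uz_def by (auto simp: X_def)

lemma rel_line: assumes "\<tau> \<in> R" shows "line (rel_line N \<tau>)"
proof -
  have "rel_line N \<tau> i \<in> P" for i
  proof (induction i rule: int_induct[where k = 0])
    case base
    then show ?case using add_subgroupD(1)[OF P_sub] by (simp add: rel_line_0)
  next
    case (step1 i)
    then show ?case unfolding rel_line_Suc using rel_step_X[OF assms] X_P add_subgroupD(2)[OF P_sub] by blast
  next
    case (step2 i)
    have "rel_line N \<tau> i = rel_line N \<tau> (i - 1) + rel_step N \<tau> (i - 1)" using rel_line_Suc[of N \<tau> "i - 1"] by simp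
    then have "rel_line N \<tau> (i - 1) = rel_line N \<tau> i + - rel_step N \<tau> (i - 1)" by (simp add: add.assoc)
    moreover have "rel_step N \<tau> (i - 1) \<in> P" using rel_step_X[OF assms] X_P by blast
    ultimately show ?case using step2 add_subgroupD(4)[OF P_sub] by simp
  qed
  then show ?thesis unfolding line_def rel_line_Suc using rel_step_X[OF assms] by (simp only: minus_add_cancel) blast
qed

lemma rel_word_P: "\<tau> \<in> R \<Longrightarrow> rel_word N \<tau> \<in> P"
  using lineD(1)[OF rel_line, of \<tau> "int (rel_len N)"] rel_line_period[of N \<tau> 0 1] by (simp add: rel_line_0)

text \<open>Inside a period, consecutive letters \<open>u\<close> repeat in the pattern \<open>=,=,\<noteq>,=,\<noteq>,\<noteq>\<close>, which is
  invariant under the two-sided action of \<open>H\<close>, fixes the position modulo 6 and is not invariant under reversal.\<close>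

lemma rel_u_eq_Suc:
  assumes "\<tau> \<in> R" "t + 1 < 6 * N"
  shows "rel_u N \<tau> t = rel_u N \<tau> (t + 1) \<longleftrightarrow> t mod 6 \<in> {0, 1, 3}"
proof -
  obtain a y b1 b2 h where \<tau>: "\<tau> = (a, y, b1, b2, h)" by (metis prod_cases5)
  have r: "a \<in> K - H" "b2 \<in> H" "b1 \<noteq> 0" "b1 \<noteq> b2" using R assms \<tau> by auto
  define m where "m = t div 6"
  have ne: "t \<noteq> 6 * N" "t + 1 \<noteq> 6 * N" using assms(2) by auto
  define x where "x = zmult (int m + 1) a"
  define B :: "nat \<Rightarrow> 'a" where "B r = (if r < 3 then 0 else if r < 5 then b1 else b2)" for r
  have ut: "rel_u N \<tau> t = x + B (t mod 6)" using ne by (simp add: \<tau> x_def m_def B_def)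
  show ?thesis
  proof (cases "t mod 6 = 5")
    case True
    then have "(t + 1) mod 6 = 0" "(t + 1) div 6 = m + 1" unfolding m_def by presburger+
    then have "rel_u N \<tau> (t + 1) = zmult (int m + 1 + 1) a" using ne by (simp add: \<tau> add.commute)
    also have "\<dots> = x + a" using zmult_add[of "int m + 1" 1 a] by (simp add: x_def)
    finally show ?thesis using ut True r by (auto simp: B_def)
  next
    case False
    moreover have "t mod 6 < 6" by simp
    ultimately have lt: "t mod 6 < 5" by linarith
    then have "(t + 1) mod 6 = t mod 6 + 1" "(t + 1) div 6 = m" unfolding m_def by presburger+
    then have "rel_u N \<tau> (t + 1) = x + B (t mod 6 + 1)" using ne by (simp add: \<tau> x_def B_def)
    then have "rel_u N \<tau> t = rel_u N \<tau> (t + 1) \<longleftrightarrow> B (t mod 6) = B (t mod 6 + 1)" using ut by simp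
    moreover have "t mod 6 \<in> {0, 1, 2, 3, 4}" using lt by auto
    ultimately show ?thesis using r by (auto simp: B_def)
  qed
qed


lemma next_multiple_of_6: "(6 - t mod 6) mod 6 \<le> (5 :: nat)" "(t + (6 - t mod 6) mod 6) mod 6 = (0 :: nat)"
proof -
  have "t mod 6 < 6" by simp
  then have "(t mod 6 + (6 - t mod 6) mod 6) mod 6 = 0" by (cases "t mod 6 = 0") simp_all
  then show "(t + (6 - t mod 6) mod 6) mod 6 = 0"
    using mod_add_left_eq[of t 6 "(6 - t mod 6) mod 6"] by (simp only:)
  have "(6 - t mod 6) mod 6 < 6" by simp
  then show "(6 - t mod 6) mod 6 \<le> 5" by linarith
qed

text \<open>At most 5 letters lead to a multiple of 6 and the 7 letters from there on suffice, hence
  windows of 12. Offsets 0, 3, 5 and 6 show that \<open>c0\<close> conjugates \<open>b1\<close>,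
  \<open>b2\<close> and \<open>a\<close> to their counterparts. Then \<open>c1 - c0\<close> is a
  multiple of \<open>a\<close> lying in \<open>H\<close>, so the blocks agree and
  \<open>c1 = c0\<close>, which settles \<open>y\<close>; \<open>R_conj\<close> settles
  \<open>h\<close>.\<close>

lemma window_forward:
  assumes \<tau>: "\<tau> \<in> R" "\<tau>' \<in> R" and c: "c0 \<in> H" "c1 \<in> H" and t: "t + 11 < 6 * N" "t' + 11 < 6 * N"
    and u: "\<And>k. k \<le> 11 \<Longrightarrow> c1 + rel_u N \<tau>' (t' + k) = rel_u N \<tau> (t + k) + c0"
    and y: "c0 + rel_y \<tau>' = rel_y \<tau> + c1"
  shows "t' = t \<and> \<tau>' = conj_relator c0 \<tau>"
proof -
  obtain a y b1 b2 h where t1: "\<tau> = (a, y, b1, b2, h)" by (metis prod_cases5)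
  obtain a' y' b1' b2' h' where t2: "\<tau>' = (a', y', b1', b2', h')" by (metis prod_cases5)
  have r: "a \<in> X True - H" using R[of a y b1 b2 h] \<tau>(1) t1 by (simp add: X_def)
  define k where "k = (6 - t mod 6) mod 6"
  define m m' where "m = (t + k) div 6" and "m' = (t' + k) div 6"
  have k: "k \<le> 5" "(t + k) mod 6 = 0" unfolding k_def by (fact next_multiple_of_6)+
  have eq: "rel_u N \<tau>' (t' + j) = rel_u N \<tau>' (t' + j + 1) \<longleftrightarrow> rel_u N \<tau> (t + j) = rel_u N \<tau> (t + j + 1)"
    if "j \<le> 10" for j
  proof -
    have "j \<le> 11" "j + 1 \<le> 11" using that by auto
    from u[OF this(1)] u[OF this(2)] show ?thesis
      unfolding add.assoc[of t] add.assoc[of t'] by (metis add_left_cancel add_right_cancel)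
  qed
  have "(t' + j) mod 6 \<in> {0, 1, 3} \<longleftrightarrow> (t + j) mod 6 \<in> {0, 1, 3}" if "j \<le> 10" for j
    using eq[OF that] rel_u_eq_Suc[OF \<tau>(1), of "t + j"] rel_u_eq_Suc[OF \<tau>(2), of "t' + j"] t that by simp
  note pat = this
  have "(t + k + 1) mod 6 = ((t + k) mod 6 + 1) mod 6" by (rule mod_add_left_eq[symmetric])
  then have "(t + k + 1) mod 6 = 1" unfolding k(2) by (simp only: add_0) simp
  then have "(t + (k + 1)) mod 6 = 1" by (simp only: add.assoc)
  then have "(t' + k) mod 6 \<in> {0, 1, 3}" "(t' + (k + 1)) mod 6 \<in> {0, 1, 3}"
    using pat[of k] pat[of "k + 1"] k by simp_all
  \<comment> \<open>Only the residue 0 belongs to {0, 1, 3} together with its successor.\<close>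
  then have k': "(t' + k) mod 6 = 0" using mod_add_left_eq[of "t' + k" 6 1] unfolding add.assoc[symmetric, of t'] by auto
  have tk: "t + k = 6 * m" "t' + k = 6 * m'" using k k' by (auto simp: m_def m'_def)
  have div6: "(6 * m + 6) div 6 = m + 1" "(6 * m + 3) div 6 = m" "(6 * m + 5) div 6 = m"
    "(6 * m + 6) mod 6 = 0" "(6 * m + 3) mod 6 = 3" "(6 * m + 5) mod 6 = 5" for m :: nat by presburger+
  have small: "6 * m + 6 < 6 * N" "6 * m' + 6 < 6 * N" using tk t k(1) by linarith+
  define x x' where "x = zmult (int m + 1) a" and "x' = zmult (int m' + 1) a'"
  have x1: "zmult (int (m + 1) + 1) a = x + a" "zmult (int (m' + 1) + 1) a' = x' + a'"
    using zmult_add[of "int m + 1" 1 a] zmult_add[of "int m' + 1" 1 a'] by (simp_all add: x_def x'_def add.commute)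
  have u': "c1 + rel_u N \<tau>' (6 * m' + j) = rel_u N \<tau> (6 * m + j) + c0" if "j \<le> 6" for j
    using u[of "k + j"] that k(1) tk by (simp add: add.assoc[symmetric])
  have "c1 + x' = x + c0" using u'[of 0] small by (simp add: t1 t2 x_def x'_def)
  moreover have "c1 + (x' + b1') = x + b1 + c0" "c1 + (x' + b2') = x + b2 + c0" "c1 + (x' + a') = x + a + c0"
    using u'[of 3] u'[of 5] u'[of 6] small unfolding t1 t2 rel_u.simps div6 x1 by (simp_all add: x_def x'_def)
  ultimately have e: "c0 + b1' = b1 + c0" "c0 + b2' = b2 + c0" "c0 + a' = a + c0"
    unfolding add.assoc[symmetric] by (simp_all add: add.assoc)
  have conj: "v' = - c0 + v + c0" if "c0 + v' = v + c0" for v v'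
    using that by (metis add.assoc minus_add_cancel)
  have "c1 + (- c0 + zmult (int m' + 1) a + c0) = zmult (int m + 1) a + c0"
    using \<open>c1 + x' = x + c0\<close> conj[OF e(3)] by (simp add: x_def x'_def zmult_conj')
  then have c10: "c1 - c0 + zmult (int m' + 1) a = zmult (int m + 1) a"
    by (simp only: add.assoc[symmetric] add_right_cancel diff_conv_add_uminus)
  have "c1 - c0 = zmult (int m + 1) a + zmult (- (int m' + 1)) a"
    using c10 by (metis zmult_minus add.assoc right_minus add.right_neutral)
  also have "\<dots> = zmult (int m - int m') a" using zmult_add[of "int m + 1" "- (int m' + 1)" a] by simp
  finally have "zmult (int m - int m') a \<in> H" using add_subgroupD(4)[OF H_sub c(2,1)] by simp
  then have m: "m' = m" using zmult_notin_H[OF r, of "int m - int m'"] by auto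
  then have "c1 - c0 + zmult (int m + 1) a = 0 + zmult (int m + 1) a" using c10 by simp
  then have "c1 = c0" by (simp only: add_right_cancel right_minus_eq)
  then have y': "y' = - c0 + y + c0" using y conj[of y' y] by (simp add: t1 t2)
  note cj = conj[OF e(3)] y' conj[OF e(1)] conj[OF e(2)]
  have "(- c0 + a + c0, - c0 + y + c0, - c0 + b1 + c0, - c0 + b2 + c0, h') \<in> R"
    using \<tau>(2) by (simp only: t2 cj)
  then have "h' = - c0 + h + c0" by (rule R_conj[OF c(1) \<tau>(1)[unfolded t1]])
  then have "\<tau>' = conj_relator c0 \<tau>" by (simp only: t1 t2 conj_relator_def prod.case cj)
  moreover have "t' = t" using tk m by linarith
  ultimately show ?thesis by blast
qed

text \<open>Offsets 0, 1 and 3 from a multiple of 6 would put \<open>s + 3\<close>,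
  \<open>s + 2\<close> and \<open>s\<close> modulo 6 into {0, 1, 3} for a single \<open>s\<close>,
  which is impossible.\<close>

lemma window_backward:
  assumes \<tau>: "\<tau> \<in> R" "\<tau>' \<in> R" and t: "t + 11 < 6 * N" "11 \<le> t'" "t' < 6 * N"
    and u: "\<And>k. k \<le> 11 \<Longrightarrow> c1 + - rel_u N \<tau>' (t' - k) = rel_u N \<tau> (t + k) + c0"
  shows False
proof -
  have eq: "rel_u N \<tau>' (t' - (j + 1)) = rel_u N \<tau>' (t' - j) \<longleftrightarrow> rel_u N \<tau> (t + j) = rel_u N \<tau> (t + (j + 1))"
    if "j \<le> 10" for j
  proof -
    have "j \<le> 11" "j + 1 \<le> 11" using that by auto
    from u[OF this(1)] u[OF this(2)] show ?thesis by (metis add_left_cancel add_right_cancel minus_minus)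
  qed
  have pat: "(t' - (j + 1)) mod 6 \<in> {0, 1, 3} \<longleftrightarrow> (t + j) mod 6 \<in> {0, 1, 3}" if "j \<le> 10" for j
  proof -
    have "t' - (j + 1) + 1 = t' - j" using that t by linarith
    then show ?thesis
      using eq[OF that] rel_u_eq_Suc[OF \<tau>(1), of "t + j"] rel_u_eq_Suc[OF \<tau>(2), of "t' - (j + 1)"] t that
      by (simp add: add.assoc)
  qed
  define k where "k = (6 - t mod 6) mod 6"
  define s where "s = t' - (k + 4)"
  have k: "k \<le> 5" "(t + k) mod 6 = 0" unfolding k_def by (fact next_multiple_of_6)+
  have s: "t' - (k + 1) = s + 3" "t' - (k + 1 + 1) = s + 2" "t' - (k + 3 + 1) = s" using t k(1) by (auto simp: s_def)
  have tk: "(t + (k + j)) mod 6 = j mod 6" for j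
    using mod_add_left_eq[of "t + k" 6 j] k(2) by (simp add: add.assoc)
  have "(s + 3) mod 6 \<in> {0, 1, 3}" using pat[of k] k unfolding s(1) by simp
  moreover have "(s + 2) mod 6 \<in> {0, 1, 3}" using pat[of "k + 1"] k(1) tk[of 1] unfolding s(2) by simp
  moreover have "s mod 6 \<in> {0, 1, 3}" using pat[of "k + 3"] k(1) tk[of 3] unfolding s(3) by simp
  ultimately show False using mod_add_left_eq[of s 6 3] mod_add_left_eq[of s 6 2] by auto
qed

text \<open>Thirty-six positions hold three disjoint windows of 12, and at most two positions have
  to be avoided.\<close>

lemma good_run:
  fixes A B :: "nat \<Rightarrow> bool"
  assumes "\<And>k l. A k \<Longrightarrow> A l \<Longrightarrow> k < 36 \<Longrightarrow> l < 36 \<Longrightarrow> k = l"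
    "\<And>k l. B k \<Longrightarrow> B l \<Longrightarrow> k < 36 \<Longrightarrow> l < 36 \<Longrightarrow> k = l"
  shows "\<exists>k0\<le>24. \<forall>k\<le>11. \<not> A (k0 + k) \<and> \<not> B (k0 + k)"
proof -
  obtain x where x: "\<And>k. k < 36 \<Longrightarrow> A k \<Longrightarrow> k = x" using assms(1) by metis
  obtain y where y: "\<And>k. k < 36 \<Longrightarrow> B k \<Longrightarrow> k = y" using assms(2) by metis
  obtain q where q: "q < 3" "x div 12 \<noteq> q" "y div 12 \<noteq> q"
  proof -
    have "\<exists>q<3. u \<noteq> q \<and> v \<noteq> q" for u v :: nat by presburger
    then show ?thesis using that by blast
  qed
  have "\<not> A (12 * q + k) \<and> \<not> B (12 * q + k)" if "k \<le> 11" for k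
    using x[of "12 * q + k"] y[of "12 * q + k"] q that by auto
  moreover have "12 * q \<le> 24" using q(1) by simp
  ultimately show ?thesis by blast
qed

lemma mod_run_up:
  assumes "\<And>k. k \<le> 11 \<Longrightarrow> (z + int k) mod int (6 * N + 1) \<noteq> int (6 * N)" "k \<le> 11"
  shows "(z + int k) mod int (6 * N + 1) = z mod int (6 * N + 1) + int k"
  using assms(2)
proof (induction k)
  case (Suc k)
  let ?n = "int (6 * N + 1)"
  have "(z + int k) mod ?n + 1 < ?n"
    using assms(1)[of k] Suc.prems pos_mod_bound[of ?n "z + int k"] by linarith
  moreover have "(z + int k) mod ?n \<ge> 0" by simp
  ultimately have "((z + int k) mod ?n + 1) mod ?n = (z + int k) mod ?n + 1" by (intro mod_pos_pos_trivial) auto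
  moreover have "((z + int k) mod ?n + 1) mod ?n = (z + int (Suc k)) mod ?n" by (simp add: mod_simps add.commute add.left_commute)
  ultimately show ?case using Suc by simp
qed simp

lemma mod_run_down:
  assumes "\<And>k. k \<le> 11 \<Longrightarrow> (z - int k) mod int (6 * N + 1) \<noteq> int (6 * N)" "k \<le> 11"
  shows "(z - int k) mod int (6 * N + 1) = z mod int (6 * N + 1) - int k"
  using assms(2)
proof (induction k)
  case (Suc k)
  let ?n = "int (6 * N + 1)"
  have "(z - int (Suc k)) mod ?n + 1 < ?n"
    using assms(1)[of "Suc k"] Suc.prems pos_mod_bound[of ?n "z - int (Suc k)"] by linarith
  moreover have "(z - int (Suc k)) mod ?n \<ge> 0" by simp
  ultimately have "((z - int (Suc k)) mod ?n + 1) mod ?n = (z - int (Suc k)) mod ?n + 1" by (intro mod_pos_pos_trivial) auto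
  moreover have "((z - int (Suc k)) mod ?n + 1) mod ?n = (z - int k) mod ?n" by (simp add: mod_simps)
  ultimately show ?case using Suc by simp
qed simp


text \<open>The discrepancies \<open>c m\<close> between the two lines lie in \<open>H\<close>.
  Comparing successive letters \<open>y\<close>, malnormality of \<open>H\<close> in
  \<open>L\<close> shows that they alternate between two constants \<open>c0\<close> and
  \<open>c1\<close>. So a window of 12 letters \<open>u\<close> free of the exceptional position can
  be compared directly. Eighty steps hold the 36 letters \<open>u\<close> among which it is found,
  with room to align parities.\<close>

lemma overlap:
  assumes \<tau>: "\<tau> \<in> R" "\<tau>' \<in> R" and \<sigma>: "\<sigma> \<in> {1, - 1}"
    and sh: "\<And>m. m \<le> 80 \<Longrightarrow> g + rel_line N \<tau> (i + int m) \<sim> g' + rel_line N \<tau>' (j + \<sigma> * int m)"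
  shows "\<sigma> = 1 \<and> g + rel_word N \<tau> - g = g' + rel_word N \<tau>' - g' \<and> int (rel_len N) dvd i - j"
proof -
  let ?n = "int (6 * N + 1)"
  define c where "c m = - (g + rel_line N \<tau> (i + int m)) + (g' + rel_line N \<tau>' (j + \<sigma> * int m))" for m
  define s' where "s' m = (if \<sigma> = 1 then rel_step N \<tau>' (j + int m) else - rel_step N \<tau>' (j - int m - 1))" for m
  have cH: "c m \<in> H" if "m \<le> 80" for m using sh[OF that] by (simp add: same_edge_def c_def)
  have line': "rel_line N \<tau>' (j + \<sigma> * int (Suc m)) = rel_line N \<tau>' (j + \<sigma> * int m) + s' m" for m
  proof (cases "\<sigma> = 1")
    case True
    then show ?thesis using rel_line_Suc[of N \<tau>' "j + int m"] by (simp add: s'_def algebra_simps)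
  next
    case False
    then have "\<sigma> = - 1" using \<sigma> by auto
    moreover have "rel_line N \<tau>' (j - int m - 1) = rel_line N \<tau>' (j - int m) + - rel_step N \<tau>' (j - int m - 1)"
      using rel_line_Suc[of N \<tau>' "j - int m - 1"] by (simp add: add.assoc)
    ultimately show ?thesis by (simp add: s'_def algebra_simps)
  qed
  have cs: "c m + s' m = rel_step N \<tau> (i + int m) + c (Suc m)" for m
  proof -
    have "i + int (Suc m) = i + int m + 1" by simp
    then show ?thesis unfolding c_def line' rel_line_Suc
      using rel_line_Suc[of N \<tau> "i + int m"]
      by (simp only: minus_add add.assoc add_minus_cancel)
  qed
  have s'X: "s' m \<in> X (odd (i + int m)) - H" if "m < 80" for m
  proof -
    have "s' m = - c m + rel_step N \<tau> (i + int m) + c (Suc m)"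
      using cs[of m] by (metis add.assoc minus_add_cancel)
    moreover have "- c m \<in> H" "c (Suc m) \<in> H" using cH[of m] cH[of "Suc m"] that add_subgroupD(3)[OF H_sub] by auto
    ultimately show ?thesis using X_absorb rel_step_X[OF \<tau>(1), of "i + int m"] by (simp only:)
  qed
  \<comment> \<open>Skips at most one step, so that the comparison begins with a letter
    \<open>y\<close>.\<close>
  define m0 :: nat where "m0 = (if even i then 0 else 1)"
  define I where "I = (i + int m0) div 2"
  have I: "i + int m0 = 2 * I" by (simp add: I_def m0_def)
  have m0: "m0 \<le> 1" by (simp add: m0_def)
  \<comment> \<open>Step \<open>m\<close> along a reversed line is the inverse of the letter with
    index \<open>j - m - 1\<close>; hence the extra 1.\<close>
  define J where "J = (if \<sigma> = 1 then (j + int m0) div 2 else (j - int m0 - 1) div 2)"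
  have J: "if \<sigma> = 1 then j + int m0 = 2 * J else j - int m0 - 1 = 2 * J"
  proof -
    have sX: "s' m0 \<in> X False" "s' m0 \<notin> H" using s'X[of m0] I m0 by auto
    have "even (if \<sigma> = 1 then j + int m0 else j - int m0 - 1)"
    proof (rule ccontr)
      assume o: "\<not> ?thesis"
      have "s' m0 \<in> X True"
      proof (cases "\<sigma> = 1")
        case True
        then have "odd (j + int m0)" using o by simp
        then show ?thesis using rel_step_X[OF \<tau>(2), of "j + int m0"] True by (simp add: s'_def)
      next
        case False
        then have "odd (j - int m0 - 1)" using o by simp
        then have "rel_step N \<tau>' (j - int m0 - 1) \<in> X True" using rel_step_X[OF \<tau>(2), of "j - int m0 - 1"] by simp
        then show ?thesis using False add_subgroupD(3)[OF X_sub] by (simp add: s'_def)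
      qed
      then show False using X_other[of "s' m0" True] sX by simp
    qed
    then show ?thesis by (auto simp: J_def)
  qed
  define y' where "y' = (if \<sigma> = 1 then rel_y \<tau>' else - rel_y \<tau>')"
  define z where "z k = (if \<sigma> = 1 then J + int k else J - 1 - int k)" for k
  have sy: "s' (m0 + 2 * k) = y'" "rel_step N \<tau> (i + int (m0 + 2 * k)) = rel_y \<tau>" for k
  proof -
    have e: "i + int (m0 + 2 * k) = 2 * (I + int k)" using I by simp
    show "rel_step N \<tau> (i + int (m0 + 2 * k)) = rel_y \<tau>" unfolding e rel_step_def by simp
    have e1: "j + int (m0 + 2 * k) = 2 * (J + int k)" if "\<sigma> = 1" using J that by simp
    have e2: "j - int (m0 + 2 * k) - 1 = 2 * (J - int k)" if "\<sigma> \<noteq> 1" using J that by simp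
    show "s' (m0 + 2 * k) = y'"
    proof (cases "\<sigma> = 1")
      case True
      show ?thesis unfolding s'_def y'_def rel_step_def e1[OF True] using True by simp
    next
      case False
      show ?thesis unfolding s'_def y'_def rel_step_def e2[OF False] using False by simp
    qed
  qed
  have su: "s' (m0 + 2 * k + 1) = (if \<sigma> = 1 then rel_uz N \<tau>' (z k) else - rel_uz N \<tau>' (z k))"
    "rel_step N \<tau> (i + int (m0 + 2 * k + 1)) = rel_uz N \<tau> (I + int k)" for k
  proof -
    have d: "rel_step N \<tau>' (2 * w + 1) = rel_uz N \<tau>' w" for w by (simp add: rel_step_def)
    have e: "i + int (m0 + 2 * k + 1) = 2 * (I + int k) + 1" using I by simp
    show "rel_step N \<tau> (i + int (m0 + 2 * k + 1)) = rel_uz N \<tau> (I + int k)" unfolding e rel_step_def by simp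
    have e1: "j + int (m0 + 2 * k + 1) = 2 * (J + int k) + 1" if "\<sigma> = 1" using J that by simp
    have e2: "j - int (m0 + 2 * k + 1) - 1 = 2 * (J - 1 - int k) + 1" if "\<sigma> \<noteq> 1" using J that by simp
    show "s' (m0 + 2 * k + 1) = (if \<sigma> = 1 then rel_uz N \<tau>' (z k) else - rel_uz N \<tau>' (z k))"
    proof (cases "\<sigma> = 1")
      case True
      show ?thesis unfolding s'_def e1[OF True] d using True by (simp add: z_def)
    next
      case False
      show ?thesis unfolding s'_def e2[OF False] d using False by (simp add: z_def)
    qed
  qed
  define c0 c1 where "c0 = c m0" and "c1 = c (m0 + 1)"
  have c01: "c0 \<in> H" "c1 \<in> H" using cH m0 by (auto simp: c0_def c1_def)
  have ceq: "c (m0 + 2 * k) = c0 \<and> c (m0 + 2 * k + 1) = c1" if "k \<le> 38" for k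
    using that
  proof (induction k)
    case (Suc k)
    then have IH: "c (m0 + 2 * k) = c0" "c (m0 + 2 * k + 1) = c1" by auto
    define d0 d1 where "d0 = c (m0 + 2 * Suc k)" and "d1 = c (m0 + 2 * Suc k + 1)"
    have dH: "d0 \<in> H" "d1 \<in> H" using cH Suc.prems m0 by (auto simp: d0_def d1_def)
    have "c0 + y' = rel_y \<tau> + c1" using cs[of "m0 + 2 * k"] sy[of k] IH by simp
    moreover have "d0 + y' = rel_y \<tau> + d1" using cs[of "m0 + 2 * Suc k"] sy[of "Suc k"] by (simp add: d0_def d1_def)
    ultimately have e: "- d0 + (rel_y \<tau> + d1) = - c0 + (rel_y \<tau> + c1)" by (metis minus_add_cancel)
    then have "c0 + (- d0 + (rel_y \<tau> + d1)) = rel_y \<tau> + c1" by (simp only: add_minus_cancel)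
    then have "- rel_y \<tau> + (c0 + (- d0 + (rel_y \<tau> + d1))) + - d1 = - rel_y \<tau> + (rel_y \<tau> + c1) + - d1"
      by (simp only:)
    then have "- rel_y \<tau> + (c0 + - d0) + rel_y \<tau> = c1 + - d1"
      by (simp only: add.assoc minus_add_cancel right_minus add_0_right)
    moreover have "c1 + - d1 \<in> H" "c0 + - d0 \<in> H" using c01 dH add_subgroupD(2,3)[OF H_sub] by blast+
    moreover have "rel_y \<tau> \<in> X False - H" using rel_y_X[OF \<tau>(1)] by (simp add: X_def)
    ultimately have "c0 + - d0 = 0" using malnormal[of "rel_y \<tau>" False "c0 + - d0"] by (simp only:)
    then have "d0 = c0" by simp
    then have "d1 = c1" using e by simp
    then show ?case using \<open>d0 = c0\<close> by (simp add: d0_def d1_def)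
  qed (simp add: c0_def c1_def)
  have y: "c0 + y' = rel_y \<tau> + c1" using cs[of m0] sy[of 0] by (simp add: c0_def c1_def)
  have u: "c1 + (if \<sigma> = 1 then rel_uz N \<tau>' (z k) else - rel_uz N \<tau>' (z k)) = rel_uz N \<tau> (I + int k) + c0"
    if "k \<le> 36" for k
    using cs[of "m0 + 2 * k + 1"] su[of k] ceq[of k] ceq[of "Suc k"] that by (simp del: of_nat_add of_nat_Suc)
  have inj: "k = l" if "x mod ?n = w mod ?n" "\<bar>x - w\<bar> = \<bar>int k - int l\<bar>" "k < 36" "l < 36" for x w k l
  proof -
    have "?n dvd \<bar>int k - int l\<bar>" using that(1,2) by (metis mod_eq_dvd_iff dvd_abs_iff)
    then have "\<bar>int k - int l\<bar> \<ge> ?n \<or> int k = int l" using zdvd_imp_le[of ?n "\<bar>int k - int l\<bar>"] by auto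
    then show ?thesis using that(3,4) N by auto
  qed
  \<comment> \<open>The exceptional position recurs only every \<open>6 * N + 1\<close> letters
    \<open>u\<close>, so each of the two lines meets it at most once among 36.\<close>
  have "\<exists>k0\<le>24. \<forall>k\<le>11. \<not> (I + int (k0 + k)) mod ?n = int (6 * N) \<and> \<not> z (k0 + k) mod ?n = int (6 * N)"
  proof (rule good_run)
    show "k = l" if "(I + int k) mod ?n = int (6 * N)" "(I + int l) mod ?n = int (6 * N)" "k < 36" "l < 36" for k l
    proof (rule inj[OF _ _ that(3,4)])
      show "(I + int k) mod ?n = (I + int l) mod ?n" using that(1,2) by (simp only:)
      show "\<bar>(I + int k) - (I + int l)\<bar> = \<bar>int k - int l\<bar>" by simp
    qed
    show "k = l" if "z k mod ?n = int (6 * N)" "z l mod ?n = int (6 * N)" "k < 36" "l < 36" for k l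
    proof (rule inj[OF _ _ that(3,4)])
      show "z k mod ?n = z l mod ?n" using that(1,2) by (simp only:)
      show "\<bar>z k - z l\<bar> = \<bar>int k - int l\<bar>" by (simp add: z_def abs_minus_commute)
    qed
  qed
  then obtain k0 where k0: "k0 \<le> 24" "\<And>k. k \<le> 11 \<Longrightarrow> (I + int (k0 + k)) mod ?n \<noteq> int (6 * N)"
    "\<And>k. k \<le> 11 \<Longrightarrow> z (k0 + k) mod ?n \<noteq> int (6 * N)" by blast
  define t t' where "t = nat ((I + int k0) mod ?n)" and "t' = nat (z k0 mod ?n)"
  have t_run: "(I + int (k0 + k)) mod ?n = int t + int k" if "k \<le> 11" for k
    using mod_run_up[of "I + int k0" k] k0(2) that by (simp add: t_def add.assoc)
  have t11: "t + 11 < 6 * N"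
    using t_run[of 11] k0(2)[of 11] pos_mod_bound[of ?n "I + int (k0 + 11)"] by simp
  have ut: "rel_uz N \<tau> (I + int (k0 + k)) = rel_u N \<tau> (t + k)" if "k \<le> 11" for k
    unfolding rel_uz_def t_run[OF that] by (simp add: nat_add_distrib)
  show ?thesis
  proof (cases "\<sigma> = 1")
    case True
    have t'_run: "z (k0 + k) mod ?n = int t' + int k" if "k \<le> 11" for k
      using mod_run_up[of "z k0" k] k0(3) that True by (simp add: t'_def z_def add.assoc)
    have t'11: "t' + 11 < 6 * N"
      using t'_run[of 11] k0(3)[of 11] pos_mod_bound[of ?n "z (k0 + 11)"] by simp
    have ut': "rel_uz N \<tau>' (z (k0 + k)) = rel_u N \<tau>' (t' + k)" if "k \<le> 11" for k
      unfolding rel_uz_def t'_run[OF that] by (simp add: nat_add_distrib)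
    have "t' = t \<and> \<tau>' = conj_relator c0 \<tau>"
    proof (rule window_forward[OF \<tau> c01 t11 t'11])
      show "c1 + rel_u N \<tau>' (t' + k) = rel_u N \<tau> (t + k) + c0" if "k \<le> 11" for k
        using u[of "k0 + k"] ut[OF that] ut'[OF that] True k0(1) that by simp
      show "c0 + rel_y \<tau>' = rel_y \<tau> + c1" using y True by (simp add: y'_def)
    qed
    then have t: "t' = t" and conj: "\<tau>' = conj_relator c0 \<tau>" by auto
    have "z k0 mod ?n = (I + int k0) mod ?n" using t t_run[of 0] t'_run[of 0] by simp
    then have "?n dvd (J + int k0) - (I + int k0)" using True by (simp add: z_def mod_eq_dvd_iff del: of_nat_add of_nat_Suc of_nat_mult)
    then obtain q where q: "J - I = ?n * q" by (auto simp: dvd_def)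
    have jq: "j = i + q * int (rel_len N)" using q I J True by (simp add: algebra_simps)
    have "g + rel_line N \<tau> (i + int m0) + c0 = g' + rel_line N \<tau>' (j + int m0)"
      using True by (simp add: c0_def c_def add.assoc)
    also have "j + int m0 = (i + int m0) + q * int (rel_len N)" using jq by simp
    also have "rel_line N \<tau>' \<dots> = zmult q (rel_word N \<tau>') + (- c0 + rel_line N \<tau> (i + int m0) + c0)"
      unfolding rel_line_period by (simp only: conj conj_rel_line)
    \<comment> \<open>The translating elements agree up to a multiple of the relator and the element
      \<open>c0\<close>. The multiple commutes with the relator and \<open>c0\<close> turns one
      relator into the other, so both drop out of the rotation.\<close>
    finally have "g = g' + zmult q (rel_word N \<tau>') + - c0"
      by (simp only: add.assoc[symmetric] add_right_cancel)
    then have "g + rel_word N \<tau> - g = g' + zmult q (rel_word N \<tau>') + (- c0 + rel_word N \<tau> + c0) + - zmult q (rel_word N \<tau>') - g'"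
      by (simp only: grp_norm minus_minus)
    also have "- c0 + rel_word N \<tau> + c0 = rel_word N \<tau>'" by (simp only: conj conj_rel_word)
    also have "g' + zmult q (rel_word N \<tau>') + rel_word N \<tau>' + - zmult q (rel_word N \<tau>') - g'
        = g' + (zmult q (rel_word N \<tau>') + rel_word N \<tau>') + - zmult q (rel_word N \<tau>') - g'"
      by (simp only: add.assoc)
    also have "zmult q (rel_word N \<tau>') + rel_word N \<tau>' = rel_word N \<tau>' + zmult q (rel_word N \<tau>')"
      using zmult_commute[of q "rel_word N \<tau>'" 1] by (simp only: zmult_1)
    also have "g' + (rel_word N \<tau>' + zmult q (rel_word N \<tau>')) + - zmult q (rel_word N \<tau>') - g' = g' + rel_word N \<tau>' - g'"
      by (simp only: grp_norm minus_minus add_minus_cancel)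
    finally have "g + rel_word N \<tau> - g = g' + rel_word N \<tau>' - g'" .
    moreover have "i - j = int (rel_len N) * (- q)" using jq by (simp add: algebra_simps)
    ultimately show ?thesis using True dvd_triv_left[of "int (rel_len N)" "- q"] by metis
  next
    case False
    have t'_run: "z (k0 + k) mod ?n = int t' - int k" if "k \<le> 11" for k
    proof -
      have "z (k0 + l) = z k0 - int l" for l using False by (simp add: z_def)
      then show ?thesis using mod_run_down[of "z k0" k] k0(3) that by (simp add: t'_def)
    qed
    have t'11: "11 \<le> t'" using t'_run[of 11] pos_mod_sign[of ?n "z (k0 + 11)"] by simp
    have t'N: "t' < 6 * N" using t'_run[of 0] k0(3)[of 0] pos_mod_bound[of ?n "z k0"] by simp
    have ut': "rel_uz N \<tau>' (z (k0 + k)) = rel_u N \<tau>' (t' - k)" if "k \<le> 11" for k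
      unfolding rel_uz_def t'_run[OF that] using t'11 that by (simp add: nat_diff_distrib)
    have "c1 + - rel_u N \<tau>' (t' - k) = rel_u N \<tau> (t + k) + c0" if "k \<le> 11" for k
      using u[of "k0 + k"] ut[OF that] ut'[OF that] False k0(1) that by simp
    then show ?thesis using window_backward[OF \<tau> t11 t'11 t'N] by blast
  qed
qed

end

section \<open>Quotients of amalgamated products\<close>

context relators begin

abbreviation "period \<equiv> int (rel_len N)"

definition translates :: "('a \<times> 'a relator) set" where "translates = P \<times> R"

definition tline :: "'a \<times> 'a relator \<Rightarrow> int \<Rightarrow> 'a" where
  "tline q i = fst q + rel_line N (snd q) i"

definition trot :: "'a \<times> 'a relator \<Rightarrow> 'a" where
  "trot q = fst q + rel_word N (snd q) - fst q"

text \<open>The translates supply all conjugates, so this span is the normal closure of the relators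
  in \<open>P\<close>.\<close>

definition NN :: "'a set" where "NN = add_span (trot ` translates)"

lemma tline: "q \<in> translates \<Longrightarrow> line (tline q)"
  using line_shift[OF rel_line] by (auto simp: translates_def tline_def[abs_def])

lemma trot_P: "q \<in> translates \<Longrightarrow> trot q \<in> P"
  using rel_word_P add_subgroupD(2,4)[OF P_sub] by (auto simp: translates_def trot_def)

lemma trot_tline: "zmult k (trot q) + tline q i = tline q (i + k * period)"
  unfolding tline_def trot_def rel_line_period zmult_conj
  by (simp only: grp_norm minus_add_cancel)

lemma few_shared:
  assumes q: "q1 \<in> translates" "q2 \<in> translates" and ne: "trot q1 \<noteq> trot q2"
    and e: "tline q1 i \<sim> tline q2 j" "tline q1 i' \<sim> tline q2 j'"
  shows "\<bar>i - i'\<bar> \<le> 80 \<and> \<bar>j - j'\<bar> \<le> 80"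
proof -
  have *: "i' - i \<le> 80" if q: "q1 \<in> translates" "q2 \<in> translates" and ne: "trot q1 \<noteq> trot q2"
    and e: "tline q1 i \<sim> tline q2 j" "tline q1 i' \<sim> tline q2 j'" for q1 q2 i i' j j'
  proof (rule ccontr)
    assume far: "\<not> i' - i \<le> 80"
    define n where "n = nat (i' - i)"
    have n: "n > 0" "i' = i + int n" "80 \<le> n" using far by (auto simp: n_def)
    have "\<exists>\<sigma>\<in>{1, - 1}. \<forall>m\<le>n. tline q1 (i + int m) \<sim> tline q2 (j + \<sigma> * int m)"
      using shared_segment[OF tline[OF q(1)] tline[OF q(2)] e(1) _ n(1)] e(2) n(2) by auto
    then obtain \<sigma> where "\<sigma> \<in> {1, - 1}" "\<And>m. m \<le> 80 \<Longrightarrow> tline q1 (i + int m) \<sim> tline q2 (j + \<sigma> * int m)"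
      using n(3) by (meson le_trans)
    then have "trot q1 = trot q2"
      using overlap[of "snd q1" "snd q2" \<sigma> "fst q1" i "fst q2" j] q
      by (auto simp: tline_def trot_def translates_def)
    then show False using ne by simp
  qed
  show ?thesis
    using *[OF q ne e] *[OF q ne e(2,1)] *[OF q(2,1) ne[symmetric] same_edge_sym[OF e(1)] same_edge_sym[OF e(2)]]
      *[OF q(2,1) ne[symmetric] same_edge_sym[OF e(2)] same_edge_sym[OF e(1)]] by linarith
qed

lemma trot_shift: "trot (g + fst q, snd q) = g + trot q - g"
  by (simp only: trot_def fst_conv snd_conv grp_norm)

text \<open>The constant 81 is the bound 80 of \<open>few_shared\<close> increased by the 1 of
  \<open>behrstock_lines\<close>. Indices are translates rather than rotations, since a projection
  needs a parametrised line; translates with equal rotations are exempt from the Behrstock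
  condition.\<close>

interpretation windmill P "K \<union> L" translates "\<lambda>g q. (g + fst q, snd q)" "\<lambda>q. proj (tline q)" trot period 81
proof
  show "add_subgroup P" by (fact P_sub)
  show "K \<union> L \<subseteq> P" using X_P[of _ True] X_P[of _ False] by (auto simp: X_def)
  show "A = P" if "A \<subseteq> P" "A \<noteq> {}" "\<And>x s. x \<in> A \<Longrightarrow> s \<in> K \<union> L \<Longrightarrow> x + s \<in> A" for A
    using P_right_induct that by blast
  show "(g + fst q, snd q) \<in> translates" if "g \<in> P" "q \<in> translates" for g q
    using that add_subgroupD(2)[OF P_sub] by (auto simp: translates_def)
  show "proj (tline (g + fst q, snd q)) (g + x) = proj (tline q) x" if "g \<in> P" "q \<in> translates" "x \<in> P" for g q x
  proof -
    have "tline (g + fst q, snd q) = (\<lambda>i. g + tline q i)" by (auto simp: tline_def add.assoc)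
    then show ?thesis using proj_shift[OF tline[OF that(2)] that(1,3)] by simp
  qed
  show "trot q \<in> P" if "q \<in> translates" for q using trot_P that .
  show "trot (g + fst q, snd q) = g + trot q - g" for g q by (rule trot_shift)
  \<comment> \<open>A rotation shifts its own line by one period. The period is even, so reindexing
    the line computes the effect on the projection.\<close>
  show "proj (tline q) (trot q + x) = proj (tline q) x + period" if q: "q \<in> translates" and x: "x \<in> P" for q x
  proof -
    have e: "i + - period + 1 * period = i" for i by simp
    have "trot q + tline q (i + - period) = tline q i" for i
      using trot_tline[of 1 q "i + - period"] unfolding e by (simp only: zmult_1)
    then have "tline q = (\<lambda>i. trot q + tline q (i + - period))" by auto
    moreover have l: "line (\<lambda>i. tline q (i + - period))"
      using lineD[OF tline[OF q], of "_ - period"] unfolding line_def by (simp add: algebra_simps)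
    ultimately have "proj (tline q) (trot q + x) = proj (\<lambda>i. tline q (i + - period)) x"
      using proj_shift[OF l trot_P[OF q] x] by metis
    then show ?thesis using proj_reindex[OF tline[OF q] _ x, of "- period"] by simp
  qed
  show "\<bar>proj (tline q) (x + s) - proj (tline q) x\<bar> \<le> 1" if "q \<in> translates" "x \<in> P" "s \<in> K \<union> L" for q x s
    using proj_step[OF tline] that by blast
  show "\<exists>a b. \<forall>x\<in>P. \<bar>proj (tline q) x - a\<bar> \<le> 81 \<or> \<bar>proj (tline q') x - b\<bar> \<le> 81"
    if "q \<in> translates" "q' \<in> translates" "trot q \<noteq> trot q'" for q q'
    using behrstock_lines[OF tline[OF that(1)] tline[OF that(2)] few_shared[OF that]] by simp
  show "period > 12 * 81" using N by simp
qed simp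

text \<open>The counterpart of Greendlinger's lemma: a nontrivial consequence of the relators
  follows some axis for all but 486 = 6 * 81 edges of a period.\<close>

lemma greendlinger:
  assumes "\<nu> \<in> NN" "\<nu> \<noteq> 0"
  shows "\<exists>q\<in>translates. \<bar>proj (tline q) \<nu> - proj (tline q) 0\<bar> \<ge> period - 486"
proof (rule ccontr)
  assume "\<not> ?thesis"
  then have "\<bar>proj (tline q) (\<nu> + 0) - proj (tline q) 0\<bar> \<le> period - 6 * 81 - 1" if "q \<in> translates" for q
    using that by force
  then have "\<nu> = 0"
    using rot_span_trivial[OF _ add_subgroupD(1)[OF P_sub], of \<nu>] assms(1) unfolding NN_def by blast
  then show False using assms(2) by simp
qed

lemma NN_sub: "add_subgroup NN" by (simp add: NN_def add_subgroup_span)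

lemma NN_P: "NN \<subseteq> P"
  unfolding NN_def by (rule add_span_least[OF _ P_sub]) (auto intro: trot_P)

lemma trot_NN: "q \<in> translates \<Longrightarrow> trot q \<in> NN"
  unfolding NN_def by (auto intro: add_span_base)

lemma rel_word_NN: "\<tau> \<in> R \<Longrightarrow> rel_word N \<tau> \<in> NN"
  using trot_NN[of "(0, \<tau>)"] add_subgroupD(1)[OF P_sub] by (auto simp: translates_def trot_def)

lemma NN_conj: assumes g: "g \<in> P" and "\<nu> \<in> NN" shows "g + \<nu> - g \<in> NN"
proof -
  have c: "g + (a + x) - g = (g + a - g) + (g + x - g)" for a x
    by (simp only: grp_norm minus_add_cancel)
  have m: "g + (- a) - g = - (g + a - g)" for a
    by (simp only: grp_norm minus_minus)
  have t: "g + trot q - g \<in> NN" if "q \<in> translates" for q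
    using trot_NN[of "(g + fst q, snd q)"] that g add_subgroupD(2)[OF P_sub]
    unfolding trot_shift by (auto simp: translates_def)
  show ?thesis using assms(2) unfolding NN_def
  proof induction
    case zero
    then show ?case by (simp add: add_span.zero)
  next
    case (plus a x)
    then have "g + a - g \<in> NN" using t by blast
    then show ?case using plus unfolding c NN_def by (intro add_span_add)
  next
    case (minus a x)
    then have "- (g + a - g) \<in> NN" using t add_subgroupD(3)[OF NN_sub] by blast
    then show ?case using minus unfolding c[of "- a"] m NN_def by (intro add_span_add)
  qed
qed

lemma NN_conj': "g \<in> P \<Longrightarrow> \<nu> \<in> NN \<Longrightarrow> - g + \<nu> + g \<in> NN"
  using NN_conj[of "- g" \<nu>] add_subgroupD(3)[OF P_sub] by simp

text \<open>Two letters move a projection by at most 2. Hence distinct elements of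
  \<open>K \<union> L\<close> stay distinct in the quotient.\<close>

lemma NN_short:
  assumes "\<nu> \<in> NN" "\<nu> = x + y" "x \<in> K \<union> L" "y \<in> K \<union> L" shows "\<nu> = 0"
proof (rule ccontr)
  assume "\<nu> \<noteq> 0"
  then obtain q where q: "q \<in> translates" "\<bar>proj (tline q) \<nu> - proj (tline q) 0\<bar> \<ge> period - 486"
    using greendlinger assms(1) by blast
  have "x \<in> P" using assms(3) X_P[of x True] X_P[of x False] by (auto simp: X_def)
  then have "\<bar>proj (tline q) (x + y) - proj (tline q) x\<bar> \<le> 1" "\<bar>proj (tline q) (0 + x) - proj (tline q) 0\<bar> \<le> 1"
    using proj_step[OF tline[OF q(1)]] assms add_subgroupD(1)[OF P_sub] by blast+
  then show False using q(2) N assms(2) by simp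
qed

section \<open>Syllable length and Dehn's algorithm\<close>

definition spells :: "'a list \<Rightarrow> 'a \<Rightarrow> bool" where
  "spells ws g \<longleftrightarrow> set ws \<subseteq> K \<union> L \<and> sum_list ws \<sim> g"

text \<open>Spelling only modulo \<open>H\<close> on the right makes the length of
  \<open>- x + y\<close> depend on nothing but the edges of \<open>x\<close> and \<open>y\<close>,
  and gives length 0 to \<open>H\<close>.\<close>

definition glen :: "'a \<Rightarrow> nat" where
  "glen g = (LEAST n. \<exists>ws. spells ws g \<and> length ws = n)"

lemma glen_le: "spells ws g \<Longrightarrow> glen g \<le> length ws"
  unfolding glen_def by (rule Least_le) blast

lemma spells_ex: assumes "g \<in> P" shows "\<exists>ws. spells ws g"
proof -
  have "g \<in> H \<or> (\<exists>b. starts b g)" using starts_cases[OF assms] by blast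
  then show ?thesis
  proof
    assume "g \<in> H"
    then show ?thesis by (intro exI[of _ "[]"]) (simp add: spells_def same_edge_def)
  next
    assume "\<exists>b. starts b g"
    then obtain b ws where "alt b ws" "g = sum_list ws" by (auto simp: starts_def)
    moreover have "alt b ws \<Longrightarrow> set ws \<subseteq> K \<union> L" for b ws
      by (induction ws arbitrary: b) (auto simp: X_def split: if_splits)
    ultimately show ?thesis unfolding spells_def by (intro exI[of _ ws]) auto
  qed
qed

lemma glen_ex: "g \<in> P \<Longrightarrow> \<exists>ws. spells ws g \<and> length ws = glen g"
  unfolding glen_def by (rule LeastI_ex) (use spells_ex in blast)

lemma KL_P: "x \<in> K \<union> L \<Longrightarrow> x \<in> P"
  using X_P[of x True] X_P[of x False] by (auto simp: X_def)

lemma KL_absorb: "h \<in> H \<Longrightarrow> x \<in> K \<union> L \<Longrightarrow> h + x \<in> K \<union> L \<and> x + h \<in> K \<union> L"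
  using add_subgroupD(2)[OF K] add_subgroupD(2)[OF L] unfolding H_def by blast

lemma spells_append:
  assumes "spells us x" "spells vs y" shows "\<exists>ws. spells ws (x + y) \<and> length ws = length us + length vs"
proof -
  define h where "h = - sum_list us + x"
  have h: "h \<in> H" using assms(1) by (simp add: h_def spells_def same_edge_def)
  have x: "x = sum_list us + h" by (simp add: h_def)
  show ?thesis
  proof (cases vs)
    case Nil
    then have "y \<in> H" using assms(2) by (simp add: spells_def same_edge_def)
    then have "h + y \<in> H" using h add_subgroupD(2)[OF H_sub] by blast
    then have "spells us (x + y)" using assms(1) unfolding spells_def x same_edge_def
      by (simp only: add.assoc minus_add_cancel)
    then show ?thesis using Nil by auto
  next
    case (Cons v ws)
    have "- sum_list (us @ (h + v) # ws) + (x + y) = - sum_list vs + y"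
      unfolding Cons x by (simp only: sum_list.Cons sum_list_append minus_add add.assoc minus_add_cancel)
    then have "spells (us @ (h + v) # ws) (x + y)"
      using assms KL_absorb[OF h, of v] Cons unfolding spells_def same_edge_def by auto
    then show ?thesis using Cons by (intro exI[of _ "us @ (h + v) # ws"]) simp
  qed
qed

lemma glen_add: assumes "x \<in> P" "y \<in> P" shows "glen (x + y) \<le> glen x + glen y"
proof -
  obtain us vs where uv: "spells us x" "length us = glen x" "spells vs y" "length vs = glen y"
    using glen_ex assms by metis
  then show ?thesis using spells_append[OF uv(1,3)] glen_le by metis
qed

lemma glen_sum_list: "set ws \<subseteq> K \<union> L \<Longrightarrow> glen (sum_list ws) \<le> length ws"
  by (rule glen_le) (simp add: spells_def)

lemma glen_H: "h \<in> H \<Longrightarrow> glen h = 0"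
  using glen_le[of "[]" h] by (simp add: spells_def same_edge_def)

lemma H_P: "h \<in> H \<Longrightarrow> h \<in> P" using X_P[of h True] H_X by blast

lemma glen_same_edge:
  assumes "x \<in> P" "y \<in> P" "x' \<sim> x" "y' \<sim> y" shows "glen (- x' + y') \<le> glen (- x + y)"
proof -
  have h: "- x' + x \<in> H" "- y + y' \<in> H" using assms(3) same_edge_sym[OF assms(4)] by (auto simp: same_edge_def)
  have "- x + y \<in> P" using assms(1,2) add_subgroupD(2,3)[OF P_sub] by blast
  then have "glen ((- x' + x) + ((- x + y) + (- y + y'))) \<le> glen (- x' + x) + glen ((- x + y) + (- y + y'))"
    using glen_add H_P[OF h(1)] H_P[OF h(2)] add_subgroupD(2)[OF P_sub] by blast
  also have "\<dots> \<le> glen (- x' + x) + (glen (- x + y) + glen (- y + y'))"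
    using glen_add[OF \<open>- x + y \<in> P\<close> H_P[OF h(2)]] by simp
  also have "\<dots> = glen (- x + y)" using glen_H[OF h(1)] glen_H[OF h(2)] by simp
  finally have "glen ((- x' + x) + ((- x + y) + (- y + y'))) \<le> glen (- x + y)" .
  then show ?thesis by (simp only: add.assoc minus_add_cancel add_minus_cancel)
qed

lemma alt_set: "alt b ws \<Longrightarrow> set ws \<subseteq> K \<union> L"
  by (induction ws arbitrary: b) (auto simp: X_def split: if_splits)

lemma glen_line: assumes "line p" shows "glen (- p i + p j) \<le> nat \<bar>i - j\<bar>"
proof -
  have *: "glen (- p i + p j) \<le> nat (j - i)" if line: "line p" and le: "i \<le> j" for p i j
  proof -
    obtain ws where ws: "alt (odd i) ws" "length ws = nat (j - i)"
      "\<forall>m\<le>nat (j - i). sum_list (take m ws) = - p i + p (i + int m)"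
      using line_diff[OF line, of i "nat (j - i)"] by blast
    then have "sum_list (take (length ws) ws) = - p i + p (i + int (nat (j - i)))" by auto
    then have "sum_list ws = - p i + p j" using le by simp
    then show ?thesis using glen_sum_list[OF alt_set[OF ws(1)]] ws(2) by simp
  qed
  show ?thesis
  proof (cases "i \<le> j")
    case True
    then show ?thesis using *[OF assms] by simp
  next
    case False
    then show ?thesis using *[OF line_reverse[OF assms], of "1 - i" "1 - j"] by simp
  qed
qed

text \<open>A shortest spelling is reduced, because two neighbours from one factor, or a letter from
  \<open>H\<close> and its neighbour, could be merged.\<close>

lemma glen_minimal_alt:
  assumes "g \<in> P" shows "glen g = 0 \<and> g \<in> H \<or> (\<exists>b ws. alt b ws \<and> ws \<noteq> [] \<and> length ws = glen g \<and> g = sum_list ws)"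
proof -
  obtain ws where ws: "spells ws g" "length ws = glen g" using glen_ex[OF assms] by blast
  show ?thesis
  proof (cases "ws = []")
    case True
    then show ?thesis using ws by (simp add: spells_def same_edge_def)
  next
    case False
    define h where "h = - sum_list ws + g"
    have h: "h \<in> H" using ws(1) by (simp add: h_def spells_def same_edge_def)
    have *: "\<exists>b. alt b us" if "set us \<subseteq> K \<union> L" "us \<noteq> []"
      "\<And>vs. set vs \<subseteq> K \<union> L \<Longrightarrow> sum_list vs = sum_list us \<Longrightarrow> length us \<le> length vs"
      "length us = 1 \<longrightarrow> us ! 0 \<notin> H" for us
      using that
    proof (induction us)
      case (Cons u us)
      define b where "b \<longleftrightarrow> u \<in> K"
      have b: "u \<in> X b" using Cons.prems(1) by (auto simp: X_def b_def)
      show ?case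
      proof (cases us)
        case Nil
        then show ?thesis using b Cons.prems(4) by (intro exI[of _ b]) simp
      next
        case (Cons v vs)
        have merge: "\<not> (u + v \<in> K \<union> L)"
          using Cons.prems(3)[of "(u + v) # vs"] Cons.prems(1) Cons by (auto simp: add.assoc)
        have uH: "u \<notin> H" using merge KL_absorb[of u v] Cons.prems(1) Cons by auto
        have vH: "v \<notin> H" using merge KL_absorb[of v u] Cons.prems(1) Cons by auto
        have "\<exists>c. alt c us"
        proof (rule Cons.IH)
          show "length us \<le> length ws" if "set ws \<subseteq> K \<union> L" "sum_list ws = sum_list us" for ws
            using Cons.prems(3)[of "u # ws"] that Cons.prems(1) by simp
        qed (use Cons.prems(1) Cons vH in auto)
        then obtain c where c: "alt c us" by blast
        have "c = (\<not> b)"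
        proof (rule ccontr)
          assume "c \<noteq> (\<not> b)"
          then have "u + v \<in> X b" using b c Cons add_subgroupD(2)[OF X_sub] by auto
          then show False using merge by (auto simp: X_def split: if_splits)
        qed
        then show ?thesis using c b uH by (intro exI[of _ b]) simp
      qed
    qed simp
    show ?thesis
    proof (cases "g \<in> H")
      case True
      then show ?thesis using glen_H by simp
    next
      case gH: False
      obtain us t where us: "ws = us @ [t]" using False by (metis rev_exhaust)
      have "sum_list (us @ [t + h]) = sum_list ws + h" by (simp add: us add.assoc)
      then have g: "g = sum_list (us @ [t + h])" by (simp only: h_def add_minus_cancel)
      have "\<exists>b. alt b (us @ [t + h])"
      proof (rule *)
        show "set (us @ [t + h]) \<subseteq> K \<union> L" using ws(1) us KL_absorb[OF h, of t] by (auto simp: spells_def)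
        show "length (us @ [t + h]) \<le> length vs" if "set vs \<subseteq> K \<union> L" "sum_list vs = sum_list (us @ [t + h])" for vs
          using glen_sum_list[OF that(1)] that(2) g ws(2) us by simp
        show "length (us @ [t + h]) = 1 \<longrightarrow> (us @ [t + h]) ! 0 \<notin> H" using gH g by (cases us) auto
      qed simp
      then show ?thesis using g ws(2) us by (intro disjI2) (metis length_append_singleton snoc_eq_iff_butlast)
    qed
  qed
qed

text \<open>A rotation exchanges an arc of an axis for the complementary arc of one period.\<close>

lemma glen_rotate:
  assumes q: "q \<in> translates" and \<sigma>: "\<sigma> \<in> {1, - 1}" and e: "u \<sim> tline q i" "v \<sim> tline q (i + \<sigma> * int e)" "int e \<le> period"
  shows "\<exists>\<nu>\<in>NN. glen (- u + (\<nu> + v)) \<le> rel_len N - e"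
proof
  let ?\<nu> = "zmult (- \<sigma>) (trot q)"
  show "?\<nu> \<in> NN" using zmult_in[OF NN_sub trot_NN[OF q]] .
  have "?\<nu> + v \<sim> ?\<nu> + tline q (i + \<sigma> * int e)" using e(2) same_edge_left by blast
  then have 1: "?\<nu> + v \<sim> tline q (i + \<sigma> * int e - \<sigma> * period)" using trot_tline[of "- \<sigma>" q "i + \<sigma> * int e"] by simp
  have "glen (- u + (?\<nu> + v)) \<le> glen (- tline q i + tline q (i + \<sigma> * int e - \<sigma> * period))"
    using glen_same_edge[OF _ _ e(1) 1] lineD(1)[OF tline[OF q]] by blast
  also have "\<dots> \<le> nat \<bar>i - (i + \<sigma> * int e - \<sigma> * period)\<bar>" by (rule glen_line[OF tline[OF q]])
  also have "\<bar>i - (i + \<sigma> * int e - \<sigma> * period)\<bar> = period - int e" using \<sigma> e(3) by auto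
  finally show "glen (- u + (?\<nu> + v)) \<le> rel_len N - e" using e(3) by (simp add: nat_diff_distrib)
qed

text \<open>One step of Dehn's algorithm: an arc longer than half a period is replaced by its
  shorter complement.\<close>

lemma path_shorten:
  assumes q: "q \<in> translates" and \<sigma>: "\<sigma> \<in> {1, - 1}" and vs: "set vs \<subseteq> K \<union> L"
    and e: "sum_list (take j vs) \<sim> tline q i" "sum_list (take (j + e) vs) \<sim> tline q (i + \<sigma> * int e)"
    and le: "j + e \<le> length vs" "int e \<le> period" "rel_len N < 2 * e"
  shows "\<exists>\<nu>\<in>NN. glen (\<nu> + sum_list vs) < length vs"
proof -
  obtain \<nu> where \<nu>: "\<nu> \<in> NN" "glen (- sum_list (take j vs) + (\<nu> + sum_list (take (j + e) vs))) \<le> rel_len N - e"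
    using glen_rotate[OF q \<sigma> e le(2)] by blast
  let ?a = "sum_list (take j vs)" and ?b = "sum_list (take (j + e) vs)" and ?c = "sum_list (drop (j + e) vs)"
  have sub: "set (take j vs) \<subseteq> K \<union> L" "set (take (j + e) vs) \<subseteq> K \<union> L" "set (drop (j + e) vs) \<subseteq> K \<union> L"
    using vs set_take_subset set_drop_subset by (metis subset_trans)+
  have slP: "sum_list ws \<in> P" if "set ws \<subseteq> K \<union> L" for ws
    using that by (induction ws) (auto intro: KL_P add_subgroupD(1,2)[OF P_sub])
  have P: "?a \<in> P" "?b \<in> P" "?c \<in> P" using slP sub by blast+
  then have m: "- ?a + (\<nu> + ?b) \<in> P" using \<nu>(1) NN_P add_subgroupD(2,3)[OF P_sub] by (meson subsetD)
  have "sum_list vs = ?b + ?c" by (metis append_take_drop_id sum_list_append)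
  then have "\<nu> + sum_list vs = ?a + ((- ?a + (\<nu> + ?b)) + ?c)" by (simp only: add.assoc add_minus_cancel)
  then have "glen (\<nu> + sum_list vs) \<le> glen ?a + (glen (- ?a + (\<nu> + ?b)) + glen ?c)"
    using glen_add[OF P(1) add_subgroupD(2)[OF P_sub m P(3)]] glen_add[OF m P(3)] by (simp only:)
  also have "\<dots> \<le> j + ((rel_len N - e) + (length vs - (j + e)))"
    using glen_sum_list[OF sub(1)] glen_sum_list[OF sub(3)] \<nu>(2) by (intro add_mono) auto
  also have "\<dots> < length vs" using le by linarith
  finally show ?thesis using \<nu>(1) by blast
qed

end

section \<open>Malnormality of the factors in the quotient\<close>

context relators begin

text \<open>No element of \<open>P\<close> reverses a segment of 80 steps of an axis, since
  \<open>overlap\<close> never yields the direction -1.\<close>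

lemma reflected_overlap:
  assumes q: "q \<in> translates" and \<sigma>: "\<sigma> \<in> {1, - 1}" and g: "g \<in> P"
    and e: "\<And>j. j \<le> 80 \<Longrightarrow> g + tline q (a - \<sigma> * int j) \<sim> tline q (b + \<sigma> * int j)"
  shows False
proof -
  have q': "fst q \<in> P" "snd q \<in> R" using q by (auto simp: translates_def)
  have tl: "g + tline q i = (g + fst q) + rel_line N (snd q) i" for i by (simp add: tline_def add.assoc)
  show False
  proof (cases "\<sigma> = 1")
    case True
    have "(g + fst q) + rel_line N (snd q) (a - 80 + int m) \<sim> fst q + rel_line N (snd q) (b + 80 + - 1 * int m)"
      if "m \<le> 80" for m
      using e[of "80 - m"] that True unfolding tl by (simp add: tline_def of_nat_diff algebra_simps)
    then have "(- 1 :: int) = 1" using overlap[OF q'(2,2), of "- 1"] by blast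
    then show False by simp
  next
    case False
    then have s: "\<sigma> = - 1" using \<sigma> by auto
    have "(g + fst q) + rel_line N (snd q) (a + int m) \<sim> fst q + rel_line N (snd q) (b + - 1 * int m)"
      if "m \<le> 80" for m
      using e[of m] that s unfolding tl by (simp add: tline_def)
    then have "(- 1 :: int) = 1" using overlap[OF q'(2,2), of "- 1"] by blast
    then show False by simp
  qed
qed

text \<open>The path of the palindrome has two arms, and \<theta> carries one to the other. By
  minimality neither arm follows an axis for more than half a period. An axis followed for almost a
  whole period therefore passes the centre by more than 80 edges on both sides, and \<theta> would
  reverse a segment of it.\<close>

lemma palindrome_not_short:
  assumes vs: "alt c vs" and t: "t \<in> X (\<not> c) - H" and s: "s' \<in> K \<union> L"
    and min: "\<And>\<nu>. \<nu> \<in> NN \<Longrightarrow> length vs \<le> glen (\<nu> + sum_list vs)"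
    and nz: "- sum_list vs + t + sum_list vs + s' \<noteq> 0"
  shows "- sum_list vs + t + sum_list vs + s' \<notin> NN"
proof
  define V where "V = sum_list vs"
  define \<theta> where "\<theta> = - V + t + V"
  define l where "l = length vs"
  define W where "W = rev (map uminus vs) @ t # vs"
  assume "- sum_list vs + t + sum_list vs + s' \<in> NN"
  then have \<nu>: "\<theta> + s' \<in> NN" "\<theta> + s' \<noteq> 0" using nz by (simp_all only: \<theta>_def V_def not_False_eq_True)
  then obtain q where q: "q \<in> translates" "\<bar>proj (tline q) (\<theta> + s') - proj (tline q) 0\<bar> \<ge> period - 486"
    using greendlinger by blast
  have VP: "V \<in> P" unfolding V_def using alt_P[OF vs] .
  have tP: "t \<in> P" using t X_P by blast
  have \<theta>P: "\<theta> \<in> P" unfolding \<theta>_def using VP tP add_subgroupD(2,3)[OF P_sub] by blast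
  \<comment> \<open>Dropping the last letter \<open>s'\<close> costs one more edge than the 486 of
    \<open>greendlinger\<close>.\<close>
  have far: "\<bar>proj (tline q) \<theta> - proj (tline q) 0\<bar> \<ge> period - 487"
    using q(2) proj_step[OF tline[OF q(1)] \<theta>P s] by linarith
  have W: "alt (flip l (\<not> c)) W" unfolding W_def l_def
    using alt_rev[OF vs] vs t by (simp add: alt_append)
  have sW: "sum_list W = \<theta>" by (simp add: W_def \<theta>_def V_def sum_list_rev add.assoc)
  have lW: "length W = 2 * l + 1" by (simp add: W_def l_def)
  define d where "d = nat \<bar>proj (tline q) \<theta> - proj (tline q) 0\<bar>"
  have d: "int d \<ge> period - 487" using far by (simp add: d_def)
  obtain k i \<sigma> where \<sigma>: "\<sigma> \<in> {1, - 1}"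
    and seg: "\<And>m. m < d \<Longrightarrow> k + m \<le> 2 * l + 1 \<and> sum_list (take (k + m) W) \<sim> tline q (i + \<sigma> * int m)"
    using path_segment[OF tline[OF q(1)] add_subgroupD(1)[OF P_sub] W] unfolding sW lW d_def by auto
  have left: "sum_list (take (l - j) W) = - V + sum_list (take j vs)" if "j \<le> l" for j
  proof -
    have "take (l - j) W = rev (map uminus (drop j vs))"
      using that by (simp add: W_def l_def take_rev drop_map)
    then have "sum_list (take (l - j) W) = - sum_list (drop j vs)" by (simp only: sum_list_rev)
    moreover have "V = sum_list (take j vs) + sum_list (drop j vs)"
      unfolding V_def by (metis append_take_drop_id sum_list_append)
    ultimately show ?thesis by (simp only: minus_add add.assoc left_minus add_0_right)
  qed
  have right: "sum_list (take (l + 1 + j) W) = \<theta> + (- V + sum_list (take j vs))" for j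
    by (simp add: W_def l_def V_def \<theta>_def sum_list_rev add.assoc)
  have vsKL: "set vs \<subseteq> K \<union> L" using alt_set[OF vs] .
  have no_block: False if "q' \<in> translates" "\<sigma>' \<in> {1, - 1}" "sum_list (take j vs) \<sim> tline q' i'"
    "sum_list (take (j + e) vs) \<sim> tline q' (i' + \<sigma>' * int e)" "j + e \<le> l" "int e \<le> period" "rel_len N < 2 * e" for q' \<sigma>' j i' e
    using path_shorten[OF that(1,2) vsKL that(3,4)] that(5-7) min unfolding l_def by (meson not_le)
  have shift_q: "(g + fst q, snd q) \<in> translates" "tline (g + fst q, snd q) x = g + tline q x" if "g \<in> P" for g x
    using q(1) that add_subgroupD(2)[OF P_sub] by (auto simp: translates_def tline_def add.assoc)
  \<comment> \<open>Just over half a period: an arc of this length inside one arm contradicts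
    minimality.\<close>
  define h where "h = rel_len N div 2 + 1"
  have h: "rel_len N < 2 * h" "int h \<le> period" by (simp_all add: h_def)
  have N': "d \<ge> h + 200" using d N by (simp add: h_def)
  have kl: "l < k + h"
  proof (rule ccontr)
    assume a: "\<not> l < k + h"
    define j where "j = l - (k + h)"
    have j: "l - j = k + h" "l - (j + h) = k" "j + h \<le> l" using a by (auto simp: j_def)
    have "- V + sum_list (take j vs) \<sim> tline q (i + \<sigma> * int h)"
      using seg[of h] N' left[of j] j by simp
    then have "V + (- V + sum_list (take j vs)) \<sim> V + tline q (i + \<sigma> * int h)" by (simp only: same_edge_left)
    moreover have "- V + sum_list (take (j + h) vs) \<sim> tline q i"
      using seg[of 0] N' left[of "j + h"] j by simp
    then have "V + (- V + sum_list (take (j + h) vs)) \<sim> V + tline q i" by (simp only: same_edge_left)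
    ultimately show False
      using no_block[OF shift_q(1)[OF VP], of "- \<sigma>" j "i + \<sigma> * int h" h] \<sigma> h j(3)
      unfolding shift_q(2)[OF VP] add_minus_cancel by auto
  qed
  have kr: "k + d < l + h + 2"
  proof (rule ccontr)
    assume a: "\<not> k + d < l + h + 2"
    define m where "m = d - 1 - h"
    define j where "j = k + m - (l + 1)"
    have m: "k + m = l + 1 + j" "m < d" "m + h < d" "k + (m + h) = l + 1 + (j + h)"
      using a N' by (auto simp: m_def j_def)
    have jh: "j + h \<le> l" using seg[of "m + h"] m by simp
    define g where "g = - (\<theta> + - V)"
    have gP: "g \<in> P" unfolding g_def using VP \<theta>P add_subgroupD(2,3)[OF P_sub] by blast
    have c: "g + (\<theta> + (- V + x)) = x" for x by (simp only: g_def minus_add minus_minus add.assoc minus_add_cancel add_minus_cancel)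
    have "\<theta> + (- V + sum_list (take j vs)) \<sim> tline q (i + \<sigma> * int m)"
      using seg[OF m(2)] unfolding m(1) right by blast
    then have "g + (\<theta> + (- V + sum_list (take j vs))) \<sim> g + tline q (i + \<sigma> * int m)" by (simp only: same_edge_left)
    moreover have "\<theta> + (- V + sum_list (take (j + h) vs)) \<sim> tline q (i + \<sigma> * int (m + h))"
      using seg[OF m(3)] unfolding m(4) right by blast
    then have "g + (\<theta> + (- V + sum_list (take (j + h) vs))) \<sim> g + tline q (i + \<sigma> * int (m + h))" by (simp only: same_edge_left)
    moreover have "i + \<sigma> * int (m + h) = i + \<sigma> * int m + \<sigma> * int h" by (simp add: distrib_left)
    ultimately show False
      using no_block[OF shift_q(1)[OF gP] \<sigma>, of j "i + \<sigma> * int m" h] h jh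
      unfolding shift_q(2)[OF gP] c by (simp add: add.assoc)
  qed
  have "k \<le> l" using kr N' seg[of "d - 1"] by linarith
  define m where "m = l - k"
  have km: "k + m = l" using \<open>k \<le> l\<close> by (simp add: m_def)
  have mm: "m + 90 < d" "90 \<le> m" using kl kr N' km by linarith+
  have "\<theta> + tline q ((i + \<sigma> * int m) - \<sigma> * int j) \<sim> tline q ((i + \<sigma> * int m + \<sigma>) + \<sigma> * int j)" if j: "j \<le> 80" for j
  proof -
    have j': "m - j < d" "m + 1 + j < d" "k + (m - j) = l - j" "k + (m + 1 + j) = l + 1 + j" "j \<le> l"
      using mm j km by auto
    have "- V + sum_list (take j vs) \<sim> tline q (i + \<sigma> * int (m - j))"
      using seg[OF j'(1)] unfolding j'(3) left[OF j'(5)] by blast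
    then have "tline q (i + \<sigma> * int (m - j)) \<sim> - V + sum_list (take j vs)" by (rule same_edge_sym)
    then have "\<theta> + tline q (i + \<sigma> * int (m - j)) \<sim> \<theta> + (- V + sum_list (take j vs))" by (simp only: same_edge_left)
    moreover have "\<theta> + (- V + sum_list (take j vs)) \<sim> tline q (i + \<sigma> * int (m + 1 + j))"
      using seg[OF j'(2)] unfolding j'(4) right by blast
    ultimately have "\<theta> + tline q (i + \<sigma> * int (m - j)) \<sim> tline q (i + \<sigma> * int (m + 1 + j))" by (rule same_edge_trans)
    moreover have "i + \<sigma> * int (m - j) = (i + \<sigma> * int m) - \<sigma> * int j" using mm j by (simp add: of_nat_diff algebra_simps)
    moreover have "i + \<sigma> * int (m + 1 + j) = (i + \<sigma> * int m + \<sigma>) + \<sigma> * int j" by (simp add: algebra_simps)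
    ultimately show ?thesis by (simp only:)
  qed
  then show False using reflected_overlap[OF q(1) \<sigma> \<theta>P] by blast
qed

text \<open>Were the sum 0, the reduced palindrome would equal a single syllable of side
  \<open>b\<close>. It has at least three syllables unless \<open>vs\<close> is empty, and then its
  only syllable is on side \<open>\<not> c\<close>.\<close>

lemma palindrome_nonzero:
  assumes vs: "alt c vs" and t: "t \<in> X (\<not> c) - H" and s: "s' \<in> X b" and ne: "vs \<noteq> [] \<or> b = c"
  shows "- sum_list vs + t + sum_list vs + s' \<noteq> 0"
proof
  let ?W = "rev (map uminus vs) @ t # vs"
  assume "- sum_list vs + t + sum_list vs + s' = 0"
  moreover have sW: "sum_list ?W = - sum_list vs + t + sum_list vs" by (simp add: sum_list_rev add.assoc)
  ultimately have "sum_list ?W = - s'" by (simp add: eq_neg_iff_add_eq_0)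
  then have "sum_list ?W \<in> X b" using add_subgroupD(3)[OF X_sub s] by simp
  moreover have W: "alt (flip (length vs) (\<not> c)) ?W" using alt_rev[OF vs] vs t by (simp add: alt_append)
  ultimately have v: "alt b [sum_list ?W]" using alt_notin_H[OF W] by simp
  have "- sum_list [sum_list ?W] + 0 + sum_list ?W \<in> H"
    using add_subgroupD(1)[OF H_sub] by (simp only: sum_list.Cons sum_list.Nil add_0_right left_minus)
  then have "flip (length vs) (\<not> c) = b \<and> length ?W = length [sum_list ?W]"
    using alt_unique[OF v W add_subgroupD(1)[OF H_sub]] by blast
  then show False using ne by auto
qed

text \<open>The hypothesis says that \<open>g\<close> conjugates \<open>s\<close> into
  \<open>X b\<close> modulo \<open>NN\<close>. A shortest \<open>g0\<close> in
  \<open>X b + NN + g\<close> starts on the other side, so the conjugate of \<open>s\<close> by it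
  is a palindrome with a short arm, unless the assertion holds.\<close>

theorem quotient_malnormal:
  assumes s: "s \<in> X b" "s' \<in> X b" "s \<noteq> 0" and g: "g \<in> P" and e: "- g + s + g + s' \<in> NN"
  shows "\<exists>x\<in>X b. - x + g \<in> NN"
proof (rule ccontr)
  assume contra: "\<not> ?thesis"
  define C where "C = {x + \<nu> + g | x \<nu>. x \<in> X b \<and> \<nu> \<in> NN}"
  have "g \<in> C" unfolding C_def using add_subgroupD(1)[OF X_sub] add_subgroupD(1)[OF NN_sub] by force
  then obtain g0 where g0: "g0 \<in> C" and min: "\<And>g'. g' \<in> C \<Longrightarrow> glen g0 \<le> glen g'"
    using ex_has_least_nat[of "\<lambda>x. x \<in> C" g glen] by blast
  obtain x \<nu> where x: "g0 = x + \<nu> + g" "x \<in> X b" "\<nu> \<in> NN" using g0 by (auto simp: C_def)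
  have C_left: "y + g' \<in> C" if y: "y \<in> X b" and g': "g' \<in> C" for y g'
  proof -
    obtain x \<nu> where "g' = x + \<nu> + g" "x \<in> X b" "\<nu> \<in> NN" using g' by (auto simp: C_def)
    then show ?thesis using y add_subgroupD(2)[OF X_sub y] unfolding C_def
      by (auto simp: add.assoc[symmetric])
  qed
  have C_NN: "\<mu> + g' \<in> C" if \<mu>: "\<mu> \<in> NN" and g': "g' \<in> C" for \<mu> g'
  proof -
    obtain x \<nu> where g': "g' = x + \<nu> + g" "x \<in> X b" "\<nu> \<in> NN" using g' by (auto simp: C_def)
    have "\<mu> + g' = x + ((- x + \<mu> + x) + \<nu>) + g" by (simp only: g'(1) add.assoc add_minus_cancel)
    moreover have "(- x + \<mu> + x) + \<nu> \<in> NN" using NN_conj'[OF X_P[OF g'(2)] \<mu>] g'(3) add_subgroupD(2)[OF NN_sub] by blast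
    ultimately show ?thesis using g'(2) unfolding C_def by blast
  qed
  have nX: "g0 \<notin> X b"
  proof
    assume "g0 \<in> X b"
    then have "- x + g0 \<in> X b" using x(2) add_subgroupD(2,3)[OF X_sub] by blast
    moreover have "- (- x + g0) + g = - g + - \<nu> + g" by (simp only: x(1) minus_add minus_minus add.assoc minus_add_cancel)
    moreover have "- g + - \<nu> + g \<in> NN" using NN_conj'[OF g] x(3) add_subgroupD(3)[OF NN_sub] by blast
    ultimately show False using contra by metis
  qed
  have g0P: "g0 \<in> P" using x g NN_P X_P add_subgroupD(2)[OF P_sub] by (metis subsetD)
  define s1 where "s1 = x + s + - x"
  have s1: "s1 \<in> X b" "s1 \<noteq> 0"
    unfolding s1_def using x(2) s add_subgroupD(2,3)[OF X_sub] apply blast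
    using s(3) by (metis add.assoc add.right_neutral left_minus minus_add_cancel)
  have e0: "- g0 + s1 + g0 + s' \<in> NN"
  proof -
    have "- g0 + s1 + g0 = - g + - \<nu> + (s + \<nu> + g)"
      by (simp only: x(1) s1_def minus_add minus_minus add.assoc minus_add_cancel add_minus_cancel)
    then have "- g0 + s1 + g0 + s' = (- g + - \<nu> + g) + (- g + (s + \<nu> + - s) + g) + (- g + s + g + s')"
      by (simp only: add.assoc minus_add_cancel add_minus_cancel)
    moreover have "- g + - \<nu> + g \<in> NN" using NN_conj'[OF g] x(3) add_subgroupD(3)[OF NN_sub] by blast
    moreover have "s + \<nu> + - s \<in> NN" using NN_conj[OF X_P[OF s(1)] x(3)] by simp
    then have "- g + (s + \<nu> + - s) + g \<in> NN" using NN_conj'[OF g] by blast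
    ultimately show ?thesis using e add_subgroupD(2)[OF NN_sub] by metis
  qed
  obtain c ws where ws: "alt c ws" "ws \<noteq> []" "length ws = glen g0" "g0 = sum_list ws"
    using glen_minimal_alt[OF g0P] nX H_X by blast
  obtain w us where wu: "ws = w # us" using ws(2) by (cases ws) auto
  have cb: "c = (\<not> b)"
  proof (rule ccontr)
    assume "c \<noteq> (\<not> b)"
    then have "- w \<in> X b" using ws(1) wu add_subgroupD(3)[OF X_sub] by auto
    then have "- w + g0 \<in> C" using C_left g0 by blast
    moreover have "- w + g0 = sum_list us" by (simp add: ws(4) wu)
    ultimately have "glen g0 \<le> length us"
      using min glen_sum_list[of us] alt_set[OF ws(1)] wu by (metis le_trans set_subset_Cons subset_trans)
    then show False using ws(3) wu by simp
  qed
  have s'KL: "s' \<in> K \<union> L" using s(2) by (auto simp: X_def split: if_splits)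
  show False
  proof (cases "s1 \<in> H")
    case False
    have "- sum_list ws + s1 + sum_list ws + s' \<notin> NN"
    proof (rule palindrome_not_short[OF ws(1) _ s'KL])
      show "s1 \<in> X (\<not> c) - H" using s1 False cb by simp
      show "length ws \<le> glen (\<nu> + sum_list ws)" if "\<nu> \<in> NN" for \<nu>
        using min[OF C_NN[OF that g0]] ws(3,4) by simp
      show "- sum_list ws + s1 + sum_list ws + s' \<noteq> 0"
        by (rule palindrome_nonzero[OF ws(1) _ s(2)]) (use s1 False cb ws(2) in auto)
    qed
    then show False using e0 ws(4) by simp
  next
    case True
    \<comment> \<open>An element of \<open>H\<close> is not a syllable. Conjugation by the first
      syllable \<open>w\<close> moves it out of \<open>H\<close>, by malnormality in the factor, and
      shortens the arm to \<open>us\<close>.\<close>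
    define t where "t = - w + s1 + w"
    have w: "w \<in> X (\<not> b) - H" using ws(1) wu cb by simp
    have tX: "t \<in> X (\<not> b) - H"
      unfolding t_def using malnormal[OF w True] s1(2) w H_X[OF True] add_subgroupD(2,3)[OF X_sub] by blast
    have th: "- g0 + s1 + g0 = - sum_list us + t + sum_list us"
      by (simp only: ws(4) wu t_def sum_list.Cons minus_add add.assoc)
    have us: "alt b us" using ws(1) wu cb by simp
    have "- sum_list us + t + sum_list us + s' \<notin> NN"
    proof (rule palindrome_not_short[OF us tX s'KL])
      show "length us \<le> glen (\<nu> + sum_list us)" if \<nu>: "\<nu> \<in> NN" for \<nu>
      proof -
        have wP: "w \<in> P" using w X_P by blast
        have \<nu>': "w + \<nu> - w \<in> NN" using NN_conj[OF wP \<nu>] .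
        have eq: "(w + \<nu> - w) + g0 = w + (\<nu> + sum_list us)"
          by (simp only: ws(4) wu sum_list.Cons grp_norm minus_add_cancel)
        have P: "\<nu> + sum_list us \<in> P" using \<nu> NN_P alt_P[OF us] add_subgroupD(2)[OF P_sub] by blast
        have "length ws \<le> glen (w + (\<nu> + sum_list us))" using min[OF C_NN[OF \<nu>' g0]] ws(3) unfolding eq by simp
        also have "\<dots> \<le> glen w + glen (\<nu> + sum_list us)" by (rule glen_add[OF wP P])
        also have "glen w \<le> 1" using glen_sum_list[of "[w]"] alt_set[OF ws(1)] wu by simp
        finally show ?thesis using wu by simp
      qed
      show "- sum_list us + t + sum_list us + s' \<noteq> 0"
        by (rule palindrome_nonzero[OF us tX s(2)]) simp
    qed
    then show False using e0 unfolding th by simp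
  qed
qed

section \<open>Absence of torsion in the quotient\<close>

lemma alt_replicate: "alt b ws \<Longrightarrow> even (length ws) \<Longrightarrow> alt b (concat (replicate k ws))"
proof (induction k)
  case (Suc k)
  have "flip (length ws) b = b" using Suc.prems(2) by (simp add: flip_iff)
  then show ?case using Suc by (simp add: alt_append)
qed simp

lemma sum_list_replicate: "sum_list (concat (replicate k ws)) = zmult (int k) (sum_list ws :: 'a)"
  using zmult_Suc_left[of "int _" "sum_list ws"] by (induction k) (simp_all add: add.commute[of 1 "int _"])

lemma take_replicate_shift:
  "j \<le> k * length ws \<Longrightarrow> sum_list (take (length ws + j) (concat (replicate (Suc k) ws)))
    = sum_list ws + sum_list (take j (concat (replicate (Suc k) ws)) :: 'a list)"
proof -
  assume j: "j \<le> k * length ws"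
  have r: "concat (replicate (Suc k) ws) = concat (replicate k ws) @ ws"
    by (induction k) simp_all
  have "length (concat (replicate k ws)) = k * length ws" by (induction k) auto
  then have "take j (concat (replicate (Suc k) ws)) = take j (concat (replicate k ws))" using j r by simp
  then show ?thesis by simp
qed

text \<open>Take \<open>g0\<close> shortest among the conjugates of \<open>g\<close> modulo
  \<open>NN\<close>. Outside the factors it is cyclically reduced, and the path of its multiple
  follows an axis for almost a period. If this segment is longer than \<open>g0\<close> by 81, then
  \<open>g0\<close> slides the axis along itself and is a multiple of the rotation. Otherwise more
  than half a period fits into a cyclic conjugate of \<open>g0\<close>, which could be
  shortened.\<close>

theorem quotient_torsion_free:
  assumes g: "g \<in> P" and k: "k > 0" "zmult (int k) g \<in> NN" shows "g \<in> NN"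
proof -
  define C where "C = {- x + (\<nu> + g) + x | x \<nu>. x \<in> P \<and> \<nu> \<in> NN}"
  have "g \<in> C" unfolding C_def using add_subgroupD(1)[OF P_sub] add_subgroupD(1)[OF NN_sub] by force
  then obtain g0 where g0: "g0 \<in> C" and min: "\<And>g'. g' \<in> C \<Longrightarrow> glen g0 \<le> glen g'"
    using ex_has_least_nat[of "\<lambda>x. x \<in> C" g glen] by blast
  have C_conj: "- y + (\<mu> + g') + y \<in> C" if y: "y \<in> P" and \<mu>: "\<mu> \<in> NN" and g': "g' \<in> C" for y \<mu> g'
  proof -
    obtain x \<nu> where g': "g' = - x + (\<nu> + g) + x" "x \<in> P" "\<nu> \<in> NN" using g' by (auto simp: C_def)
    have "- y + (\<mu> + g') + y = - (x + y) + (((x + \<mu> - x) + \<nu>) + g) + (x + y)"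
      by (simp only: g'(1) grp_norm minus_minus minus_add_cancel add_minus_cancel)
    moreover have "x + y \<in> P" using g'(2) y add_subgroupD(2)[OF P_sub] by blast
    moreover have "(x + \<mu> - x) + \<nu> \<in> NN" using NN_conj[OF g'(2) \<mu>] g'(3) add_subgroupD(2)[OF NN_sub] by blast
    ultimately show ?thesis unfolding C_def by blast
  qed
  obtain x \<nu> where x: "g0 = - x + (\<nu> + g) + x" "x \<in> P" "\<nu> \<in> NN" using g0 by (auto simp: C_def)
  have g0P: "g0 \<in> P" using x g NN_P add_subgroupD(2,3)[OF P_sub] by (metis subsetD)
  have descend: "g \<in> NN" if "g0 \<in> NN"
  proof -
    have "x + g0 - x \<in> NN" using NN_conj[OF x(2) that] .
    then have "- \<nu> + (x + g0 - x) \<in> NN" using x(3) add_subgroupD(2,3)[OF NN_sub] by blast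
    then show ?thesis by (simp only: x(1) grp_norm minus_minus minus_add_cancel add_minus_cancel right_minus add_0_right)
  qed
  have pow: "zmult (int m) (\<nu> + g) + - zmult (int m) g \<in> NN" for m
  proof (induction m)
    case (Suc m)
    define z where "z = zmult (int m) g"
    define z' where "z' = zmult (int m) (\<nu> + g)"
    have S: "zmult (int (Suc m)) y = y + zmult (int m) y" for y :: 'a
      using zmult_Suc_left[of "int m" y] by (simp add: add.commute)
    have "zmult (int (Suc m)) (\<nu> + g) + - zmult (int (Suc m)) g = \<nu> + (g + (z' + - z) - g)"
      unfolding S z_def[symmetric] z'_def[symmetric] by (simp only: grp_norm)
    then show ?case using NN_conj[OF g Suc] x(3) add_subgroupD(2)[OF NN_sub] unfolding z_def z'_def by metis
  qed (simp add: add_subgroupD(1)[OF NN_sub])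
  have k0: "zmult (int k) g0 \<in> NN"
  proof -
    have "(zmult (int k) (\<nu> + g) + - zmult (int k) g) + zmult (int k) g \<in> NN"
      using pow[of k] k(2) add_subgroupD(2)[OF NN_sub] by blast
    then have "zmult (int k) (\<nu> + g) \<in> NN" by (simp only: add.assoc left_minus add_0_right)
    then show ?thesis unfolding x(1) zmult_conj' using NN_conj'[OF x(2)] by blast
  qed
  have base: "g0 \<in> NN" if "g0 \<in> X b" for b
  proof -
    have "zmult (int k) g0 \<in> X b" using zmult_in[OF X_sub that] .
    then have "zmult (int k) g0 \<in> K \<union> L" by (auto simp: X_def split: if_splits)
    then have "zmult (int k) g0 = 0" using NN_short[OF k0, of "zmult (int k) g0" 0] add_subgroupD(1)[OF K] by simp
    then have "g0 = 0" using torsion_free[OF that, of "int k"] k(1) by simp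
    then show ?thesis using add_subgroupD(1)[OF NN_sub] by simp
  qed
  show ?thesis
  proof (cases "\<exists>b. g0 \<in> X b")
    case True
    then show ?thesis using base descend by blast
  next
    case nX: False
    obtain c ws where ws: "alt c ws" "ws \<noteq> []" "length ws = glen g0" "g0 = sum_list ws"
      using glen_minimal_alt[OF g0P] nX H_X by blast
    define n where "n = length ws"
    obtain w us where wu: "ws = w # us" using ws(2) by (cases ws) auto
    have "us \<noteq> []" using nX ws wu by auto
    then obtain vs v where vv: "us = vs @ [v]" by (metis rev_exhaust)
    \<comment> \<open>For odd length the first and last syllables come from the same factor and
      would merge after a conjugation.\<close>
    have even: "even n"
    proof (rule ccontr)
      assume "odd n"
      then have "even (length us)" by (simp add: n_def wu)
      then have "flip (length vs) (\<not> c) = c" by (simp add: vv flip_iff)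
      then have "v \<in> X c" "w \<in> X c" using ws(1) by (auto simp: wu vv alt_append)
      then have vw: "v + w \<in> K \<union> L" using add_subgroupD(2)[OF X_sub[of c], of v w] by (auto simp: X_def split: if_splits)
      have wP: "w \<in> P" using \<open>w \<in> X c\<close> X_P by blast
      have "- w + (0 + g0) + w \<in> C" using C_conj[OF wP add_subgroupD(1)[OF NN_sub] g0] .
      moreover have "- w + (0 + g0) + w = sum_list (vs @ [v + w])"
        by (simp add: ws(4) wu vv add.assoc)
      moreover have "set (vs @ [v + w]) \<subseteq> K \<union> L" using alt_set[OF ws(1)] vw by (auto simp: wu vv)
      ultimately have "glen g0 \<le> length (vs @ [v + w])" using min glen_sum_list by (metis le_trans)
      then show False using ws(3) by (simp add: wu vv)
    qed
    \<comment> \<open>One copy of \<open>ws\<close> beyond the \<open>k\<close> needed for the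
      multiple, so that a shift by \<open>n\<close> stays inside the word.\<close>
    define W where "W = concat (replicate (Suc k) ws)"
    define W0 where "W0 = concat (replicate k ws)"
    have W: "alt c W" "alt c W0" unfolding W_def W0_def using alt_replicate[OF ws(1)] even unfolding n_def by blast+
    have lenW0: "length W0 = k * n" unfolding W0_def n_def by (induction k) auto
    have lenW: "length W = k * n + n" using lenW0 by (simp add: W_def W0_def n_def)
    have W0_W: "take j W0 = take j W" if "j \<le> k * n" for j
    proof -
      have "W = W0 @ ws" unfolding W_def W0_def by (induction k) simp_all
      then show ?thesis using that lenW0 by simp
    qed
    have shift: "sum_list (take (n + j) W) = g0 + sum_list (take j W)" if "j \<le> k * n" for j
      using take_replicate_shift[of j k ws] that unfolding W_def n_def ws(4) by simp
    have W0sum: "sum_list W0 = zmult (int k) g0" by (simp add: W0_def sum_list_replicate ws(4))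
    have "W0 \<noteq> []" using lenW0 k(1) ws(2) by (auto simp: n_def)
    then have "zmult (int k) g0 \<noteq> 0" using alt_nonzero[OF W(2)] W0sum by simp
    then obtain q where q: "q \<in> translates" "\<bar>proj (tline q) (zmult (int k) g0) - proj (tline q) 0\<bar> \<ge> period - 486"
      using greendlinger k0 by blast
    define d where "d = nat \<bar>proj (tline q) (zmult (int k) g0) - proj (tline q) 0\<bar>"
    have d: "int d \<ge> period - 486" using q(2) by (simp add: d_def)
    obtain l i \<sigma> where \<sigma>: "\<sigma> \<in> {1, - 1}"
      and seg0: "\<And>m. m < d \<Longrightarrow> l + m \<le> k * n \<and> sum_list (take (l + m) W0) \<sim> tline q (i + \<sigma> * int m)"
      using path_segment[OF tline[OF q(1)] add_subgroupD(1)[OF P_sub] W(2)] unfolding W0sum lenW0 d_def by auto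
    have seg: "l + m \<le> k * n \<and> sum_list (take (l + m) W) \<sim> tline q (i + \<sigma> * int m)" if "m < d" for m
      using seg0[OF that] W0_W[of "l + m"] by simp
    have q': "fst q \<in> P" "snd q \<in> R" using q(1) by (auto simp: translates_def)
    show ?thesis
    proof (cases "n + 81 \<le> d")
      case True
      have sh: "g0 + tline q (i + \<sigma> * int m) \<sim> tline q (i + \<sigma> * int n + \<sigma> * int m)" if m: "m \<le> 80" for m
      proof -
        have m': "m < d" "m + n < d" using m True by auto
        have "g0 + sum_list (take (l + m) W) \<sim> tline q (i + \<sigma> * int (m + n))"
          using seg[OF m'(2)] shift[of "l + m"] seg[OF m'(1)] by (simp add: ac_simps)
        moreover have "tline q (i + \<sigma> * int m) \<sim> sum_list (take (l + m) W)"
          using seg[OF m'(1)] same_edge_sym by blast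
        then have "g0 + tline q (i + \<sigma> * int m) \<sim> g0 + sum_list (take (l + m) W)" by (simp only: same_edge_left)
        ultimately have "g0 + tline q (i + \<sigma> * int m) \<sim> tline q (i + \<sigma> * int (m + n))" using same_edge_trans by blast
        moreover have "i + \<sigma> * int (m + n) = i + \<sigma> * int n + \<sigma> * int m" by (simp add: algebra_simps)
        ultimately show ?thesis by (simp only:)
      qed
      have "period dvd \<sigma> * int n"
      proof (cases "\<sigma> = 1")
        case True
        have "(g0 + fst q) + rel_line N (snd q) (i + int m) \<sim> fst q + rel_line N (snd q) (i + \<sigma> * int n + 1 * int m)"
          if "m \<le> 80" for m using sh[OF that] True by (simp add: tline_def add.assoc)
        then have "period dvd i - (i + \<sigma> * int n)" using overlap[OF q'(2,2), of 1] by blast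
        then show ?thesis by (simp add: dvd_minus_iff)
      next
        case False
        then have s: "\<sigma> = - 1" using \<sigma> by auto
        have "(g0 + fst q) + rel_line N (snd q) (i - 80 + int m) \<sim> fst q + rel_line N (snd q) (i + \<sigma> * int n - 80 + 1 * int m)"
          if m: "m \<le> 80" for m
        proof -
          have "i + \<sigma> * int (80 - m) = i - 80 + int m" "i + \<sigma> * int n + \<sigma> * int (80 - m) = i + \<sigma> * int n - 80 + 1 * int m"
            using m s by (auto simp: of_nat_diff)
          then show ?thesis using sh[of "80 - m"] by (simp only: tline_def add.assoc)
        qed
        then have "period dvd (i - 80) - (i + \<sigma> * int n - 80)" using overlap[OF q'(2,2), of 1] by blast
        moreover have "(i - 80) - (i + \<sigma> * int n - 80) = - (\<sigma> * int n)" by simp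
        ultimately show ?thesis by (simp only: dvd_minus_iff)
      qed
      then obtain r where r: "\<sigma> * int n = r * period" by (metis dvd_def mult.commute)
      define \<mu> where "\<mu> = zmult (- r) (trot q) + g0"
      have stab: "\<mu> + tline q (i + \<sigma> * int m) \<sim> tline q (i + \<sigma> * int m)" if m: "m \<le> 80" for m
      proof -
        have "zmult (- r) (trot q) + (g0 + tline q (i + \<sigma> * int m)) \<sim> zmult (- r) (trot q) + tline q (i + \<sigma> * int n + \<sigma> * int m)"
          using sh[OF m] by (simp only: same_edge_left)
        moreover have "zmult (- r) (trot q) + tline q (i + \<sigma> * int n + \<sigma> * int m) = tline q (i + \<sigma> * int m)"
          unfolding trot_tline r by (simp add: algebra_simps)
        ultimately show ?thesis by (simp only: \<mu>_def add.assoc)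
      qed
      obtain a where a: "\<mu> + tline q a \<sim> tline q a" "\<mu> + tline q (a + 1) \<sim> tline q (a + 1)"
      proof (cases "\<sigma> = 1")
        case True
        then show ?thesis using stab[of 0] stab[of 1] by (intro that[of i]) simp_all
      next
        case False
        then show ?thesis using stab[of 0] stab[of 1] \<sigma> by (intro that[of "i - 1"]) simp_all
      qed
      \<comment> \<open>\<mu> fixes two adjacent edges of the line. Seen from the first it is an
        element of \<open>H\<close> whose conjugate by the next syllable is again in
        \<open>H\<close>, so malnormality makes it 0.\<close>
      define h where "h = - tline q a + - \<mu> + tline q a"
      define s where "s = - tline q a + tline q (a + 1)"
      have h: "h \<in> H" using a(1) by (simp only: h_def same_edge_def minus_add)
      have "- s + h + s = - tline q (a + 1) + - \<mu> + tline q (a + 1)"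
        by (simp only: h_def s_def minus_add minus_minus add.assoc add_minus_cancel)
      also have "\<dots> \<in> H" using a(2) by (simp only: same_edge_def minus_add)
      finally have "h = 0" using malnormal[OF _ h, of s] lineD(2)[OF tline[OF q(1)], of a] by (simp only: s_def)
      then have "\<mu> = 0" unfolding h_def by (metis add.assoc add.right_neutral add_minus_cancel minus_minus neg_0_equal_iff_equal right_minus)
      then have "g0 = - zmult (- r) (trot q)" unfolding \<mu>_def by (simp add: eq_neg_iff_add_eq_0 minus_unique)
      then have "g0 \<in> NN" using zmult_in[OF NN_sub trot_NN[OF q(1)]] add_subgroupD(3)[OF NN_sub] by simp
      then show ?thesis using descend by blast
    next
      case False
      \<comment> \<open>From \<open>d < n + 81\<close> this is at most \<open>n\<close>, while twice
        its value still exceeds the period. The cap \<open>e'\<close> keeps the arc within a single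
        period.\<close>
      define e where "e = d - 82"
      have e: "e \<le> n" "e < d" "rel_len N < 2 * e" using False d N by (auto simp: e_def)
      define e' where "e' = min e (rel_len N)"
      have e': "e' \<le> n" "e' < d" "rel_len N < 2 * e'" "int e' \<le> period"
      proof -
        have *: "e' = e \<or> e' = rel_len N" "e' \<le> e" "e' \<le> rel_len N" unfolding e'_def by linarith+
        then show "e' \<le> n" "e' < d" "int e' \<le> period" using e by linarith+
        show "rel_len N < 2 * e'" using *(1) e(3) by (elim disjE) simp_all
      qed
      define x where "x = sum_list (take l W)"
      define y where "y = sum_list (take (l + e') W)"
      have xP: "x \<in> P" "y \<in> P" unfolding x_def y_def using alt_P[OF alt_take[OF W(1)]] by blast+
      have le: "l + e' \<le> k * n" using seg[OF e'(2)] by blast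
      have "x \<sim> tline q i" "y \<sim> tline q (i + \<sigma> * int e')" using seg[of 0] seg[OF e'(2)] e'(2) by (auto simp: x_def y_def)
      from glen_rotate[OF q(1) \<sigma> this e'(4)] obtain \<mu> where \<mu>: "\<mu> \<in> NN" "glen (- x + (\<mu> + y)) \<le> rel_len N - e'" by blast
      define z where "z = - y + (g0 + x)"
      have "g0 + x = sum_list (take (n + l) W)" unfolding x_def using shift[of l] le by simp
      also have "take (n + l) W = take (l + e') W @ take (n - e') (drop (l + e') W)"
        using e'(1) by (metis add.assoc add.commute le_add_diff_inverse take_add)
      finally have "z = sum_list (take (n - e') (drop (l + e') W))" by (simp add: z_def y_def)
      moreover have "set (take (n - e') (drop (l + e') W)) \<subseteq> K \<union> L"
        using alt_set[OF W(1)] set_take_subset set_drop_subset by (metis subset_trans)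
      ultimately have gz: "glen z \<le> n - e'" using glen_sum_list[of "take (n - e') (drop (l + e') W)"] by simp
      have zP: "z \<in> P" unfolding z_def using xP g0P add_subgroupD(2,3)[OF P_sub] by blast
      have mP: "- x + (\<mu> + y) \<in> P" using xP \<mu>(1) NN_P add_subgroupD(2,3)[OF P_sub] by (meson subsetD)
      have "- x + (\<mu> + g0) + x = (- x + (\<mu> + y)) + z" by (simp only: z_def add.assoc add_minus_cancel)
      moreover have "glen ((- x + (\<mu> + y)) + z) \<le> (rel_len N - e') + (n - e')"
        using glen_add[OF mP zP] \<mu>(2) gz by linarith
      moreover have "(rel_len N - e') + (n - e') < n" using e' by linarith
      moreover have "glen g0 \<le> glen (- x + (\<mu> + g0) + x)" using min[OF C_conj[OF xP(1) \<mu>(1) g0]] .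
      ultimately show ?thesis using ws(3) by (simp add: n_def)
    qed
  qed
qed

end

section \<open>Extensions of groups\<close>

text \<open>The geometric part needs a type of class \<open>group_add\<close>, whereas the groups to
  be amalgamated are records. Permutations of normal forms provide the ambient group.\<close>

typedef 'a bijection = "{f :: 'a \<Rightarrow> 'a. bij f}" by (rule exI[of _ id]) simp

instantiation bijection :: (type) group_add
begin

definition zero_bijection :: "'a bijection" where "0 = Abs_bijection id"
definition plus_bijection :: "'a bijection \<Rightarrow> 'a bijection \<Rightarrow> 'a bijection" where
  "f + g = Abs_bijection (Rep_bijection f \<circ> Rep_bijection g)"
definition uminus_bijection :: "'a bijection \<Rightarrow> 'a bijection" where
  "- f = Abs_bijection (inv_into UNIV (Rep_bijection f))"
definition minus_bijection :: "'a bijection \<Rightarrow> 'a bijection \<Rightarrow> 'a bijection" where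
  "f - g = f + - (g :: 'a bijection)"

lemma bij_Rep: "bij (Rep_bijection f)" using Rep_bijection by blast

lemma Rep_plus: "Rep_bijection (f + g) = Rep_bijection f \<circ> Rep_bijection g"
  by (simp add: plus_bijection_def Abs_bijection_inverse bij_Rep bij_comp)

lemma Rep_zero: "Rep_bijection 0 = id"
  by (simp add: zero_bijection_def Abs_bijection_inverse)

lemma Rep_uminus: "Rep_bijection (- f) = inv_into UNIV (Rep_bijection f)"
  by (simp add: uminus_bijection_def Abs_bijection_inverse bij_Rep bij_imp_bij_inv)

instance
proof
  show "- a + a = 0" for a :: "'a bijection"
    by (simp add: Rep_bijection_inject[symmetric] Rep_plus Rep_zero Rep_uminus bij_Rep bij_is_inj)
qed (simp_all add: Rep_bijection_inject[symmetric] Rep_plus Rep_zero minus_bijection_def comp_assoc)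

end

locale group_amalgam =
  fixes A B :: "'u monoid"
  assumes A: "group A" and B: "group B"
    and one_eq: "\<one>\<^bsub>A\<^esub> = \<one>\<^bsub>B\<^esub>"
    and H_sub_A: "subgroup (carrier A \<inter> carrier B) A"
    and mult_eq: "\<And>x y. x \<in> carrier A \<inter> carrier B \<Longrightarrow> y \<in> carrier A \<inter> carrier B \<Longrightarrow> x \<otimes>\<^bsub>A\<^esub> y = x \<otimes>\<^bsub>B\<^esub> y"
begin

definition G :: "bool \<Rightarrow> 'u monoid" where "G b = (if b then A else B)"
definition C :: "'u set" where "C = carrier A \<inter> carrier B"

lemma G_group: "group (G b)" using A B by (simp add: G_def)
lemma one_G: "\<one>\<^bsub>G b\<^esub> = \<one>\<^bsub>A\<^esub>" using one_eq by (simp add: G_def)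
lemma C_G: "h \<in> C \<Longrightarrow> h \<in> carrier (G b)" by (simp add: C_def G_def)
lemma G_other: "x \<in> carrier (G b) \<Longrightarrow> x \<in> carrier (G (\<not> b)) \<Longrightarrow> x \<in> C" by (cases b) (simp_all add: C_def G_def)
lemma C_mult: "x \<in> C \<Longrightarrow> y \<in> C \<Longrightarrow> x \<otimes>\<^bsub>G b\<^esub> y = x \<otimes>\<^bsub>A\<^esub> y"
  using mult_eq by (auto simp: C_def G_def)

lemma inv_eq: assumes "x \<in> C" shows "inv\<^bsub>B\<^esub> x = inv\<^bsub>A\<^esub> x"
proof -
  have i: "inv\<^bsub>A\<^esub> x \<in> C" using assms H_sub_A subgroup.m_inv_closed unfolding C_def by fast
  have "x \<otimes>\<^bsub>B\<^esub> inv\<^bsub>A\<^esub> x = \<one>\<^bsub>B\<^esub>"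
    using mult_eq[of x "inv\<^bsub>A\<^esub> x"] assms i group.r_inv[OF A] one_eq by (auto simp: C_def)
  then show ?thesis using group.inv_equality[OF B, of "inv\<^bsub>A\<^esub> x" x] assms i group.inv_comm[OF B] by (auto simp: C_def)
qed

lemma C_sub: "subgroup C (G b)"
proof (cases b)
  case True
  then show ?thesis using H_sub_A by (simp add: G_def C_def)
next
  case False
  have "subgroup C B"
  proof (rule group.subgroupI[OF B])
    show "C \<subseteq> carrier B" by (auto simp: C_def)
    show "C \<noteq> {}" using subgroup.one_closed[OF H_sub_A] by (auto simp: C_def)
    show "inv\<^bsub>B\<^esub> x \<in> C" if "x \<in> C" for x
      using inv_eq[OF that] subgroup.m_inv_closed[OF H_sub_A] that by (simp add: C_def)
    show "x \<otimes>\<^bsub>B\<^esub> y \<in> C" if "x \<in> C" "y \<in> C" for x y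
      using mult_eq[of x y] subgroup.m_closed[OF H_sub_A, of x y] that unfolding C_def by metis
  qed
  then show ?thesis using False by (simp add: G_def)
qed

lemma C_absorb: assumes "h \<in> C" "x \<in> carrier (G b)"
  shows "h \<otimes>\<^bsub>G b\<^esub> x \<in> C \<longleftrightarrow> x \<in> C" "x \<otimes>\<^bsub>G b\<^esub> h \<in> C \<longleftrightarrow> x \<in> C"
proof -
  interpret g: group "G b" by (rule G_group)
  have hi: "inv\<^bsub>G b\<^esub> h \<in> C" "h \<in> carrier (G b)" using assms(1) subgroup.m_inv_closed[OF C_sub] C_G by auto
  have "inv\<^bsub>G b\<^esub> h \<otimes>\<^bsub>G b\<^esub> (h \<otimes>\<^bsub>G b\<^esub> x) = x" "(x \<otimes>\<^bsub>G b\<^esub> h) \<otimes>\<^bsub>G b\<^esub> inv\<^bsub>G b\<^esub> h = x"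
    using hi(2) assms(2) by (simp_all add: g.m_assoc[symmetric]) (simp add: g.m_assoc)
  then show "h \<otimes>\<^bsub>G b\<^esub> x \<in> C \<longleftrightarrow> x \<in> C" "x \<otimes>\<^bsub>G b\<^esub> h \<in> C \<longleftrightarrow> x \<in> C"
    using subgroup.m_closed[OF C_sub[of b]] hi(1) assms(1) by metis+
qed

definition rep :: "bool \<Rightarrow> 'u \<Rightarrow> 'u" where
  "rep b x = (SOME t. t \<in> carrier (G b) \<and> (\<exists>h\<in>C. x = h \<otimes>\<^bsub>G b\<^esub> t))"

definition hpart :: "bool \<Rightarrow> 'u \<Rightarrow> 'u" where
  "hpart b x = x \<otimes>\<^bsub>G b\<^esub> inv\<^bsub>G b\<^esub> rep b x"

lemma rep: assumes x: "x \<in> carrier (G b)"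
  shows "rep b x \<in> carrier (G b)" "hpart b x \<in> C" "hpart b x \<otimes>\<^bsub>G b\<^esub> rep b x = x" "rep b x \<in> C \<longleftrightarrow> x \<in> C"
proof -
  interpret g: group "G b" by (rule G_group)
  have "x = \<one>\<^bsub>G b\<^esub> \<otimes>\<^bsub>G b\<^esub> x" "\<one>\<^bsub>G b\<^esub> \<in> C" using x subgroup.one_closed[OF C_sub] by simp_all
  then have "\<exists>t. t \<in> carrier (G b) \<and> (\<exists>h\<in>C. x = h \<otimes>\<^bsub>G b\<^esub> t)" using x by metis
  then have "rep b x \<in> carrier (G b) \<and> (\<exists>h\<in>C. x = h \<otimes>\<^bsub>G b\<^esub> rep b x)"
    unfolding rep_def by (rule someI_ex)
  then obtain h where r: "rep b x \<in> carrier (G b)" "h \<in> C" "x = h \<otimes>\<^bsub>G b\<^esub> rep b x" by blast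
  show "rep b x \<in> carrier (G b)" by fact
  have hG: "h \<in> carrier (G b)" using r(2) C_G by blast
  have "x \<otimes>\<^bsub>G b\<^esub> inv\<^bsub>G b\<^esub> rep b x = (h \<otimes>\<^bsub>G b\<^esub> rep b x) \<otimes>\<^bsub>G b\<^esub> inv\<^bsub>G b\<^esub> rep b x" using r(3) by simp
  also have "\<dots> = h" using r(1) hG by (simp add: g.m_assoc)
  finally have h: "hpart b x = h" by (simp add: hpart_def)
  show "hpart b x \<in> C" "hpart b x \<otimes>\<^bsub>G b\<^esub> rep b x = x" using h r by simp_all
  show "rep b x \<in> C \<longleftrightarrow> x \<in> C" using C_absorb(1)[OF r(2,1)] r(3) by simp
qed

lemma rep_mult: assumes h: "h \<in> C" and x: "x \<in> carrier (G b)" shows "rep b (h \<otimes>\<^bsub>G b\<^esub> x) = rep b x"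
proof -
  interpret g: group "G b" by (rule G_group)
  have hG: "h \<in> carrier (G b)" "inv\<^bsub>G b\<^esub> h \<in> C" using h C_G subgroup.m_inv_closed[OF C_sub] by auto
  have "(\<exists>k\<in>C. h \<otimes>\<^bsub>G b\<^esub> x = k \<otimes>\<^bsub>G b\<^esub> t) \<longleftrightarrow> (\<exists>k\<in>C. x = k \<otimes>\<^bsub>G b\<^esub> t)" if t: "t \<in> carrier (G b)" for t
  proof
    assume "\<exists>k\<in>C. h \<otimes>\<^bsub>G b\<^esub> x = k \<otimes>\<^bsub>G b\<^esub> t"
    then obtain k where k: "k \<in> C" "h \<otimes>\<^bsub>G b\<^esub> x = k \<otimes>\<^bsub>G b\<^esub> t" by blast
    then have "x = inv\<^bsub>G b\<^esub> h \<otimes>\<^bsub>G b\<^esub> (k \<otimes>\<^bsub>G b\<^esub> t)" using hG(1) x by (metis g.inv_solve_left g.m_closed)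
    then have "x = (inv\<^bsub>G b\<^esub> h \<otimes>\<^bsub>G b\<^esub> k) \<otimes>\<^bsub>G b\<^esub> t" using hG(1) k(1) t C_G by (simp add: g.m_assoc)
    then show "\<exists>k\<in>C. x = k \<otimes>\<^bsub>G b\<^esub> t" using subgroup.m_closed[OF C_sub hG(2) k(1)] by blast
  next
    assume "\<exists>k\<in>C. x = k \<otimes>\<^bsub>G b\<^esub> t"
    then obtain k where k: "k \<in> C" "x = k \<otimes>\<^bsub>G b\<^esub> t" by blast
    then have "h \<otimes>\<^bsub>G b\<^esub> x = (h \<otimes>\<^bsub>G b\<^esub> k) \<otimes>\<^bsub>G b\<^esub> t" using hG(1) t C_G by (simp add: g.m_assoc)
    then show "\<exists>k\<in>C. h \<otimes>\<^bsub>G b\<^esub> x = k \<otimes>\<^bsub>G b\<^esub> t" using subgroup.m_closed[OF C_sub h k(1)] by blast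
  qed
  then show ?thesis unfolding rep_def by (metis (no_types, lifting))
qed

text \<open>Normal forms \<open>h t\<^sub>1 \<dots> t\<^sub>n\<close> with alternating right coset representatives \<open>t\<^sub>i\<close>;
  each factor acts from the left on the syllables next to \<open>h\<close>.\<close>

definition Y :: "bool \<Rightarrow> 'u set" where
  "Y b = {t \<in> carrier (G b) - C. rep b t = t}"

definition normal_forms :: "('u \<times> 'u list) set" where
  "normal_forms = {(h, ts). h \<in> C \<and> (\<exists>b. alternating Y b ts)}"

text \<open>Splitting rewrites a normal form as an element of factor \<open>b\<close> followed by
  syllables that begin on the other side; joining is the inverse. In split coordinates the action of
  factor \<open>b\<close> is plain left multiplication.\<close>

definition split_form :: "bool \<Rightarrow> 'u \<times> 'u list \<Rightarrow> 'u \<times> 'u list" where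
  "split_form b w = (if snd w \<noteq> [] \<and> hd (snd w) \<in> carrier (G b)
    then (fst w \<otimes>\<^bsub>G b\<^esub> hd (snd w), tl (snd w)) else w)"

definition join_form :: "bool \<Rightarrow> 'u \<times> 'u list \<Rightarrow> 'u \<times> 'u list" where
  "join_form b w = (if fst w \<in> C then w else (hpart b (fst w), rep b (fst w) # snd w))"

text \<open>The identity outside the normal forms, so that elements act as permutations of the whole
  type.\<close>

definition act :: "bool \<Rightarrow> 'u \<Rightarrow> 'u \<times> 'u list \<Rightarrow> 'u \<times> 'u list" where
  "act b k w = (if w \<in> normal_forms
    then join_form b (k \<otimes>\<^bsub>G b\<^esub> fst (split_form b w), snd (split_form b w)) else w)"

definition split_forms :: "bool \<Rightarrow> ('u \<times> 'u list) set" where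
  "split_forms b = {(x, ts). x \<in> carrier (G b) \<and> alternating Y (\<not> b) ts}"

lemma Y_other: "t \<in> Y b \<Longrightarrow> t \<in> carrier (G c) \<longleftrightarrow> c = b"
  using G_other[of t b] by (cases "c = b") (auto simp: Y_def)

lemma rep_Y: "x \<in> carrier (G b) \<Longrightarrow> x \<notin> C \<Longrightarrow> rep b x \<in> Y b"
  using rep[of x b] rep_mult[of "hpart b x" "rep b x" b] by (simp add: Y_def)

lemma split_form_in: assumes "w \<in> normal_forms" shows "split_form b w \<in> split_forms b"
proof -
  obtain h ts c where w: "w = (h, ts)" "h \<in> C" "alternating Y c ts" using assms by (auto simp: normal_forms_def)
  interpret g: group "G b" by (rule G_group)
  show ?thesis
  proof (cases ts)
    case Nil
    then show ?thesis using w C_G by (simp add: split_form_def split_forms_def)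
  next
    case (Cons t us)
    then have t: "t \<in> Y c" "alternating Y (\<not> c) us" using w by auto
    show ?thesis
    proof (cases "b = c")
      case True
      then have "t \<in> carrier (G b)" using t(1) by (simp add: Y_def)
      moreover from this have "h \<otimes>\<^bsub>G b\<^esub> t \<in> carrier (G b)" using C_G[OF w(2)] by simp
      ultimately show ?thesis using w(1) Cons t(2) True by (simp add: split_form_def split_forms_def)
    next
      case False
      then have "c = (\<not> b)" by auto
      then show ?thesis using w Cons Y_other[OF t(1), of b] C_G[OF w(2)] by (simp add: split_form_def split_forms_def)
    qed
  qed
qed

lemma join_split: assumes "w \<in> normal_forms" shows "join_form b (split_form b w) = w"
proof -
  obtain h ts c where w: "w = (h, ts)" "h \<in> C" "alternating Y c ts" using assms by (auto simp: normal_forms_def)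
  interpret g: group "G b" by (rule G_group)
  show ?thesis
  proof (cases "ts \<noteq> [] \<and> hd ts \<in> carrier (G b)")
    case False
    then have "split_form b w = w" using w unfolding split_form_def by (simp only: fst_conv snd_conv if_False)
    then show ?thesis using w by (simp add: join_form_def)
  next
    case True
    then obtain t us where ts: "ts = t # us" by (cases ts) auto
    then have t: "t \<in> Y b" using w(3) True Y_other[of t c b] by auto
    have tG: "t \<in> carrier (G b)" "t \<notin> C" "rep b t = t" using t by (auto simp: Y_def)
    have hG: "h \<in> carrier (G b)" using w(2) C_G by blast
    have r: "rep b (h \<otimes>\<^bsub>G b\<^esub> t) = t" using rep_mult[OF w(2) tG(1)] tG by simp
    have "h \<otimes>\<^bsub>G b\<^esub> t \<notin> C" using C_absorb(1)[OF w(2) tG(1)] tG(2) by blast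
    moreover have "hpart b (h \<otimes>\<^bsub>G b\<^esub> t) = h" unfolding hpart_def r using tG(1) hG by (simp add: g.m_assoc)
    ultimately show ?thesis using w ts tG(1) r by (simp add: split_form_def join_form_def)
  qed
qed

lemma split_join: assumes "w \<in> split_forms b"
  shows "join_form b w \<in> normal_forms" "split_form b (join_form b w) = w"
proof -
  obtain x ts where w: "w = (x, ts)" "x \<in> carrier (G b)" "alternating Y (\<not> b) ts" using assms by (auto simp: split_forms_def)
  have hd: "\<not> (ts \<noteq> [] \<and> hd ts \<in> carrier (G b))" using w(3) Y_other[of "hd ts" "\<not> b" b] by (cases ts) auto
  show "join_form b w \<in> normal_forms"
  proof (cases "x \<in> C")
    case True
    then show ?thesis using w unfolding join_form_def normal_forms_def by auto
  next
    case False
    then have "alternating Y b (rep b x # ts)" using w(3) rep_Y[OF w(2)] by simp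
    then show ?thesis using w(1) False rep(2)[OF w(2)] unfolding join_form_def normal_forms_def by auto
  qed
  show "split_form b (join_form b w) = w"
    using w hd rep[OF w(2)] by (auto simp: join_form_def split_form_def)
qed

lemma act_in: assumes "w \<in> normal_forms" "k \<in> carrier (G b)"
  shows "(k \<otimes>\<^bsub>G b\<^esub> fst (split_form b w), snd (split_form b w)) \<in> split_forms b" "act b k w \<in> normal_forms"
proof -
  interpret g: group "G b" by (rule G_group)
  show 1: "(k \<otimes>\<^bsub>G b\<^esub> fst (split_form b w), snd (split_form b w)) \<in> split_forms b"
    using split_form_in[OF assms(1), of b] assms(2) by (auto simp: split_forms_def)
  show "act b k w \<in> normal_forms" using split_join(1)[OF 1] assms(1) by (simp add: act_def)
qed

lemma act_mult: assumes "k \<in> carrier (G b)" "k' \<in> carrier (G b)"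
  shows "act b (k \<otimes>\<^bsub>G b\<^esub> k') = act b k \<circ> act b k'"
proof
  interpret g: group "G b" by (rule G_group)
  fix w show "act b (k \<otimes>\<^bsub>G b\<^esub> k') w = (act b k \<circ> act b k') w"
  proof (cases "w \<in> normal_forms")
    case True
    have s: "fst (split_form b w) \<in> carrier (G b)" using split_form_in[OF True, of b] by (auto simp: split_forms_def)
    have "split_form b (act b k' w) = (k' \<otimes>\<^bsub>G b\<^esub> fst (split_form b w), snd (split_form b w))"
      using split_join(2)[OF act_in(1)[OF True assms(2)]] True by (simp add: act_def)
    then show ?thesis using True act_in(2)[OF True assms(2)] assms s by (simp add: act_def[of b k] act_def[of b "k \<otimes>\<^bsub>G b\<^esub> k'"] g.m_assoc)
  qed (simp add: act_def)
qed

lemma act_one: "act b \<one>\<^bsub>G b\<^esub> = id"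
proof
  interpret g: group "G b" by (rule G_group)
  fix w show "act b \<one>\<^bsub>G b\<^esub> w = id w"
  proof (cases "w \<in> normal_forms")
    case True
    have "fst (split_form b w) \<in> carrier (G b)" using split_form_in[OF True, of b] by (auto simp: split_forms_def)
    then show ?thesis using True join_split[OF True, of b] by (simp add: act_def)
  qed (simp add: act_def)
qed

lemma act_bij: assumes "k \<in> carrier (G b)" shows "bij (act b k)"
proof (rule o_bij)
  interpret g: group "G b" by (rule G_group)
  show "act b (inv\<^bsub>G b\<^esub> k) \<circ> act b k = id" "act b k \<circ> act b (inv\<^bsub>G b\<^esub> k) = id"
    using act_mult[of "inv\<^bsub>G b\<^esub> k" b k] act_mult[of k b "inv\<^bsub>G b\<^esub> k"] assms act_one[of b] by simp_all
qed

lemma act_C: assumes h: "h \<in> C" shows "act b h w = (if w \<in> normal_forms then (h \<otimes>\<^bsub>A\<^esub> fst w, snd w) else w)"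
proof (cases "w \<in> normal_forms")
  case True
  interpret g: group "G b" by (rule G_group)
  obtain x ts c where w: "w = (x, ts)" "x \<in> C" "alternating Y c ts" using True by (auto simp: normal_forms_def)
  have hx: "h \<otimes>\<^bsub>G b\<^esub> x = h \<otimes>\<^bsub>A\<^esub> x" using C_mult[OF h w(2)] .
  have xh: "h \<otimes>\<^bsub>G b\<^esub> x \<in> C" "x \<in> carrier (G b)" "h \<in> carrier (G b)"
    using subgroup.m_closed[OF C_sub h w(2)] h w(2) C_G by auto
  have nf: "(h \<otimes>\<^bsub>G b\<^esub> x, ts) \<in> normal_forms" using xh w by (auto simp: normal_forms_def)
  have "(h \<otimes>\<^bsub>G b\<^esub> fst (split_form b w), snd (split_form b w)) = split_form b (h \<otimes>\<^bsub>G b\<^esub> x, ts)"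
    using w xh by (auto simp: split_form_def g.m_assoc)
  then have "act b h w = (h \<otimes>\<^bsub>G b\<^esub> x, ts)" using True join_split[OF nf, of b] by (simp add: act_def)
  then show ?thesis using True w hx by simp
qed (simp add: act_def)

definition emb :: "bool \<Rightarrow> 'u \<Rightarrow> ('u \<times> 'u list) bijection" where
  "emb b k = Abs_bijection (act b k)"

lemma Rep_emb: "k \<in> carrier (G b) \<Longrightarrow> Rep_bijection (emb b k) = act b k"
  by (simp add: emb_def Abs_bijection_inverse act_bij)

lemma emb_mult: "k \<in> carrier (G b) \<Longrightarrow> k' \<in> carrier (G b) \<Longrightarrow> emb b (k \<otimes>\<^bsub>G b\<^esub> k') = emb b k + emb b k'"
  using G_group[of b] by (simp add: Rep_bijection_inject[symmetric] Rep_plus Rep_emb act_mult group.is_monoid monoid.m_closed)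

lemma emb_one: "emb b \<one>\<^bsub>A\<^esub> = 0"
  using act_one[of b] by (simp add: one_G emb_def zero_bijection_def)

lemma emb_inv: assumes "k \<in> carrier (G b)" shows "emb b (inv\<^bsub>G b\<^esub> k) = - emb b k"
proof -
  interpret g: group "G b" by (rule G_group)
  have "emb b (inv\<^bsub>G b\<^esub> k) + emb b k = 0" using emb_mult[of "inv\<^bsub>G b\<^esub> k" b k] assms emb_one[of b] one_G by simp
  then show ?thesis by (simp add: eq_neg_iff_add_eq_0)
qed

lemma emb_C: "h \<in> C \<Longrightarrow> emb b h = emb c h"
proof -
  assume h: "h \<in> C"
  have "act b h = act c h" by (rule ext) (simp only: act_C[OF h])
  then show ?thesis by (simp add: emb_def)
qed

definition w0 :: "'u \<times> 'u list" where "w0 = (\<one>\<^bsub>A\<^esub>, [])"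

lemma w0: "w0 \<in> normal_forms" "split_form b w0 = w0"
  using subgroup.one_closed[OF H_sub_A] by (auto simp: w0_def normal_forms_def split_form_def C_def intro: exI[of _ True])

lemma act_w0: assumes "k \<in> carrier (G b)" shows "act b k w0 = join_form b (k, [])"
proof -
  interpret g: group "G b" by (rule G_group)
  have "k \<otimes>\<^bsub>G b\<^esub> \<one>\<^bsub>A\<^esub> = k" using g.r_one[OF assms] unfolding one_G .
  then have "(k \<otimes>\<^bsub>G b\<^esub> fst w0, snd w0) = (k, [])" by (simp add: w0_def)
  then show ?thesis using w0 by (simp only: act_def if_True)
qed

text \<open>The permutations are compared at the base form \<open>w0\<close>, which an element
  carries to its own normal form.\<close>

lemma emb_eq: assumes k: "k \<in> carrier (G b)" "l \<in> carrier (G c)" and e: "emb b k = emb c l"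
  shows "k = l \<and> (b = c \<or> k \<in> C)"
proof -
  have e': "join_form b (k, []) = join_form c (l, [])"
    unfolding act_w0[OF k(1), symmetric] act_w0[OF k(2), symmetric] Rep_emb[OF k(1), symmetric] Rep_emb[OF k(2), symmetric] e ..
  show ?thesis
  proof (cases "b = c")
    case True
    have kl: "(k, []) \<in> split_forms b" "(l, []) \<in> split_forms b" using k True by (auto simp: split_forms_def)
    have "split_form b (join_form b (k, [])) = split_form b (join_form b (l, []))" using e' True by (simp only:)
    then have "(k, [] :: 'u list) = (l, [])" unfolding split_join(2)[OF kl(1)] split_join(2)[OF kl(2)] .
    then show ?thesis using True by simp
  next
    case False
    have "k \<in> C \<and> l \<in> C"
    proof (rule ccontr)
      assume "\<not> ?thesis"
      then have "k \<notin> C \<and> l \<notin> C \<and> rep b k = rep c l" using e' by (auto simp: join_form_def split: if_splits)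
      then show False using rep_Y[OF k(1)] rep_Y[OF k(2)] Y_other[of "rep b k" b c] Y_other[of "rep b k" c c] False by auto
    qed
    then show ?thesis using e' by (simp add: join_form_def)
  qed
qed

definition K :: "('u \<times> 'u list) bijection set" where "K = emb True ` carrier A"
definition L :: "('u \<times> 'u list) bijection set" where "L = emb False ` carrier B"

lemma emb_image: "(if b then K else L) = emb b ` carrier (G b)"
  by (simp add: K_def L_def G_def)

lemma KL_Int: "K \<inter> L = emb b ` C"
proof -
  have "K \<inter> L \<subseteq> emb True ` C"
  proof
    fix x assume "x \<in> K \<inter> L"
    then obtain k l where kl: "x = emb True k" "x = emb False l" "k \<in> carrier (G True)" "l \<in> carrier (G False)"
      unfolding K_def L_def G_def by fastforce
    then have "emb True k = emb False l" by simp
    then show "x \<in> emb True ` C" using emb_eq[OF kl(3,4)] kl(1) by blast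
  qed
  moreover have "emb True ` C \<subseteq> K \<inter> L"
  proof
    fix x assume "x \<in> emb True ` C"
    then obtain h where h: "x = emb True h" "h \<in> C" by blast
    have "x = emb False h" using h emb_C by metis
    moreover have "h \<in> carrier A" "h \<in> carrier B" using h(2) by (simp_all add: C_def)
    ultimately show "x \<in> K \<inter> L" using h(1) unfolding K_def L_def by blast
  qed
  ultimately show ?thesis using emb_C[of _ b True] unfolding image_def by fastforce
qed

lemma emb_sub: "add_subgroup (emb b ` carrier (G b))"
proof -
  interpret g: group "G b" by (rule G_group)
  show ?thesis unfolding add_subgroup_def
    using emb_mult[symmetric] emb_inv[symmetric] emb_one[of b, symmetric] one_G[of b] g.one_closed
    by (auto intro!: imageI)
qed

text \<open>Van der Waerden's argument: an alternating word carries \<open>w0\<close> to a normal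
  form with as many syllables, so a nonempty one is not the identity.\<close>

lemma act_alternating:
  assumes "alternating (\<lambda>b. emb b ` carrier (G b) - emb b ` C) b ws"
  shows "\<exists>h ts. Rep_bijection (sum_list ws) w0 = (h, ts) \<and> h \<in> C \<and> alternating Y b ts \<and> length ts = length ws"
  using assms
proof (induction ws arbitrary: b)
  case Nil
  then show ?case using subgroup.one_closed[OF H_sub_A] by (simp add: Rep_zero w0_def C_def)
next
  case (Cons s ws)
  interpret g: group "G b" by (rule G_group)
  obtain h ts where IH: "Rep_bijection (sum_list ws) w0 = (h, ts)" "h \<in> C" "alternating Y (\<not> b) ts" "length ts = length ws"
    using Cons.IH[of "\<not> b"] Cons.prems by fastforce
  obtain k where k: "s = emb b k" "k \<in> carrier (G b)" "k \<notin> C" using Cons.prems by auto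
  have nf: "(h, ts) \<in> normal_forms" using IH by (auto simp: normal_forms_def)
  have hd: "\<not> (ts \<noteq> [] \<and> hd ts \<in> carrier (G b))" using IH(3) Y_other[of "hd ts" "\<not> b" b] by (cases ts) auto
  then have sp: "split_form b (h, ts) = (h, ts)" by (auto simp: split_form_def)
  have kh: "k \<otimes>\<^bsub>G b\<^esub> h \<in> carrier (G b)" "k \<otimes>\<^bsub>G b\<^esub> h \<notin> C" using k IH(2) C_G C_absorb(2)[OF IH(2) k(2)] by auto
  have "Rep_bijection (sum_list (s # ws)) w0 = act b k (h, ts)"
    using IH(1) k by (simp add: Rep_plus Rep_emb)
  also have "\<dots> = (hpart b (k \<otimes>\<^bsub>G b\<^esub> h), rep b (k \<otimes>\<^bsub>G b\<^esub> h) # ts)"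
    using nf sp kh by (simp add: act_def join_form_def)
  finally show ?case using rep(2)[OF kh(1)] rep_Y[OF kh] IH by auto
qed

lemma amalgam: "amalgam K L"
proof
  show "add_subgroup K" "add_subgroup L" using emb_sub[of True] emb_sub[of False] by (simp_all add: K_def L_def G_def)
  fix b and ws :: "('u \<times> 'u list) bijection list"
  assume a: "alternating (\<lambda>b. (if b then K else L) - K \<inter> L) b ws" "ws \<noteq> []"
  have "(\<lambda>b. (if b then K else L) - K \<inter> L) = (\<lambda>b. emb b ` carrier (G b) - emb b ` C)"
    using KL_Int by (simp only: emb_image)
  then obtain h ts where "Rep_bijection (sum_list ws) w0 = (h, ts)" "length ts = length ws"
    using act_alternating[of b ws] a(1) by auto
  then show "sum_list ws \<noteq> 0" using a(2) by (auto simp: Rep_zero w0_def)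
qed

end

text \<open>Literal inclusion of carriers instead of an embedding, so that unions of stages need no
  transition maps.\<close>

definition subext :: "'u monoid \<Rightarrow> 'u monoid \<Rightarrow> bool" where
  "subext G M \<longleftrightarrow> carrier G \<subseteq> carrier M \<and> \<one>\<^bsub>G\<^esub> = \<one>\<^bsub>M\<^esub> \<and>
    (\<forall>x\<in>carrier G. \<forall>y\<in>carrier G. x \<otimes>\<^bsub>G\<^esub> y = x \<otimes>\<^bsub>M\<^esub> y)"

definition malnormal_in :: "'u set \<Rightarrow> 'u monoid \<Rightarrow> bool" where
  "malnormal_in S M \<longleftrightarrow> (\<forall>g\<in>carrier M - S. \<forall>h\<in>S. inv\<^bsub>M\<^esub> g \<otimes>\<^bsub>M\<^esub> h \<otimes>\<^bsub>M\<^esub> g \<in> S \<longrightarrow> h = \<one>\<^bsub>M\<^esub>)"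

definition relator_block :: "'u \<Rightarrow> 'u \<Rightarrow> 'u \<Rightarrow> 'u \<Rightarrow> nat \<Rightarrow> 'u list" where
  "relator_block a y b1 b2 t = y # replicate (t div 6 + 1) a @
    (if t mod 6 < 3 then [] else if t mod 6 < 5 then [b1] else [b2])"

text \<open>\<open>rel_word\<close> ends in \<open>a - h\<close>; ending in \<open>a\<close> instead
  makes the list a positive word whose value is \<open>rel_word\<close> followed by
  \<open>h\<close>, that is, \<open>h\<close> in the quotient.\<close>

definition relator_list :: "nat \<Rightarrow> 'u \<Rightarrow> 'u \<Rightarrow> 'u \<Rightarrow> 'u \<Rightarrow> 'u list" where
  "relator_list N a y b1 b2 = concat (map (relator_block a y b1 b2) [0..<6 * N]) @ [y, a]"

lemma zmult_replicate: "sum_list (replicate n g) = zmult (int n) (g :: 'g::group_add)"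
  using zmult_Suc_left[of "int _" g] by (induction n) (simp_all add: add.commute[of 1 "int _"])

lemma rel_word_eq:
  fixes e :: "'u \<Rightarrow> 'g::group_add"
  shows "sum_list (map e (relator_list N a y b1 b2)) = rel_word N (e a, e y, e b1, e b2, h) + h"
proof -
  let ?\<tau> = "(e a, e y, e b1, e b2, h)"
  have S: "rel_prefix N \<tau> (Suc k) = rel_prefix N \<tau> k + rel_step N \<tau> (int k)" for \<tau> :: "'g relator" and k
    by (simp add: rel_prefix_def)
  have two: "rel_prefix N ?\<tau> (2 * t + 2) = rel_prefix N ?\<tau> (2 * t) + e y + rel_u N ?\<tau> t" if "t \<le> 6 * N" for t
  proof -
    have "rel_step N ?\<tau> (int (2 * t)) = e y" by (simp add: rel_step_def)
    moreover have "rel_step N ?\<tau> (int (Suc (2 * t))) = rel_u N ?\<tau> t"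
    proof -
      have d: "int (Suc (2 * t)) div 2 = int t" by simp
      have "int t mod int (6 * N + 1) = int t" using that by (intro mod_pos_pos_trivial) auto
      then have "nat (int (Suc (2 * t)) div 2 mod int (6 * N + 1)) = t" unfolding d by (simp only: nat_int)
      then show ?thesis unfolding rel_step_def rel_uz_def by simp
    qed
    ultimately show ?thesis using S[of ?\<tau> "2 * t"] S[of ?\<tau> "Suc (2 * t)"] by simp
  qed
  have "sum_list (map e (concat (map (relator_block a y b1 b2) [0..<t]))) = rel_prefix N ?\<tau> (2 * t)" if "t \<le> 6 * N" for t
    using that
  proof (induction t)
    case 0
    show ?case by (simp add: rel_prefix_def)
  next
    case (Suc t)
    have "sum_list (map e (relator_block a y b1 b2 t)) = e y + rel_u N ?\<tau> t"
      using Suc.prems zmult_replicate[of "t div 6 + 1" "e a"]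
      by (simp add: relator_block_def add.assoc add.commute[of 1 "int _"] del: replicate_Suc)
    then show ?case using Suc two[of t] by (simp add: add.assoc)
  qed
  from this[of "6 * N"] have "sum_list (map e (relator_list N a y b1 b2)) = rel_prefix N ?\<tau> (2 * (6 * N)) + e y + e a"
    by (simp add: relator_list_def add.assoc)
  moreover have "rel_word N ?\<tau> = rel_prefix N ?\<tau> (2 * (6 * N)) + e y + (e a - h)"
    using two[of "6 * N"] by (simp add: rel_word_def)
  ultimately show ?thesis by (simp add: add.assoc)
qed

locale small_cancellation = group_amalgam A B for A B :: "'u monoid" +
  fixes R :: "('u \<times> 'u \<times> 'u \<times> 'u \<times> 'u) set" and N :: nat
  assumes N: "N \<ge> 200"
    and tf: "torsion_free A" "torsion_free B"
    and mal: "malnormal_in (carrier A \<inter> carrier B) A" "malnormal_in (carrier A \<inter> carrier B) B"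
    and R: "\<And>a y b1 b2 h. (a, y, b1, b2, h) \<in> R \<Longrightarrow> a \<in> carrier A - carrier B \<and> y \<in> carrier B - carrier A \<and>
      b1 \<in> carrier A \<inter> carrier B \<and> b2 \<in> carrier A \<inter> carrier B \<and> h \<in> carrier A \<inter> carrier B \<and> b1 \<noteq> \<one>\<^bsub>A\<^esub> \<and> b1 \<noteq> b2"
    and R_conj: "\<And>a y b1 b2 h a' y' b1' b2' h' c. c \<in> carrier A \<inter> carrier B \<Longrightarrow> (a, y, b1, b2, h) \<in> R \<Longrightarrow>
      (a', y', b1', b2', h') \<in> R \<Longrightarrow> a' = inv\<^bsub>A\<^esub> c \<otimes>\<^bsub>A\<^esub> a \<otimes>\<^bsub>A\<^esub> c \<Longrightarrow> y' = inv\<^bsub>B\<^esub> c \<otimes>\<^bsub>B\<^esub> y \<otimes>\<^bsub>B\<^esub> c \<Longrightarrow>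
      b1' = inv\<^bsub>A\<^esub> c \<otimes>\<^bsub>A\<^esub> b1 \<otimes>\<^bsub>A\<^esub> c \<Longrightarrow> b2' = inv\<^bsub>A\<^esub> c \<otimes>\<^bsub>A\<^esub> b2 \<otimes>\<^bsub>A\<^esub> c \<Longrightarrow>
      h' = inv\<^bsub>A\<^esub> c \<otimes>\<^bsub>A\<^esub> h \<otimes>\<^bsub>A\<^esub> c"
begin

lemma mal_G: assumes "g \<in> carrier (G b) - C" "h \<in> C" "inv\<^bsub>G b\<^esub> g \<otimes>\<^bsub>G b\<^esub> h \<otimes>\<^bsub>G b\<^esub> g \<in> C" shows "h = \<one>\<^bsub>A\<^esub>"
  using assms mal one_eq unfolding malnormal_in_def G_def C_def by (cases b) auto

lemma tf_G: assumes "g \<in> carrier (G b)" "n > 0" "g [^]\<^bsub>G b\<^esub> (n :: nat) = \<one>\<^bsub>A\<^esub>" shows "g = \<one>\<^bsub>A\<^esub>"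
  using assms tf one_eq unfolding torsion_free_def G_def by (cases b) auto

lemma emb_conj: assumes "g \<in> carrier (G b)" "h \<in> carrier (G b)"
  shows "- emb b g + emb b h + emb b g = emb b (inv\<^bsub>G b\<^esub> g \<otimes>\<^bsub>G b\<^esub> h \<otimes>\<^bsub>G b\<^esub> g)"
proof -
  interpret g: group "G b" by (rule G_group)
  show ?thesis using assms by (simp add: emb_mult emb_inv)
qed

lemma emb_pow: assumes "g \<in> carrier (G b)" shows "zmult (int n) (emb b g) = emb b (g [^]\<^bsub>G b\<^esub> n)"
proof (induction n)
  case 0
  then show ?case using emb_one one_G by simp
next
  case (Suc n)
  interpret g: group "G b" by (rule G_group)
  have "zmult (int (Suc n)) (emb b g) = zmult (int n) (emb b g) + zmult 1 (emb b g)"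
    using zmult_add[of "int n" 1 "emb b g"] by (simp add: add.commute del: zmult_1)
  then show ?case using Suc assms by (simp add: emb_mult)
qed

definition R' :: "(('u \<times> 'u list) bijection) relator set" where
  "R' = (\<lambda>(a, y, b1, b2, h). (emb True a, emb False y, emb True b1, emb True b2, emb True h)) ` R"

lemma relators: "relators K L R' N"
proof (intro relators.intro amalgam relators_axioms.intro N)
  show "h = 0" if s: "s \<in> (if b then K else L) - K \<inter> L" and h: "h \<in> K \<inter> L" and m: "- s + h + s \<in> K \<inter> L" for b s h
  proof -
    obtain g where g: "s = emb b g" "g \<in> carrier (G b)" "g \<notin> C" using s KL_Int[of b] unfolding emb_image by blast
    obtain x where x: "h = emb b x" "x \<in> C" using h KL_Int[of b] by blast
    interpret g: group "G b" by (rule G_group)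
    have xG: "x \<in> carrier (G b)" using x C_G by blast
    have "emb b (inv\<^bsub>G b\<^esub> g \<otimes>\<^bsub>G b\<^esub> x \<otimes>\<^bsub>G b\<^esub> g) \<in> emb b ` C"
      using m emb_conj[OF g(2) xG] KL_Int[of b] g x by simp
    then obtain z where z: "emb b (inv\<^bsub>G b\<^esub> g \<otimes>\<^bsub>G b\<^esub> x \<otimes>\<^bsub>G b\<^esub> g) = emb b z" "z \<in> C" by blast
    then have "inv\<^bsub>G b\<^esub> g \<otimes>\<^bsub>G b\<^esub> x \<otimes>\<^bsub>G b\<^esub> g = z" using emb_eq[OF _ C_G z(1)] g(2) xG by simp
    then have "x = \<one>\<^bsub>A\<^esub>" using mal_G[of g b x] g x z by simp
    then show "h = 0" using x emb_one by simp
  qed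
  show "s = 0" if s: "s \<in> (if b then K else L)" and k: "k \<noteq> 0" "zmult k s = 0" for b s k
  proof -
    obtain g where g: "s = emb b g" "g \<in> carrier (G b)" using s unfolding emb_image by blast
    interpret g: group "G b" by (rule G_group)
    define n where "n = nat \<bar>k\<bar>"
    have n: "n > 0" "k = int n \<or> k = - int n" using k(1) by (auto simp: n_def)
    then have "zmult (int n) s = 0" using k(2) zmult_minus[of "int n" s] by (auto simp: neg_equal_0_iff_equal)
    then have "emb b (g [^]\<^bsub>G b\<^esub> n) = emb b \<one>\<^bsub>A\<^esub>" using emb_pow[OF g(2)] g emb_one by metis
    then have "g [^]\<^bsub>G b\<^esub> n = \<one>\<^bsub>A\<^esub>" using emb_eq[of "g [^]\<^bsub>G b\<^esub> n" b "\<one>\<^bsub>A\<^esub>" b] g(2) one_G[of b] g.one_closed by simp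
    then show "s = 0" using tf_G[OF g(2) n(1)] g emb_one by simp
  qed
  show "a \<in> K - K \<inter> L \<and> y \<in> L - K \<inter> L \<and> b1 \<in> K \<inter> L \<and> b2 \<in> K \<inter> L \<and> h \<in> K \<inter> L \<and> b1 \<noteq> 0 \<and> b1 \<noteq> b2"
    if r0: "(a, y, b1, b2, h) \<in> R'" for a y b1 b2 h
  proof -
    obtain a0 y0 c1 c2 h0 where r: "(a0, y0, c1, c2, h0) \<in> R" "a = emb True a0" "y = emb False y0" "b1 = emb True c1"
      "b2 = emb True c2" "h = emb True h0"
      using r0 unfolding R'_def by fast
    note r' = R[OF r(1)]
    have aG: "a0 \<in> carrier (G True)" "y0 \<in> carrier (G False)" "a0 \<notin> C" "y0 \<notin> C" "c1 \<in> C" "c2 \<in> C" "h0 \<in> C"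
      using r' by (auto simp: G_def C_def)
    have CA: "x \<in> carrier A" "x \<in> carrier B" if "x \<in> C" for x using that by (simp_all add: C_def)
    have aK: "emb True x \<in> K" if "x \<in> carrier A" for x using that unfolding K_def by blast
    have yL: "emb False x \<in> L" if "x \<in> carrier B" for x using that unfolding L_def by blast
    have CKL: "emb True x \<in> K \<inter> L" if "x \<in> C" for x using that unfolding KL_Int[of True] by blast
    have out: "emb b x \<notin> K \<inter> L" if x: "x \<in> carrier (G b)" "x \<notin> C" for b x
    proof
      assume "emb b x \<in> K \<inter> L"
      then obtain z where "emb b x = emb b z" "z \<in> C" unfolding KL_Int[of b] by blast
      then show False using emb_eq[OF x(1) C_G[of z b]] x(2) by blast
    qed
    have o: "\<one>\<^bsub>A\<^esub> \<in> C" using subgroup.one_closed[OF H_sub_A] by (simp add: C_def)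
    have "b1 \<noteq> 0" using emb_eq[OF C_G[OF aG(5)] C_G[OF o], of True True] emb_one[of True] r(4) r' by metis
    moreover have "b1 \<noteq> b2" using emb_eq[OF C_G[OF aG(5)] C_G[OF aG(6)], of True True] r(4,5) r' by metis
    moreover have "a \<in> K - K \<inter> L" using aK[of a0] out[OF aG(1,3)] r(2) r' by blast
    moreover have "y \<in> L - K \<inter> L" using yL[of y0] out[OF aG(2,4)] r(3) r' by blast
    ultimately show ?thesis using CKL[OF aG(5)] CKL[OF aG(6)] CKL[OF aG(7)] r(4-6) by blast
  qed
  show "h' = - c + h + c" if c: "c \<in> K \<inter> L" and 1: "(a, y, b1, b2, h) \<in> R'"
    and 2: "(- c + a + c, - c + y + c, - c + b1 + c, - c + b2 + c, h') \<in> R'" for c a y b1 b2 h h'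
  proof -
    obtain c0 where c0: "c = emb True c0" "c0 \<in> C" using c KL_Int[of True] by blast
    have c0': "c = emb False c0" using c0 emb_C by metis
    obtain a0 y0 d1 d2 h0 where r: "(a0, y0, d1, d2, h0) \<in> R" "a = emb True a0" "y = emb False y0" "b1 = emb True d1"
      "b2 = emb True d2" "h = emb True h0"
      using 1 unfolding R'_def by fast
    obtain a1 y1 e1 e2 h1 where q: "(a1, y1, e1, e2, h1) \<in> R" "- c + a + c = emb True a1" "- c + y + c = emb False y1"
      "- c + b1 + c = emb True e1" "- c + b2 + c = emb True e2" "h' = emb True h1"
      using 2 unfolding R'_def by fast
    have G: "x \<in> carrier (G True)" if "x \<in> carrier A" for x using that by (simp add: G_def)
    have conj: "z = inv\<^bsub>A\<^esub> c0 \<otimes>\<^bsub>A\<^esub> x \<otimes>\<^bsub>A\<^esub> c0" if "x \<in> carrier A" "z \<in> carrier A" "- c + emb True x + c = emb True z" for x z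
    proof -
      interpret A: group A by (rule A)
      have cA: "c0 \<in> carrier A" using c0 by (simp add: C_def)
      have "emb True z = emb True (inv\<^bsub>A\<^esub> c0 \<otimes>\<^bsub>A\<^esub> x \<otimes>\<^bsub>A\<^esub> c0)"
        using that(3) emb_conj[OF G[OF cA] G[OF that(1)]] unfolding c0(1) by (simp add: G_def)
      then show ?thesis using emb_eq[of z True _ True] G that cA by simp
    qed
    have conjB: "z = inv\<^bsub>B\<^esub> c0 \<otimes>\<^bsub>B\<^esub> x \<otimes>\<^bsub>B\<^esub> c0" if "x \<in> carrier B" "z \<in> carrier B" "- c + emb False x + c = emb False z" for x z
    proof -
      interpret B: group B by (rule B)
      have GB: "x \<in> carrier (G False)" if "x \<in> carrier B" for x using that by (simp add: G_def)
      have cB: "c0 \<in> carrier B" using c0 by (simp add: C_def)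
      have "emb False z = emb False (inv\<^bsub>B\<^esub> c0 \<otimes>\<^bsub>B\<^esub> x \<otimes>\<^bsub>B\<^esub> c0)"
        using that(3) emb_conj[OF GB[OF cB] GB[OF that(1)]] unfolding c0' by (simp add: G_def)
      then show ?thesis using emb_eq[of z False _ False] GB that cB by simp
    qed
    note Rr = R[OF r(1)] and Rq = R[OF q(1)]
    have "h1 = inv\<^bsub>A\<^esub> c0 \<otimes>\<^bsub>A\<^esub> h0 \<otimes>\<^bsub>A\<^esub> c0"
    proof (rule R_conj[OF _ r(1) q(1)])
      show "c0 \<in> carrier A \<inter> carrier B" using c0 by (simp add: C_def)
      show "a1 = inv\<^bsub>A\<^esub> c0 \<otimes>\<^bsub>A\<^esub> a0 \<otimes>\<^bsub>A\<^esub> c0" using conj Rr Rq q(2) r(2) by blast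
      show "y1 = inv\<^bsub>B\<^esub> c0 \<otimes>\<^bsub>B\<^esub> y0 \<otimes>\<^bsub>B\<^esub> c0" using conjB Rr Rq q(3) r(3) by blast
      show "e1 = inv\<^bsub>A\<^esub> c0 \<otimes>\<^bsub>A\<^esub> d1 \<otimes>\<^bsub>A\<^esub> c0" using conj Rr Rq q(4) r(4) by blast
      show "e2 = inv\<^bsub>A\<^esub> c0 \<otimes>\<^bsub>A\<^esub> d2 \<otimes>\<^bsub>A\<^esub> c0" using conj Rr Rq q(5) r(5) by blast
    qed
    then show ?thesis using emb_conj[of c0 True h0] C_G[OF c0(2), of True] G Rr unfolding q(6) r(6) c0(1) by (simp add: G_def)
  qed
qed

end

lemma subext_foldr:
  assumes G: "group G" "subext G M" and us: "us \<in> lists (carrier G)"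
  shows "foldr (mult G) us \<one>\<^bsub>G\<^esub> \<in> carrier G \<and> foldr (mult M) us \<one>\<^bsub>M\<^esub> = foldr (mult G) us \<one>\<^bsub>G\<^esub>"
  using us
proof (induction us)
  case Nil
  then show ?case using G(2) monoid.one_closed[OF group.is_monoid[OF G(1)]] by (simp add: subext_def)
next
  case (Cons x us)
  let ?f = "foldr (mult G) us \<one>\<^bsub>G\<^esub>"
  have f: "?f \<in> carrier G" "x \<in> carrier G" "foldr (mult M) us \<one>\<^bsub>M\<^esub> = ?f" using Cons by simp_all
  moreover have "x \<otimes>\<^bsub>G\<^esub> ?f \<in> carrier G" using monoid.m_closed[OF group.is_monoid[OF G(1)]] f by blast
  moreover have "x \<otimes>\<^bsub>G\<^esub> ?f = x \<otimes>\<^bsub>M\<^esub> ?f" using G(2) f unfolding subext_def by blast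
  ultimately show ?case by simp
qed

text \<open>Over trivial \<open>H\<close> the amalgam is a free product, and erasing the letters of
  \<open>L\<close> is its retraction onto \<open>K\<close>. On words: a nonempty word with sum 0 is
  not alternating, so it has a letter 0 or two neighbours from one factor; shortening it there does
  not affect the erased sum.\<close>

lemma (in amalgam) erase_syllables:
  assumes H: "H = {0}" and "set ws \<subseteq> K \<union> L" "sum_list ws = 0"
  shows "sum_list (map (\<lambda>x. if x \<in> K then x else 0) ws) = 0"
  using assms(2,3)
proof (induction ws rule: length_induct)
  case (1 ws)
  let ?r = "\<lambda>x. if x \<in> K then x else 0"
  have rL: "?r x = 0" if "x \<in> L" for x using that H unfolding H_def by auto
  have merge: "?r (x + y) = ?r x + ?r y" if xy: "x \<in> X b" "y \<in> X b" for b x y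
  proof (cases b)
    case True
    then show ?thesis using xy add_subgroupD[OF K] by (simp add: X_def)
  next
    case False
    then have "x \<in> L" "y \<in> L" "x + y \<in> L" using xy add_subgroupD[OF L] by (simp_all add: X_def)
    then show ?thesis using rL by (simp only: add_0_right)
  qed
  have X: "\<exists>b. x \<in> X b" if "x \<in> set ws" for x using that 1(2) by (auto simp: X_def intro: exI[of _ True] exI[of _ False])
  show ?case
  proof (cases "0 \<in> set ws")
    case True
    then obtain us vs where w: "ws = us @ 0 # vs" by (metis split_list)
    have "sum_list (map ?r (us @ vs)) = 0" using 1 w by (intro 1(1)[rule_format]) auto
    then show ?thesis unfolding w by simp
  next
    case nz: False
    have "(\<exists>b. alt b ws) \<or> (\<exists>us x y vs b. ws = us @ x # y # vs \<and> x \<in> X b \<and> y \<in> X b)"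
      using X nz
    proof (induction ws)
      case Nil
      then show ?case by (auto simp: alt_def)
    next
      case (Cons x ws)
      then obtain b where b: "x \<in> X b" by auto
      have "(\<exists>c. alt c ws) \<or> (\<exists>us x y vs b. ws = us @ x # y # vs \<and> x \<in> X b \<and> y \<in> X b)" using Cons by simp
      then show ?case
      proof (elim disjE exE conjE)
        fix c assume c: "alt c ws"
        show ?thesis
        proof (cases ws)
          case Nil
          then have "alt b (x # ws)" using b Cons.prems H by (auto simp: alt_def)
          then show ?thesis by blast
        next
          case (Cons y vs)
          then have y: "y \<in> X c" using c by (auto simp: alt_def)
          show ?thesis
          proof (cases "b = c")
            case True
            then have "x # ws = [] @ x # y # vs" "x \<in> X c" using b Cons by simp_all
            then show ?thesis using y by blast
          next
            case False
            then have "c = (\<not> b)" by auto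
            then have "alt b (x # ws)" using b Cons.prems H c by (auto simp: alt_def)
            then show ?thesis by blast
          qed
        qed
      next
        fix us x' y vs d assume "ws = us @ x' # y # vs" "x' \<in> X d" "y \<in> X d"
        then have "x # ws = (x # us) @ x' # y # vs" "x' \<in> X d" "y \<in> X d" by simp_all
        then show ?thesis by blast
      qed
    qed
    then show ?thesis
    proof (elim disjE exE conjE)
      fix b assume "alt b ws"
      then show ?thesis using alt_nonzero[of b ws] 1(3) by (cases ws) auto
    next
      fix us x y vs b assume w: "ws = us @ x # y # vs" and xy: "x \<in> X b" "y \<in> X b"
      have "x + y \<in> K \<union> L" using add_subgroupD(2)[OF X_sub xy] by (auto simp: X_def split: if_splits)
      then have "sum_list (map ?r (us @ (x + y) # vs)) = 0"
        using 1(2,3) w by (intro 1(1)[rule_format]) (auto simp: add.assoc)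
      moreover have "sum_list (map ?r ws) = sum_list (map ?r (us @ (x + y) # vs))"
        unfolding w using merge[OF xy] by (simp only: map_append list.map sum_list.append sum_list.Cons add.assoc)
      ultimately show ?thesis by simp
    qed
  qed
qed

text \<open>The quotient is realised on the values of a labelling \<open>q\<close> that separates
  exactly the cosets; this allows the names of its elements to be prescribed.\<close>

lemma quotient_group:
  fixes P N :: "'g::group_add set" and q :: "'g \<Rightarrow> 'u"
  assumes P: "add_subgroup P" and N: "add_subgroup N" "N \<subseteq> P" "\<And>g x. g \<in> P \<Longrightarrow> x \<in> N \<Longrightarrow> - g + x + g \<in> N"
    and q: "\<And>g h. g \<in> P \<Longrightarrow> h \<in> P \<Longrightarrow> q g = q h \<longleftrightarrow> - g + h \<in> N"
  obtains M :: "'u monoid" where "group M" "carrier M = q ` P" "\<And>g h. g \<in> P \<Longrightarrow> h \<in> P \<Longrightarrow> q g \<otimes>\<^bsub>M\<^esub> q h = q (g + h)"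
    "\<one>\<^bsub>M\<^esub> = q 0" "\<And>g. g \<in> P \<Longrightarrow> inv\<^bsub>M\<^esub> (q g) = q (- g)"
proof -
  define rp where "rp = inv_into P q"
  have rp: "rp x \<in> P" "q (rp x) = x" if "x \<in> q ` P" for x
    using that by (simp_all add: rp_def inv_into_into f_inv_into_f)
  define M where "M = \<lparr>carrier = q ` P, mult = \<lambda>x y. q (rp x + rp y), one = q 0\<rparr>"
  note PD = add_subgroupD[OF P]
  have mult: "q g \<otimes>\<^bsub>M\<^esub> q h = q (g + h)" if gh: "g \<in> P" "h \<in> P" for g h
  proof -
    let ?r = "rp (q g)" and ?s = "rp (q h)"
    have r: "?r \<in> P" "?s \<in> P" "q g = q ?r" "q h = q ?s" using rp gh by simp_all
    have "- h + (- g + ?r) + h \<in> N" using q[OF gh(1) r(1)] r(3) gh(2) by (intro N(3)) simp_all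
    moreover have "- h + ?s \<in> N" using q[OF gh(2) r(2)] r(4) by simp
    ultimately have "(- h + (- g + ?r) + h) + (- h + ?s) \<in> N" using add_subgroupD(2)[OF N(1)] by blast
    then have "- (g + h) + (?r + ?s) \<in> N" by (simp only: grp_norm minus_minus add_minus_cancel minus_add_cancel)
    then have "q (g + h) = q (?r + ?s)" using q PD(2) gh r by simp
    then show ?thesis by (simp add: M_def)
  qed
  have one: "\<one>\<^bsub>M\<^esub> = q 0" and car: "carrier M = q ` P" by (simp_all add: M_def)
  have g: "group M"
  proof (rule groupI)
    show "x \<otimes>\<^bsub>M\<^esub> y \<in> carrier M" if "x \<in> carrier M" "y \<in> carrier M" for x y
      using that PD(2) mult unfolding car by auto
    show "\<one>\<^bsub>M\<^esub> \<in> carrier M" using PD(1) by (simp add: one car)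
    show "x \<otimes>\<^bsub>M\<^esub> y \<otimes>\<^bsub>M\<^esub> z = x \<otimes>\<^bsub>M\<^esub> (y \<otimes>\<^bsub>M\<^esub> z)" if "x \<in> carrier M" "y \<in> carrier M" "z \<in> carrier M" for x y z
      using that unfolding car by (auto simp: mult PD(2) add.assoc)
    show "\<one>\<^bsub>M\<^esub> \<otimes>\<^bsub>M\<^esub> x = x" if "x \<in> carrier M" for x using that unfolding car one by (auto simp: mult PD(1))
    show "\<exists>y\<in>carrier M. y \<otimes>\<^bsub>M\<^esub> x = \<one>\<^bsub>M\<^esub>" if x: "x \<in> carrier M" for x
    proof -
      obtain g where g: "g \<in> P" "x = q g" using x unfolding car by blast
      show ?thesis using mult[of "- g" g] PD(3)[OF g(1)] g unfolding car one by (intro bexI[of _ "q (- g)"]) simp_all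
    qed
  qed
  have inv: "inv\<^bsub>M\<^esub> (q g) = q (- g)" if "g \<in> P" for g
    using mult[of "- g" g] PD(3)[OF that] that group.inv_equality[OF g, of "q (- g)" "q g"] car one by simp
  show thesis by (rule that[of M]) (simp_all add: g car mult one inv)
qed

section \<open>The extension as a record on prescribed names\<close>

context small_cancellation
begin

interpretation rl: relators K L "\<lambda>b. if b then K else L" "K \<inter> L" "alternating (\<lambda>b. (if b then K else L) - K \<inter> L)" R' N
  by (rule relators)

definition em :: "'u \<Rightarrow> ('u \<times> 'u list) bijection" where
  "em x = (if x \<in> carrier A then emb True x else emb False x)"

lemma em: "x \<in> carrier (G b) \<Longrightarrow> em x = emb b x"
  using emb_C[of x True False] by (cases b) (auto simp: em_def G_def C_def)

lemma emA: "x \<in> carrier A \<Longrightarrow> em x = emb True x" and emB: "x \<in> carrier B \<Longrightarrow> em x = emb False x"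
  using em[of x True] em[of x False] by (simp_all add: G_def)

lemma em_one: "em \<one>\<^bsub>A\<^esub> = 0"
proof -
  have "\<one>\<^bsub>A\<^esub> \<in> carrier (G True)" using subgroup.one_closed[OF H_sub_A] by (simp add: G_def)
  then show ?thesis using em emb_one by metis
qed

lemma G_cases: "x \<in> carrier A \<union> carrier B \<Longrightarrow> \<exists>b. x \<in> carrier (G b)"
  by (auto simp: G_def intro: exI[of _ True] exI[of _ False])

lemma em_in: "x \<in> carrier A \<union> carrier B \<Longrightarrow> em x \<in> K \<union> L"
  unfolding em_def K_def L_def by auto

lemma em_P: "x \<in> carrier A \<union> carrier B \<Longrightarrow> em x \<in> rl.P"
  using em_in rl.KL_P by blast

lemma em_inj: assumes "x \<in> carrier A \<union> carrier B" "y \<in> carrier A \<union> carrier B" "em x = em y" shows "x = y"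
proof -
  obtain b c where bc: "x \<in> carrier (G b)" "y \<in> carrier (G c)" using G_cases assms by blast
  show ?thesis using emb_eq[OF bc] em[OF bc(1)] em[OF bc(2)] assms(3) by simp
qed

lemma em_cong: assumes "x \<in> carrier A \<union> carrier B" "y \<in> carrier A \<union> carrier B" "- em x + em y \<in> rl.NN" shows "x = y"
proof -
  have "- em x \<in> K \<union> L" using em_in[OF assms(1)] add_subgroupD(3)[OF rl.K] add_subgroupD(3)[OF rl.L] by blast
  then have "- em x + em y = 0" using rl.NN_short[OF assms(3) refl] em_in[OF assms(2)] by blast
  then show ?thesis using em_inj[OF assms(1,2)] using minus_unique by fastforce
qed

lemma P_lists: "rl.P = (\<lambda>xs. sum_list (map em xs)) ` lists (carrier A \<union> carrier B)"
proof
  show "(\<lambda>xs. sum_list (map em xs)) ` lists (carrier A \<union> carrier B) \<subseteq> rl.P"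
  proof (rule image_subsetI)
    fix xs assume "xs \<in> lists (carrier A \<union> carrier B)"
    then show "sum_list (map em xs) \<in> rl.P"
    proof (induction xs)
      case Nil
      then show ?case using add_subgroupD(1)[OF rl.P_sub] by simp
    next
      case (Cons x xs)
      then show ?case using em_P[of x] add_subgroupD(2)[OF rl.P_sub] by simp
    qed
  qed
  have em_image: "\<exists>z\<in>carrier A \<union> carrier B. a = em z" if "a \<in> K \<union> L" for a
    using that emA emB unfolding K_def L_def by (metis UnE UnI1 UnI2 imageE)
  have cons: "a + x \<in> (\<lambda>xs. sum_list (map em xs)) ` lists (carrier A \<union> carrier B)"
    if a: "a \<in> K \<union> L" and x: "x \<in> (\<lambda>xs. sum_list (map em xs)) ` lists (carrier A \<union> carrier B)" for a x
  proof -
    obtain z where z: "z \<in> carrier A \<union> carrier B" "a = em z" using em_image[OF a] by blast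
    obtain xs where "xs \<in> lists (carrier A \<union> carrier B)" "x = sum_list (map em xs)" using x by blast
    then show ?thesis using z by (intro image_eqI[of _ _ "z # xs"]) simp_all
  qed
  show "rl.P \<subseteq> (\<lambda>xs. sum_list (map em xs)) ` lists (carrier A \<union> carrier B)"
  proof
    fix p assume "p \<in> rl.P"
    then show "p \<in> (\<lambda>xs. sum_list (map em xs)) ` lists (carrier A \<union> carrier B)"
      unfolding rl.P_def
    proof (induction rule: add_span.induct)
      case zero
      then show ?case by (auto intro: image_eqI[of _ _ "[]"])
    next
      case (plus a x)
      then show ?case using cons[of a x] by simp
    next
      case (minus a x)
      moreover have "- a \<in> K \<union> L" using minus(1) add_subgroupD(3)[OF rl.K, of a] add_subgroupD(3)[OF rl.L, of a] by blast
      ultimately show ?case using cons[of "- a" x] by simp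
    qed
  qed
qed

text \<open>A coset that meets the image of \<open>A\<close> or \<open>B\<close> keeps the
  corresponding element as its name, which is unique because both groups embed in the quotient. The
  other cosets receive distinct names from \<open>S\<close>.\<close>

theorem quotient_names:
  assumes S: "S \<inter> (carrier A \<union> carrier B) = {}" "|lists (carrier A \<union> carrier B)| \<le>o |S|"
  obtains q where "\<And>g h. g \<in> rl.P \<Longrightarrow> h \<in> rl.P \<Longrightarrow> q g = q h \<longleftrightarrow> - g + h \<in> rl.NN"
    "\<And>x. x \<in> carrier A \<union> carrier B \<Longrightarrow> q (em x) = x" "q ` rl.P \<subseteq> carrier A \<union> carrier B \<union> S"
proof -
  define cl where "cl g = {h \<in> rl.P. - g + h \<in> rl.NN}" for g
  note PD = add_subgroupD[OF rl.P_sub] and ND = add_subgroupD[OF rl.NN_sub]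
  have self: "g \<in> cl g" if "g \<in> rl.P" for g using that ND(1) unfolding cl_def mem_Collect_eq left_minus by blast
  have cl: "cl g = cl h \<longleftrightarrow> - g + h \<in> rl.NN" if gh: "g \<in> rl.P" "h \<in> rl.P" for g h
  proof
    assume "cl g = cl h"
    then have "h \<in> cl g" using self[OF gh(2)] by simp
    then show "- g + h \<in> rl.NN" unfolding cl_def by blast
  next
    assume n: "- g + h \<in> rl.NN"
    have "- g + x \<in> rl.NN \<longleftrightarrow> - h + x \<in> rl.NN" for x
    proof
      assume "- g + x \<in> rl.NN"
      then have "- (- g + h) + (- g + x) \<in> rl.NN" by (rule ND(2)[OF ND(3)[OF n]])
      then show "- h + x \<in> rl.NN" by (simp only: grp_norm minus_minus add_minus_cancel minus_add_cancel)
    next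
      assume "- h + x \<in> rl.NN"
      then have "(- g + h) + (- h + x) \<in> rl.NN" by (rule ND(2)[OF n])
      then show "- g + x \<in> rl.NN" by (simp only: grp_norm minus_minus add_minus_cancel minus_add_cancel)
    qed
    then show "cl g = cl h" unfolding cl_def by simp
  qed
  have "cl ` rl.P = (\<lambda>xs. cl (sum_list (map em xs))) ` lists (carrier A \<union> carrier B)"
    unfolding P_lists image_image ..
  then have "|cl ` rl.P| \<le>o |S|" using card_of_image ordLeq_transitive S(2) by metis
  then obtain j where j: "inj_on j (cl ` rl.P)" "j ` cl ` rl.P \<subseteq> S" unfolding card_of_ordLeq[symmetric] by blast
  define q where "q g = (if \<exists>x\<in>carrier A \<union> carrier B. em x \<in> cl g then SOME x. x \<in> carrier A \<union> carrier B \<and> em x \<in> cl g else j (cl g))" for g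
  have q1: "q g \<in> carrier A \<union> carrier B \<and> em (q g) \<in> cl g" if "x \<in> carrier A \<union> carrier B" "em x \<in> cl g" for x g
  proof -
    have "q g = (SOME x. x \<in> carrier A \<union> carrier B \<and> em x \<in> cl g)" using that unfolding q_def by auto
    then show ?thesis using someI[of "\<lambda>x. x \<in> carrier A \<union> carrier B \<and> em x \<in> cl g" x] that by simp
  qed
  have q2: "q g = j (cl g)" if "\<not> (\<exists>x\<in>carrier A \<union> carrier B. em x \<in> cl g)" for g
    using that unfolding q_def by (simp only: if_False)
  have q3: "q g \<in> S" if "\<not> (\<exists>x\<in>carrier A \<union> carrier B. em x \<in> cl g)" "g \<in> rl.P" for g
    using q2[OF that(1)] that(2) j(2) by blast
  have mem: "cl x = cl g" if "x \<in> cl g" "g \<in> rl.P" for x g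
    using that cl[of g x] by (simp add: cl_def)
  show thesis
  proof
    show "q g = q h \<longleftrightarrow> - g + h \<in> rl.NN" if gh: "g \<in> rl.P" "h \<in> rl.P" for g h
    proof -
      have "q g = q h \<Longrightarrow> cl g = cl h"
      proof (cases "\<exists>x\<in>carrier A \<union> carrier B. em x \<in> cl g")
        case True
        then have g: "q g \<in> carrier A \<union> carrier B" "em (q g) \<in> cl g" using q1 by blast+
        assume e: "q g = q h"
        then have "q h \<notin> S" using g(1) S(1) by auto
        then have "q h \<in> carrier A \<union> carrier B \<and> em (q h) \<in> cl h" using q3[OF _ gh(2)] q1 by blast
        then show "cl g = cl h" using mem[OF g(2) gh(1)] mem[OF _ gh(2)] e by metis
      next
        case False
        assume e: "q g = q h"
        have "\<not> (\<exists>x\<in>carrier A \<union> carrier B. em x \<in> cl h)" using q3[OF False gh(1)] q1 e S(1) by (metis IntI emptyE)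
        then show "cl g = cl h" using e q2 False j(1) gh by (simp add: inj_on_eq_iff)
      qed
      moreover have "q g = q h" if "cl g = cl h" using that unfolding q_def by simp
      ultimately show ?thesis using cl[OF gh] by blast
    qed
    show "q (em x) = x" if x: "x \<in> carrier A \<union> carrier B" for x
    proof -
      have "em (q (em x)) \<in> cl (em x)" "q (em x) \<in> carrier A \<union> carrier B" using q1[OF x self[OF em_P[OF x]]] by blast+
      then show ?thesis using em_cong[OF x, of "q (em x)"] unfolding cl_def by simp
    qed
    show "q ` rl.P \<subseteq> carrier A \<union> carrier B \<union> S" using q1 q3 by blast
  qed
qed

text \<open>Besides the properties of the small cancellation quotient, the last clause records that
  for empty \<open>R\<close> and trivial intersection the extension is a free product; this is what
  makes an adjoined letter free.\<close>

theorem extension: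
  assumes S: "S \<inter> (carrier A \<union> carrier B) = {}" "|lists (carrier A \<union> carrier B)| \<le>o |S|"
  obtains M :: "'u monoid" where "group M" "subext A M" "subext B M" "carrier M \<subseteq> carrier A \<union> carrier B \<union> S"
    "torsion_free M" "malnormal_in (carrier A) M" "malnormal_in (carrier B) M"
    "|carrier M| \<le>o |lists (carrier A \<union> carrier B)|"
    "\<And>a y b1 b2 h. (a, y, b1, b2, h) \<in> R \<Longrightarrow> foldr (mult M) (relator_list N a y b1 b2) \<one>\<^bsub>M\<^esub> = h"
    "\<And>ws. R = {} \<Longrightarrow> carrier A \<inter> carrier B = {\<one>\<^bsub>A\<^esub>} \<Longrightarrow> ws \<in> lists (carrier A \<union> carrier B) \<Longrightarrow>
      foldr (mult M) ws \<one>\<^bsub>M\<^esub> = \<one>\<^bsub>M\<^esub> \<Longrightarrow>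
      foldr (mult A) (map (\<lambda>x. if x \<in> carrier A then x else \<one>\<^bsub>A\<^esub>) ws) \<one>\<^bsub>A\<^esub> = \<one>\<^bsub>A\<^esub>"
proof -
  obtain q where q: "\<And>g h. g \<in> rl.P \<Longrightarrow> h \<in> rl.P \<Longrightarrow> q g = q h \<longleftrightarrow> - g + h \<in> rl.NN"
    and qem: "\<And>x. x \<in> carrier A \<union> carrier B \<Longrightarrow> q (em x) = x" and qS: "q ` rl.P \<subseteq> carrier A \<union> carrier B \<union> S"
    using quotient_names[OF S] by blast
  obtain M :: "'u monoid" where M: "group M" and car: "carrier M = q ` rl.P"
    and mult: "\<And>g h. g \<in> rl.P \<Longrightarrow> h \<in> rl.P \<Longrightarrow> q g \<otimes>\<^bsub>M\<^esub> q h = q (g + h)"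
    and one: "\<one>\<^bsub>M\<^esub> = q 0" and inv: "\<And>g. g \<in> rl.P \<Longrightarrow> inv\<^bsub>M\<^esub> (q g) = q (- g)"
    using quotient_group[OF rl.P_sub rl.NN_sub rl.NN_P rl.NN_conj' q] by blast
  note PD = add_subgroupD[OF rl.P_sub] and ND = add_subgroupD[OF rl.NN_sub]
  interpret M: group M by (rule M)
  have oneA: "\<one>\<^bsub>A\<^esub> \<in> carrier A" using subgroup.one_closed[OF H_sub_A] by simp
  have sub: "subext (G b) M" for b
  proof -
    interpret g: group "G b" by (rule G_group)
    have in_AB: "x \<in> carrier A \<union> carrier B" if "x \<in> carrier (G b)" for x using that by (cases b) (simp_all add: G_def)
    have "x \<otimes>\<^bsub>G b\<^esub> y = x \<otimes>\<^bsub>M\<^esub> y" if xy: "x \<in> carrier (G b)" "y \<in> carrier (G b)" for x y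
    proof -
      have "em (x \<otimes>\<^bsub>G b\<^esub> y) = em x + em y" using em[OF xy(1)] em[OF xy(2)] em[OF g.m_closed[OF xy]] emb_mult[OF xy] by simp
      then show ?thesis using mult[OF em_P em_P, of x y] qem in_AB xy g.m_closed by metis
    qed
    moreover have "carrier (G b) \<subseteq> carrier M" unfolding car using qem em_P in_AB by (metis image_eqI subsetI)
    moreover have "\<one>\<^bsub>G b\<^esub> = \<one>\<^bsub>M\<^esub>" using qem[of "\<one>\<^bsub>A\<^esub>"] oneA unfolding one em_one one_G by simp
    ultimately show ?thesis unfolding subext_def by blast
  qed
  have pow: "q g [^]\<^bsub>M\<^esub> n = q (zmult (int n) g)" if "g \<in> rl.P" for g and n :: nat
  proof (induction n)
    case (Suc n)
    have "zmult (int (Suc n)) g = zmult (int n) g + g" using zmult_add[of "int n" 1 g] by (simp add: add.commute)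
    then show ?case using Suc mult[OF zmult_in[OF rl.P_sub that] that] by simp
  qed (simp add: one)
  have tf: "torsion_free M"
    unfolding torsion_free_def
  proof (intro ballI allI impI)
    fix g and n :: nat assume "g \<in> carrier M" and n: "0 < n \<and> g [^]\<^bsub>M\<^esub> n = \<one>\<^bsub>M\<^esub>"
    then obtain p where p: "p \<in> rl.P" "g = q p" unfolding car by blast
    have z: "zmult (int n) p \<in> rl.P" using zmult_in[OF rl.P_sub p(1)] .
    have "q 0 = q (zmult (int n) p)" using n pow[OF p(1)] p(2) one by simp
    then have "zmult (int n) p \<in> rl.NN" using q[OF PD(1) z] by simp
    then have "p \<in> rl.NN" using rl.quotient_torsion_free[OF p(1)] n by blast
    then show "g = \<one>\<^bsub>M\<^esub>" using q[OF PD(1) p(1)] p(2) one by simp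
  qed
  have mal: "malnormal_in (carrier (G b)) M" for b
    unfolding malnormal_in_def
  proof (intro ballI impI)
    interpret g: group "G b" by (rule G_group)
    have in_AB: "x \<in> carrier A \<union> carrier B" if "x \<in> carrier (G b)" for x using that by (cases b) (simp_all add: G_def)
    fix g h assume g: "g \<in> carrier M - carrier (G b)" and h: "h \<in> carrier (G b)" and
      c: "inv\<^bsub>M\<^esub> g \<otimes>\<^bsub>M\<^esub> h \<otimes>\<^bsub>M\<^esub> g \<in> carrier (G b)"
    obtain p where p: "p \<in> rl.P" "g = q p" using g unfolding car by blast
    define h' where "h' = inv\<^bsub>M\<^esub> g \<otimes>\<^bsub>M\<^esub> h \<otimes>\<^bsub>M\<^esub> g"
    have eh: "em h \<in> rl.P" "em h' \<in> rl.P" "q (em h) = h" "q (em h') = h'" using em_P qem in_AB h c h'_def by auto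
    have "h' = q (- p + em h + p)"
      using mult[OF PD(3)[OF p(1)] eh(1)] mult[OF PD(2)[OF PD(3)[OF p(1)] eh(1)] p(1)] inv[OF p(1)] eh(3) p(2) by (simp add: h'_def)
    then have "- em h' + (- p + em h + p) \<in> rl.NN" using q[of "em h'" "- p + em h + p"] eh PD p(1) by metis
    then have "em h' + (- em h' + (- p + em h + p)) - em h' \<in> rl.NN" by (rule rl.NN_conj[OF eh(2)])
    then have n: "- p + em h + p + - em h' \<in> rl.NN" by (simp only: grp_norm minus_minus add_minus_cancel minus_add_cancel)
    have XG: "em x \<in> (if b then K else L)" if "x \<in> carrier (G b)" for x unfolding emb_image using em[OF that] that by simp
    have mh: "- em h' \<in> (if b then K else L)" using XG[of h'] add_subgroupD(3)[OF rl.X_sub] c h'_def by simp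
    show "h = \<one>\<^bsub>M\<^esub>"
    proof (rule ccontr)
      assume "h \<noteq> \<one>\<^bsub>M\<^esub>"
      then have "em h \<noteq> 0" using eh(3) one by auto
      then obtain x where x: "x \<in> (if b then K else L)" "- x + p \<in> rl.NN"
        using rl.quotient_malnormal[OF XG[OF h] mh _ p(1) n] by blast
      obtain z where z: "z \<in> carrier (G b)" "x = em z" using x(1) em unfolding emb_image by (metis imageE)
      have "q (em z) = q p" using q[OF em_P[OF in_AB[OF z(1)]] p(1)] x(2) z(2) by simp
      then show False using qem[OF in_AB[OF z(1)]] z(1) g p(2) by simp
    qed
  qed
  have cardM: "|carrier M| \<le>o |lists (carrier A \<union> carrier B)|"
    unfolding car P_lists image_image by (rule card_of_image)
  have fold: "sum_list (map em ws) \<in> rl.P \<and> foldr (mult M) ws \<one>\<^bsub>M\<^esub> = q (sum_list (map em ws))"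
    if "ws \<in> lists (carrier A \<union> carrier B)" for ws using that
  proof (induction ws)
    case Nil
    then show ?case using PD(1) one by simp
  next
    case (Cons x ws)
    then show ?case using mult[OF em_P[of x], of "sum_list (map em ws)"] qem[of x] PD(2) em_P[of x] by simp
  qed
  have rel: "foldr (mult M) (relator_list N a y b1 b2) \<one>\<^bsub>M\<^esub> = h" if r: "(a, y, b1, b2, h) \<in> R" for a y b1 b2 h
  proof -
    let ?w = "relator_list N a y b1 b2" and ?r = "rel_word N (em a, em y, em b1, em b2, em h)"
    note Rr = R[OF r]
    have "(em a, em y, em b1, em b2, em h) = (emb True a, emb False y, emb True b1, emb True b2, emb True h)"
      using Rr emA emB by simp
    then have "(em a, em y, em b1, em b2, em h) \<in> R'" unfolding R'_def using r by force
    then have rN: "?r \<in> rl.NN" by (rule rl.rel_word_NN)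
    have "set ?w \<subseteq> {a, y, b1, b2}" by (auto simp: relator_list_def relator_block_def split: if_splits)
    then have w: "?w \<in> lists (carrier A \<union> carrier B)" using Rr by auto
    have hP: "em h \<in> rl.P" using em_P Rr by blast
    have "- em h + - ?r + em h \<in> rl.NN" by (rule rl.NN_conj'[OF hP ND(3)[OF rN]])
    then have "- (?r + em h) + em h \<in> rl.NN" by (simp only: minus_add)
    then have "q (?r + em h) = q (em h)" using q[of "?r + em h" "em h"] hP PD(2) rN rl.NN_P by blast
    then show ?thesis using fold[OF w] qem[of h] Rr unfolding rel_word_eq[of em N a y b1 b2 "em h"] by simp
  qed
  have subA: "subext A M" and subB: "subext B M" and malA: "malnormal_in (carrier A) M" and malB: "malnormal_in (carrier B) M"
    using sub[of True] sub[of False] mal[of True] mal[of False] by (simp_all add: G_def)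
  have erase: "foldr (mult A) (map (\<lambda>x. if x \<in> carrier A then x else \<one>\<^bsub>A\<^esub>) ws) \<one>\<^bsub>A\<^esub> = \<one>\<^bsub>A\<^esub>"
    if RR: "R = {}" and C1: "carrier A \<inter> carrier B = {\<one>\<^bsub>A\<^esub>}" and ws: "ws \<in> lists (carrier A \<union> carrier B)"
      and w1: "foldr (mult M) ws \<one>\<^bsub>M\<^esub> = \<one>\<^bsub>M\<^esub>" for ws
  proof -
    have "trot_set = {} \<Longrightarrow> rl.NN = {0}" if "trot_set = rl.trot ` rl.translates" for trot_set
      unfolding rl.NN_def using that add_span_least[of "{}" "{0}"] add_span.zero[of "{}"] by (auto simp: add_subgroup_def)
    moreover have "rl.translates = {}" unfolding rl.translates_def unfolding R'_def unfolding RR by simp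
    ultimately have NN: "rl.NN = {0}" by simp
    have "q 0 = q (sum_list (map em ws))" using fold[OF ws] w1 one by simp
    then have s0: "sum_list (map em ws) = 0" using q[OF PD(1)] fold[OF ws] NN by simp
    have H0: "K \<inter> L = {0}" unfolding KL_Int[of True] using C1 emb_one[of True] by (simp add: C_def)
    have "set (map em ws) \<subseteq> K \<union> L" using ws em_in by auto
    note rl.erase_syllables[OF H0 this s0]
    moreover have "map (\<lambda>x. if x \<in> K then x else 0) (map em ws) = map em (map (\<lambda>x. if x \<in> carrier A then x else \<one>\<^bsub>A\<^esub>) ws)"
    proof -
      have "(if em x \<in> K then em x else 0) = em (if x \<in> carrier A then x else \<one>\<^bsub>A\<^esub>)" if x: "x \<in> set ws" for x
      proof (cases "x \<in> carrier A")
        case True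
        then show ?thesis using emA K_def by simp
      next
        case False
        then have "x \<in> carrier B" using ws x by auto
        then have "em x \<in> L" using emB L_def by simp
        then show ?thesis using H0 False em_one by auto
      qed
      then show ?thesis by simp
    qed
    ultimately have "sum_list (map em (map (\<lambda>x. if x \<in> carrier A then x else \<one>\<^bsub>A\<^esub>) ws)) = 0" by (simp only:)
    moreover have l: "map (\<lambda>x. if x \<in> carrier A then x else \<one>\<^bsub>A\<^esub>) ws \<in> lists (carrier A)" using oneA by auto
    ultimately have "foldr (mult M) (map (\<lambda>x. if x \<in> carrier A then x else \<one>\<^bsub>A\<^esub>) ws) \<one>\<^bsub>M\<^esub> = \<one>\<^bsub>A\<^esub>"
      using fold[of "map (\<lambda>x. if x \<in> carrier A then x else \<one>\<^bsub>A\<^esub>) ws"] qem[of "\<one>\<^bsub>A\<^esub>"] em_one oneA by (auto simp: lists_eq_set)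
    then show ?thesis using subext_foldr[OF A subA l] subA unfolding subext_def by simp
  qed
  show thesis
  proof (rule that[OF M subA subB _ tf malA malB cardM])
    show "carrier M \<subseteq> carrier A \<union> carrier B \<union> S" using qS car by simp
  qed (fact rel, fact erase)
qed

end

section \<open>Directed unions\<close>

lemma subextD: assumes "subext G M"
  shows "carrier G \<subseteq> carrier M" "\<one>\<^bsub>G\<^esub> = \<one>\<^bsub>M\<^esub>"
    "\<And>x y. x \<in> carrier G \<Longrightarrow> y \<in> carrier G \<Longrightarrow> x \<otimes>\<^bsub>G\<^esub> y = x \<otimes>\<^bsub>M\<^esub> y"
  using assms unfolding subext_def by blast+

lemma subext_refl: "subext G G" by (simp add: subext_def)

lemma subext_trans: "subext G M \<Longrightarrow> subext M M' \<Longrightarrow> subext G M'"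
  unfolding subext_def by (metis subset_iff)

lemma subext_inv: assumes "group G" "group M" "subext G M" "x \<in> carrier G" shows "inv\<^bsub>G\<^esub> x = inv\<^bsub>M\<^esub> x"
proof -
  interpret G: group G by fact
  interpret M: group M by fact
  note s = subextD[OF assms(3)]
  have "inv\<^bsub>G\<^esub> x \<otimes>\<^bsub>M\<^esub> x = \<one>\<^bsub>M\<^esub>" using s(3)[of "inv\<^bsub>G\<^esub> x" x] s(2) assms(4) by simp
  then show ?thesis using M.inv_equality[of "inv\<^bsub>G\<^esub> x" x] assms(4) G.inv_closed[of x] s(1) by (metis subsetD)
qed

lemma subext_conj: assumes "group G" "group M" "subext G M" "x \<in> carrier G" "y \<in> carrier G"
  shows "inv\<^bsub>G\<^esub> x \<otimes>\<^bsub>G\<^esub> y \<otimes>\<^bsub>G\<^esub> x = inv\<^bsub>M\<^esub> x \<otimes>\<^bsub>M\<^esub> y \<otimes>\<^bsub>M\<^esub> x"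
proof -
  interpret G: group G by fact
  show ?thesis using subext_inv[OF assms(1-4)] subextD(3)[OF assms(3)] assms(4,5) by (metis G.inv_closed G.m_closed)
qed

lemma subext_subgroup: assumes "group G" "group M" "subext G M" shows "subgroup (carrier G) M"
proof -
  interpret G: group G by fact
  interpret M: group M by fact
  note s = subextD[OF assms(3)]
  show ?thesis
  proof (rule M.subgroupI)
    show "carrier G \<noteq> {}" using G.one_closed by blast
    show "inv\<^bsub>M\<^esub> x \<in> carrier G" if "x \<in> carrier G" for x using subext_inv[OF assms that] that G.inv_closed by metis
    show "x \<otimes>\<^bsub>M\<^esub> y \<in> carrier G" if "x \<in> carrier G" "y \<in> carrier G" for x y using s(3)[OF that] that G.m_closed by metis
  qed (rule s(1))
qed

lemma malnormal_in_trans: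
  assumes G: "group G" "group M" "subext G M" and S: "S \<subseteq> carrier G" "malnormal_in S G" and "malnormal_in (carrier G) M"
  shows "malnormal_in S M"
  unfolding malnormal_in_def
proof (intro ballI impI)
  fix g h assume g: "g \<in> carrier M - S" and h: "h \<in> S" and c: "inv\<^bsub>M\<^esub> g \<otimes>\<^bsub>M\<^esub> h \<otimes>\<^bsub>M\<^esub> g \<in> S"
  show "h = \<one>\<^bsub>M\<^esub>"
  proof (cases "g \<in> carrier G")
    case True
    then have "inv\<^bsub>G\<^esub> g \<otimes>\<^bsub>G\<^esub> h \<otimes>\<^bsub>G\<^esub> g \<in> S" using subext_conj[OF G True, of h] h S(1) c by auto
    then show ?thesis using S(2) True g h subextD(2)[OF G(3)] unfolding malnormal_in_def by blast
  next
    case False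
    then show ?thesis using assms(6) g h c S(1) unfolding malnormal_in_def by blast
  qed
qed

lemma malnormal_in_one: "group M \<Longrightarrow> malnormal_in {\<one>\<^bsub>M\<^esub>} M" by (simp add: malnormal_in_def)

text \<open>The unit is put in by hand, so that the empty family yields the trivial group. Other
  products are computed in an arbitrary member containing both factors; directedness makes the
  result independent of it.\<close>

definition union_group :: "'u \<Rightarrow> ('i \<Rightarrow> 'u monoid) \<Rightarrow> 'i set \<Rightarrow> 'u monoid" where
  "union_group u f I = \<lparr>carrier = insert u (\<Union>q\<in>I. carrier (f q)),
    mult = \<lambda>x y. if x = u then y else if y = u then x else
      x \<otimes>\<^bsub>f (SOME q. q \<in> I \<and> x \<in> carrier (f q) \<and> y \<in> carrier (f q))\<^esub> y, one = u\<rparr>"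

locale directed_groups =
  fixes u :: 'u and f :: "'i \<Rightarrow> 'u monoid" and I :: "'i set"
  assumes group_f: "\<And>q. q \<in> I \<Longrightarrow> group (f q)" and one_f: "\<And>q. q \<in> I \<Longrightarrow> \<one>\<^bsub>f q\<^esub> = u"
    and directed: "\<And>q r. q \<in> I \<Longrightarrow> r \<in> I \<Longrightarrow> \<exists>s\<in>I. subext (f q) (f s) \<and> subext (f r) (f s)"
begin

abbreviation "U \<equiv> union_group u f I"

lemma U_carrier: "carrier U = insert u (\<Union>q\<in>I. carrier (f q))" and U_one: "\<one>\<^bsub>U\<^esub> = u"
  by (simp_all add: union_group_def)

lemma u_f: "q \<in> I \<Longrightarrow> u \<in> carrier (f q)"
  using group_f one_f monoid.one_closed[OF group.is_monoid] by metis

lemma subext_U: assumes q: "q \<in> I" shows "subext (f q) U"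
proof -
  interpret q: group "f q" using group_f q .
  have "x \<otimes>\<^bsub>f q\<^esub> y = x \<otimes>\<^bsub>U\<^esub> y" if xy: "x \<in> carrier (f q)" "y \<in> carrier (f q)" for x y
  proof (cases "x = u \<or> y = u")
    case True
    then show ?thesis using xy q.l_one q.r_one one_f[OF q] by (auto simp: union_group_def)
  next
    case False
    define r where "r = (SOME q. q \<in> I \<and> x \<in> carrier (f q) \<and> y \<in> carrier (f q))"
    have r: "r \<in> I" "x \<in> carrier (f r)" "y \<in> carrier (f r)"
      using someI[of "\<lambda>q. q \<in> I \<and> x \<in> carrier (f q) \<and> y \<in> carrier (f q)" q] q xy unfolding r_def by blast+
    obtain s where s: "subext (f q) (f s)" "subext (f r) (f s)" using directed[OF q r(1)] by blast
    have "x \<otimes>\<^bsub>U\<^esub> y = x \<otimes>\<^bsub>f r\<^esub> y" using False by (simp add: union_group_def r_def)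
    then show ?thesis using subextD(3)[OF s(1) xy] subextD(3)[OF s(2) r(2,3)] by simp
  qed
  then show ?thesis using q one_f[OF q] unfolding subext_def U_carrier U_one by blast
qed

lemma in_common: assumes "I \<noteq> {}" "finite X" "X \<subseteq> carrier U" shows "\<exists>q\<in>I. X \<subseteq> carrier (f q)"
  using assms(2,3)
proof (induction X)
  case empty
  then show ?case using assms(1) by blast
next
  case (insert x X)
  obtain q where q: "q \<in> I" "X \<subseteq> carrier (f q)" using insert by auto
  obtain r where r: "r \<in> I" "x \<in> carrier (f r)" using insert(4) assms(1) u_f unfolding U_carrier by auto
  obtain s where "s \<in> I" "subext (f q) (f s)" "subext (f r) (f s)" using directed[OF q(1) r(1)] by blast
  then show ?case using q(2) r(2) subextD(1) by (intro bexI[of _ s]) blast+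
qed

lemma group_U: "group U"
proof (cases "I = {}")
  case True
  then show ?thesis by (intro groupI) (auto simp: union_group_def)
next
  case False
  show ?thesis
  proof (rule groupI)
    fix x y z assume x: "x \<in> carrier U" and y: "y \<in> carrier U" and z: "z \<in> carrier U"
    obtain q where q: "q \<in> I" "{x, y, z} \<subseteq> carrier (f q)" using in_common[OF False, of "{x, y, z}"] x y z by blast
    interpret q: group "f q" using group_f q(1) .
    note s = subextD[OF subext_U[OF q(1)]]
    have xyz: "x \<in> carrier (f q)" "y \<in> carrier (f q)" "z \<in> carrier (f q)" using q(2) by auto
    have "x \<otimes>\<^bsub>f q\<^esub> y \<in> carrier U" using q.m_closed xyz s(1) by blast
    then show "x \<otimes>\<^bsub>U\<^esub> y \<in> carrier U" using s(3)[OF xyz(1,2)] by simp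
    have "(x \<otimes>\<^bsub>f q\<^esub> y) \<otimes>\<^bsub>f q\<^esub> z = (x \<otimes>\<^bsub>U\<^esub> y) \<otimes>\<^bsub>U\<^esub> z" "x \<otimes>\<^bsub>f q\<^esub> (y \<otimes>\<^bsub>f q\<^esub> z) = x \<otimes>\<^bsub>U\<^esub> (y \<otimes>\<^bsub>U\<^esub> z)"
      using s(3) xyz q.m_closed by metis+
    then show "x \<otimes>\<^bsub>U\<^esub> y \<otimes>\<^bsub>U\<^esub> z = x \<otimes>\<^bsub>U\<^esub> (y \<otimes>\<^bsub>U\<^esub> z)" using q.m_assoc[OF xyz] by simp
  next
    fix x assume x: "x \<in> carrier U"
    show "\<one>\<^bsub>U\<^esub> \<otimes>\<^bsub>U\<^esub> x = x" by (simp add: union_group_def)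
    obtain q where q: "q \<in> I" "{x} \<subseteq> carrier (f q)" using in_common[OF False, of "{x}"] x by blast
    interpret q: group "f q" using group_f q(1) .
    note s = subextD[OF subext_U[OF q(1)]]
    have "inv\<^bsub>f q\<^esub> x \<otimes>\<^bsub>U\<^esub> x = \<one>\<^bsub>U\<^esub>" "inv\<^bsub>f q\<^esub> x \<in> carrier U" using s(1) s(3)[of "inv\<^bsub>f q\<^esub> x" x] s(2) q(2) by auto
    then show "\<exists>y\<in>carrier U. y \<otimes>\<^bsub>U\<^esub> x = \<one>\<^bsub>U\<^esub>" by blast
  qed (simp add: union_group_def)
qed

lemma torsion_free_U: assumes "\<And>q. q \<in> I \<Longrightarrow> torsion_free (f q)" shows "torsion_free U"
  unfolding torsion_free_def
proof (intro ballI allI impI)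
  fix g and n :: nat assume g: "g \<in> carrier U" and n: "0 < n \<and> g [^]\<^bsub>U\<^esub> n = \<one>\<^bsub>U\<^esub>"
  show "g = \<one>\<^bsub>U\<^esub>"
  proof (cases "I = {}")
    case True
    then show ?thesis using g by (simp add: union_group_def)
  next
    case False
    obtain q where q: "q \<in> I" "{g} \<subseteq> carrier (f q)" using in_common[OF False, of "{g}"] g by blast
    interpret q: group "f q" using group_f q(1) .
    note s = subextD[OF subext_U[OF q(1)]]
    have gq: "g \<in> carrier (f q)" using q(2) by simp
    have "g [^]\<^bsub>f q\<^esub> m = g [^]\<^bsub>U\<^esub> m" for m :: nat
    proof (induction m)
      case (Suc m)
      then show ?case using s(3)[OF q.nat_pow_closed[OF gq] gq, of m] by simp
    qed (simp add: s(2))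
    then have "g [^]\<^bsub>f q\<^esub> n = \<one>\<^bsub>f q\<^esub>" using n s(2) by simp
    then show ?thesis using assms[OF q(1)] n q(2) s(2) unfolding torsion_free_def by (metis insert_subset)
  qed
qed

text \<open>Both a malnormal subset of a cofinal family of members and a union of malnormal members are
  malnormal, because malnormality only involves two elements at a time.\<close>

lemma malnormal_in_U:
  assumes S: "\<And>q. q \<in> I \<Longrightarrow> \<exists>s\<in>I. subext (f q) (f s) \<and> S \<subseteq> carrier (f s) \<and> malnormal_in S (f s)"
    and I: "I \<noteq> {}"
  shows "malnormal_in S U"
  unfolding malnormal_in_def
proof (intro ballI impI)
  fix g h assume g: "g \<in> carrier U - S" and h: "h \<in> S" and c: "inv\<^bsub>U\<^esub> g \<otimes>\<^bsub>U\<^esub> h \<otimes>\<^bsub>U\<^esub> g \<in> S"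
  obtain q where q: "q \<in> I" "{g} \<subseteq> carrier (f q)" using in_common[OF I, of "{g}"] g by blast
  obtain s where s: "s \<in> I" "subext (f q) (f s)" "S \<subseteq> carrier (f s)" "malnormal_in S (f s)" using S[OF q(1)] by blast
  have gh: "g \<in> carrier (f s)" "h \<in> carrier (f s)" using q(2) subextD(1)[OF s(2)] h s(3) by auto
  have "inv\<^bsub>f s\<^esub> g \<otimes>\<^bsub>f s\<^esub> h \<otimes>\<^bsub>f s\<^esub> g \<in> S"
    using subext_conj[OF group_f[OF s(1)] group_U subext_U[OF s(1)] gh] c by simp
  then show "h = \<one>\<^bsub>U\<^esub>" using s(4) g h gh one_f[OF s(1)] unfolding malnormal_in_def U_one by blast
qed

lemma U_malnormal_in:
  assumes M: "group M" "\<one>\<^bsub>M\<^esub> = u"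
    and J: "\<And>q. q \<in> I \<Longrightarrow> subext (f q) M \<and> malnormal_in (carrier (f q)) M"
  shows "malnormal_in (carrier U) M"
proof (cases "I = {}")
  case True
  then show ?thesis using malnormal_in_one[OF M(1)] M(2) True by (simp add: union_group_def)
next
  case False
  show ?thesis
    unfolding malnormal_in_def
  proof (intro ballI impI)
    fix g h assume g: "g \<in> carrier M - carrier U" and h: "h \<in> carrier U"
      and c: "inv\<^bsub>M\<^esub> g \<otimes>\<^bsub>M\<^esub> h \<otimes>\<^bsub>M\<^esub> g \<in> carrier U"
    obtain q where q: "q \<in> I" "{h, inv\<^bsub>M\<^esub> g \<otimes>\<^bsub>M\<^esub> h \<otimes>\<^bsub>M\<^esub> g} \<subseteq> carrier (f q)"
      using in_common[OF False, of "{h, inv\<^bsub>M\<^esub> g \<otimes>\<^bsub>M\<^esub> h \<otimes>\<^bsub>M\<^esub> g}"] h c by blast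
    have "g \<notin> carrier (f q)" using g q(1) unfolding U_carrier by blast
    then show "h = \<one>\<^bsub>M\<^esub>" using J[OF q(1)] q(2) g unfolding malnormal_in_def by blast
  qed
qed

lemma U_subext: assumes M: "\<one>\<^bsub>M\<^esub> = u" "u \<in> carrier M" and J: "\<And>q. q \<in> I \<Longrightarrow> subext (f q) M" and M': "group M"
  shows "subext U M"
proof -
  interpret M: group M by fact
  have c: "carrier U \<subseteq> carrier M" unfolding U_carrier using M(2) subextD(1)[OF J] by blast
  have "x \<otimes>\<^bsub>U\<^esub> y = x \<otimes>\<^bsub>M\<^esub> y" if xy: "x \<in> carrier U" "y \<in> carrier U" for x y
  proof (cases "I = {}")
    case True
    then show ?thesis using xy M M.l_one[OF M.one_closed] by (simp add: union_group_def)
  next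
    case False
    obtain q where q: "q \<in> I" "{x, y} \<subseteq> carrier (f q)" using in_common[OF False, of "{x, y}"] xy by blast
    then show ?thesis using subextD(3)[OF J[OF q(1)], of x y] subextD(3)[OF subext_U[OF q(1)], of x y] by simp
  qed
  then show ?thesis using c M(1) unfolding subext_def U_one by blast
qed

end

section \<open>Adjoining a free letter\<close>

definition int_copy :: "(int \<Rightarrow> 'u) \<Rightarrow> 'u monoid" where
  "int_copy z = \<lparr>carrier = range z, mult = \<lambda>x y. z (inv_into UNIV z x + inv_into UNIV z y), one = z 0\<rparr>"

lemma int_copy:
  assumes "inj z"
  shows "group (int_copy z)" "torsion_free (int_copy z)"
proof -
  have m: "z i \<otimes>\<^bsub>int_copy z\<^esub> z j = z (i + j)" for i j using assms by (simp add: int_copy_def)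
  show g: "group (int_copy z)"
  proof (rule groupI)
    fix x assume "x \<in> carrier (int_copy z)"
    then obtain i where i: "x = z i" by (auto simp: int_copy_def)
    show "\<exists>y\<in>carrier (int_copy z). y \<otimes>\<^bsub>int_copy z\<^esub> x = \<one>\<^bsub>int_copy z\<^esub>"
      using m[of "- i" i] i by (intro bexI[of _ "z (- i)"]) (simp_all add: int_copy_def)
  qed (use assms in \<open>auto simp: int_copy_def add.assoc\<close>)
  have p: "z i [^]\<^bsub>int_copy z\<^esub> n = z (int n * i)" for i and n :: nat
  proof (induction n)
    case 0
    then show ?case by (simp add: int_copy_def)
  next
    case (Suc n)
    then show ?case using m by (simp add: algebra_simps)
  qed
  show "torsion_free (int_copy z)"
    unfolding torsion_free_def
  proof (intro ballI allI impI)
    fix g and n :: nat assume g: "g \<in> carrier (int_copy z)" and n: "0 < n \<and> g [^]\<^bsub>int_copy z\<^esub> n = \<one>\<^bsub>int_copy z\<^esub>"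
    obtain i where i: "g = z i" using g by (auto simp: int_copy_def)
    then have "z (int n * i) = z 0" using n p by (simp add: int_copy_def)
    then have "int n * i = 0" using assms by (simp only: inj_eq)
    then show "g = \<one>\<^bsub>int_copy z\<^esub>" using n i by (simp add: int_copy_def)
  qed
qed

text \<open>The free product with an infinite cyclic group on the names \<open>z\<close>. Erasing
  the letters outside \<open>L\<close> turns a word evaluated at \<open>z 1\<close> into the same
  word evaluated at the unit, which gives the last clause.\<close>

lemma free_letter:
  fixes L :: "'u monoid" and z :: "int \<Rightarrow> 'u"
  assumes L: "group L" "torsion_free L" and z: "inj z" "z 0 = \<one>\<^bsub>L\<^esub>" "range z \<inter> carrier L = {\<one>\<^bsub>L\<^esub>}"
    and S: "S \<inter> (carrier L \<union> range z) = {}" "|lists (carrier L \<union> range z)| \<le>o |S|"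
  obtains M :: "'u monoid" where "group M" "subext L M" "range z \<subseteq> carrier M" "carrier M \<subseteq> carrier L \<union> range z \<union> S"
    "torsion_free M" "malnormal_in (carrier L) M" "|carrier M| \<le>o |lists (carrier L \<union> range z)|"
    "\<And>w. w \<in> group_words L \<Longrightarrow> word_value M w (z 1) = \<one>\<^bsub>M\<^esub> \<Longrightarrow> word_value M w \<one>\<^bsub>M\<^esub> = \<one>\<^bsub>M\<^esub>"
proof -
  let ?B = "int_copy z"
  have cB: "carrier ?B = range z" and oB: "\<one>\<^bsub>?B\<^esub> = z 0" by (simp_all add: int_copy_def)
  have int: "carrier L \<inter> carrier ?B = {\<one>\<^bsub>L\<^esub>}" using z(3) cB by blast
  note B = int_copy[OF z(1)]
  interpret L: group L by fact
  interpret sc: small_cancellation L ?B "{}" 200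
  proof (intro small_cancellation.intro group_amalgam.intro small_cancellation_axioms.intro)
    show "\<one>\<^bsub>L\<^esub> = \<one>\<^bsub>?B\<^esub>" using oB z(2) by simp
    show "subgroup (carrier L \<inter> carrier ?B) L" unfolding int by (rule L.triv_subgroup)
    show "x \<otimes>\<^bsub>L\<^esub> y = x \<otimes>\<^bsub>?B\<^esub> y" if "x \<in> carrier L \<inter> carrier ?B" "y \<in> carrier L \<inter> carrier ?B" for x y
    proof -
      have "x = \<one>\<^bsub>L\<^esub>" "y = \<one>\<^bsub>L\<^esub>" using that int by auto
      then show ?thesis using monoid.l_one[OF group.is_monoid[OF B(1)] monoid.one_closed[OF group.is_monoid[OF B(1)]]] oB z(2) by simp
    qed
    show "malnormal_in (carrier L \<inter> carrier ?B) L" unfolding int by (rule malnormal_in_one[OF L(1)])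
    show "malnormal_in (carrier L \<inter> carrier ?B) ?B" unfolding int using malnormal_in_one[OF B(1)] oB z(2) by simp
  qed (use B L in simp_all)
  obtain M :: "'u monoid" where M: "group M" "subext L M" "subext ?B M" "carrier M \<subseteq> carrier L \<union> carrier ?B \<union> S"
    "torsion_free M" "malnormal_in (carrier L) M" "|carrier M| \<le>o |lists (carrier L \<union> carrier ?B)|"
    and er: "\<And>ws. ws \<in> lists (carrier L \<union> carrier ?B) \<Longrightarrow> foldr (mult M) ws \<one>\<^bsub>M\<^esub> = \<one>\<^bsub>M\<^esub> \<Longrightarrow>
      foldr (mult L) (map (\<lambda>x. if x \<in> carrier L then x else \<one>\<^bsub>L\<^esub>) ws) \<one>\<^bsub>L\<^esub> = \<one>\<^bsub>L\<^esub>"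
    by (rule sc.extension[of S]) (use S cB int in simp_all)
  have "z 1 \<noteq> z 0" using z(1) by (simp add: inj_eq)
  then have zL: "z 1 \<notin> carrier L" using z(2) rangeI[of z 1] by (metis IntI singletonD z(3))
  have "word_value M w \<one>\<^bsub>M\<^esub> = \<one>\<^bsub>M\<^esub>" if w: "w \<in> group_words L" "word_value M w (z 1) = \<one>\<^bsub>M\<^esub>" for w
  proof -
    have l: "subst_letter (z 1) x \<in> carrier L \<union> carrier ?B \<and> subst_letter \<one>\<^bsub>M\<^esub> x \<in> carrier L \<and>
      (if subst_letter (z 1) x \<in> carrier L then subst_letter (z 1) x else \<one>\<^bsub>L\<^esub>) = subst_letter \<one>\<^bsub>M\<^esub> x"
      if "x \<in> set w" for x using that w(1) zL subextD(2)[OF M(2)] cB L.one_closed unfolding group_words_def by (cases x) auto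
    note l1 = conjunct1[OF l] and l2 = conjunct1[OF conjunct2[OF l]] and l3 = conjunct2[OF conjunct2[OF l]]
    have "map (subst_letter (z 1)) w \<in> lists (carrier L \<union> carrier ?B)" unfolding in_lists_conv_set set_map using l1 by blast
    then have "foldr (mult L) (map (\<lambda>x. if x \<in> carrier L then x else \<one>\<^bsub>L\<^esub>) (map (subst_letter (z 1)) w)) \<one>\<^bsub>L\<^esub> = \<one>\<^bsub>L\<^esub>"
      using er w(2) unfolding word_value_def by blast
    moreover have "map (\<lambda>x. if x \<in> carrier L then x else \<one>\<^bsub>L\<^esub>) (map (subst_letter (z 1)) w) = map (subst_letter \<one>\<^bsub>M\<^esub>) w"
      unfolding map_map comp_def using l3 by (rule map_cong[OF refl])
    moreover have "map (subst_letter \<one>\<^bsub>M\<^esub>) w \<in> lists (carrier L)" unfolding in_lists_conv_set set_map using l2 by blast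
    ultimately show ?thesis using subext_foldr[OF L(1) M(2)] subextD(2)[OF M(2)] unfolding word_value_def by metis
  qed
  then show thesis using that[OF M(1,2) _ _ M(5,6)] M(4,7) subextD(1)[OF M(3)] unfolding cB by blast
qed

section \<open>Stages\<close>

text \<open>Stability bounds the lists of each length, and uncountability of \<open>r\<close> the
  union over all lengths.\<close>

lemma card_lists_less:
  fixes X :: "'u set"
  assumes r: "stable r" "natLeq <o r" and X: "|X| <o r"
  shows "|lists X| <o r"
proof -
  have n: "|{xs \<in> lists X. length xs = n}| <o r" for n :: nat
  proof (induction n)
    case 0
    have "{xs \<in> lists X. length xs = 0} = {[]}" by auto
    moreover have "|{[] :: 'u list}| <o r"
      using finite_iff_ordLess_natLeq[of "{[] :: 'u list}"] r(2) ordLess_transitive by blast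
    ultimately show ?case by (simp only:)
  next
    case (Suc n)
    have "{xs \<in> lists X. length xs = Suc n} \<subseteq> (\<Union>x\<in>X. (\<lambda>xs. x # xs) ` {xs \<in> lists X. length xs = n})"
    proof
      fix xs assume "xs \<in> {xs \<in> lists X. length xs = Suc n}"
      then obtain y ys where "xs = y # ys" "y \<in> X" "ys \<in> {xs \<in> lists X. length xs = n}" by (cases xs) auto
      then show "xs \<in> (\<Union>x\<in>X. (\<lambda>xs. x # xs) ` {xs \<in> lists X. length xs = n})" by blast
    qed
    moreover have "|\<Union>x\<in>X. (\<lambda>xs. x # xs) ` {xs \<in> lists X. length xs = n}| <o r"
      by (rule stable_UNION[OF r(1) X]) (rule ordLeq_ordLess_trans[OF card_of_image Suc])
    ultimately show ?case using card_of_mono1 ordLeq_ordLess_trans by blast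
  qed
  have "|UNIV :: nat set| <o r" using card_of_nat r(2) ordIso_ordLess_trans by blast
  then have "|\<Union>n\<in>UNIV :: nat set. {xs \<in> lists X. length xs = n}| <o r" by (rule stable_UNION[OF r(1)]) (rule n)
  moreover have "(\<Union>n\<in>UNIV. {xs \<in> lists X. length xs = n}) = lists X" by blast
  ultimately show ?thesis by simp
qed

section \<open>The order on stages\<close>

locale colored_cardinals =
  fixes \<kappa> :: "'k rel" and \<theta> :: "'t rel" and c0 c1 :: "'k set \<Rightarrow> 'k" and e :: "'k set \<Rightarrow> 't"
  assumes \<kappa>: "infinite_regular_cardinal \<kappa>" and \<theta>: "infinite_regular_cardinal \<theta>" and \<theta>_\<kappa>: "\<theta> <o \<kappa>"
    and e: "e \<in> [Field \<kappa>]\<^bsup>2\<^esup> \<rightarrow> Field \<theta>" and e_sub: "subadditive \<kappa> \<theta> e"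
begin

abbreviation lt :: "'k \<Rightarrow> 'k \<Rightarrow> bool" where "lt \<alpha> \<beta> \<equiv> ord_less \<kappa> \<alpha> \<beta>"
abbreviation le_\<theta> :: "'t \<Rightarrow> 't \<Rightarrow> bool" where "le_\<theta> i j \<equiv> (i, j) \<in> \<theta>"

lemma Card_\<kappa>: "Card_order \<kappa>" and inf_\<kappa>: "infinite (Field \<kappa>)" and reg_\<kappa>: "regularCard \<kappa>"
  and Card_\<theta>: "Card_order \<theta>" and inf_\<theta>: "infinite (Field \<theta>)"
  using \<kappa> \<theta> unfolding infinite_regular_cardinal_def by blast+

lemma Well_\<kappa>: "Well_order \<kappa>" and Well_\<theta>: "Well_order \<theta>"
  using Card_\<kappa> Card_\<theta> by (simp_all add: card_order_on_def)

lemma lt_Field: "lt \<alpha> \<beta> \<Longrightarrow> \<alpha> \<in> Field \<kappa>" "lt \<alpha> \<beta> \<Longrightarrow> \<beta> \<in> Field \<kappa>"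
  by (auto simp: underS_def Field_def)

lemma lt_irrefl: "\<not> lt \<alpha> \<alpha>" by (simp add: underS_def)

lemma \<kappa>_order: "trans \<kappa>" "antisym \<kappa>" "total_on (Field \<kappa>) \<kappa>" "refl_on (Field \<kappa>) \<kappa>"
  and \<theta>_order: "trans \<theta>" "antisym \<theta>" "total_on (Field \<theta>) \<theta>" "refl_on (Field \<theta>) \<theta>"
  using Well_\<kappa> Well_\<theta>
  by (simp_all add: well_order_on_def linear_order_on_def partial_order_on_def preorder_on_def)

lemma lt_trans: "lt \<alpha> \<beta> \<Longrightarrow> lt \<beta> \<gamma> \<Longrightarrow> lt \<alpha> \<gamma>"
  using \<kappa>_order(1,2) unfolding underS_def trans_def antisym_def by blast

lemma lt_asym: "lt \<alpha> \<beta> \<Longrightarrow> \<not> lt \<beta> \<alpha>" using lt_trans lt_irrefl by blast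

lemma lt_linear: "\<alpha> \<in> Field \<kappa> \<Longrightarrow> \<beta> \<in> Field \<kappa> \<Longrightarrow> lt \<alpha> \<beta> \<or> \<alpha> = \<beta> \<or> lt \<beta> \<alpha>"
  using \<kappa>_order(3) unfolding total_on_def underS_def by blast

lemma le_refl: "i \<in> Field \<theta> \<Longrightarrow> le_\<theta> i i" using \<theta>_order(4) by (simp add: refl_on_def)
lemma le_Field: "le_\<theta> i j \<Longrightarrow> i \<in> Field \<theta>" "le_\<theta> i j \<Longrightarrow> j \<in> Field \<theta>" by (auto simp: Field_def)
lemma le_trans: "le_\<theta> i j \<Longrightarrow> le_\<theta> j k \<Longrightarrow> le_\<theta> i k" using \<theta>_order(1) unfolding trans_def by blast
lemma le_antisym: "le_\<theta> i j \<Longrightarrow> le_\<theta> j i \<Longrightarrow> i = j" using \<theta>_order(2) unfolding antisym_def by blast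
lemma le_linear: "i \<in> Field \<theta> \<Longrightarrow> j \<in> Field \<theta> \<Longrightarrow> le_\<theta> i j \<or> le_\<theta> j i"
  using \<theta>_order(3) le_refl unfolding total_on_def by metis
lemma le_bound: assumes "finite X" "X \<subseteq> Field \<theta>" shows "\<exists>k\<in>Field \<theta>. \<forall>i\<in>X. le_\<theta> i k"
  using assms
proof (induction X)
  case empty
  then show ?case using inf_\<theta> by (metis all_not_in_conv finite.emptyI)
next
  case (insert x X)
  then obtain k where k: "k \<in> Field \<theta>" "\<forall>i\<in>X. le_\<theta> i k" by auto
  then show ?case using le_linear[of x k] le_refl[of x] le_trans[of _ k x] insert(4) by (auto simp: Bex_def)
qed

lemma lt_bound: assumes "finite X" "X \<subseteq> Field \<kappa>" shows "\<exists>\<delta>\<in>Field \<kappa>. \<forall>\<alpha>\<in>X. lt \<alpha> \<delta>"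
proof -
  have step: "\<exists>\<delta>\<in>Field \<kappa>. lt \<alpha> \<delta>" if "\<alpha> \<in> Field \<kappa>" for \<alpha>
    using infinite_Card_order_limit[OF Card_\<kappa> inf_\<kappa> that] by (auto simp: underS_def)
  show ?thesis using assms
  proof (induction X)
    case empty
    then show ?case using inf_\<kappa> by (metis all_not_in_conv finite.emptyI)
  next
    case (insert x X)
    then obtain \<delta> where d: "\<delta> \<in> Field \<kappa>" "\<forall>i\<in>X. lt i \<delta>" by auto
    obtain \<delta>' where d': "\<delta>' \<in> Field \<kappa>" "lt \<delta> \<delta>'" using step d(1) by blast
    obtain \<delta>'' where d'': "\<delta>'' \<in> Field \<kappa>" "lt x \<delta>''" using step insert(4) by blast
    show ?case using lt_linear[OF d(1) d''(1)]
    proof (elim disjE)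
      assume "lt \<delta> \<delta>''"
      then show ?thesis using d(2) d'' lt_trans[of _ \<delta> \<delta>''] by (intro bexI[of _ \<delta>'']) auto
    next
      assume "\<delta> = \<delta>''"
      then show ?thesis using d d'' by (intro bexI[of _ \<delta>]) auto
    next
      assume "lt \<delta>'' \<delta>"
      then show ?thesis using d d'' lt_trans[of x \<delta>'' \<delta>] by (intro bexI[of _ \<delta>]) auto
    qed
  qed
qed

lemma e_Field: assumes "lt \<alpha> \<beta>" shows "e {\<alpha>, \<beta>} \<in> Field \<theta>"
proof -
  have "\<alpha> \<noteq> \<beta>" using assms lt_irrefl by blast
  then have "{\<alpha>, \<beta>} \<in> [Field \<kappa>]\<^bsup>2\<^esup>" using lt_Field[OF assms] by (simp add: nsets_def)
  then show ?thesis using e by blast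
qed

lemma max2_le: "le_\<theta> x (wo_rel.max2 \<theta> i j) \<Longrightarrow> le_\<theta> i k \<Longrightarrow> le_\<theta> j k \<Longrightarrow> le_\<theta> x k"
  unfolding wo_rel.max2_def[OF wo_rel.intro[OF Well_\<theta>], of i j] using le_trans[of x i k] le_trans[of x j k]
  by (simp split: if_splits)

text \<open>The two inequalities of subadditivity with a common bound \<open>k\<close>. The first
  makes \<open>below\<close> transitive; the second makes the stages below a given one
  directed.\<close>

lemma e_trans: "lt \<alpha> \<beta> \<Longrightarrow> lt \<beta> \<gamma> \<Longrightarrow> le_\<theta> (e {\<alpha>, \<beta>}) k \<Longrightarrow> le_\<theta> (e {\<beta>, \<gamma>}) k \<Longrightarrow> le_\<theta> (e {\<alpha>, \<gamma>}) k"
  and e_common: "lt \<alpha> \<beta> \<Longrightarrow> lt \<beta> \<gamma> \<Longrightarrow> le_\<theta> (e {\<alpha>, \<gamma>}) k \<Longrightarrow> le_\<theta> (e {\<beta>, \<gamma>}) k \<Longrightarrow> le_\<theta> (e {\<alpha>, \<beta>}) k"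
  using e_sub max2_le[of "e {\<alpha>, \<gamma>}" "e {\<alpha>, \<beta>}" "e {\<beta>, \<gamma>}" k] max2_le[of "e {\<alpha>, \<beta>}" "e {\<alpha>, \<gamma>}" "e {\<beta>, \<gamma>}" k]
  unfolding subadditive_def by simp_all

definition idx :: "('k \<times> 't) set" where "idx = Field \<kappa> \<times> Field \<theta>"

definition below :: "'k \<times> 't \<Rightarrow> 'k \<times> 't \<Rightarrow> bool" where
  "below p q \<longleftrightarrow> p \<in> idx \<and> q \<in> idx \<and> le_\<theta> (snd p) (snd q) \<and>
    (fst p = fst q \<or> lt (fst p) (fst q) \<and> le_\<theta> (e {fst p, fst q}) (snd q))"

lemma below_idx: "below p q \<Longrightarrow> p \<in> idx" "below p q \<Longrightarrow> q \<in> idx" by (simp_all add: below_def)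
lemma below_refl: "p \<in> idx \<Longrightarrow> below p p" using le_refl by (auto simp: below_def idx_def)

lemma below_trans: assumes "below p q" "below q r" shows "below p r"
proof -
  obtain \<alpha> i \<beta> j \<gamma> k where pqr: "p = (\<alpha>, i)" "q = (\<beta>, j)" "r = (\<gamma>, k)" by (cases p, cases q, cases r) blast
  have ik: "le_\<theta> i j" "le_\<theta> j k" "le_\<theta> i k" using assms le_trans by (auto simp: below_def pqr)
  have "\<alpha> = \<gamma> \<or> lt \<alpha> \<gamma> \<and> le_\<theta> (e {\<alpha>, \<gamma>}) k"
  proof (cases "\<alpha> = \<beta> \<or> \<beta> = \<gamma>")
    case True
    then show ?thesis using assms le_trans[OF _ ik(2)] by (auto simp: below_def pqr)
  next
    case False
    then have l: "lt \<alpha> \<beta>" "lt \<beta> \<gamma>" "le_\<theta> (e {\<alpha>, \<beta>}) k" "le_\<theta> (e {\<beta>, \<gamma>}) k"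
      using assms le_trans[OF _ ik(2)] by (auto simp: below_def pqr)
    then show ?thesis using lt_trans e_trans by blast
  qed
  then show ?thesis using ik(3) assms by (auto simp: below_def pqr)
qed

text \<open>The larger first coordinate, taken with the second coordinate of the upper stage, bounds
  both stages and stays below the upper one; this rests on \<open>e_common\<close>.\<close>

lemma below_join:
  assumes "below (\<alpha>, i) (\<gamma>, k)" "below (\<beta>, j) (\<gamma>, k)" "\<alpha> = \<beta> \<or> lt \<alpha> \<beta>"
  shows "below (\<alpha>, i) (\<beta>, k)" "below (\<beta>, j) (\<beta>, k)" "below (\<beta>, k) (\<gamma>, k)"
proof -
  have F: "k \<in> Field \<theta>" "\<beta> \<in> Field \<kappa>" "\<alpha> \<in> Field \<kappa>" "i \<in> Field \<theta>" using assms by (auto simp: below_def idx_def)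
  show "below (\<beta>, j) (\<beta>, k)" "below (\<beta>, k) (\<gamma>, k)" using assms(2) F le_refl by (auto simp: below_def idx_def)
  have "\<alpha> = \<beta> \<or> lt \<alpha> \<beta> \<and> le_\<theta> (e {\<alpha>, \<beta>}) k"
    using assms e_common[of \<alpha> \<beta> \<gamma> k] lt_asym[of \<alpha> \<beta>] by (auto simp: below_def)
  then show "below (\<alpha>, i) (\<beta>, k)" using assms(1) F by (auto simp: below_def idx_def)
qed

lemma nat_\<kappa>: "natLeq <o \<kappa>"
proof -
  have "natLeq \<le>o |Field \<theta>|" using inf_\<theta> infinite_iff_natLeq_ordLeq by blast
  then have "natLeq \<le>o \<theta>" using card_of_Field_ordIso[OF Card_\<theta>] ordLeq_ordIso_trans by blast
  then show ?thesis using \<theta>_\<kappa> ordLeq_ordLess_trans by blast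
qed

lemma stable_\<kappa>: "stable \<kappa>" by (rule regularCard_stable[OF Card_\<kappa> inf_\<kappa> reg_\<kappa>])

lemma small_finite: "finite X \<Longrightarrow> |X| <o \<kappa>"
  using finite_iff_ordLess_natLeq nat_\<kappa> ordLess_transitive by blast

lemma small_Field_\<theta>: "|Field \<theta>| <o \<kappa>"
  using card_of_Field_ordIso[OF Card_\<theta>] \<theta>_\<kappa> ordIso_ordLess_trans by blast

lemma small_mono: "X \<subseteq> Y \<Longrightarrow> |Y| <o \<kappa> \<Longrightarrow> |X| <o \<kappa>"
  using card_of_mono1 ordLeq_ordLess_trans by blast

lemma small_Un: "|X| <o \<kappa> \<Longrightarrow> |Y| <o \<kappa> \<Longrightarrow> |X \<union> Y| <o \<kappa>"
  by (rule card_of_Un_ordLess_infinite_Field[OF inf_\<kappa> Card_\<kappa>])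

lemma small_idx: "|underS \<kappa> \<gamma> \<times> Field \<theta>| <o \<kappa>" if "\<gamma> \<in> Field \<kappa>"
  using stable_elim[OF stable_\<kappa> card_of_underS[OF Card_\<kappa> that], of "\<lambda>_. Field \<theta>"] small_Field_\<theta> by simp

text \<open>\<kappa> is divided into disjoint supplies of \<kappa> names, countably many for each
  stage, and receives a pairing function. Carriers become sets of ordinals below \<kappa>, so that a
  color can denote a group element or a pair of them.\<close>

lemma ex_names:
  obtains nm :: "'k \<times> 't \<Rightarrow> nat \<Rightarrow> 'k \<Rightarrow> 'k" and pr :: "'k \<Rightarrow> 'k \<Rightarrow> 'k"
  where "\<And>p q m n \<zeta> \<xi>. p \<in> idx \<Longrightarrow> q \<in> idx \<Longrightarrow> \<zeta> \<in> Field \<kappa> \<Longrightarrow> \<xi> \<in> Field \<kappa> \<Longrightarrow> nm p m \<zeta> = nm q n \<xi> \<Longrightarrow> p = q \<and> m = n \<and> \<zeta> = \<xi>"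
    "\<And>p n \<zeta>. p \<in> idx \<Longrightarrow> \<zeta> \<in> Field \<kappa> \<Longrightarrow> nm p n \<zeta> \<in> Field \<kappa>"
    "\<And>x y. x \<in> Field \<kappa> \<Longrightarrow> y \<in> Field \<kappa> \<Longrightarrow> pr x y \<in> Field \<kappa>"
    "\<And>x y x' y'. x \<in> Field \<kappa> \<Longrightarrow> y \<in> Field \<kappa> \<Longrightarrow> x' \<in> Field \<kappa> \<Longrightarrow> y' \<in> Field \<kappa> \<Longrightarrow> pr x y = pr x' y' \<Longrightarrow> x = x' \<and> y = y'"
proof -
  have F: "|Field \<kappa>| =o \<kappa>" using card_of_Field_ordIso[OF Card_\<kappa>] .
  have le: "|Field \<kappa>| \<le>o \<kappa>" using F ordIso_imp_ordLeq by blast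
  have n: "|UNIV :: nat set| \<le>o \<kappa>" using card_of_nat nat_\<kappa> ordIso_ordLess_trans ordLess_imp_ordLeq by blast
  note T = card_of_Times_ordLeq_infinite_Field[OF inf_\<kappa> _ _ Card_\<kappa>]
  have "|idx \<times> (UNIV :: nat set) \<times> Field \<kappa>| \<le>o \<kappa>"
    unfolding idx_def using T[OF T[OF le ordLess_imp_ordLeq[OF small_Field_\<theta>]] T[OF n le]] .
  then have "|idx \<times> (UNIV :: nat set) \<times> Field \<kappa>| \<le>o |Field \<kappa>|" using F ordLeq_ordIso_trans ordIso_symmetric by blast
  then obtain f where f: "inj_on f (idx \<times> (UNIV :: nat set) \<times> Field \<kappa>)" "f ` (idx \<times> UNIV \<times> Field \<kappa>) \<subseteq> Field \<kappa>"
    unfolding card_of_ordLeq[symmetric] by blast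
  have "|Field \<kappa> \<times> Field \<kappa>| \<le>o |Field \<kappa>|" using T[OF le le] F ordLeq_ordIso_trans ordIso_symmetric by blast
  then obtain g where g: "inj_on g (Field \<kappa> \<times> Field \<kappa>)" "g ` (Field \<kappa> \<times> Field \<kappa>) \<subseteq> Field \<kappa>"
    unfolding card_of_ordLeq[symmetric] by blast
  show thesis
  proof (rule that[of "\<lambda>p n \<zeta>. f (p, n, \<zeta>)" "\<lambda>x y. g (x, y)"])
    show "p = q \<and> m = n \<and> \<zeta> = \<xi>" if "p \<in> idx" "q \<in> idx" "\<zeta> \<in> Field \<kappa>" "\<xi> \<in> Field \<kappa>" "f (p, m, \<zeta>) = f (q, n, \<xi>)" for p q m n \<zeta> \<xi>
      using inj_onD[OF f(1) that(5)] that by simp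
    show "x = x' \<and> y = y'" if "x \<in> Field \<kappa>" "y \<in> Field \<kappa>" "x' \<in> Field \<kappa>" "y' \<in> Field \<kappa>" "g (x, y) = g (x', y')" for x y x' y'
      using inj_onD[OF g(1) that(5)] that by simp
  qed (use f(2) g(2) in blast)+
qed

end

section \<open>Names, first appearances and the invariant of a stage\<close>

locale named_cardinals = colored_cardinals +
  fixes nm :: "'a \<times> 'b \<Rightarrow> nat \<Rightarrow> 'a \<Rightarrow> 'a" and pr :: "'a \<Rightarrow> 'a \<Rightarrow> 'a" and u :: 'a
  assumes nm_inj: "\<And>p q m n \<zeta> \<xi>. p \<in> idx \<Longrightarrow> q \<in> idx \<Longrightarrow> \<zeta> \<in> Field \<kappa> \<Longrightarrow> \<xi> \<in> Field \<kappa> \<Longrightarrow>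
      nm p m \<zeta> = nm q n \<xi> \<Longrightarrow> p = q \<and> m = n \<and> \<zeta> = \<xi>"
    and nm_Field: "\<And>p n \<zeta>. p \<in> idx \<Longrightarrow> \<zeta> \<in> Field \<kappa> \<Longrightarrow> nm p n \<zeta> \<in> Field \<kappa>"
    and pr_inj: "\<And>x y x' y'. x \<in> Field \<kappa> \<Longrightarrow> y \<in> Field \<kappa> \<Longrightarrow> x' \<in> Field \<kappa> \<Longrightarrow> y' \<in> Field \<kappa> \<Longrightarrow>
      pr x y = pr x' y' \<Longrightarrow> x = x' \<and> y = y'"
    and u_Field: "u \<in> Field \<kappa>" and nm_u: "\<And>p n \<zeta>. p \<in> idx \<Longrightarrow> \<zeta> \<in> Field \<kappa> \<Longrightarrow> nm p n \<zeta> \<noteq> u"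
begin

text \<open>Three supplies are consumed at each stage: 0 for the powers of the free letter, 1 for
  the free product with it and 2 for the quotient.\<close>

definition fresh :: "'a \<times> 'b \<Rightarrow> nat \<Rightarrow> 'a set" where "fresh p n = nm p n ` Field \<kappa>"

text \<open>Old elements keep their names under extension, so the supply to which a name belongs
  tells the stage where the element first appears.\<close>

definition tag :: "'a \<Rightarrow> 'a \<times> 'b" where "tag x = (SOME p. p \<in> idx \<and> (\<exists>n. x \<in> fresh p n))"

abbreviation ht :: "'a \<Rightarrow> 'a" where "ht x \<equiv> fst (tag x)"

lemma tag: assumes "p \<in> idx" "x \<in> fresh p n" shows "tag x = p" "x \<noteq> u" "x \<in> Field \<kappa>"
proof -
  have "tag x \<in> idx \<and> (\<exists>n. x \<in> fresh (tag x) n)"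
    unfolding tag_def by (rule someI[of _ p]) (use assms in blast)
  then obtain m \<zeta> where m: "tag x \<in> idx" "x = nm (tag x) m \<zeta>" "\<zeta> \<in> Field \<kappa>" unfolding fresh_def by blast
  obtain \<xi> where x: "x = nm p n \<xi>" "\<xi> \<in> Field \<kappa>" using assms(2) unfolding fresh_def by blast
  have "nm (tag x) m \<zeta> = nm p n \<xi>" using m(2) x(1) by simp
  then show "tag x = p" using nm_inj[OF m(1) assms(1) m(3) x(2)] by blast
  show "x \<noteq> u" "x \<in> Field \<kappa>" using assms nm_u nm_Field unfolding fresh_def by blast+
qed

lemma fresh_disjoint: "p \<in> idx \<Longrightarrow> m \<noteq> n \<Longrightarrow> fresh p m \<inter> fresh p n = {}"
  using nm_inj[of p p _ _ m n] unfolding fresh_def by auto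

lemma card_fresh: assumes "p \<in> idx" shows "\<kappa> \<le>o |fresh p n|"
proof -
  have "inj_on (nm p n) (Field \<kappa>)" using nm_inj[OF assms assms] by (auto simp: inj_on_def)
  then have "|Field \<kappa>| \<le>o |fresh p n|" unfolding fresh_def by (metis card_of_ordLeq order_refl)
  then show ?thesis using card_of_Field_ordIso[OF Card_\<kappa>] ordIso_ordLeq_trans ordIso_symmetric by blast
qed

definition IK :: "'a \<times> 'b \<Rightarrow> ('a \<times> 'b) set" where
  "IK p = {q. below q p \<and> lt (fst q) (fst p)}"

definition IL :: "'a \<times> 'b \<Rightarrow> ('a \<times> 'b) set" where
  "IL p = {q. \<exists>k. ord_less \<theta> k (snd p) \<and> below q (fst p, k)}"

text \<open>The parameters of the relators introduced at stage \<open>(\<gamma>, k)\<close>: the colors of \<open>{ht a, \<gamma>}\<close>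
  determine the right-hand side \<open>h\<close> and the pair \<open>(b1, b2)\<close>.\<close>

definition params :: "('a \<times> 'b \<Rightarrow> 'a monoid) \<Rightarrow> 'a \<times> 'b \<Rightarrow> ('a \<times> 'a \<times> 'a \<times> 'a \<times> 'a) set" where
  "params f p = {(a, y, b1, b2, h).
    a \<in> carrier (union_group u f (IK p)) - carrier (union_group u f (IL p)) \<and>
    y \<in> carrier (union_group u f (IL p)) - carrier (union_group u f (IK p)) \<and>
    b1 \<in> carrier (union_group u f (IK p)) \<inter> carrier (union_group u f (IL p)) \<and>
    b2 \<in> carrier (union_group u f (IK p)) \<inter> carrier (union_group u f (IL p)) \<and>
    h \<in> carrier (union_group u f (IK p)) \<inter> carrier (union_group u f (IL p)) \<and>
    b1 \<noteq> u \<and> b2 \<noteq> u \<and> lt (ht b1) (ht b2) \<and> lt (ht b2) (ht a) \<and>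
    c0 {ht a, fst p} = h \<and> c1 {ht a, fst p} = pr b1 b2}"

text \<open>The invariant of the recursion. It refers to \<open>f\<close> only at stages strictly
  below \<open>p\<close>. The clause on tags lets membership in a union be read off from the first
  appearance, and the last clause provides a letter that is free over the union along
  \<open>IL p\<close>.\<close>

definition stage :: "('a \<times> 'b \<Rightarrow> 'a monoid) \<Rightarrow> 'a \<times> 'b \<Rightarrow> 'a monoid \<Rightarrow> bool" where
  "stage f p M \<longleftrightarrow> group M \<and> \<one>\<^bsub>M\<^esub> = u \<and> torsion_free M \<and> |carrier M| <o \<kappa> \<and> carrier M \<subseteq> Field \<kappa> \<and>
    (\<forall>q. below q p \<and> q \<noteq> p \<longrightarrow> subext (f q) M \<and> malnormal_in (carrier (f q)) M) \<and>
    (\<forall>x\<in>carrier M. x = u \<or> tag x = p \<or> below (tag x) p \<and> tag x \<noteq> p \<and> x \<in> carrier (f (tag x))) \<and>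
    (\<forall>(a, y, b1, b2, h)\<in>params f p. foldr (mult M) (relator_list 200 a y b1 b2) u = h) \<and>
    (\<exists>t\<in>carrier M. t \<noteq> u \<and> tag t = p \<and>
      (\<forall>w\<in>group_words (union_group u f (IL p)). word_value M w t = u \<longrightarrow> word_value M w u = u))"

end

lemma (in group) conj_cancel: assumes "x \<in> carrier G" "c \<in> carrier G" shows "c \<otimes> (inv c \<otimes> x \<otimes> c) \<otimes> inv c = x"
proof -
  have "c \<otimes> (inv c \<otimes> x) = x" using assms by (simp add: m_assoc[symmetric])
  then show ?thesis using assms by (simp add: m_assoc)
qed

text \<open>The part of the tower available at some moment of the recursion; for
  \<open>Q = idx\<close> it is the finished tower.\<close>

locale stages = named_cardinals +
  fixes f :: "'a \<times> 'b \<Rightarrow> 'a monoid" and Q :: "('a \<times> 'b) set"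
  assumes Q_idx: "Q \<subseteq> idx" and Q_down: "\<And>q r. q \<in> Q \<Longrightarrow> below r q \<Longrightarrow> r \<in> Q"
    and stage_f: "\<And>q. q \<in> Q \<Longrightarrow> stage f q (f q)"
begin

lemma
  assumes "q \<in> Q"
  shows group_f: "group (f q)" and one_f: "\<one>\<^bsub>f q\<^esub> = u" and tf_f: "torsion_free (f q)"
    and small_f: "|carrier (f q)| <o \<kappa>" and Field_f: "carrier (f q) \<subseteq> Field \<kappa>"
  using stage_f[OF assms] unfolding stage_def by blast+

lemma below_f: assumes q: "q \<in> Q" and r: "below r q"
  shows "subext (f r) (f q)" "malnormal_in (carrier (f r)) (f q)"
proof -
  have "subext (f r) (f q) \<and> malnormal_in (carrier (f r)) (f q)"
  proof (cases "r = q")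
    case True
    then show ?thesis using subext_refl by (simp add: malnormal_in_def)
  next
    case False
    then show ?thesis using stage_f[OF q] r unfolding stage_def by blast
  qed
  then show "subext (f r) (f q)" "malnormal_in (carrier (f r)) (f q)" by blast+
qed

lemma tag_f: assumes q: "q \<in> Q" and x: "x \<in> carrier (f q)" "x \<noteq> u"
  shows "below (tag x) q" "x \<in> carrier (f (tag x))"
proof -
  have "tag x = q \<or> below (tag x) q \<and> x \<in> carrier (f (tag x))"
    using stage_f[OF q] x unfolding stage_def by blast
  then show "below (tag x) q" "x \<in> carrier (f (tag x))" using below_refl[of q] q Q_idx x by auto
qed

section \<open>Unions over ideals of stages\<close>

definition ideal :: "('a \<times> 'b) set \<Rightarrow> bool" where
  "ideal D \<longleftrightarrow> D \<subseteq> Q \<and> (\<forall>q\<in>D. \<forall>r. below r q \<longrightarrow> r \<in> D) \<and> (\<forall>q\<in>D. \<forall>r\<in>D. \<exists>s\<in>D. below q s \<and> below r s)"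

abbreviation "UG D \<equiv> union_group u f D"

lemma ideal_directed: assumes D: "ideal D" shows "directed_groups u f D"
proof (rule directed_groups.intro)
  have DQ: "D \<subseteq> Q" using D by (simp add: ideal_def)
  show "group (f q)" "\<one>\<^bsub>f q\<^esub> = u" if "q \<in> D" for q using that DQ group_f one_f by blast+
  show "\<exists>s\<in>D. subext (f q) (f s) \<and> subext (f r) (f s)" if "q \<in> D" "r \<in> D" for q r
  proof -
    obtain s where "s \<in> D" "below q s" "below r s" using D \<open>q \<in> D\<close> \<open>r \<in> D\<close> unfolding ideal_def by blast
    then show ?thesis using below_f(1) DQ by blast
  qed
qed

text \<open>An element is found at the stage of its tag or not at all, because an ideal is closed
  downwards. Hence unions over two ideals intersect in the union over the common stages.\<close>

lemma UG_carrier: assumes D: "ideal D"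
  shows "x \<in> carrier (UG D) \<longleftrightarrow> x = u \<or> tag x \<in> D \<and> x \<in> carrier (f (tag x))"
proof
  assume x: "x \<in> carrier (UG D)"
  show "x = u \<or> tag x \<in> D \<and> x \<in> carrier (f (tag x))"
  proof (cases "x = u")
    case False
    then obtain q where q: "q \<in> D" "x \<in> carrier (f q)" using x directed_groups.U_carrier[OF ideal_directed[OF D]] by blast
    then have "q \<in> Q" using D by (auto simp: ideal_def)
    then show ?thesis using tag_f[OF _ q(2) False] q(1) D unfolding ideal_def by blast
  qed simp
qed (use directed_groups.U_carrier[OF ideal_directed[OF D]] in blast)

lemma UG_Int: assumes "ideal D" "ideal E" "ideal (D \<inter> E)"
  shows "carrier (UG D) \<inter> carrier (UG E) = carrier (UG (D \<inter> E))"
  using UG_carrier[OF assms(1)] UG_carrier[OF assms(2)] UG_carrier[OF assms(3)] by auto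

lemma UG_group: assumes "ideal D" shows "group (UG D)" "\<one>\<^bsub>UG D\<^esub> = u"
  using directed_groups.group_U[OF ideal_directed[OF assms]] directed_groups.U_one[OF ideal_directed[OF assms]] .

lemma UG_tf: assumes "ideal D" shows "torsion_free (UG D)"
proof (rule directed_groups.torsion_free_U[OF ideal_directed[OF assms]])
  show "torsion_free (f q)" if "q \<in> D" for q using that assms tf_f unfolding ideal_def by blast
qed

lemma UG_member: assumes D: "ideal D" and q: "q \<in> D"
  shows "subext (f q) (UG D)" "malnormal_in (carrier (f q)) (UG D)"
proof -
  interpret D: directed_groups u f D by (rule ideal_directed[OF D])
  show "subext (f q) (UG D)" by (rule D.subext_U[OF q])
  show "malnormal_in (carrier (f q)) (UG D)"
  proof (rule D.malnormal_in_U)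
    fix r assume r: "r \<in> D"
    obtain s where s: "s \<in> D" "below q s" "below r s" using D q r unfolding ideal_def by blast
    then have "s \<in> Q" using D by (auto simp: ideal_def)
    then show "\<exists>s\<in>D. subext (f r) (f s) \<and> carrier (f q) \<subseteq> carrier (f s) \<and> malnormal_in (carrier (f q)) (f s)"
      using s below_f subextD(1) by blast
  qed (use q in blast)
qed

lemma UG_in: assumes D: "ideal D" and M: "group M" "\<one>\<^bsub>M\<^esub> = u"
    and s: "\<And>q. q \<in> D \<Longrightarrow> subext (f q) M \<and> malnormal_in (carrier (f q)) M"
  shows "subext (UG D) M" "malnormal_in (carrier (UG D)) M"
proof -
  interpret D: directed_groups u f D by (rule ideal_directed[OF D])
  have "u \<in> carrier M" using monoid.one_closed[OF group.is_monoid[OF M(1)]] M(2) by simp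
  then show "subext (UG D) M" using D.U_subext[OF M(2)] s M(1) by blast
  show "malnormal_in (carrier (UG D)) M" using D.U_malnormal_in[OF M] s by blast
qed

lemma UG_mono: assumes "ideal D" "ideal E" "D \<subseteq> E"
  shows "subext (UG D) (UG E)" "malnormal_in (carrier (UG D)) (UG E)"
  using UG_in[OF assms(1) UG_group[OF assms(2)]] UG_member[OF assms(2)] assms(3) by blast+

lemma UG_small: assumes D: "ideal D" "|D| <o \<kappa>" shows "|carrier (UG D)| <o \<kappa>" "carrier (UG D) \<subseteq> Field \<kappa>"
proof -
  have c: "carrier (UG D) = {u} \<union> (\<Union>q\<in>D. carrier (f q))" using directed_groups.U_carrier[OF ideal_directed[OF D(1)]] by simp
  have DQ: "D \<subseteq> Q" using D by (simp add: ideal_def)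
  have "|\<Union>q\<in>D. carrier (f q)| <o \<kappa>" by (rule stable_UNION[OF stable_\<kappa> D(2)]) (use DQ small_f in blast)
  then show "|carrier (UG D)| <o \<kappa>" unfolding c using small_Un[OF small_finite[of "{u}"]] by blast
  show "carrier (UG D) \<subseteq> Field \<kappa>" unfolding c using u_Field Field_f DQ by blast
qed

text \<open>Directedness comes from \<open>below_join\<close>: the bound keeps the second coordinate
  of \<open>p\<close> and uses one of the two given first coordinates, so it stays in the
  segment.\<close>

lemma ideal_segment:
  assumes B: "\<And>\<alpha> \<beta>. \<beta> \<in> B \<Longrightarrow> lt \<alpha> \<beta> \<Longrightarrow> \<alpha> \<in> B" and sub: "{q. below q p \<and> fst q \<in> B} \<subseteq> Q"
  shows "ideal {q. below q p \<and> fst q \<in> B}"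
  unfolding ideal_def
proof (intro conjI ballI allI impI sub)
  show "r \<in> {q. below q p \<and> fst q \<in> B}" if "q \<in> {q. below q p \<and> fst q \<in> B}" "below r q" for q r
  proof -
    have "below r p" using that below_trans by blast
    moreover have "fst r = fst q \<or> lt (fst r) (fst q)" using that(2) by (auto simp: below_def)
    ultimately show ?thesis using that(1) B by auto
  qed
  show "\<exists>s\<in>{q. below q p \<and> fst q \<in> B}. below q s \<and> below r s"
    if qr: "q \<in> {q. below q p \<and> fst q \<in> B}" "r \<in> {q. below q p \<and> fst q \<in> B}" for q r
  proof -
    obtain \<gamma> k \<alpha> i \<beta> j where p: "p = (\<gamma>, k)" "q = (\<alpha>, i)" "r = (\<beta>, j)" by (cases p, cases q, cases r) blast
    have b: "below (\<alpha>, i) (\<gamma>, k)" "below (\<beta>, j) (\<gamma>, k)" "\<alpha> \<in> B" "\<beta> \<in> B" using qr p by auto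
    have "lt \<alpha> \<beta> \<or> \<alpha> = \<beta> \<or> lt \<beta> \<alpha>" using b(1,2) lt_linear by (auto simp: below_def idx_def)
    then show ?thesis
    proof (elim disjE)
      assume "lt \<beta> \<alpha>"
      then show ?thesis using below_join[OF b(2,1)] b(3) p by (intro bexI[of _ "(\<alpha>, k)"]) auto
    qed (use below_join[OF b(1,2)] b(4) p in \<open>auto intro!: bexI[of _ "(\<beta>, k)"]\<close>)
  qed
qed

text \<open>The elements with height in an initial segment form the union over an ideal of lower
  stages, hence a malnormal subgroup. This is what controls the height of a conjugate.\<close>

lemma segment_f:
  assumes r: "r \<in> Q" and B: "\<And>\<alpha> \<beta>. \<beta> \<in> B \<Longrightarrow> lt \<alpha> \<beta> \<Longrightarrow> \<alpha> \<in> B"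
  shows "subgroup {x \<in> carrier (f r). x = u \<or> ht x \<in> B} (f r)" "malnormal_in {x \<in> carrier (f r). x = u \<or> ht x \<in> B} (f r)"
proof -
  let ?D = "{q. below q r \<and> fst q \<in> B}"
  have D: "ideal ?D" by (rule ideal_segment[OF B]) (use Q_down[OF r] in auto)
  have s: "subext (f q) (f r) \<and> malnormal_in (carrier (f q)) (f r)" if "q \<in> ?D" for q using that below_f[OF r] by blast
  note U = UG_in[OF D group_f[OF r] one_f[OF r] s]
  have "carrier (UG ?D) = {x \<in> carrier (f r). x = u \<or> ht x \<in> B}"
  proof (intro Set.set_eqI iffI)
    fix x assume "x \<in> carrier (UG ?D)"
    then show "x \<in> {x \<in> carrier (f r). x = u \<or> ht x \<in> B}"
      using UG_carrier[OF D, of x] subextD(1)[OF U(1)] by auto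
  next
    fix x assume "x \<in> {x \<in> carrier (f r). x = u \<or> ht x \<in> B}"
    then show "x \<in> carrier (UG ?D)" using UG_carrier[OF D, of x] tag_f[OF r, of x] by auto
  qed
  then show "subgroup {x \<in> carrier (f r). x = u \<or> ht x \<in> B} (f r)" "malnormal_in {x \<in> carrier (f r). x = u \<or> ht x \<in> B} (f r)"
    using subext_subgroup[OF UG_group(1)[OF D] group_f[OF r] U(1)] U(2) by simp_all
qed

text \<open>Conjugation by a higher element raises the height to that of the conjugating element.\<close>

lemma ht_conj:
  assumes r: "r \<in> Q" and x: "x \<in> carrier (f r)" "x \<noteq> u" and c: "c \<in> carrier (f r)" "c \<noteq> u"
  shows "lt (ht x) (ht c) \<Longrightarrow> ht (inv\<^bsub>f r\<^esub> c \<otimes>\<^bsub>f r\<^esub> x \<otimes>\<^bsub>f r\<^esub> c) = ht c"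
    "lt (ht c) (ht x) \<Longrightarrow> ht (inv\<^bsub>f r\<^esub> c \<otimes>\<^bsub>f r\<^esub> x \<otimes>\<^bsub>f r\<^esub> c) = ht x"
proof -
  interpret M: group "f r" using group_f[OF r] .
  let ?z = "inv\<^bsub>f r\<^esub> c \<otimes>\<^bsub>f r\<^esub> x \<otimes>\<^bsub>f r\<^esub> c"
  have z: "?z \<in> carrier (f r)" "?z \<noteq> u" using x c M.conj_cancel[OF x(1) c(1)] one_f[OF r] by auto
  have xz: "x = c \<otimes>\<^bsub>f r\<^esub> ?z \<otimes>\<^bsub>f r\<^esub> inv\<^bsub>f r\<^esub> c" using M.conj_cancel[OF x(1) c(1)] by simp
  let ?S = "\<lambda>B. {x \<in> carrier (f r). x = u \<or> ht x \<in> B}"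
  define B0 where "B0 \<beta> = {\<alpha>. lt \<alpha> \<beta>}" for \<beta>
  define B1 where "B1 \<beta> = {\<alpha>. lt \<alpha> \<beta> \<or> \<alpha> = \<beta>}" for \<beta>
  have S0: "subgroup (?S (B0 \<beta>)) (f r)" "malnormal_in (?S (B0 \<beta>)) (f r)" for \<beta>
  proof -
    have d: "\<alpha>' \<in> B0 \<beta>" if "\<alpha> \<in> B0 \<beta>" "lt \<alpha>' \<alpha>" for \<alpha> \<alpha>' using that lt_trans unfolding B0_def by blast
    show "subgroup (?S (B0 \<beta>)) (f r)" "malnormal_in (?S (B0 \<beta>)) (f r)" by (rule segment_f[OF r d], assumption+)+
  qed
  have S1: "subgroup (?S (B1 \<beta>)) (f r)" for \<beta>
  proof -
    have d: "\<alpha>' \<in> B1 \<beta>" if "\<alpha> \<in> B1 \<beta>" "lt \<alpha>' \<alpha>" for \<alpha> \<alpha>' using that lt_trans unfolding B1_def by blast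
    show ?thesis by (rule segment_f(1)[OF r d], assumption+)
  qed
  have cj: "?z \<in> S" if "subgroup S (f r)" "x \<in> S" "c \<in> S" for S
    using subgroup.m_closed[OF that(1) subgroup.m_closed[OF that(1) subgroup.m_inv_closed[OF that(1,3)] that(2)] that(3)] .
  have cj': "x \<in> S" if "subgroup S (f r)" "?z \<in> S" "c \<in> S" for S
    using subgroup.m_closed[OF that(1) subgroup.m_closed[OF that(1,3,2)] subgroup.m_inv_closed[OF that(1,3)]] xz by simp
  have mem: "w \<in> ?S B \<longleftrightarrow> ht w \<in> B" if "w \<in> carrier (f r)" "w \<noteq> u" for w B using that by simp
  have up: "lt (ht ?z) \<beta> \<or> ht ?z = \<beta>" if h: "lt (ht x) \<beta> \<or> ht x = \<beta>" "lt (ht c) \<beta> \<or> ht c = \<beta>" for \<beta>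
  proof -
    have "x \<in> ?S (B1 \<beta>)" "c \<in> ?S (B1 \<beta>)" unfolding mem[OF x] mem[OF c] using h by (simp_all only: B1_def mem_Collect_eq)
    then have "?z \<in> ?S (B1 \<beta>)" by (rule cj[OF S1])
    then show ?thesis unfolding mem[OF z] by (simp only: B1_def mem_Collect_eq)
  qed
  show "ht ?z = ht c" if l: "lt (ht x) (ht c)"
  proof -
    have "\<not> lt (ht ?z) (ht c)"
    proof
      assume "lt (ht ?z) (ht c)"
      then have "?z \<in> ?S (B0 (ht c))" "x \<in> ?S (B0 (ht c))" "c \<notin> ?S (B0 (ht c))"
        unfolding mem[OF x] mem[OF c] mem[OF z] using l lt_irrefl by (simp_all only: B0_def mem_Collect_eq not_False_eq_True)
      then have "x = \<one>\<^bsub>f r\<^esub>" using S0(2)[of "ht c"] c(1) unfolding malnormal_in_def by blast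
      then show False using x(2) one_f[OF r] by simp
    qed
    then show ?thesis using up[of "ht c"] l by blast
  qed
  show "ht ?z = ht x" if l: "lt (ht c) (ht x)"
  proof -
    have "\<not> lt (ht ?z) (ht x)"
    proof
      assume "lt (ht ?z) (ht x)"
      then have "?z \<in> ?S (B0 (ht x))" "c \<in> ?S (B0 (ht x))"
        unfolding mem[OF c] mem[OF z] using l by (simp_all only: B0_def mem_Collect_eq)
      then have "x \<in> ?S (B0 (ht x))" by (rule cj'[OF S0(1)])
      then show False unfolding mem[OF x] using lt_irrefl by (simp only: B0_def mem_Collect_eq)
    qed
    then show ?thesis using up[of "ht x"] l by blast
  qed
qed

end

context stages
begin

lemma ideal_IK: assumes "IK p \<subseteq> Q" shows "ideal (IK p)"
proof -
  have "IK p = {q. below q p \<and> fst q \<in> {\<alpha>. lt \<alpha> (fst p)}}" by (simp add: IK_def)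
  moreover have "\<alpha> \<in> {\<alpha>. lt \<alpha> (fst p)}" if "\<beta> \<in> {\<alpha>. lt \<alpha> (fst p)}" "lt \<alpha> \<beta>" for \<alpha> \<beta> using that lt_trans by blast
  ultimately show ?thesis using ideal_segment[of "{\<alpha>. lt \<alpha> (fst p)}" p] assms by simp
qed

lemma common_below:
  assumes "ord_less \<theta> k (snd p)" "ord_less \<theta> k' (snd p)" "below q (fst p, k)" "below q' (fst p, k')"
  obtains k'' where "ord_less \<theta> k'' (snd p)" "below q (fst p, k'')" "below q' (fst p, k'')"
proof -
  have F: "k \<in> Field \<theta>" "k' \<in> Field \<theta>" "fst p \<in> Field \<kappa>" using assms(3,4) by (auto simp: below_def idx_def)
  have up: "below (fst p, i) (fst p, j)" if "le_\<theta> i j" for i j using that F le_Field[OF that] by (simp add: below_def idx_def)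
  show thesis using le_linear[OF F(1,2)]
  proof
    assume "le_\<theta> k k'"
    then show thesis using that[OF assms(2) below_trans[OF assms(3) up] assms(4)] by blast
  next
    assume "le_\<theta> k' k"
    then show thesis using that[OF assms(1,3) below_trans[OF assms(4) up]] by blast
  qed
qed

lemma ideal_IL: assumes "IL p \<subseteq> Q" shows "ideal (IL p)"
  unfolding ideal_def
proof (intro conjI ballI allI impI assms)
  show "r \<in> IL p" if "q \<in> IL p" "below r q" for q r using that below_trans unfolding IL_def by blast
  show "\<exists>s\<in>IL p. below q s \<and> below r s" if qr: "q \<in> IL p" "r \<in> IL p" for q r
  proof -
    obtain k k' where k: "ord_less \<theta> k (snd p)" "ord_less \<theta> k' (snd p)" "below q (fst p, k)" "below r (fst p, k')"
      using qr unfolding IL_def by blast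
    obtain k'' where k'': "ord_less \<theta> k'' (snd p)" "below q (fst p, k'')" "below r (fst p, k'')" by (rule common_below[OF k])
    then have "(fst p, k'') \<in> IL p" using below_refl[OF below_idx(2)[OF k''(2)]] unfolding IL_def by blast
    then show ?thesis using k'' by blast
  qed
qed

text \<open>An intersection of ideals need not be directed. Here two members lie below a common
  \<open>(fst p, k'')\<close> with \<open>k''\<close> smaller than \<open>snd p\<close>, and the
  stages under it with smaller first coordinate form an ideal by
  \<open>ideal_segment\<close>.\<close>

lemma ideal_IKL: assumes "IK p \<subseteq> Q" "IL p \<subseteq> Q" shows "ideal (IK p \<inter> IL p)"
  unfolding ideal_def
proof (intro conjI ballI allI impI)
  show "IK p \<inter> IL p \<subseteq> Q" using assms by blast
  show "r \<in> IK p \<inter> IL p" if "q \<in> IK p \<inter> IL p" "below r q" for q r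
    using that ideal_IK[OF assms(1)] ideal_IL[OF assms(2)] unfolding ideal_def by blast
  show "\<exists>s\<in>IK p \<inter> IL p. below q s \<and> below r s" if qr: "q \<in> IK p \<inter> IL p" "r \<in> IK p \<inter> IL p" for q r
  proof -
    obtain k k' where k: "ord_less \<theta> k (snd p)" "ord_less \<theta> k' (snd p)" "below q (fst p, k)" "below r (fst p, k')"
      using qr unfolding IL_def by blast
    obtain k'' where k'': "ord_less \<theta> k'' (snd p)" "below q (fst p, k'')" "below r (fst p, k'')" by (rule common_below[OF k])
    let ?D = "{q. below q (fst p, k'') \<and> fst q \<in> {\<alpha>. lt \<alpha> (fst p)}}"
    have le: "below (fst p, k'') p"
      using below_idx[OF k''(2)] k''(1) qr(1) by (auto simp: below_def idx_def underS_def IK_def)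
    have sub: "?D \<subseteq> IK p \<inter> IL p" using below_trans[OF _ le] k''(1) unfolding IK_def IL_def by blast
    have "ideal ?D" using ideal_segment[of "{\<alpha>. lt \<alpha> (fst p)}" "(fst p, k'')"] lt_trans sub assms(1) by blast
    moreover have "q \<in> ?D" "r \<in> ?D" using qr k'' unfolding IK_def by blast+
    ultimately have "\<exists>s\<in>?D. below q s \<and> below r s" unfolding ideal_def by blast
    then show ?thesis using sub by blast
  qed
qed

lemma small_down: assumes "p \<in> idx" "D \<subseteq> {q. below q p}" shows "|D| <o \<kappa>"
proof (rule small_mono)
  have "D \<subseteq> (underS \<kappa> (fst p) \<times> Field \<theta>) \<union> ({fst p} \<times> Field \<theta>)" using assms(2) by (force simp: below_def idx_def)
  then show "D \<subseteq> (underS \<kappa> (fst p) \<times> Field \<theta>) \<union> ({fst p} \<times> Field \<theta>)" .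
  have "{fst p} \<times> Field \<theta> = Pair (fst p) ` Field \<theta>" by auto
  then have "|{fst p} \<times> Field \<theta>| <o \<kappa>" using ordLeq_ordLess_trans[OF card_of_image small_Field_\<theta>] by metis
  then show "|(underS \<kappa> (fst p) \<times> Field \<theta>) \<union> ({fst p} \<times> Field \<theta>)| <o \<kappa>"
    using small_Un[OF small_idx] assms(1) by (simp add: idx_def mem_Times_iff)
qed

text \<open>Equivariance of the relators. A nontrivial \<open>c\<close> at least as high as \<open>a\<close> would lift \<open>b1\<close> and
  \<open>b2\<close> to the same height; a lower one preserves the height of \<open>a\<close>, hence the colors and both \<open>b1\<close>
  and \<open>b2\<close>, which is impossible as these have different heights.\<close>

lemma params_conj:
  assumes IK: "IK p \<subseteq> Q" and IL: "IL p \<subseteq> Q"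
    and c: "c \<in> carrier (UG (IK p)) \<inter> carrier (UG (IL p))"
    and 1: "(a, y, b1, b2, h) \<in> params f p" and 2: "(a', y', b1', b2', h') \<in> params f p"
    and e: "a' = inv\<^bsub>UG (IK p)\<^esub> c \<otimes>\<^bsub>UG (IK p)\<^esub> a \<otimes>\<^bsub>UG (IK p)\<^esub> c"
      "b1' = inv\<^bsub>UG (IK p)\<^esub> c \<otimes>\<^bsub>UG (IK p)\<^esub> b1 \<otimes>\<^bsub>UG (IK p)\<^esub> c"
      "b2' = inv\<^bsub>UG (IK p)\<^esub> c \<otimes>\<^bsub>UG (IK p)\<^esub> b2 \<otimes>\<^bsub>UG (IK p)\<^esub> c"
  shows "h' = inv\<^bsub>UG (IK p)\<^esub> c \<otimes>\<^bsub>UG (IK p)\<^esub> h \<otimes>\<^bsub>UG (IK p)\<^esub> c"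
proof -
  let ?K = "UG (IK p)"
  note I = ideal_IK[OF IK]
  interpret K: group ?K by (rule UG_group(1)[OF I])
  have oneK: "\<one>\<^bsub>?K\<^esub> = u" by (rule UG_group(2)[OF I])
  have P1: "a \<in> carrier ?K" "b1 \<in> carrier ?K" "b2 \<in> carrier ?K" "h \<in> carrier ?K" "b1 \<noteq> u" "b2 \<noteq> u"
      "lt (ht b1) (ht b2)" "lt (ht b2) (ht a)" "c0 {ht a, fst p} = h" "c1 {ht a, fst p} = pr b1 b2" "a \<notin> carrier (UG (IL p))"
    using 1 unfolding params_def by blast+
  have P2: "a' \<in> carrier ?K" "b1' \<in> carrier ?K" "b2' \<in> carrier ?K" "lt (ht b1') (ht b2')" "c0 {ht a', fst p} = h'" "c1 {ht a', fst p} = pr b1' b2'"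
    using 2 unfolding params_def by blast+
  have cK: "c \<in> carrier ?K" using c by blast
  have h: "h' = h" if "ht a' = ht a" using that P1(9) P2(5) by simp
  show ?thesis
  proof (cases "c = u")
    case True
    then have "a' = a" using e(1) P1(1) K.l_one K.r_one K.inv_one oneK by metis
    then have "h' = h" using h by simp
    then show ?thesis using True P1(4) K.l_one K.r_one K.inv_one oneK by metis
  next
    case cu: False
    interpret D: directed_groups u f "IK p" by (rule ideal_directed[OF I])
    have au: "a \<noteq> u" using P1(11) D.U_carrier directed_groups.U_carrier[OF ideal_directed[OF ideal_IL[OF IL]]] by blast
    have "IK p \<noteq> {}" using cu cK D.U_carrier by blast
    then obtain r where r: "r \<in> IK p" "{a, b1, b2, h, c} \<subseteq> carrier (f r)"
      using D.in_common[of "{a, b1, b2, h, c}"] P1 cK by blast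
    have rQ: "r \<in> Q" using r(1) IK by blast
    interpret M: group "f r" by (rule group_f[OF rQ])
    have m: "a \<in> carrier (f r)" "b1 \<in> carrier (f r)" "b2 \<in> carrier (f r)" "c \<in> carrier (f r)" using r(2) by blast+
    have cj: "inv\<^bsub>?K\<^esub> c \<otimes>\<^bsub>?K\<^esub> x \<otimes>\<^bsub>?K\<^esub> c = inv\<^bsub>f r\<^esub> c \<otimes>\<^bsub>f r\<^esub> x \<otimes>\<^bsub>f r\<^esub> c" if "x \<in> carrier (f r)" for x
      using subext_conj[OF M.is_group K.is_group D.subext_U[OF r(1)] m(4) that] by simp
    note hc = ht_conj[OF rQ _ _ m(4) cu]
    have F: "ht c \<in> Field \<kappa>" "ht a \<in> Field \<kappa>" "ht b2 \<in> Field \<kappa>"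
      using tag_f(1)[OF rQ m(4) cu] tag_f(1)[OF rQ m(1) au] tag_f(1)[OF rQ m(3) P1(6)] by (auto simp: below_def idx_def)
    have lift: False if "lt (ht b2) (ht c)"
    proof -
      have "ht b2' = ht c" using hc(1)[OF m(3) P1(6) that] e(3) cj[OF m(3)] by simp
      moreover have "ht b1' = ht c" using hc(1)[OF m(2) P1(5) lt_trans[OF P1(7) that]] e(2) cj[OF m(2)] by simp
      ultimately show False using P2(4) lt_irrefl by simp
    qed
    have "lt (ht c) (ht a)"
      using lt_linear[OF F(1,2)] lift P1(8) lt_trans by metis
    then have ha: "ht a' = ht a" using hc(2)[OF m(1) au] e(1) cj[OF m(1)] by simp
    then have "pr b1' b2' = pr b1 b2" using P1(10) P2(6) by simp
    moreover have KF: "carrier ?K \<subseteq> Field \<kappa>" unfolding D.U_carrier using u_Field Field_f IK by blast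
    ultimately have b: "b1' = b1" "b2' = b2" using pr_inj[of b1' b2' b1 b2] P1(2,3) P2(2,3) by blast+
    \<comment> \<open>Now \<open>c\<close> centralises \<open>b1\<close> and \<open>b2\<close>. If
      \<open>c\<close> is lower than \<open>b2\<close>, conjugating \<open>c\<close> by
      \<open>b2\<close> would raise its height; if both have the same height, conjugating
      \<open>b1\<close> by \<open>c\<close> would raise that of \<open>b1\<close>.\<close>
    have False using lt_linear[OF F(1,3)]
    proof (elim disjE)
      assume l: "lt (ht c) (ht b2)"
      have z: "inv\<^bsub>f r\<^esub> c \<otimes>\<^bsub>f r\<^esub> b2 \<otimes>\<^bsub>f r\<^esub> c = b2" using b(2) e(3) cj[OF m(3)] by simp
      have "b2 \<otimes>\<^bsub>f r\<^esub> c = c \<otimes>\<^bsub>f r\<^esub> (inv\<^bsub>f r\<^esub> c \<otimes>\<^bsub>f r\<^esub> b2 \<otimes>\<^bsub>f r\<^esub> c)" using m by (simp add: M.m_assoc[symmetric])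
      then have "b2 \<otimes>\<^bsub>f r\<^esub> c = c \<otimes>\<^bsub>f r\<^esub> b2" using z by simp
      then have "inv\<^bsub>f r\<^esub> b2 \<otimes>\<^bsub>f r\<^esub> c \<otimes>\<^bsub>f r\<^esub> b2 = inv\<^bsub>f r\<^esub> b2 \<otimes>\<^bsub>f r\<^esub> (b2 \<otimes>\<^bsub>f r\<^esub> c)" using m by (simp add: M.m_assoc)
      also have "\<dots> = c" using m by (simp add: M.m_assoc[symmetric])
      finally show False using ht_conj(1)[OF rQ m(4) cu m(3) P1(6) l] l lt_irrefl by simp
    next
      assume l: "ht c = ht b2"
      then have "ht b1' = ht c" using hc(1)[OF m(2) P1(5)] P1(7) e(2) cj[OF m(2)] by simp
      then show False using b(1) l P1(7) lt_irrefl by simp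
    qed (use lift in blast)
    then show ?thesis ..
  qed
qed

lemma ex_int_names: assumes "p \<in> idx"
  obtains z :: "int \<Rightarrow> 'a" where "inj z" "z 0 = u" "\<And>i. i \<noteq> 0 \<Longrightarrow> z i \<in> fresh p 0"
proof -
  have "|UNIV :: int set| \<le>o |UNIV :: nat set|" using card_of_ordLeq[of "UNIV :: int set" "UNIV :: nat set"] inj_to_nat by blast
  then have "|UNIV :: int set| <o \<kappa>"
    using card_of_nat nat_\<kappa> by (metis ordIso_ordLess_trans ordLeq_ordLess_trans)
  then have "|UNIV :: int set| \<le>o |fresh p 0|"
    using card_fresh[OF assms] ordLess_imp_ordLeq ordLeq_transitive by blast
  then obtain j where j: "inj_on j (UNIV :: int set)" "j ` UNIV \<subseteq> fresh p 0" unfolding card_of_ordLeq[symmetric] by blast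
  have ju: "j i \<noteq> u" for i using tag(2)[OF assms] j(2) by blast
  show thesis
  proof (rule that[of "\<lambda>i. if i = 0 then u else j i"])
    show "inj (\<lambda>i. if i = 0 then u else j i)" using j(1) ju by (auto simp: inj_def inj_on_def)
  qed (use j(2) in auto)
qed

text \<open>Two extensions in a row: a free letter is adjoined to the union over
  \<open>IL p\<close>, and the result is amalgamated with the union over \<open>IK p\<close> modulo
  the relators. Since each step takes its new names from a supply of its own, the intersection of
  the factors does not grow.\<close>

lemma ex_stage: assumes p: "p \<in> idx" and IK: "IK p \<subseteq> Q" and IL: "IL p \<subseteq> Q" shows "\<exists>M. stage f p M"
proof -
  let ?K = "UG (IK p)" and ?L = "UG (IL p)" and ?J = "UG (IK p \<inter> IL p)"
  note I = ideal_IK[OF IK] ideal_IL[OF IL] ideal_IKL[OF IK IL]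
  have down: "IK p \<subseteq> {q. below q p}" "IL p \<subseteq> {q. below q p}"
  proof -
    show "IL p \<subseteq> {q. below q p}"
    proof
      fix q assume "q \<in> IL p"
      then obtain k where k: "ord_less \<theta> k (snd p)" "below q (fst p, k)" by (auto simp: IL_def)
      then have "below (fst p, k) p" using p below_idx(2)[OF k(2)] by (auto simp: below_def underS_def idx_def)
      then show "q \<in> {q. below q p}" using below_trans[OF k(2)] by blast
    qed
  qed (auto simp: IK_def)
  note K = UG_group[OF I(1)] and L = UG_group[OF I(2)] and J = UG_group[OF I(3)]
  have pKL: "p \<notin> IK p" "p \<notin> IL p"
  proof -
    show "p \<notin> IK p" using lt_irrefl by (simp add: IK_def)
    show "p \<notin> IL p"
    proof
      assume "p \<in> IL p"
      then obtain k where "ord_less \<theta> k (snd p)" "below p (fst p, k)" by (auto simp: IL_def)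
      then show False using le_antisym by (auto simp: below_def underS_def)
    qed
  qed
  have old: "x = u \<or> tag x \<noteq> p" if "x \<in> carrier ?K \<union> carrier ?L" for x
    using that UG_carrier[OF I(1), of x] UG_carrier[OF I(2), of x] pKL by auto
  have fr: "x \<noteq> u" "tag x = p" "x \<in> Field \<kappa>" "x \<notin> carrier ?K \<union> carrier ?L" if "x \<in> fresh p n" for x n
    using tag[OF p that] old by blast+
  note sK = UG_small[OF I(1) small_down[OF p down(1)]] and sL = UG_small[OF I(2) small_down[OF p down(2)]]
  have lists: "|lists X| \<le>o |fresh p n|" if "|X| <o \<kappa>" for X :: "'a set" and n
    using card_lists_less[OF stable_\<kappa> nat_\<kappa> that] card_fresh[OF p, of n] ordLess_imp_ordLeq ordLeq_transitive by blast
  obtain z :: "int \<Rightarrow> 'a" where z: "inj z" "z 0 = u" "\<And>i. i \<noteq> 0 \<Longrightarrow> z i \<in> fresh p 0" 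
    by (rule ex_int_names[OF p]) blast
  have rz: "x = u \<or> x \<in> fresh p 0" if x: "x \<in> range z" for x
  proof -
    obtain i where "x = z i" using x by blast
    then show ?thesis using z(2) z(3)[of i] by (cases "i = 0") simp_all
  qed
  have uL: "u \<in> carrier ?L" "u \<in> carrier ?K" using UG_carrier[OF I(2)] UG_carrier[OF I(1)] by blast+
  have srz: "|range z| <o \<kappa>"
  proof -
    have "|range z| \<le>o |UNIV :: int set|" by (rule card_of_image)
    also have "|UNIV :: int set| \<le>o |UNIV :: nat set|" using card_of_ordLeq[of "UNIV :: int set" "UNIV :: nat set"] inj_to_nat by blast
    finally show ?thesis using card_of_nat nat_\<kappa> by (metis ordIso_ordLess_trans ordLeq_ordLess_trans)
  qed
  note sLz = small_Un[OF sL(1) srz]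
  obtain L' :: "'a monoid" where L': "group L'" "subext ?L L'" "range z \<subseteq> carrier L'"
      "carrier L' \<subseteq> carrier ?L \<union> range z \<union> fresh p 1"
      "torsion_free L'" "malnormal_in (carrier ?L) L'" "|carrier L'| \<le>o |lists (carrier ?L \<union> range z)|"
    and w: "\<And>w. w \<in> group_words ?L \<Longrightarrow> word_value L' w (z 1) = \<one>\<^bsub>L'\<^esub> \<Longrightarrow> word_value L' w \<one>\<^bsub>L'\<^esub> = \<one>\<^bsub>L'\<^esub>"
  proof (rule free_letter[OF L(1) UG_tf[OF I(2)] z(1), of "fresh p 1"])
    show "z 0 = \<one>\<^bsub>?L\<^esub>" using z(2) L(2) by simp
    show "range z \<inter> carrier ?L = {\<one>\<^bsub>?L\<^esub>}" 
    proof (intro equalityI subsetI)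
      fix x assume "x \<in> range z \<inter> carrier ?L"
      then have "x = u" using rz[of x] fr(4)[of x 0] by blast
      then show "x \<in> {\<one>\<^bsub>?L\<^esub>}" using L(2) by simp
    next
      fix x assume "x \<in> {\<one>\<^bsub>?L\<^esub>}"
      then have "x = z 0" "x = u" using L(2) z(2) by simp_all
      then show "x \<in> range z \<inter> carrier ?L" using uL(1) by simp
    qed
    show "fresh p 1 \<inter> (carrier ?L \<union> range z) = {}" 
    proof (rule equals0I)
      fix x assume x: "x \<in> fresh p 1 \<inter> (carrier ?L \<union> range z)"
      have "x \<notin> fresh p 0" using fresh_disjoint[OF p, of 1 0] x by auto
      then show False using rz[of x] fr(1,4)[of x 1] x by blast
    qed
    show "|lists (carrier ?L \<union> range z)| \<le>o |fresh p 1|" by (rule lists[OF sLz])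
  qed blast
  have sL': "|carrier L'| <o \<kappa>" using L'(7) card_lists_less[OF stable_\<kappa> nat_\<kappa> sLz] ordLeq_ordLess_trans by blast
  have oL': "\<one>\<^bsub>L'\<^esub> = u" using subextD(2)[OF L'(2)] L(2) by simp
  have new: "x \<in> carrier ?L \<or> x \<in> fresh p 0 \<or> x \<in> fresh p 1" if "x \<in> carrier L'" for x
    using subsetD[OF L'(4) that] rz[of x] uL(1) by blast
  have KL': "carrier ?K \<inter> carrier L' = carrier ?K \<inter> carrier ?L" 
  proof (intro equalityI subsetI)
    fix x assume x: "x \<in> carrier ?K \<inter> carrier L'"
    then show "x \<in> carrier ?K \<inter> carrier ?L" using new[of x] fr(4)[of x 0] fr(4)[of x 1] by blast
  qed (use subextD(1)[OF L'(2)] in blast)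
  \<comment> \<open>The amalgamated subgroup is the union over the common stages, which inherits
    malnormality on both sides from its members.\<close>
  have KJ: "carrier ?K \<inter> carrier L' = carrier ?J" unfolding KL' by (rule UG_Int[OF I])
  note JK = UG_mono[OF I(3,1) Int_lower1] and JL = UG_mono[OF I(3,2) Int_lower2]
  interpret sc: small_cancellation ?K L' "params f p" 200
  proof (intro small_cancellation.intro group_amalgam.intro small_cancellation_axioms.intro)
    show "group ?K" "group L'" "torsion_free ?K" "torsion_free L'" using K L' UG_tf[OF I(1)] by blast+
    show "\<one>\<^bsub>?K\<^esub> = \<one>\<^bsub>L'\<^esub>" using K oL' by simp
    show "subgroup (carrier ?K \<inter> carrier L') ?K" unfolding KJ by (rule subext_subgroup[OF J(1) K(1) JK(1)])
    show "x \<otimes>\<^bsub>?K\<^esub> y = x \<otimes>\<^bsub>L'\<^esub> y" if "x \<in> carrier ?K \<inter> carrier L'" "y \<in> carrier ?K \<inter> carrier L'" for x y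
      using that subextD(3)[OF JK(1), of x y] subextD(3)[OF subext_trans[OF JL(1) L'(2)], of x y] unfolding KJ by simp
    show "malnormal_in (carrier ?K \<inter> carrier L') ?K" unfolding KJ by (rule JK(2))
    show "malnormal_in (carrier ?K \<inter> carrier L') L'" unfolding KJ
      by (rule malnormal_in_trans[OF L(1) L'(1,2) subextD(1)[OF JL(1)] JL(2) L'(6)])
    show "a \<in> carrier ?K - carrier L' \<and> y \<in> carrier L' - carrier ?K \<and> b1 \<in> carrier ?K \<inter> carrier L' \<and>
      b2 \<in> carrier ?K \<inter> carrier L' \<and> h \<in> carrier ?K \<inter> carrier L' \<and> b1 \<noteq> \<one>\<^bsub>?K\<^esub> \<and> b1 \<noteq> b2"
      if "(a, y, b1, b2, h) \<in> params f p" for a y b1 b2 h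
    proof -
      have P: "a \<in> carrier ?K - carrier ?L" "y \<in> carrier ?L - carrier ?K" "b1 \<in> carrier ?K \<inter> carrier ?L"
        "b2 \<in> carrier ?K \<inter> carrier ?L" "h \<in> carrier ?K \<inter> carrier ?L" "b1 \<noteq> u" "lt (ht b1) (ht b2)"
        using that unfolding params_def by blast+
      have "a \<in> carrier ?K - carrier L'" using P(1) KL' by blast
      moreover have "y \<in> carrier L' - carrier ?K" using P(2) subextD(1)[OF L'(2)] by blast
      moreover have "b1 \<noteq> b2" using P(7) lt_irrefl by auto
      ultimately show ?thesis using P(3-6) K(2) unfolding KL' by simp
    qed
    show "h' = inv\<^bsub>?K\<^esub> c \<otimes>\<^bsub>?K\<^esub> h \<otimes>\<^bsub>?K\<^esub> c"
      if "c \<in> carrier ?K \<inter> carrier L'" "(a, y, b1, b2, h) \<in> params f p" "(a', y', b1', b2', h') \<in> params f p"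
        "a' = inv\<^bsub>?K\<^esub> c \<otimes>\<^bsub>?K\<^esub> a \<otimes>\<^bsub>?K\<^esub> c" "y' = inv\<^bsub>L'\<^esub> c \<otimes>\<^bsub>L'\<^esub> y \<otimes>\<^bsub>L'\<^esub> c"
        "b1' = inv\<^bsub>?K\<^esub> c \<otimes>\<^bsub>?K\<^esub> b1 \<otimes>\<^bsub>?K\<^esub> c" "b2' = inv\<^bsub>?K\<^esub> c \<otimes>\<^bsub>?K\<^esub> b2 \<otimes>\<^bsub>?K\<^esub> c"
      for a y b1 b2 h a' y' b1' b2' h' c
      using params_conj[OF IK IL _ that(2-4,6,7)] that(1) unfolding KL' by blast
  qed simp
  note sKL = small_Un[OF sK(1) sL']
  obtain M :: "'a monoid" where M: "group M" "subext ?K M" "subext L' M" "carrier M \<subseteq> carrier ?K \<union> carrier L' \<union> fresh p 2"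
      "torsion_free M" "malnormal_in (carrier ?K) M" "malnormal_in (carrier L') M"
      "|carrier M| \<le>o |lists (carrier ?K \<union> carrier L')|"
    and rel: "\<And>a y b1 b2 h. (a, y, b1, b2, h) \<in> params f p \<Longrightarrow> foldr (mult M) (relator_list 200 a y b1 b2) \<one>\<^bsub>M\<^esub> = h"
  proof (rule sc.extension[of "fresh p 2"])
    show "fresh p 2 \<inter> (carrier ?K \<union> carrier L') = {}"

    proof (rule equals0I)
      fix x assume x: "x \<in> fresh p 2 \<inter> (carrier ?K \<union> carrier L')"
      have "x \<notin> fresh p 0" "x \<notin> fresh p 1" using fresh_disjoint[OF p, of 2 0] fresh_disjoint[OF p, of 2 1] x by auto
      then show False using new[of x] fr(4)[of x 2] x by blast
    qed
    show "|lists (carrier ?K \<union> carrier L')| \<le>o |fresh p 2|" by (rule lists[OF sKL])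
  qed blast
  have oM: "\<one>\<^bsub>M\<^esub> = u" using subextD(2)[OF M(2)] K(2) by simp
  note LM = subext_trans[OF L'(2) M(3)]
  have mLM: "malnormal_in (carrier ?L) M" by (rule malnormal_in_trans[OF L'(1) M(1,3) subextD(1)[OF L'(2)] L'(6) M(7)])
  have mem: "x \<in> carrier ?K \<or> x \<in> carrier ?L \<or> (\<exists>n. x \<in> fresh p n)" if "x \<in> carrier M" for x
    using subsetD[OF M(4) that] new[of x] by blast
  have "stage f p M"
    unfolding stage_def
  proof (intro conjI M(1,5) oM)
    show "|carrier M| <o \<kappa>" using M(8) card_lists_less[OF stable_\<kappa> nat_\<kappa> sKL] ordLeq_ordLess_trans by blast
    show "carrier M \<subseteq> Field \<kappa>" using mem fr(3) sK(2) sL(2) by blast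
    show "\<forall>q. below q p \<and> q \<noteq> p \<longrightarrow> subext (f q) M \<and> malnormal_in (carrier (f q)) M"
    proof (intro allI impI)
      fix q assume q: "below q p \<and> q \<noteq> p"
      have "q \<in> IK p \<or> q \<in> IL p"
      proof (cases "fst q = fst p")
        case True
        then have "snd q \<noteq> snd p" using q by (metis prod.expand)
        then have "ord_less \<theta> (snd q) (snd p)" using q by (simp add: below_def underS_def)
        moreover have "below q (fst p, snd q)" using below_refl[OF below_idx(1)] q True by (metis prod.collapse)
        ultimately show ?thesis unfolding IL_def by blast
      next
        case False
        then show ?thesis using q unfolding IK_def below_def by blast
      qed
      then show "subext (f q) M \<and> malnormal_in (carrier (f q)) M"
      proof
        assume q: "q \<in> IK p"
        note m = UG_member[OF I(1) q]
        have "q \<in> Q" using q IK by blast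
        then show ?thesis using subext_trans[OF m(1) M(2)]
            malnormal_in_trans[OF K(1) M(1,2) subextD(1)[OF m(1)] m(2) M(6)] by blast
      next
        assume q: "q \<in> IL p"
        note m = UG_member[OF I(2) q]
        show ?thesis using subext_trans[OF m(1) LM]
            malnormal_in_trans[OF L(1) M(1) LM subextD(1)[OF m(1)] m(2) mLM] by blast
      qed
    qed
    show "\<forall>x\<in>carrier M. x = u \<or> tag x = p \<or> below (tag x) p \<and> tag x \<noteq> p \<and> x \<in> carrier (f (tag x))"
    proof
      fix x assume x: "x \<in> carrier M"
      have "x \<in> carrier ?K \<union> carrier ?L \<Longrightarrow> x = u \<or> below (tag x) p \<and> tag x \<noteq> p \<and> x \<in> carrier (f (tag x))"
        using UG_carrier[OF I(1), of x] UG_carrier[OF I(2), of x] down old[of x] by blast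
      then show "x = u \<or> tag x = p \<or> below (tag x) p \<and> tag x \<noteq> p \<and> x \<in> carrier (f (tag x))"
        using mem[OF x] fr(2)[of x] by blast
    qed
    show "\<forall>(a, y, b1, b2, h)\<in>params f p. foldr (mult M) (relator_list 200 a y b1 b2) u = h"
      using rel unfolding oM by blast
    have tp: "z 1 \<in> fresh p 0" using z(3) by simp
    have "z 1 \<in> carrier L'" using L'(3) by blast
    have "word_value M w u = u" if "w \<in> group_words ?L" "word_value M w (z 1) = u" for w
    proof -
      have vv: "word_value M w g = word_value L' w g" if g: "g \<in> carrier L'" for g
      proof -
        have "map (subst_letter g) w \<in> lists (carrier L')"
          unfolding in_lists_conv_set set_map
        proof (intro ballI)
          fix v assume "v \<in> subst_letter g ` set w"
          then obtain l where l: "v = subst_letter g l" "l \<in> set w" by blast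
          then have "l = Var \<or> (\<exists>a\<in>carrier ?L. l = Const a)" using \<open>w \<in> group_words ?L\<close> unfolding group_words_def by auto
          then show "v \<in> carrier L'" using l(1) g subextD(1)[OF L'(2)] by auto
        qed
        then show ?thesis unfolding word_value_def using subext_foldr[OF L'(1) M(3)] by blast
      qed
      have "u \<in> carrier L'" using subextD(1)[OF L'(2)] uL by blast
      then show ?thesis using w[OF that(1)] that(2) vv \<open>z 1 \<in> carrier L'\<close> oL' by simp
    qed
    then show "\<exists>t\<in>carrier M. t \<noteq> u \<and> tag t = p \<and>
      (\<forall>w\<in>group_words ?L. word_value M w t = u \<longrightarrow> word_value M w u = u)"
      using subextD(1)[OF M(3)] \<open>z 1 \<in> carrier L'\<close> fr(1,2)[OF tp] by blast
  qed
  then show ?thesis ..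
qed

end

section \<open>Group topologies\<close>

lemma set_power_nbhd:
  assumes G: "group G" and T: "group_topology G T" and U: "openin T U" "\<one>\<^bsub>G\<^esub> \<in> U"
  shows "\<exists>V. openin T V \<and> \<one>\<^bsub>G\<^esub> \<in> V \<and> set_power G V n \<subseteq> U"
  using U
proof (induction n arbitrary: U)
  case 0
  then show ?case by (auto simp: set_power_def)
next
  case (Suc n)
  interpret group G by (rule G)
  have tT: "topspace T = carrier G" and m: "continuous_map (prod_topology T T) T (\<lambda>(x, y). x \<otimes>\<^bsub>G\<^esub> y)"
    using T unfolding group_topology_def by blast+
  let ?W = "{z \<in> topspace (prod_topology T T). (case z of (x, y) \<Rightarrow> x \<otimes>\<^bsub>G\<^esub> y) \<in> U}"
  have "openin (prod_topology T T) ?W" using openin_continuous_map_preimage[OF m Suc.prems(1)] .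
  moreover have "(\<one>\<^bsub>G\<^esub>, \<one>\<^bsub>G\<^esub>) \<in> ?W" using Suc.prems(2) tT by simp
  ultimately obtain A B where AB: "openin T A" "openin T B" "\<one>\<^bsub>G\<^esub> \<in> A" "\<one>\<^bsub>G\<^esub> \<in> B" "A \<times> B \<subseteq> ?W"
    unfolding openin_prod_topology_alt by meson
  obtain V where V: "openin T V" "\<one>\<^bsub>G\<^esub> \<in> V" "set_power G V n \<subseteq> B" using Suc.IH[OF AB(2,4)] by blast
  have "set_power G (A \<inter> V) (Suc n) \<subseteq> U"
  proof
    fix g assume "g \<in> set_power G (A \<inter> V) (Suc n)"
    then obtain xs where xs: "g = foldr (mult G) xs \<one>\<^bsub>G\<^esub>" "length xs = Suc n" "set xs \<subseteq> A \<inter> V"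
      unfolding set_power_def by blast
    obtain x ys where xy: "xs = x # ys" using xs(2) by (cases xs) auto
    have "foldr (mult G) ys \<one>\<^bsub>G\<^esub> \<in> set_power G V n" using xs xy unfolding set_power_def by auto
    then have "(x, foldr (mult G) ys \<one>\<^bsub>G\<^esub>) \<in> A \<times> B" using V(3) xs(3) xy by auto
    then have "(case (x, foldr (mult G) ys \<one>\<^bsub>G\<^esub>) of (x, y) \<Rightarrow> x \<otimes>\<^bsub>G\<^esub> y) \<in> U" using AB(5) by blast
    then show "g \<in> U" using xs(1) xy by simp
  qed
  then show ?case using AB V by (intro exI[of _ "A \<inter> V"]) auto
qed

lemma translation_continuous:
  assumes G: "group G" and T: "group_topology G T" and c: "c \<in> carrier G"
  shows "continuous_map T T (\<lambda>x. c \<otimes>\<^bsub>G\<^esub> x)" "continuous_map T T (\<lambda>x. x \<otimes>\<^bsub>G\<^esub> c)"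
proof -
  have tT: "topspace T = carrier G" and m: "continuous_map (prod_topology T T) T (\<lambda>(x, y). x \<otimes>\<^bsub>G\<^esub> y)"
    using T unfolding group_topology_def by blast+
  have k: "continuous_map T T (\<lambda>x. c)" "continuous_map T T (\<lambda>x. x)" using c tT by simp_all
  show "continuous_map T T (\<lambda>x. c \<otimes>\<^bsub>G\<^esub> x)"
    using continuous_map_compose[OF continuous_map_pairedI[OF k] m] by (simp add: o_def)
  show "continuous_map T T (\<lambda>x. x \<otimes>\<^bsub>G\<^esub> c)"
    using continuous_map_compose[OF continuous_map_pairedI[OF k(2,1)] m] by (simp add: o_def)
qed

text \<open>A neighborhood \<open>V\<close> of \<open>1\<close> with \<open>V\<^sup>n \<noteq> G\<close> is too small to meet a suitable conjugate of itself.\<close>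

lemma t1_discrete:
  assumes G: "group G" and T: "group_topology G T" "t1_space T" and n: "n_Shelah G n"
    and g: "g \<in> carrier G" "g \<noteq> \<one>\<^bsub>G\<^esub>"
    and mal: "\<And>V. V \<subseteq> carrier G \<Longrightarrow> \<not> |V| =o |carrier G| \<Longrightarrow>
      \<exists>c\<in>carrier G. \<forall>x\<in>V. inv\<^bsub>G\<^esub> c \<otimes>\<^bsub>G\<^esub> x \<otimes>\<^bsub>G\<^esub> c \<in> V \<longrightarrow> x = \<one>\<^bsub>G\<^esub>"
  shows "T = discrete_topology (carrier G)"
proof -
  interpret group G by (rule G)
  have tT: "topspace T = carrier G" using T by (simp add: group_topology_def)
  have "closedin T {g}" using T(2) g(1) tT by (simp add: t1_space_closedin_singleton)
  then have "openin T (carrier G - {g})" using tT by (metis openin_diff openin_topspace)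
  then obtain V where V: "openin T V" "\<one>\<^bsub>G\<^esub> \<in> V" "set_power G V n \<subseteq> carrier G - {g}"
    using set_power_nbhd[OF G T(1), of "carrier G - {g}" n] g by blast
  have VG: "V \<subseteq> carrier G" using openin_subset[OF V(1)] tT by simp
  have "set_power G V n \<noteq> carrier G" using V(3) g(1) by blast
  then have "\<not> |V| =o |carrier G|" using n VG unfolding n_Shelah_def by blast
  then obtain c where c: "c \<in> carrier G" "\<forall>x\<in>V. inv\<^bsub>G\<^esub> c \<otimes>\<^bsub>G\<^esub> x \<otimes>\<^bsub>G\<^esub> c \<in> V \<longrightarrow> x = \<one>\<^bsub>G\<^esub>"
    using mal[OF VG] by blast
  have cont: "continuous_map T T (\<lambda>x. inv\<^bsub>G\<^esub> c \<otimes>\<^bsub>G\<^esub> x \<otimes>\<^bsub>G\<^esub> c)"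
    using continuous_map_compose[OF translation_continuous(1)[OF G T(1), of "inv\<^bsub>G\<^esub> c"] translation_continuous(2)[OF G T(1), of c]] c(1)
    by (simp add: o_def)
  have "openin T (V \<inter> {x \<in> topspace T. inv\<^bsub>G\<^esub> c \<otimes>\<^bsub>G\<^esub> x \<otimes>\<^bsub>G\<^esub> c \<in> V})"
    using openin_Int[OF V(1) openin_continuous_map_preimage[OF cont V(1)]] .
  moreover have "V \<inter> {x \<in> topspace T. inv\<^bsub>G\<^esub> c \<otimes>\<^bsub>G\<^esub> x \<otimes>\<^bsub>G\<^esub> c \<in> V} = {\<one>\<^bsub>G\<^esub>}"
  proof -
    have "inv\<^bsub>G\<^esub> c \<otimes>\<^bsub>G\<^esub> \<one>\<^bsub>G\<^esub> \<otimes>\<^bsub>G\<^esub> c = \<one>\<^bsub>G\<^esub>" using c(1) by simp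
    then have "\<one>\<^bsub>G\<^esub> \<in> V \<inter> {x \<in> topspace T. inv\<^bsub>G\<^esub> c \<otimes>\<^bsub>G\<^esub> x \<otimes>\<^bsub>G\<^esub> c \<in> V}"
      using V(2) one_closed by (simp only: tT Int_iff mem_Collect_eq simp_thms)
    then show ?thesis using c(2) by blast
  qed
  ultimately have one: "openin T {\<one>\<^bsub>G\<^esub>}" by simp
  have "openin T {x}" if x: "x \<in> carrier G" for x
  proof -
    have "openin T {y \<in> topspace T. inv\<^bsub>G\<^esub> x \<otimes>\<^bsub>G\<^esub> y \<in> {\<one>\<^bsub>G\<^esub>}}"
      by (rule openin_continuous_map_preimage[OF translation_continuous(1)[OF G T(1)] one]) (use x in simp)
    moreover have "{y \<in> topspace T. inv\<^bsub>G\<^esub> x \<otimes>\<^bsub>G\<^esub> y \<in> {\<one>\<^bsub>G\<^esub>}} = {x}"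
    proof -
      have "y = x" if "y \<in> carrier G" "inv\<^bsub>G\<^esub> x \<otimes>\<^bsub>G\<^esub> y = \<one>\<^bsub>G\<^esub>" for y
        using inv_solve_left[of y x "\<one>\<^bsub>G\<^esub>"] that x by (metis inv_closed inv_equality inv_inv inv_comm)
      moreover have "inv\<^bsub>G\<^esub> x \<otimes>\<^bsub>G\<^esub> x = \<one>\<^bsub>G\<^esub>" using x by simp
      ultimately show ?thesis using x unfolding tT by blast
    qed
    ultimately show ?thesis by simp
  qed
  then show ?thesis using discrete_topology_unique[of "carrier G" T] tT by simp
qed

text \<open>The length does not depend on the letters, so one exponent serves every set
  \<open>X\<close>.\<close>

lemma length_relator_list: "length (relator_list N a y b1 b2) = length (relator_list N () () () ())"
proof -
  have "length (relator_block a y b1 b2 t) = length (relator_block () () () () t)" for t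
    by (simp add: relator_block_def)
  then show ?thesis by (simp add: relator_list_def length_concat comp_def)
qed

lemma set_relator_list: "set (relator_list N a y b1 b2) \<subseteq> {a, y, b1, b2}"
  by (auto simp: relator_list_def relator_block_def split: if_splits)

section \<open>Recursion along the stages\<close>

context named_cardinals
begin

lemma IK_below: "q \<in> IK p \<Longrightarrow> below q p \<and> q \<noteq> p" using lt_irrefl by (auto simp: IK_def)

lemma IL_below: assumes "p \<in> idx" "q \<in> IL p" shows "below q p \<and> q \<noteq> p"
proof -
  obtain k where k: "ord_less \<theta> k (snd p)" "below q (fst p, k)" using assms(2) by (auto simp: IL_def)
  then have "below (fst p, k) p" using assms(1) below_idx(2)[OF k(2)] by (auto simp: below_def underS_def idx_def)
  moreover have "q \<noteq> p" using k le_antisym by (auto simp: below_def underS_def)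
  ultimately show ?thesis using below_trans[OF k(2)] by blast
qed

text \<open>The invariant at \<open>p\<close> is determined by the strictly lower groups, as a
  definition by recursion requires.\<close>

lemma stage_cong: assumes p: "p \<in> idx" and fg: "\<And>q. below q p \<Longrightarrow> q \<noteq> p \<Longrightarrow> f q = g q" and s: "stage f p M"
  shows "stage g p M"
proof -
  have c: "carrier (union_group u f (IK p)) = carrier (union_group u g (IK p))"
    "carrier (union_group u f (IL p)) = carrier (union_group u g (IL p))"
    using fg IK_below IL_below[OF p] by (auto simp: union_group_def)
  then have "params f p = params g p" by (simp only: params_def)
  moreover have "group_words (union_group u f (IL p)) = group_words (union_group u g (IL p))"
    using c(2) by (simp only: group_words_def)
  moreover have "\<forall>q. below q p \<and> q \<noteq> p \<longrightarrow> subext (g q) M \<and> malnormal_in (carrier (g q)) M"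
    using s fg unfolding stage_def by metis
  moreover have "\<forall>x\<in>carrier M. x = u \<or> tag x = p \<or> below (tag x) p \<and> tag x \<noteq> p \<and> x \<in> carrier (g (tag x))"
    using s fg unfolding stage_def by metis
  ultimately show ?thesis using s unfolding stage_def by simp
qed

text \<open>\<open>below\<close> is extended to the lexicographic order, which is well-founded. Its
  initial segments are closed downwards for \<open>below\<close>, so each of them is an instance of
  \<open>stages\<close> and \<open>ex_stage\<close> applies.\<close>

lemma ex_tower: "\<exists>f. \<forall>p\<in>idx. stage f p (f p)"
proof -
  define R where "R = (\<kappa> - Id) <*lex*> (\<theta> - Id)"
  have wf: "wf R" unfolding R_def using Well_\<kappa> Well_\<theta> by (intro wf_lex_prod) (auto simp: well_order_on_def)
  have RI: "(q, p) \<in> R \<longleftrightarrow> lt (fst q) (fst p) \<or> fst q = fst p \<and> ord_less \<theta> (snd q) (snd p)" for q p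
    by (cases q, cases p) (auto simp: R_def underS_def)
  have below_R: "(q, p) \<in> R" if "below q p" "q \<noteq> p" for q p
    unfolding RI using that by (cases q, cases p) (auto simp: below_def underS_def)
  have Rt: "(r, p) \<in> R" if "below r q" "(q, p) \<in> R" for r q p
  proof -
    have q: "lt (fst q) (fst p) \<or> fst q = fst p \<and> ord_less \<theta> (snd q) (snd p)" using that(2) RI by blast
    have r: "le_\<theta> (snd r) (snd q)" "fst r = fst q \<or> lt (fst r) (fst q)" using that(1) unfolding below_def by blast+
    have "ord_less \<theta> (snd r) (snd p)" if "ord_less \<theta> (snd q) (snd p)"
      using that r(1) le_trans[of "snd r" "snd q" "snd p"] le_antisym[of "snd r" "snd q"] by (auto simp: underS_def)
    then show ?thesis unfolding RI using q r(2) lt_trans[of "fst r" "fst q" "fst p"] by metis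
  qed
  have "\<exists>f. \<forall>p. p \<in> idx \<longrightarrow> stage f p (f p)"
  proof (rule dependent_wf_choice[OF wf])
    show "(x \<in> idx \<longrightarrow> stage f x r) = (x \<in> idx \<longrightarrow> stage g x r)" if fg: "\<And>z. (z, x) \<in> R \<Longrightarrow> f z = g z" for f g x r
    proof -
      have "stage f x r \<longleftrightarrow> stage g x r" if x: "x \<in> idx"
        using stage_cong[OF x, of f g r] stage_cong[OF x, of g f r] fg below_R by metis
      then show ?thesis by blast
    qed
    show "\<exists>M. p \<in> idx \<longrightarrow> stage f p M" if IH: "\<And>q. (q, p) \<in> R \<Longrightarrow> q \<in> idx \<longrightarrow> stage f q (f q)" for p f
    proof (cases "p \<in> idx")
      case True
      interpret stages \<kappa> \<theta> c0 c1 e nm pr u f "{q \<in> idx. (q, p) \<in> R}"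
        by unfold_locales (use IH Rt below_idx in blast)+
      show ?thesis
        using ex_stage[OF True] IK_below IL_below[OF True] below_R below_idx by blast
    qed simp
  qed
  then show ?thesis by blast
qed

end

section \<open>The Shelah group\<close>

lemma (in named_cardinals) stage_relator:
  assumes "stage f p M" "(a, y, b1, b2, h) \<in> params f p"
  shows "foldr (mult M) (relator_list 200 a y b1 b2) u = h"
proof -
  have "\<forall>(a, y, b1, b2, h)\<in>params f p. foldr (mult M) (relator_list 200 a y b1 b2) u = h"
    using assms(1) unfolding stage_def by (elim conjE)
  from bspec[OF this assms(2)] show ?thesis by (simp only: prod.case)
qed

locale tower = named_cardinals +
  fixes f :: "'a \<times> 'b \<Rightarrow> 'a monoid"
  assumes f_stage: "\<And>p. p \<in> idx \<Longrightarrow> stage f p (f p)"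
begin

sublocale stages \<kappa> \<theta> c0 c1 e nm pr u f idx
  by unfold_locales (use f_stage below_idx in auto)

text \<open>Keep the larger first coordinate and take a second one above both given ones and above
  the value of \<open>e\<close> at the two first coordinates.\<close>

lemma idx_join:
  assumes p: "p \<in> idx" and q: "q \<in> idx"
  obtains s where "s \<in> idx" "below p s" "below q s" "fst s = fst p \<or> fst s = fst q"
proof -
  have *: "\<exists>s\<in>idx. below p s \<and> below q s \<and> fst s = fst q" if p: "p \<in> idx" and q: "q \<in> idx" and l: "fst p = fst q \<or> lt (fst p) (fst q)" for p q
  proof -
    define E where "E = (if lt (fst p) (fst q) then {e {fst p, fst q}} else {})"
    have "{snd p, snd q} \<union> E \<subseteq> Field \<theta>" "finite ({snd p, snd q} \<union> E)" using p q e_Field by (auto simp: idx_def E_def)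
    then obtain k where k: "k \<in> Field \<theta>" "\<forall>i\<in>{snd p, snd q} \<union> E. le_\<theta> i k" using le_bound by metis
    have "below p (fst q, k)" "below q (fst q, k)" "(fst q, k) \<in> idx" using k p q l by (auto simp: below_def idx_def E_def split: if_splits)
    then show ?thesis by (intro bexI[of _ "(fst q, k)"]) auto
  qed
  have "fst p \<in> Field \<kappa>" "fst q \<in> Field \<kappa>" using p q by (auto simp: idx_def)
  then consider "fst p = fst q \<or> lt (fst p) (fst q)" | "lt (fst q) (fst p)" using lt_linear by blast
  then show thesis using *[OF p q] *[OF q p] that by cases blast+
qed

lemma ideal_cut: assumes B: "\<And>\<alpha> \<beta>. \<beta> \<in> B \<Longrightarrow> lt \<alpha> \<beta> \<Longrightarrow> \<alpha> \<in> B" shows "ideal {q \<in> idx. fst q \<in> B}"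
  unfolding ideal_def
proof (intro conjI ballI allI impI)
  show "r \<in> {q \<in> idx. fst q \<in> B}" if "q \<in> {q \<in> idx. fst q \<in> B}" "below r q" for q r
    using that B[of "fst q" "fst r"] by (auto simp: below_def)
  show "\<exists>s\<in>{q \<in> idx. fst q \<in> B}. below q s \<and> below r s" if qr: "q \<in> {q \<in> idx. fst q \<in> B}" "r \<in> {q \<in> idx. fst q \<in> B}" for q r
  proof -
    obtain s where "s \<in> idx" "below q s" "below r s" "fst s = fst q \<or> fst s = fst r" using idx_join[of q r] qr by auto
    then show ?thesis using qr by (intro bexI[of _ s]) auto
  qed
qed auto

lemma ideal_idx: "ideal idx" using ideal_cut[of UNIV] by simp

abbreviation "G \<equiv> UG idx"

lemma G_tag: "x \<in> carrier G \<longleftrightarrow> x = u \<or> tag x \<in> idx \<and> x \<in> carrier (f (tag x))"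
  by (rule UG_carrier[OF ideal_idx])

lemma G_ht: "x \<in> carrier G \<Longrightarrow> x \<noteq> u \<Longrightarrow> ht x \<in> Field \<kappa>" using G_tag by (auto simp: idx_def)

lemma G_f: assumes "p \<in> idx" shows "subext (f p) G" using UG_member(1)[OF ideal_idx assms] .

lemma G_Field: "carrier G \<subseteq> Field \<kappa>"
  unfolding directed_groups.U_carrier[OF ideal_directed[OF ideal_idx]] using u_Field Field_f by blast

definition level :: "'a \<Rightarrow> 'a set" where "level \<beta> = {x \<in> carrier G. x = u \<or> lt (ht x) \<beta>}"

text \<open>Fewer than \<kappa> stages have their first coordinate below \<beta>, and each of their
  groups has fewer than \<kappa> elements; malnormality passes to the union.\<close>

lemma level: assumes "\<beta> \<in> Field \<kappa>" shows "malnormal_in (level \<beta>) G" "|level \<beta>| <o \<kappa>"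
proof -
  let ?D = "{q \<in> idx. fst q \<in> {\<alpha>. lt \<alpha> \<beta>}}"
  have D: "ideal ?D" by (rule ideal_cut) (use lt_trans in blast)
  have c: "carrier (UG ?D) = level \<beta>"
    unfolding level_def using UG_carrier[OF D] G_tag by auto
  show "malnormal_in (level \<beta>) G" using UG_mono(2)[OF D ideal_idx] c by auto
  have "?D \<subseteq> underS \<kappa> \<beta> \<times> Field \<theta>" by (auto simp: idx_def)
  then have "|?D| <o \<kappa>" using small_mono small_idx[OF assms] by blast
  then show "|level \<beta>| <o \<kappa>" using UG_small(1)[OF D] c by simp
qed

lemma small_bounded: assumes "X \<subseteq> Field \<kappa>" "|X| <o \<kappa>" shows "\<exists>\<beta>\<in>Field \<kappa>. \<forall>\<alpha>\<in>X. lt \<alpha> \<beta>"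
proof -
  have "\<not> cofinal X \<kappa>" using reg_\<kappa> assms not_ordLess_ordIso unfolding regularCard_def by blast
  then obtain a where a: "a \<in> Field \<kappa>" "\<forall>b\<in>X. \<not> lt a b" unfolding cofinal_def underS_def by blast
  obtain \<beta> where b: "\<beta> \<in> Field \<kappa>" "lt a \<beta>" using lt_bound[of "{a}"] a(1) by auto
  have "lt \<alpha> \<beta>" if "\<alpha> \<in> X" for \<alpha> using a(2) lt_linear[of \<alpha> a] that assms(1) a(1) b(2) lt_trans by blast
  then show ?thesis using b(1) by blast
qed

lemma small_level: assumes "V \<subseteq> carrier G" "|ht ` (V - {u})| <o \<kappa>" shows "\<exists>\<beta>\<in>Field \<kappa>. V \<subseteq> level \<beta>"
proof -
  have "ht ` (V - {u}) \<subseteq> Field \<kappa>" using G_ht assms(1) by blast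
  then obtain \<beta> where "\<beta> \<in> Field \<kappa>" "\<forall>\<alpha>\<in>ht ` (V - {u}). lt \<alpha> \<beta>" using small_bounded assms(2) by blast
  then show ?thesis using assms(1) unfolding level_def by blast
qed

lemma free_elements:
  assumes "p \<in> idx"
  obtains t where "t \<in> carrier G" "t \<noteq> u" "tag t = p"
    "\<And>w. w \<in> group_words (UG (IL p)) \<Longrightarrow> word_value (f p) w t = u \<Longrightarrow> word_value (f p) w u = u" "t \<in> carrier (f p)"
proof -
  obtain t where t: "t \<in> carrier (f p)" "t \<noteq> u" "tag t = p"
    "\<forall>w\<in>group_words (UG (IL p)). word_value (f p) w t = u \<longrightarrow> word_value (f p) w u = u"
    using f_stage[OF assms] unfolding stage_def by blast
  then show thesis using that[of t] subextD(1)[OF G_f[OF assms]] by blast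
qed

text \<open>The free letters realise every height, and the carrier consists of names in
  \<open>Field \<kappa>\<close>.\<close>

lemma card_G: "|carrier G| =o \<kappa>"
proof -
  obtain k where k: "k \<in> Field \<theta>" using inf_\<theta> by (metis all_not_in_conv finite.emptyI)
  have "Field \<kappa> \<subseteq> ht ` carrier G"
  proof
    fix \<gamma> assume "\<gamma> \<in> Field \<kappa>"
    then have "(\<gamma>, k) \<in> idx" using k by (simp add: idx_def)
    then obtain t where "t \<in> carrier G" "tag t = (\<gamma>, k)" using free_elements[of "(\<gamma>, k)"] by metis
    then show "\<gamma> \<in> ht ` carrier G" by (intro image_eqI[of _ _ t]) simp_all
  qed
  then have "|Field \<kappa>| \<le>o |carrier G|" using card_of_mono1 card_of_image ordLeq_transitive by blast
  moreover have "|carrier G| \<le>o |Field \<kappa>|" using G_Field by (rule card_of_mono1)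
  ultimately have "|carrier G| =o |Field \<kappa>|" using ordIso_iff_ordLeq by blast
  then show ?thesis using card_of_Field_ordIso[OF Card_\<kappa>] ordIso_transitive by blast
qed

lemma not_small: "X \<subseteq> Field \<kappa> \<Longrightarrow> \<not> |X| <o \<kappa> \<Longrightarrow> |X| =o \<kappa>"
proof -
  assume "X \<subseteq> Field \<kappa>" "\<not> |X| <o \<kappa>"
  moreover from this(1) have "|X| \<le>o \<kappa>"
    using card_of_mono1 card_of_Field_ordIso[OF Card_\<kappa>] ordLeq_ordIso_trans by blast
  ultimately show "|X| =o \<kappa>" using ordLeq_iff_ordLess_or_ordIso by blast
qed

lemma large: "|X| =o |carrier G| \<Longrightarrow> \<not> |X| <o \<kappa>"
  using card_G ordIso_transitive not_ordLess_ordIso by blast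

text \<open>A defining system would contain a word \<open>w\<close> that is nontrivial at the unit.
  Its finitely many constants lie in the group of one stage \<open>p\<close>. A free letter over
  that group is not the unit, so it satisfies \<open>w\<close>, and then \<open>w\<close> would be
  trivial at the unit.\<close>

lemma nonalgebraic: "\<not> algebraic_subset G (carrier G - {u})"
proof
  assume "algebraic_subset G (carrier G - {u})"
  then obtain W where W: "W \<subseteq> group_words G" "carrier G - {u} = {g \<in> carrier G. \<forall>w\<in>W. word_value G w g = u}"
    unfolding algebraic_subset_def UG_group(2)[OF ideal_idx] by blast
  interpret D: directed_groups u f idx by (rule ideal_directed[OF ideal_idx])
  have "u \<in> carrier G" using G_tag by blast
  then obtain w where w: "w \<in> W" "word_value G w u \<noteq> u" using W(2) by blast
  define X where "X = {a. Const a \<in> set w}"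
  have "X \<subseteq> subst_letter u ` set w"
    unfolding X_def by (intro subsetI image_eqI[of _ "subst_letter u" "Const _"]) simp_all
  then have "finite X" by (rule finite_subset) simp
  moreover have XG: "X \<subseteq> carrier G" using W(1) w(1) unfolding X_def group_words_def by auto
  moreover have "idx \<noteq> {}" using inf_\<kappa> inf_\<theta> unfolding idx_def by auto
  ultimately obtain p where p: "p \<in> idx" "X \<subseteq> carrier (f p)" using D.in_common by blast
  \<comment> \<open>Raising only the second coordinate places \<open>p\<close> in \<open>IL\<close>
    of the new stage, over whose union the new letter is free.\<close>
  obtain k where k: "k \<in> Field \<theta>" "ord_less \<theta> (snd p) k"
    using infinite_Card_order_limit[OF Card_\<theta> inf_\<theta>, of "snd p"] p(1) by (auto simp: idx_def underS_def)
  let ?q = "(fst p, k)"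
  have q: "?q \<in> idx" using p k by (simp add: idx_def mem_Times_iff)
  have "p \<in> IL ?q" using k(2) below_refl[OF p(1)] unfolding IL_def by (auto intro: exI[of _ "snd p"])
  then have L: "X \<subseteq> carrier (UG (IL ?q))"
    using p(2) unfolding union_group_def by auto
  have "w \<in> group_words (UG (IL ?q))"
    unfolding group_words_def in_lists_conv_set
  proof
    fix l assume l: "l \<in> set w"
    show "l \<in> insert Var (Const ` carrier (UG (IL ?q)))"
    proof (cases l)
      case (Const a)
      then have "a \<in> X" using l by (simp add: X_def)
      then show ?thesis using L Const by blast
    qed simp
  qed
  moreover obtain t where t: "t \<in> carrier G" "t \<noteq> u" "t \<in> carrier (f ?q)"
    "\<And>w. w \<in> group_words (UG (IL ?q)) \<Longrightarrow> word_value (f ?q) w t = u \<Longrightarrow> word_value (f ?q) w u = u"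
    using free_elements[OF q] by metis
  have pq: "below p ?q" using p q k by (auto simp: below_def idx_def underS_def)
  have v: "word_value G w g = word_value (f ?q) w g" if g: "g \<in> carrier (f ?q)" for g
  proof -
    have "map (subst_letter g) w \<in> lists (carrier (f ?q))"
      unfolding in_lists_conv_set set_map
    proof (intro ballI)
      fix v assume "v \<in> subst_letter g ` set w"
      then obtain l where l: "v = subst_letter g l" "l \<in> set w" by blast
      show "v \<in> carrier (f ?q)"
      proof (cases l)
        case (Const a)
        then have "a \<in> X" using l(2) by (simp add: X_def)
        then show ?thesis using l(1) Const p(2) subextD(1)[OF below_f(1)[OF q pq]] by auto
      qed (use l(1) g in simp)
    qed
    then show ?thesis unfolding word_value_def using subext_foldr[OF group_f[OF q] G_f[OF q]] by blast
  qed
  have "word_value G w t = u" using W(2) t(1,2) w(1) by blast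
  moreover have "u \<in> carrier (f ?q)" using D.u_f[OF q] .
  ultimately show False using t(4)[of w] t(3) v w(2) by metis
qed

text \<open>A set with few heights would lie in one small level. So \<kappa> many heights occur, and
  since \<theta> is smaller than the regular \<kappa>, one second coordinate occurs at \<kappa> many
  of them.\<close>

lemma ex_large_fibre:
  assumes X: "X \<subseteq> carrier G" "|X| =o |carrier G|"
  obtains x A i where "A \<subseteq> Field \<kappa>" "|A| =o \<kappa>" "i \<in> Field \<theta>"
    "\<And>\<gamma>. \<gamma> \<in> A \<Longrightarrow> x \<gamma> \<in> X \<and> x \<gamma> \<noteq> u \<and> tag (x \<gamma>) = (\<gamma>, i)"
proof -
  let ?A = "ht ` (X - {u})"
  have big: "\<not> |?A| <o \<kappa>"
  proof
    assume "|?A| <o \<kappa>"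
    then obtain \<beta> where "\<beta> \<in> Field \<kappa>" "X \<subseteq> level \<beta>" using small_level[OF X(1)] by blast
    then show False using level(2) small_mono large[OF X(2)] by blast
  qed
  have "\<forall>\<gamma>\<in>?A. \<exists>y. y \<in> X \<and> y \<noteq> u \<and> ht y = \<gamma>" by auto
  then obtain x where x: "\<And>\<gamma>. \<gamma> \<in> ?A \<Longrightarrow> x \<gamma> \<in> X \<and> x \<gamma> \<noteq> u \<and> ht (x \<gamma>) = \<gamma>" by metis
  let ?F = "\<lambda>i. {\<gamma> \<in> ?A. snd (tag (x \<gamma>)) = i}"
  have "snd (tag (x \<gamma>)) \<in> Field \<theta>" if "\<gamma> \<in> ?A" for \<gamma>
    using x[OF that] X(1) G_tag[of "x \<gamma>"] by (auto simp: idx_def mem_Times_iff)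
  then have "?A \<subseteq> (\<Union>i\<in>Field \<theta>. ?F i)" by blast
  then have "\<not> |\<Union>i\<in>Field \<theta>. ?F i| <o \<kappa>" using big small_mono by blast
  then obtain i where i: "i \<in> Field \<theta>" "\<not> |?F i| <o \<kappa>" using stable_UNION[OF stable_\<kappa> small_Field_\<theta>, of ?F] by blast
  have F: "?F i \<subseteq> Field \<kappa>" using G_ht X(1) by blast
  show thesis
  proof (rule that[OF F not_small[OF F i(2)] i(1)])
    show "x \<gamma> \<in> X \<and> x \<gamma> \<noteq> u \<and> tag (x \<gamma>) = (\<gamma>, i)" if "\<gamma> \<in> ?F i" for \<gamma>
      using x[of \<gamma>] that by (auto simp: prod_eq_iff)
  qed
qed

text \<open>The order of choices matters. After \<open>b1\<close>, \<open>b2\<close> and a \<delta>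
  in the club come \<beta> and a bound \<open>i\<close> for the second coordinates that
  \<open>b1\<close>, \<open>b2\<close>, \<open>h\<close> and \<open>x \<beta>\<close> need below
  \<beta>; only then is \<alpha> chosen, with \<open>e {\<alpha>, \<beta>}\<close> above
  \<open>i\<close>. At the stage \<open>(\<beta>, e {\<alpha>, \<beta>})\<close> the element
  \<open>x \<alpha>\<close> has just entered \<open>K\<close> and is not in \<open>L\<close>,
  whereas \<open>b1\<close>, \<open>b2\<close> and \<open>h\<close> are already in both.\<close>

lemma n_Shelah:
  assumes hyp: "\<And>A. A \<subseteq> Field \<kappa> \<Longrightarrow> |A| =o \<kappa> \<Longrightarrow>
      \<exists>D. club \<kappa> D \<and>
        (\<forall>\<delta>\<in>D. \<forall>\<beta>\<in>A - underS \<kappa> \<delta>. \<forall>(\<xi>0, \<xi>1)\<in>underS \<kappa> \<delta> \<times> underS \<kappa> \<delta>. \<forall>i\<in>Field \<theta>.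
          cofinal_in \<kappa> \<delta> {\<alpha> \<in> A \<inter> underS \<kappa> \<delta>.
            c0 {\<alpha>, \<beta>} = \<xi>0 \<and> c1 {\<alpha>, \<beta>} = \<xi>1 \<and> ord_less \<theta> i (e {\<alpha>, \<beta>})})"
    and pr_Field: "\<And>x y. x \<in> Field \<kappa> \<Longrightarrow> y \<in> Field \<kappa> \<Longrightarrow> pr x y \<in> Field \<kappa>"
  shows "n_Shelah G (length (relator_list 200 () () () ()))"
  unfolding n_Shelah_def
proof (intro allI impI equalityI subsetI)
  fix X g assume X: "X \<subseteq> carrier G \<and> |X| =o |carrier G|" and "g \<in> set_power G X (length (relator_list 200 () () () ()))"
  then obtain xs where "g = foldr (mult G) xs \<one>\<^bsub>G\<^esub>" "set xs \<subseteq> X" unfolding set_power_def by blast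
  then show "g \<in> carrier G"
    using subext_foldr[OF UG_group(1)[OF ideal_idx] subext_refl, of xs] X by (auto simp: in_lists_conv_set)
next
  fix X h assume X: "X \<subseteq> carrier G \<and> |X| =o |carrier G|" and h: "h \<in> carrier G"
  obtain x A i0 where A: "A \<subseteq> Field \<kappa>" "|A| =o \<kappa>" and i0: "i0 \<in> Field \<theta>"
    and x: "\<And>\<gamma>. \<gamma> \<in> A \<Longrightarrow> x \<gamma> \<in> X \<and> x \<gamma> \<noteq> u \<and> tag (x \<gamma>) = (\<gamma>, i0)"
    using ex_large_fibre[of X] X by metis
  have xG: "x \<gamma> \<in> carrier G" "x \<gamma> \<in> Field \<kappa>" if "\<gamma> \<in> A" for \<gamma> using x[OF that] X G_Field by blast+
  obtain D where D: "club \<kappa> D" and hD: "\<And>\<delta> \<beta> \<xi>0 \<xi>1 i. \<delta> \<in> D \<Longrightarrow> \<beta> \<in> A - underS \<kappa> \<delta> \<Longrightarrow> lt \<xi>0 \<delta> \<Longrightarrow> lt \<xi>1 \<delta> \<Longrightarrow> i \<in> Field \<theta> \<Longrightarrow>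
      cofinal_in \<kappa> \<delta> {\<alpha> \<in> A \<inter> underS \<kappa> \<delta>. c0 {\<alpha>, \<beta>} = \<xi>0 \<and> c1 {\<alpha>, \<beta>} = \<xi>1 \<and> ord_less \<theta> i (e {\<alpha>, \<beta>})}"
    using hyp[OF A] by fast
  have unb: "\<exists>\<alpha>\<in>A. lt \<beta> \<alpha>" if b: "\<beta> \<in> Field \<kappa>" for \<beta>
  proof (rule ccontr)
    assume "\<not> ?thesis"
    then have "A \<subseteq> underS \<kappa> \<beta> \<union> {\<beta>}" using A(1) lt_linear[OF b] by blast
    moreover have "|underS \<kappa> \<beta> \<union> {\<beta>}| <o \<kappa>" using small_Un[OF card_of_underS[OF Card_\<kappa> b] small_finite[of "{\<beta>}"]] by blast
    ultimately show False using small_mono A(2) not_ordLess_ordIso by blast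
  qed
  have "Field \<kappa> \<noteq> {}" using inf_\<kappa> by auto
  then obtain \<alpha>1 where a1: "\<alpha>1 \<in> A" using unb by blast
  then obtain \<alpha>2 where a2: "\<alpha>2 \<in> A" "lt \<alpha>1 \<alpha>2" using unb A(1) by blast
  \<comment> \<open>A lower bound for the later choice of \<alpha>, which ensures
    \<open>\<alpha>2 < \<alpha>\<close>.\<close>
  then obtain \<alpha>3 where a3: "\<alpha>3 \<in> A" "lt \<alpha>2 \<alpha>3" using unb A(1) by blast
  \<comment> \<open>(\<eta>, j) is the tag of \<open>h\<close>. For the unit, whose tag carries no
    information, values already in use are substituted.\<close>
  define b1 b2 \<eta> j where "b1 = x \<alpha>1" and "b2 = x \<alpha>2"
    and "\<eta> = (if h = u then \<alpha>1 else ht h)" and "j = (if h = u then i0 else snd (tag h))"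
  have b: "tag b1 = (\<alpha>1, i0)" "tag b2 = (\<alpha>2, i0)" "b1 \<noteq> u" "b2 \<noteq> u" "b1 \<in> carrier G" "b2 \<in> carrier G"
    using x xG a1 a2 by (simp_all add: b1_def b2_def)
  have \<eta>: "\<eta> \<in> Field \<kappa>" "j \<in> Field \<theta>" using a1 A(1) i0 h G_tag[of h] by (auto simp: \<eta>_def j_def idx_def)
  have bF: "b1 \<in> Field \<kappa>" "b2 \<in> Field \<kappa>" "h \<in> Field \<kappa>" using xG a1 a2 h G_Field by (auto simp: b1_def b2_def)
  \<comment> \<open>The hypothesis realises only colors below \<delta>, so \<delta> must exceed the
    codes \<open>h\<close> and \<open>pr b1 b2\<close>.\<close>
  have "{\<alpha>1, \<alpha>3, \<eta>, h, pr b1 b2} \<subseteq> Field \<kappa>" using a1 a3 A(1) \<eta>(1) bF pr_Field by auto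
  then obtain \<delta>0 where d0: "\<delta>0 \<in> Field \<kappa>" "\<forall>\<alpha>\<in>{\<alpha>1, \<alpha>3, \<eta>, h, pr b1 b2}. lt \<alpha> \<delta>0"
    using lt_bound[of "{\<alpha>1, \<alpha>3, \<eta>, h, pr b1 b2}"] by auto
  then obtain \<delta> where d: "\<delta> \<in> D" "lt \<delta>0 \<delta>" using D unfolding club_def cofinal_def underS_def by blast
  have l: "lt \<alpha>1 \<delta>" "lt \<alpha>3 \<delta>" "lt \<eta> \<delta>" "lt h \<delta>" "lt (pr b1 b2) \<delta>" using d0(2) d(2) lt_trans by blast+
  obtain \<beta> where \<beta>: "\<beta> \<in> A" "lt \<delta> \<beta>" using unb lt_Field(2)[OF d(2)] by blast
  have l\<beta>: "lt \<alpha>1 \<beta>" "lt \<alpha>2 \<beta>" "lt \<eta> \<beta>" using l \<beta>(2) a3(2) lt_trans by blast+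
  have "{i0, j, e {\<alpha>1, \<beta>}, e {\<alpha>2, \<beta>}, e {\<eta>, \<beta>}} \<subseteq> Field \<theta>" using i0 \<eta>(2) e_Field l\<beta> by auto
  then obtain i where i: "i \<in> Field \<theta>" "\<forall>k\<in>{i0, j, e {\<alpha>1, \<beta>}, e {\<alpha>2, \<beta>}, e {\<eta>, \<beta>}}. le_\<theta> k i"
    using le_bound[of "{i0, j, e {\<alpha>1, \<beta>}, e {\<alpha>2, \<beta>}, e {\<eta>, \<beta>}}"] by auto
  have "\<beta> \<in> A - underS \<kappa> \<delta>" using \<beta> lt_asym by blast
  from hD[OF d(1) this l(4,5) i(1)] obtain \<alpha> where \<alpha>: "(\<alpha>3, \<alpha>) \<in> \<kappa>" "\<alpha> \<in> A" "lt \<alpha> \<delta>" "c0 {\<alpha>, \<beta>} = h" "c1 {\<alpha>, \<beta>} = pr b1 b2"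
      "ord_less \<theta> i (e {\<alpha>, \<beta>})"
    using l(2) unfolding cofinal_in_def by blast
  have \<alpha>\<beta>: "lt \<alpha> \<beta>" using \<alpha>(3) \<beta>(2) lt_trans by blast
  have "\<alpha> = \<alpha>3 \<or> lt \<alpha>3 \<alpha>" using \<alpha>(1) by (auto simp: underS_def)
  then have \<alpha>2: "lt \<alpha>2 \<alpha>" using a3(2) lt_trans by blast
  define k where "k = e {\<alpha>, \<beta>}"
  have k: "k \<in> Field \<theta>" "ord_less \<theta> i k" using e_Field[OF \<alpha>\<beta>] \<alpha>(6) by (simp_all add: k_def)
  have ik: "le_\<theta> i k" "\<not> le_\<theta> k i" using k(2) le_antisym by (auto simp: underS_def)
  let ?p = "(\<beta>, k)"
  have p: "?p \<in> idx" using \<beta>(1) A(1) k(1) by (auto simp: idx_def)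
  have IKQ: "IK ?p \<subseteq> idx" "IL ?p \<subseteq> idx" using IK_below IL_below[OF p] below_idx by blast+
  note K = UG_carrier[OF ideal_IK[OF IKQ(1)]] and L = UG_carrier[OF ideal_IL[OF IKQ(2)]]
  have bel: "below (\<gamma>, m) (\<beta>, i)" if "lt \<gamma> \<beta>" "le_\<theta> (e {\<gamma>, \<beta>}) i" "le_\<theta> m i" for \<gamma> m
    using that lt_Field le_Field(1)[OF that(3)] i(1) by (auto simp: below_def idx_def)
  have inL: "q \<in> IL ?p" if "below q (\<beta>, i)" for q using that k(2) unfolding IL_def by auto
  have inK: "q \<in> IK ?p" if "below q (\<beta>, i)" "lt (fst q) \<beta>" for q
  proof -
    have "below (\<beta>, i) ?p" using below_idx(2)[OF that(1)] p ik(1) by (simp add: below_def)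
    then show ?thesis using below_trans[OF that(1)] that(2) by (simp add: IK_def)
  qed
  have both: "w \<in> carrier (UG (IK ?p)) \<inter> carrier (UG (IL ?p))"
    if "w \<in> carrier G" "tag w = (\<gamma>, m)" "lt \<gamma> \<beta>" "le_\<theta> (e {\<gamma>, \<beta>}) i" "le_\<theta> m i" for w \<gamma> m
    using K[of w] L[of w] G_tag[of w] that inL[OF bel[OF that(3-5)]] inK[OF bel[OF that(3-5)]] by auto
  have hKL: "h \<in> carrier (UG (IK ?p)) \<inter> carrier (UG (IL ?p))"
  proof (cases "h = u")
    case True
    then show ?thesis using K L by blast
  next
    case False
    then have "tag h = (\<eta>, j)" by (simp add: \<eta>_def j_def)
    then show ?thesis using both[OF h] l\<beta>(3) i(2) by blast
  qed
  have "(\<alpha>, i0) \<in> IK ?p"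
    using \<alpha>\<beta> p i0 lt_Field(1)[OF \<alpha>\<beta>] le_refl[OF k(1)] le_trans[OF _ ik(1), of i0] i(2)
    unfolding IK_def below_def idx_def by (auto simp: k_def)
  moreover have "(\<alpha>, i0) \<notin> IL ?p"
  proof
    assume "(\<alpha>, i0) \<in> IL ?p"
    then obtain m where "ord_less \<theta> m k" "le_\<theta> k m" using \<alpha>\<beta> lt_irrefl unfolding IL_def below_def k_def by auto
    then show False using le_antisym by (auto simp: underS_def)
  qed
  ultimately have a: "x \<alpha> \<in> carrier (UG (IK ?p)) - carrier (UG (IL ?p))"
    using K[of "x \<alpha>"] L[of "x \<alpha>"] x[OF \<alpha>(2)] G_tag[of "x \<alpha>"] xG(1)[OF \<alpha>(2)] by auto
  have "below (\<beta>, i0) (\<beta>, i)" using p i0 i by (simp add: below_def idx_def)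
  then have "(\<beta>, i0) \<in> IL ?p" by (rule inL)
  moreover have "(\<beta>, i0) \<notin> IK ?p" using lt_irrefl by (simp add: IK_def)
  ultimately have y: "x \<beta> \<in> carrier (UG (IL ?p)) - carrier (UG (IK ?p))"
    using K[of "x \<beta>"] L[of "x \<beta>"] x[OF \<beta>(1)] G_tag[of "x \<beta>"] xG(1)[OF \<beta>(1)] by auto
  have b1: "b1 \<in> carrier (UG (IK ?p)) \<inter> carrier (UG (IL ?p))" using both[OF b(5,1) l\<beta>(1)] i(2) by blast
  have b2: "b2 \<in> carrier (UG (IK ?p)) \<inter> carrier (UG (IL ?p))" using both[OF b(6,2) l\<beta>(2)] i(2) by blast
  have hts: "ht b1 = \<alpha>1" "ht b2 = \<alpha>2" "ht (x \<alpha>) = \<alpha>" using b(1,2) x[OF \<alpha>(2)] by simp_all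
  have "(x \<alpha>, x \<beta>, b1, b2, h) \<in> params f ?p"
    unfolding params_def mem_Collect_eq prod.case fst_conv hts
    by (intro conjI a y b1 b2 hKL b(3,4) a2(2) \<alpha>2 \<alpha>(4,5))
  then have r: "foldr (mult (f ?p)) (relator_list 200 (x \<alpha>) (x \<beta>) b1 b2) u = h"
    by (rule stage_relator[OF f_stage[OF p]])
  have inp: "w \<in> carrier (f ?p)" if w: "w \<in> carrier (UG (IK ?p)) \<or> w \<in> carrier (UG (IL ?p))" "w \<noteq> u" for w
  proof -
    have t: "tag w \<in> IK ?p \<or> tag w \<in> IL ?p" "w \<in> carrier (f (tag w))" using w K[of w] L[of w] by blast+
    have "below (tag w) ?p" using t(1) IK_below[of "tag w" ?p] IL_below[OF p, of "tag w"] by blast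
    then show ?thesis using t(2) subextD(1)[OF below_f(1)[OF p]] by blast
  qed
  have "{x \<alpha>, x \<beta>, b1, b2} \<subseteq> carrier (f ?p)" using inp[of "x \<alpha>"] inp[of "x \<beta>"] inp[of b1] inp[of b2] a y b1 b2 b(3,4) x[OF \<alpha>(2)] x[OF \<beta>(1)] by simp
  then have "relator_list 200 (x \<alpha>) (x \<beta>) b1 b2 \<in> lists (carrier (f ?p))"
    using set_relator_list[of 200 "x \<alpha>" "x \<beta>" b1 b2] by (auto simp: in_lists_conv_set)
  then have "foldr (mult G) (relator_list 200 (x \<alpha>) (x \<beta>) b1 b2) \<one>\<^bsub>G\<^esub> = h"
    using subext_foldr[OF group_f[OF p] G_f[OF p]] r one_f[OF p] by simp
  moreover have "set (relator_list 200 (x \<alpha>) (x \<beta>) b1 b2) \<subseteq> X"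
    using set_relator_list[of 200 "x \<alpha>" "x \<beta>" b1 b2] x \<alpha>(2) \<beta>(1) a1 a2(1) unfolding b1_def b2_def by blast
  ultimately show "h \<in> set_power G X (length (relator_list 200 () () () ()))"
    unfolding set_power_def using length_relator_list[of 200 "x \<alpha>" "x \<beta>" b1 b2] by blast
qed

text \<open>A set of fewer than \<kappa> elements has bounded heights and lies in a malnormal
  \<open>level \<beta>\<close>; a free letter of height \<beta> lies outside it and serves as the
  conjugating element.\<close>

lemma discrete: assumes n: "n_Shelah G n" and T: "group_topology G T" "t1_space T"
  shows "T = discrete_topology (carrier G)"
proof -
  have g: "\<one>\<^bsub>G\<^esub> = u" "group G" using UG_group[OF ideal_idx] by blast+
  have "idx \<noteq> {}" using inf_\<kappa> inf_\<theta> unfolding idx_def by auto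
  then obtain p where p: "p \<in> idx" by blast
  obtain t where t: "t \<in> carrier G" "t \<noteq> u" using free_elements[OF p] by metis
  show ?thesis
  proof (rule t1_discrete[OF g(2) T n t(1)])
    show "t \<noteq> \<one>\<^bsub>G\<^esub>" using t g by simp
    fix V assume V: "V \<subseteq> carrier G" "\<not> |V| =o |carrier G|"
    have "\<not> |V| =o \<kappa>" using V(2) card_G ordIso_symmetric ordIso_transitive by blast
    then have "|V| <o \<kappa>" using not_small V(1) G_Field by blast
    then have "|ht ` (V - {u})| <o \<kappa>" using small_mono[of "V - {u}" V] ordLeq_ordLess_trans[OF card_of_image] by blast
    then obtain \<beta> where \<beta>: "\<beta> \<in> Field \<kappa>" "V \<subseteq> level \<beta>" using small_level[OF V(1)] by blast
    have "(\<beta>, snd p) \<in> idx" using \<beta>(1) p by (auto simp: idx_def)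
    then obtain c where c: "c \<in> carrier G" "c \<noteq> u" "tag c = (\<beta>, snd p)" using free_elements by metis
    then have "c \<notin> level \<beta>" using lt_irrefl by (simp add: level_def)
    then show "\<exists>c\<in>carrier G. \<forall>x\<in>V. inv\<^bsub>G\<^esub> c \<otimes>\<^bsub>G\<^esub> x \<otimes>\<^bsub>G\<^esub> c \<in> V \<longrightarrow> x = \<one>\<^bsub>G\<^esub>"
      using level(1)[OF \<beta>(1)] c(1) \<beta>(2) unfolding malnormal_in_def by blast
  qed
qed

end

theorem lemma5p11:
  fixes \<kappa> :: "'k rel" and \<theta> :: "'t rel"
    and c0 c1 :: "'k set \<Rightarrow> 'k" and e :: "'k set \<Rightarrow> 't"
  assumes "infinite_regular_cardinal \<kappa>" and "infinite_regular_cardinal \<theta>" and "\<theta> <o \<kappa>"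
    and "c0 \<in> [Field \<kappa>]\<^bsup>2\<^esup> \<rightarrow> Field \<kappa>"
    and "c1 \<in> [Field \<kappa>]\<^bsup>2\<^esup> \<rightarrow> Field \<kappa>"
    and "e \<in> [Field \<kappa>]\<^bsup>2\<^esup> \<rightarrow> Field \<theta>" and "subadditive \<kappa> \<theta> e"
    and "\<And>A. A \<subseteq> Field \<kappa> \<Longrightarrow> |A| =o \<kappa> \<Longrightarrow>
      \<exists>D. club \<kappa> D \<and>
        (\<forall>\<delta>\<in>D. \<forall>\<beta>\<in>A - underS \<kappa> \<delta>. \<forall>(\<xi>0, \<xi>1)\<in>underS \<kappa> \<delta> \<times> underS \<kappa> \<delta>. \<forall>i\<in>Field \<theta>.
          cofinal_in \<kappa> \<delta> {\<alpha> \<in> A \<inter> underS \<kappa> \<delta>.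
            c0 {\<alpha>, \<beta>} = \<xi>0 \<and> c1 {\<alpha>, \<beta>} = \<xi>1 \<and> ord_less \<theta> i (e {\<alpha>, \<beta>})})"
  shows "\<exists>G :: 'k monoid. group G \<and> torsion_free G \<and> Shelah G \<and> |carrier G| =o \<kappa> \<and>
    (\<forall>T. group_topology G T \<and> t1_space T \<longrightarrow> T = discrete_topology (carrier G)) \<and>
    \<not> algebraic_subset G (carrier G - {\<one>\<^bsub>G\<^esub>}) \<and>
    unconditionally_closed G (carrier G - {\<one>\<^bsub>G\<^esub>})"
proof -
  interpret cc: colored_cardinals \<kappa> \<theta> c0 c1 e by unfold_locales (fact assms)+
  obtain nm :: "'k \<times> 't \<Rightarrow> nat \<Rightarrow> 'k \<Rightarrow> 'k" and pr
    where nm: "\<And>p q m n \<zeta> \<xi>. p \<in> cc.idx \<Longrightarrow> q \<in> cc.idx \<Longrightarrow> \<zeta> \<in> Field \<kappa> \<Longrightarrow> \<xi> \<in> Field \<kappa> \<Longrightarrow> nm p m \<zeta> = nm q n \<xi> \<Longrightarrow> p = q \<and> m = n \<and> \<zeta> = \<xi>"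
      "\<And>p n \<zeta>. p \<in> cc.idx \<Longrightarrow> \<zeta> \<in> Field \<kappa> \<Longrightarrow> nm p n \<zeta> \<in> Field \<kappa>"
    and pr: "\<And>x y. x \<in> Field \<kappa> \<Longrightarrow> y \<in> Field \<kappa> \<Longrightarrow> pr x y \<in> Field \<kappa>"
      "\<And>x y x' y'. x \<in> Field \<kappa> \<Longrightarrow> y \<in> Field \<kappa> \<Longrightarrow> x' \<in> Field \<kappa> \<Longrightarrow> y' \<in> Field \<kappa> \<Longrightarrow> pr x y = pr x' y' \<Longrightarrow> x = x' \<and> y = y'"
    by (rule cc.ex_names) blast
  have "cc.idx \<noteq> {}" "Field \<kappa> \<noteq> {}" using cc.inf_\<kappa> cc.inf_\<theta> unfolding cc.idx_def by auto
  then obtain p0 \<zeta>0 where p0: "p0 \<in> cc.idx" "\<zeta>0 \<in> Field \<kappa>" by blast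
  \<comment> \<open>One name from supply 0 becomes the unit; the supplies of all stages are shifted
    by one to keep clear of it.\<close>
  interpret nc: named_cardinals \<kappa> \<theta> c0 c1 e "\<lambda>p n. nm p (Suc n)" pr "nm p0 0 \<zeta>0"
  proof unfold_locales
    show "p = q \<and> m = n \<and> \<zeta> = \<xi>" if "p \<in> cc.idx" "q \<in> cc.idx" "\<zeta> \<in> Field \<kappa>" "\<xi> \<in> Field \<kappa>" "nm p (Suc m) \<zeta> = nm q (Suc n) \<xi>" for p q m n \<zeta> \<xi>
      using nm(1)[OF that] by simp
    show "nm p (Suc n) \<zeta> \<noteq> nm p0 0 \<zeta>0" if "p \<in> cc.idx" "\<zeta> \<in> Field \<kappa>" for p n \<zeta>
      using nm(1)[OF that(1) p0(1) that(2) p0(2), of "Suc n" 0] by auto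
    show "nm p (Suc n) \<zeta> \<in> Field \<kappa>" if "p \<in> cc.idx" "\<zeta> \<in> Field \<kappa>" for p n \<zeta> by (rule nm(2)[OF that])
    show "x = x' \<and> y = y'" if "x \<in> Field \<kappa>" "y \<in> Field \<kappa>" "x' \<in> Field \<kappa>" "y' \<in> Field \<kappa>" "pr x y = pr x' y'" for x y x' y'
      by (rule pr(2)[OF that])
    show "nm p0 0 \<zeta>0 \<in> Field \<kappa>" by (rule nm(2)[OF p0])
  qed
  obtain f where f: "\<And>p. p \<in> cc.idx \<Longrightarrow> nc.stage f p (f p)" using nc.ex_tower by blast
  interpret tower \<kappa> \<theta> c0 c1 e "\<lambda>p n. nm p (Suc n)" pr "nm p0 0 \<zeta>0" f by unfold_locales (rule f)
  let ?n = "length (relator_list 200 () () () ())"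
  have n: "n_Shelah G ?n" by (rule n_Shelah[OF assms(8) pr(1)])
  have n0: "?n > 0" by (simp add: relator_list_def)
  have d: "T = discrete_topology (carrier G)" if "group_topology G T" "t1_space T" for T using discrete[OF n that] .
  show ?thesis
  proof (intro exI[of _ G] conjI allI impI)
    show "group G" "torsion_free G" using UG_group(1)[OF ideal_idx] UG_tf[OF ideal_idx] by blast+
    show "Shelah G" using n n0 unfolding Shelah_def by blast
    show "|carrier G| =o \<kappa>" by (rule card_G)
    show "T = discrete_topology (carrier G)" if "group_topology G T \<and> t1_space T" for T using d that by blast
    show "\<not> algebraic_subset G (carrier G - {\<one>\<^bsub>G\<^esub>})" using nonalgebraic UG_group(2)[OF ideal_idx] by simp
    show "unconditionally_closed G (carrier G - {\<one>\<^bsub>G\<^esub>})"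
      unfolding unconditionally_closed_def
    proof (intro conjI allI impI)
      show "closedin T (carrier G - {\<one>\<^bsub>G\<^esub>})" if "group_topology G T \<and> Hausdorff_space T" for T
        using d[of T] that Hausdorff_imp_t1_space by (metis Diff_subset closedin_discrete_topology)
    qed blast
  qed
qed

end
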